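(* Let $m\geq 2$ and $n\geq 1$ be integers, let $s_1,\dots,s_m\in\mathbb{R}$, $1\leq p_1<\infty$, $0<p_i\leq\infty$ for $i=2,\dots,m$, and $0<q\leq\infty$. Assume $$0<s_1<s_2\leq s_3\leq\dots\leq s_m\qquad\text{and}\qquad s_1<\frac{n}{p_1}.$$ Suppose further that $$\frac1p=\frac1{p_1}+\sum_{i=2}^m\frac1{h_i}<1,$$ where $$\Big(\frac1{p_i}-\frac{s_i}{n}\Big)_+<\frac1{h_i}\leq\frac1{p_i},\qquad i=2,\dots,m.$$ Then $$F^{s_1}_{p_1,q}\cdot B^{s_2}_{p_2,\infty}\cdot\ldots\cdot B^{s_m}_{p_m,\infty}\hookrightarrow F^{s_1}_{p,q}$$ holds. That is, for all $f_1\in F^{s_1}_{p_1,q}$ and $f_i\in B^{s_i}_{p_i,\infty}$ ($i=2,\dots,m$), the product $f_1\cdot f_2\cdots f_m$ exists in $\mathcal{S}'(\mathbb{R}^n)$ and belongs to $F^{s_1}_{p,q}$, and there is a constant $c>0$, independent of $f_1,\dots,f_m$, such that $$\big\|f_1\cdot f_2\cdots f_m\mid F^{s_1}_{p,q}\big\|\leq c\,\big\|f_1\mid F^{s_1}_{p_1,q}\big\|\prod_{i=2}^m\big\|f_i\mid B^{s_i}_{p_i,\infty}\big\|.$$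
   Context: All spaces are spaces of tempered distributions on $\mathbb{R}^n$. Write $a_+=\max(0,a)$ for $a\in\mathbb{R}$, and $1/\infty=0$. The Fourier transform is $\mathcal{F}f(\xi)=(2\pi)^{-n/2}\int_{\mathbb{R}^n}e^{-ix\cdot\xi}f(x)\,dx$ on the Schwartz space $\mathcal{S}(\mathbb{R}^n)$, extended to $\mathcal{S}'(\mathbb{R}^n)$ in the usual way. $\|\cdot\|_p$ denotes the $L_p(\mathbb{R}^n)$ (quasi-)norm. Resolution of unity: let $\Psi\in\mathcal{S}(\mathbb{R}^n)$ satisfy $\Psi(x)=1$ for $|x|\leq1$ and $\Psi(x)=0$ for $|x|\geq\frac32$. Put $\varphi_0=\Psi$, $\varphi_1(x)=\Psi(x/2)-\Psi(x)$ and $\varphi_j(x)=\varphi_1(2^{-j+1}x)$ for $j=2,3,\dots$. For $f\in\mathcal{S}'(\mathbb{R}^n)$ and $j\in\mathbb{N}_0=\{0,1,2,\dots\}$ define $\Delta_jf=\mathcal{F}^{-1}\varphi_j*f$ and $Q_jf=\mathcal{F}^{-1}\Psi(2^{-j}\cdot)*f=\sum_{k=0}^j\Delta_kf$, where the convolutions are understood as the Fourier multiplier operators with symbols $\varphi_j$ and $\Psi(2^{-j}\cdot)$ (up to the normalizing constant of the Fourier transform). Besov space: for $s\in\mathbb{R}$, $0<p,q\leq\infty$, $B^s_{p,q}$ is the set of all $f\in\mathcal{S}'(\mathbb{R}^n)$ with $$\|f\mid B^s_{p,q}\|=\Big(\sum_{j=0}^\infty2^{jsq}\|\Delta_jf\|_p^q\Big)^{1/q}<\infty,$$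 with the supremum over $j$ in place of the sum if $q=\infty$. Triebel–Lizorkin space: for $s\in\mathbb{R}$, $0<p<\infty$, $0<q\leq\infty$, $F^s_{p,q}$ is the set of all $f\in\mathcal{S}'(\mathbb{R}^n)$ with $$\|f\mid F^s_{p,q}\|=\Big\|\Big(\sum_{j=0}^\infty2^{jsq}|\Delta_jf|^q\Big)^{1/q}\Big\|_p<\infty,$$ with the supremum over $j$ in place of the sum if $q=\infty$. Product: for $f_1,\dots,f_m\in\mathcal{S}'(\mathbb{R}^n)$ the product is defined by $f_1\cdot f_2\cdots f_m=\prod_{i=1}^mf_i=\lim_{j\to\infty}\prod_{i=1}^mQ_jf_i$, whenever the limit exists in $\mathcal{S}'(\mathbb{R}^n)$. The notation $X_1\cdot X_2\cdot\ldots\cdot X_m\hookrightarrow Y$ refers to boundedness of the $m$-linear map $(f_1,\dots,f_m)\mapsto f_1\cdot f_2\cdots f_m$ from $X_1\times\dots\times X_m$ to $Y$. *)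

theory Defs
  imports "HOL-Analysis.Analysis" "HOL-Probability.Essential_Supremum"
begin

text \<open>
  Throughout, \<open>'a :: euclidean_space\<close> plays the role of \<open>\<real>\<^sup>n\<close> with \<open>n = DIM('a)\<close>; functions and
  distributions are complex-valued.
\<close>

definition partial_deriv :: "'a::euclidean_space \<Rightarrow> ('a \<Rightarrow> complex) \<Rightarrow> 'a \<Rightarrow> complex" where
  "partial_deriv b f x = frechet_derivative f (at x) b"

text \<open>A multi-index is encoded as a list of basis vectors, the directions of differentiation.\<close>

definition iter_deriv :: "'a::euclidean_space list \<Rightarrow> ('a \<Rightarrow> complex) \<Rightarrow> 'a \<Rightarrow> complex" where
  "iter_deriv bs f = foldr partial_deriv bs f"

definition deriv_lists :: "nat \<Rightarrow> 'a::euclidean_space list set" where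
  "deriv_lists N = {bs. set bs \<subseteq> Basis \<and> length bs \<le> N}"

definition smooth :: "('a::euclidean_space \<Rightarrow> complex) \<Rightarrow> bool" where
  "smooth f \<longleftrightarrow> (\<forall>bs x. set bs \<subseteq> Basis \<longrightarrow> iter_deriv bs f differentiable (at x))"

text \<open>
  The seminorm \<open>sup\<^sub>x (1 + |x|)\<^sup>N \<Sum> |D\<^sup>\<alpha> f(x)|\<close>, the sum being over \<open>|\<alpha>| \<le> N\<close>. Since directions are
  listed in order, a multi-index may be counted several times; this only changes constants.
\<close>

definition schwartz_weight :: "nat \<Rightarrow> ('a::euclidean_space \<Rightarrow> complex) \<Rightarrow> 'a \<Rightarrow> real" where
  "schwartz_weight N f x = (1 + norm x) ^ N * (\<Sum>bs\<in>deriv_lists N. norm (iter_deriv bs f x))"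

definition schwartz_seminorm :: "nat \<Rightarrow> ('a::euclidean_space \<Rightarrow> complex) \<Rightarrow> real" where
  "schwartz_seminorm N f = (SUP x. schwartz_weight N f x)"

definition schwartz_space :: "('a::euclidean_space \<Rightarrow> complex) set" where
  "schwartz_space = {f. smooth f \<and> (\<forall>N. bdd_above (range (schwartz_weight N f)))}"

text \<open>
  A tempered distribution is a continuous linear functional on the Schwartz space. It is encoded
  as a HOL function on all of \<open>'a \<Rightarrow> complex\<close>; values outside \<^const>\<open>schwartz_space\<close> are irrelevant and
  never used below. Because the seminorms increase with \<open>N\<close>, continuity is a bound by one of them.
\<close>

type_synonym 'a functional = "('a \<Rightarrow> complex) \<Rightarrow> complex"

definition tempered_distributions :: "'a::euclidean_space functional set" where
  "tempered_distributions = {u.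
     (\<forall>f\<in>schwartz_space. \<forall>g\<in>schwartz_space. u (\<lambda>x. f x + g x) = u f + u g) \<and>
     (\<forall>c. \<forall>f\<in>schwartz_space. u (\<lambda>x. c * f x) = c * u f) \<and>
     (\<exists>N C. \<forall>f\<in>schwartz_space. norm (u f) \<le> C * schwartz_seminorm N f)}"

definition represents :: "('a::euclidean_space \<Rightarrow> complex) \<Rightarrow> 'a functional \<Rightarrow> bool" where
  "represents g u \<longleftrightarrow>
     (\<forall>f\<in>schwartz_space. integrable lborel (\<lambda>x. g x * f x) \<and> u f = (\<integral>x. g x * f x \<partial>lborel))"

text \<open>
  The continuous function by which a distribution is given. It is unique if it exists; it is only
  applied to distributions with compactly supported Fourier transform, for which it does exist by
  the Paley--Wiener--Schwartz theorem.
\<close>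

definition as_function :: "'a::euclidean_space functional \<Rightarrow> 'a \<Rightarrow> complex" where
  "as_function u = (THE g. continuous_on UNIV g \<and> represents g u)"

definition fourier :: "('a::euclidean_space \<Rightarrow> complex) \<Rightarrow> 'a \<Rightarrow> complex" where
  "fourier f \<xi> = complex_of_real ((2 * pi) powr (- (real DIM('a) / 2))) *
     (\<integral>x. exp (- (\<i> * complex_of_real (x \<bullet> \<xi>))) * f x \<partial>lborel)"

definition inv_fourier :: "('a::euclidean_space \<Rightarrow> complex) \<Rightarrow> 'a \<Rightarrow> complex" where
  "inv_fourier f x = complex_of_real ((2 * pi) powr (- (real DIM('a) / 2))) *
     (\<integral>\<xi>. exp (\<i> * complex_of_real (x \<bullet> \<xi>)) * f \<xi> \<partial>lborel)"

definition fourier_dist :: "'a::euclidean_space functional \<Rightarrow> 'a functional" where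
  "fourier_dist u = (\<lambda>f. u (fourier f))"

definition inv_fourier_dist :: "'a::euclidean_space functional \<Rightarrow> 'a functional" where
  "inv_fourier_dist u = (\<lambda>f. u (inv_fourier f))"

definition mult_dist :: "('a::euclidean_space \<Rightarrow> complex) \<Rightarrow> 'a functional \<Rightarrow> 'a functional" where
  "mult_dist \<sigma> u = (\<lambda>f. u (\<lambda>x. \<sigma> x * f x))"

definition fourier_multiplier ::
  "('a::euclidean_space \<Rightarrow> complex) \<Rightarrow> 'a functional \<Rightarrow> 'a functional" where
  "fourier_multiplier \<sigma> u = inv_fourier_dist (mult_dist \<sigma> (fourier_dist u))"

definition resolution_generator :: "('a::euclidean_space \<Rightarrow> complex) \<Rightarrow> bool" where
  "resolution_generator \<Psi> \<longleftrightarrow> \<Psi> \<in> schwartz_space \<and>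
     (\<forall>x. norm x \<le> 1 \<longrightarrow> \<Psi> x = 1) \<and> (\<forall>x. norm x \<ge> 3/2 \<longrightarrow> \<Psi> x = 0)"

definition lp_symbol1 :: "('a::euclidean_space \<Rightarrow> complex) \<Rightarrow> 'a \<Rightarrow> complex" where
  "lp_symbol1 \<Psi> x = \<Psi> (x /\<^sub>R 2) - \<Psi> x"

definition lp_symbol :: "('a::euclidean_space \<Rightarrow> complex) \<Rightarrow> nat \<Rightarrow> 'a \<Rightarrow> complex" where
  "lp_symbol \<Psi> j x = (if j = 0 then \<Psi> x else lp_symbol1 \<Psi> ((2 powr (1 - real j)) *\<^sub>R x))"

definition lp_block ::
  "('a::euclidean_space \<Rightarrow> complex) \<Rightarrow> nat \<Rightarrow> 'a functional \<Rightarrow> 'a \<Rightarrow> complex" where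
  "lp_block \<Psi> j u = as_function (fourier_multiplier (lp_symbol \<Psi> j) u)"

definition lp_lowpass ::
  "('a::euclidean_space \<Rightarrow> complex) \<Rightarrow> nat \<Rightarrow> 'a functional \<Rightarrow> 'a \<Rightarrow> complex" where
  "lp_lowpass \<Psi> j u = as_function (fourier_multiplier (\<lambda>x. \<Psi> ((2 powr (- real j)) *\<^sub>R x)) u)"

text \<open>Integrability and summability exponents range over \<open>(0, \<infinity>]\<close> inside \<^typ>\<open>ennreal\<close>.\<close>

text \<open>The real number \<open>1/p\<close>, with \<open>1/\<infinity> = 0\<close>. Pitfall: also \<open>recip 0 = 0\<close>.\<close>

definition recip :: "ennreal \<Rightarrow> real" where
  "recip p = enn2real (1 / p)"

text \<open>Powers with exponent \<open>a > 0\<close>.\<close>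

definition epowr :: "ennreal \<Rightarrow> real \<Rightarrow> ennreal" where
  "epowr x a = (if x = top then top else ennreal (enn2real x powr a))"

definition Lp_norm :: "ennreal \<Rightarrow> ('a::euclidean_space \<Rightarrow> ennreal) \<Rightarrow> ennreal" where
  "Lp_norm p g = (if p = top then esssup lborel g
     else epowr (\<integral>\<^sup>+ x. epowr (g x) (enn2real p) \<partial>lborel) (1 / enn2real p))"

definition lq_norm :: "ennreal \<Rightarrow> (nat \<Rightarrow> ennreal) \<Rightarrow> ennreal" where
  "lq_norm q a = (if q = top then (SUP j. a j)
     else epowr (\<Sum>j. epowr (a j) (enn2real q)) (1 / enn2real q))"

definition besov_norm ::
  "('a::euclidean_space \<Rightarrow> complex) \<Rightarrow> real \<Rightarrow> ennreal \<Rightarrow> ennreal \<Rightarrow> 'a functional \<Rightarrow> ennreal" where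
  "besov_norm \<Psi> s p q u = lq_norm q
     (\<lambda>j. ennreal (2 powr (real j * s)) * Lp_norm p (\<lambda>x. ennreal (norm (lp_block \<Psi> j u x))))"

definition besov_space ::
  "('a::euclidean_space \<Rightarrow> complex) \<Rightarrow> real \<Rightarrow> ennreal \<Rightarrow> ennreal \<Rightarrow> 'a functional set" where
  "besov_space \<Psi> s p q = {u \<in> tempered_distributions. besov_norm \<Psi> s p q u < top}"

definition triebel_norm ::
  "('a::euclidean_space \<Rightarrow> complex) \<Rightarrow> real \<Rightarrow> ennreal \<Rightarrow> ennreal \<Rightarrow> 'a functional \<Rightarrow> ennreal" where
  "triebel_norm \<Psi> s p q u = Lp_norm p
     (\<lambda>x. lq_norm q (\<lambda>j. ennreal (2 powr (real j * s)) * ennreal (norm (lp_block \<Psi> j u x))))"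

definition triebel_space ::
  "('a::euclidean_space \<Rightarrow> complex) \<Rightarrow> real \<Rightarrow> ennreal \<Rightarrow> ennreal \<Rightarrow> 'a functional set" where
  "triebel_space \<Psi> s p q = {u \<in> tempered_distributions. triebel_norm \<Psi> s p q u < top}"

text \<open>
  \<open>is_product \<Psi> m f g\<close>: the product of \<open>f 1, \<dots>, f m\<close> exists in the tempered distributions, with the
  weak-* topology, and equals \<open>g\<close>. As a limit, \<open>g\<close> is determined on \<^const>\<open>schwartz_space\<close>.
\<close>

definition is_product ::
  "('a::euclidean_space \<Rightarrow> complex) \<Rightarrow> nat \<Rightarrow> (nat \<Rightarrow> 'a functional) \<Rightarrow> 'a functional \<Rightarrow> bool" where
  "is_product \<Psi> m f g \<longleftrightarrow> g \<in> tempered_distributions \<and>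
     (\<forall>\<eta>\<in>schwartz_space.
        (\<lambda>j. \<integral>x. (\<Prod>i=1..m. lp_lowpass \<Psi> j (f i) x) * \<eta> x \<partial>lborel) \<longlonglongrightarrow> g \<eta>)"

end

theory Submission
  imports Defs "HOL-Probability.Probability"
begin

text \<open>
  Write \<open>\<Delta>\<^sub>k\<close> for the \<open>k\<close>-th Littlewood--Paley block and \<open>P\<^sub>i(l)\<close> for the sum of the first \<open>l\<close> blocks
  of \<open>f\<^sub>i\<close>. The first factor is strictly rougher than the others, so at frequency \<open>2\<^sup>j\<close> the product
  looks like \<open>f\<^sub>1\<close> multiplied by slowly varying functions:
  \<open>\<Delta>\<^sub>j (f\<^sub>1 \<cdots> f\<^sub>m) = R\<^sub>j \<sqdot> \<Delta>\<^sub>j f\<^sub>1 + E\<^sub>j\<close> with \<open>R\<^sub>j = P\<^sub>2(j - 2m) \<cdots> P\<^sub>m(j - 2m)\<close>,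
  where \<open>E\<^sub>j\<close> has \<open>L\<^sub>p\<close>-norm at most a constant times \<open>2 powr (- j * (s\<^sub>1 + \<eta>))\<close> for some \<open>\<eta> > 0\<close>
  (\<open>product_block_estimate\<close>). Both parts are then easy to measure. The factors of \<open>R\<^sub>j\<close> are bounded,
  pointwise and uniformly in \<open>j\<close>, by the sums \<open>\<Sum>\<^sub>k \<bar>\<Delta>\<^sub>k f\<^sub>i\<bar>\<close>; so the product of these sums leaves the
  \<open>l\<^sub>q\<close>-norm over \<open>j\<close> as a factor, and Hoelder's inequality with \<open>1/p = 1/p\<^sub>1 + \<Sum> 1/h\<^sub>i\<close> bounds the main
  term by the \<open>F\<close>-norm of \<open>f\<^sub>1\<close>. The errors still decay geometrically after multiplication by
  \<open>2 powr (j * s\<^sub>1)\<close>, so their \<open>l\<^sub>q\<close>-norm is bounded by a convergent sum, for every \<open>q\<close>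
  (\<open>lq_product_estimate\<close>).

  Membership of \<open>\<Sum>\<^sub>k \<bar>\<Delta>\<^sub>k f\<^sub>i\<bar>\<close> in the Lebesgue space with exponent \<open>h\<^sub>i\<close> is the Nikol'skij inequality
  (\<open>lp_block_nikolskii\<close>): raising the integrability of a block from \<open>p\<^sub>i\<close> to \<open>h\<^sub>i\<close> costs
  a factor \<open>2 powr (k * n * (1/p\<^sub>i - 1/h\<^sub>i))\<close>, and the decay \<open>2 powr (- k * s\<^sub>i)\<close> of the blocks
  outweighs it precisely because \<open>1/h\<^sub>i > 1/p\<^sub>i - s\<^sub>i/n\<close>.

  The error splits into three pieces, with \<open>l = j - 2m\<close> and \<open>T > j + 1\<close> a truncation of all factors.
  The product \<open>P\<^sub>1(l) \<cdots> P\<^sub>m(l)\<close> has its spectrum in a ball on which the symbol of \<open>\<Delta>\<^sub>j\<close> vanishes, so it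
  contributes nothing (\<open>smoothing_full_product_low\<close>). The commutator of \<open>\<Delta>\<^sub>j\<close> with multiplication by
  \<open>R\<^sub>j\<close>, applied to \<open>P\<^sub>1(T) - P\<^sub>1(l)\<close>, gains a factor \<open>2 powr (- j * \<epsilon>)\<close> over the size
  \<open>2 powr (- j * s\<^sub>1)\<close> of that difference,
  because the functions \<open>P\<^sub>i(l)\<close> are Hoelder continuous in the mean uniformly in \<open>l\<close>
  (\<open>commutator_Lnorm\<close>, \<open>product_modulus\<close>). The remaining terms contain a difference
  \<open>P\<^sub>r(T) - P\<^sub>r(l)\<close> with \<open>r \<ge> 2\<close>. If one simply used the exponents \<open>h\<^sub>i\<close>, its decay rate
  \<open>s\<^sub>r - n(1/p\<^sub>r - 1/h\<^sub>r)\<close> might fail to exceed \<open>s\<^sub>1\<close>; but \<open>f\<^sub>1\<close> has smoothness \<open>s\<^sub>1\<close> to trade for better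
  integrability. Hence the \<open>r\<close>-th factor can be measured with a smaller exponent and the first with a
  larger one in such a way that the rate becomes greater than \<open>s\<^sub>1\<close> (\<open>exponent_shift\<close>,
  \<open>remainder_bound\<close>).

  The same telescoping shows that the truncated products are Cauchy in \<open>L\<^sub>p\<close>. As \<open>1/p < 1\<close>, Schwartz
  functions lie in the dual space of \<open>L\<^sub>p\<close>, so the limit exists as a tempered distribution, and testing
  it against the kernel of \<open>\<Delta>\<^sub>j\<close> carries the block estimate over to the limit
  (\<open>product_dist_is_product\<close>, \<open>product_dist_block_estimate\<close>).

  Exponents of the factors \<open>i \<ge> 2\<close> may lie below one. All norms are therefore expressed by a bound
  \<open>Lnorm_le\<close> indexed by the reciprocal exponent, in which Hoelder's inequality holds on the whole scale,
  and infinite sums only occur with geometric decay, for which \<open>Lnorm_le_geometric\<close> replaces the triangle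
  inequality. The first half of the development connects this calculus with the definitions: a block is
  given as the continuous function representing a distribution, and
  \<open>multiplier_fun_represents\<close> identifies it with the distribution tested against translates of a
  Schwartz kernel. This rests on Fourier inversion and on interchanging a distribution with an integral
  (\<open>tempered_convolution_interchange\<close>).
\<close>

section \<open>Schwartz functions\<close>

definition rapid :: "('a::euclidean_space \<Rightarrow> complex) \<Rightarrow> bool" where
  "rapid f \<longleftrightarrow> (\<forall>N. \<exists>C. \<forall>x. (1 + norm x) ^ N * norm (f x) \<le> C)"

lemma rapidE:
  assumes "rapid f"
  obtains C where "C > 0" "\<And>x. (1 + norm x) ^ N * norm (f x) \<le> C"
proof -
  obtain C where C: "\<And>x. (1 + norm x) ^ N * norm (f x) \<le> C"
    using assms unfolding rapid_def by blast
  show ?thesis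
    by (rule that[of "max C 1"]) (use C in \<open>auto simp: le_max_iff_disj\<close>)
qed

lemma rapid_add: 
  assumes "rapid f" "rapid g" shows "rapid (\<lambda>x. f x + g x)"
  unfolding rapid_def
proof
  fix N
  obtain C where C: "\<And>x. (1 + norm x) ^ N * norm (f x) \<le> C" using assms(1) unfolding rapid_def by blast
  obtain D where D: "\<And>x. (1 + norm x) ^ N * norm (g x) \<le> D" using assms(2) unfolding rapid_def by blast
  have "(1 + norm x) ^ N * norm (f x + g x) \<le> C + D" for x
  proof -
    have "(1 + norm x) ^ N * norm (f x + g x) \<le> (1 + norm x) ^ N * (norm (f x) + norm (g x))"
      by (intro mult_left_mono norm_triangle_ineq) auto
    also have "\<dots> \<le> C + D" using C[of x] D[of x] by (simp add: distrib_left)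
    finally show ?thesis .
  qed
  then show "\<exists>C. \<forall>x. (1 + norm x) ^ N * norm (f x + g x) \<le> C" by blast
qed

lemma rapid_mult: 
  assumes "rapid f" "\<And>x. norm (g x) \<le> K * (1 + norm x) ^ M" shows "rapid (\<lambda>x. g x * f x)"
  unfolding rapid_def
proof
  fix N
  obtain C where C: "\<And>x. (1 + norm x) ^ (N+M) * norm (f x) \<le> C" using assms(1) unfolding rapid_def by blast
  have "norm (g 0) \<le> K" using assms(2)[of 0] by simp
  then have K: "0 \<le> K" by (rule order_trans[OF norm_ge_zero])
  have "(1 + norm x) ^ N * norm (g x * f x) \<le> K * C" for x
  proof -
    have "(1 + norm x) ^ N * norm (g x * f x) \<le> (1 + norm x) ^ N * ((K * (1 + norm x) ^ M) * norm (f x))"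
      unfolding norm_mult by (intro mult_left_mono mult_right_mono assms(2)) auto
    also have "\<dots> = K * ((1 + norm x) ^ (N+M) * norm (f x))" by (simp add: power_add)
    also have "\<dots> \<le> K * C" by (intro mult_left_mono C K)
    finally show ?thesis .
  qed
  then show "\<exists>C. \<forall>x. (1 + norm x) ^ N * norm (g x * f x) \<le> C" by blast
qed

lemma rapid_cmult: "rapid f \<Longrightarrow> rapid (\<lambda>x. c * f x)"
  by (rule rapid_mult[where K="norm c" and M=0]) auto

lemma finite_deriv_lists: "finite (deriv_lists N :: 'a::euclidean_space list set)"
  unfolding deriv_lists_def by (rule finite_lists_length_le) simp

text \<open>
  The seminorms bound finitely many derivatives at a time; separating the derivatives lets each of
  them be treated by the closure properties of \<open>rapid\<close>.
\<close>

lemma schwartz_iff: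
  "f \<in> schwartz_space \<longleftrightarrow> smooth f \<and> (\<forall>bs. set bs \<subseteq> Basis \<longrightarrow> rapid (iter_deriv bs f))"
proof (intro iffI conjI allI impI)
  assume f: "f \<in> schwartz_space"
  then show "smooth f" by (simp add: schwartz_space_def)
  fix bs :: "'a list" assume bs: "set bs \<subseteq> Basis"
  show "rapid (iter_deriv bs f)" unfolding rapid_def
  proof
    fix N
    define M where "M = max N (length bs)"
    from f have "bdd_above (range (schwartz_weight M f))" by (simp add: schwartz_space_def)
    then obtain C where C: "\<And>x. schwartz_weight M f x \<le> C" by (auto simp: bdd_above_def)
    have "(1 + norm x) ^ N * norm (iter_deriv bs f x) \<le> C" for x
    proof -
      have "norm (iter_deriv bs f x) \<le> (\<Sum>bs\<in>deriv_lists M. norm (iter_deriv bs f x))"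
        by (rule member_le_sum) (use bs finite_deriv_lists in \<open>auto simp: deriv_lists_def M_def\<close>)
      then have "(1 + norm x) ^ N * norm (iter_deriv bs f x) \<le> schwartz_weight M f x"
        unfolding schwartz_weight_def
        by (intro mult_mono power_increasing) (auto simp: M_def)
      then show ?thesis using C[of x] by simp
    qed
    then show "\<exists>C. \<forall>x. (1 + norm x) ^ N * norm (iter_deriv bs f x) \<le> C" by blast
  qed
next
  assume f: "smooth f \<and> (\<forall>bs. set bs \<subseteq> Basis \<longrightarrow> rapid (iter_deriv bs f))"
  have "bdd_above (range (schwartz_weight N f))" for N
  proof -
    have "\<forall>bs. \<exists>C. bs \<in> deriv_lists N \<longrightarrow> (\<forall>x. (1 + norm x) ^ N * norm (iter_deriv bs f x) \<le> C)"
      using f unfolding rapid_def deriv_lists_def by blast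
    then obtain C where C: "\<And>bs x. bs \<in> deriv_lists N \<Longrightarrow> (1 + norm x) ^ N * norm (iter_deriv bs f x) \<le> C bs"
      by metis
    have "schwartz_weight N f x \<le> (\<Sum>bs\<in>deriv_lists N. C bs)" for x
      unfolding schwartz_weight_def sum_distrib_left by (intro sum_mono C)
    then show ?thesis by (auto simp: bdd_above_def)
  qed
  then show "f \<in> schwartz_space" using f by (simp add: schwartz_space_def)
qed

lemma iter_deriv_Nil [simp]: "iter_deriv [] f = f"
  and iter_deriv_Cons [simp]: "iter_deriv (b # bs) f = partial_deriv b (iter_deriv bs f)"
  and iter_deriv_snoc: "iter_deriv (bs @ [b]) f = iter_deriv bs (partial_deriv b f)"
  by (simp_all add: iter_deriv_def)

lemma schwartz_rapid: "f \<in> schwartz_space \<Longrightarrow> rapid f"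
  unfolding schwartz_iff by (metis empty_subsetI empty_set iter_deriv_Nil)

lemma schwartz_differentiable: "f \<in> schwartz_space \<Longrightarrow> f differentiable (at x)"
  unfolding schwartz_iff smooth_def by (metis empty_subsetI empty_set iter_deriv_Nil)

lemma schwartz_partial: "f \<in> schwartz_space \<Longrightarrow> b \<in> Basis \<Longrightarrow> partial_deriv b f \<in> schwartz_space"
  unfolding schwartz_iff smooth_def iter_deriv_snoc[symmetric] by auto

lemma schwartz_iter_deriv: "f \<in> schwartz_space \<Longrightarrow> set bs \<subseteq> Basis \<Longrightarrow> iter_deriv bs f \<in> schwartz_space"
  by (induction bs) (auto intro: schwartz_partial)

text \<open>
  A class of rapidly decreasing differentiable functions that is closed under partial derivatives
  consists of Schwartz functions, since all iterated derivatives stay in the class. All closure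
  properties below use it, with a class that describes the shape of the derivatives; this
  replaces formulas for higher derivatives.
\<close>

lemma schwartz_coinduct:
  assumes "X f"
    and "\<And>f. X f \<Longrightarrow> rapid f"
    and "\<And>f x. X f \<Longrightarrow> f differentiable (at x)"
    and "\<And>f b. X f \<Longrightarrow> b \<in> Basis \<Longrightarrow> X (partial_deriv b f)"
  shows "f \<in> schwartz_space"
proof -
  have "X (iter_deriv bs f)" if "set bs \<subseteq> Basis" for bs
    using that by (induction bs) (auto intro: assms)
  then show ?thesis unfolding schwartz_iff smooth_def using assms by blast
qed

lemma partial_deriv_eq: "(f has_derivative D) (at x) \<Longrightarrow> partial_deriv b f x = D b"
  unfolding partial_deriv_def by (metis frechet_derivative_at)

lemma schwartz_has_derivative_frechet:
  "f \<in> schwartz_space \<Longrightarrow> (f has_derivative frechet_derivative f (at x)) (at x)"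
  using schwartz_differentiable frechet_derivative_works by blast

lemma differentiable_has_derivative_partial:
  fixes f :: "'a::euclidean_space \<Rightarrow> complex"
  assumes "f differentiable (at x)"
  shows "(f has_derivative (\<lambda>h. \<Sum>b\<in>Basis. (h \<bullet> b) *\<^sub>R partial_deriv b f x)) (at x)"
proof -
  have D: "(f has_derivative frechet_derivative f (at x)) (at x)"
    using assms frechet_derivative_works by blast
  then have L: "linear (frechet_derivative f (at x))" by (rule has_derivative_linear)
  have "frechet_derivative f (at x) h = (\<Sum>b\<in>Basis. (h \<bullet> b) *\<^sub>R partial_deriv b f x)" for h
  proof -
    have "frechet_derivative f (at x) h = frechet_derivative f (at x) (\<Sum>b\<in>Basis. (h \<bullet> b) *\<^sub>R b)"
      by (simp add: euclidean_representation)
    also have "\<dots> = (\<Sum>b\<in>Basis. (h \<bullet> b) *\<^sub>R partial_deriv b f x)"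
      unfolding partial_deriv_def by (simp add: linear_sum[OF L] linear_cmul[OF L])
    finally show ?thesis .
  qed
  then have "frechet_derivative f (at x) = (\<lambda>h. \<Sum>b\<in>Basis. (h \<bullet> b) *\<^sub>R partial_deriv b f x)" by blast
  with D show ?thesis by simp
qed

lemmas schwartz_has_derivative = differentiable_has_derivative_partial[OF schwartz_differentiable]

lemma schwartz_continuous: "f \<in> schwartz_space \<Longrightarrow> continuous_on S f"
  by (meson schwartz_differentiable continuous_at_imp_continuous_on differentiable_imp_continuous_within)

lemma schwartz_measurable: "f \<in> schwartz_space \<Longrightarrow> f \<in> borel_measurable borel"
  by (intro borel_measurable_continuous_onI schwartz_continuous)

subsection \<open>Closure properties\<close>

lemma schwartz_add:
  assumes "f \<in> schwartz_space" "g \<in> schwartz_space"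
  shows "(\<lambda>x. f x + g x) \<in> schwartz_space"
proof (rule schwartz_coinduct[where X="\<lambda>h. \<exists>f\<in>schwartz_space. \<exists>g\<in>schwartz_space. h = (\<lambda>x. f x + g x)"])
  fix h :: "'a \<Rightarrow> complex" and b :: 'a
  assume b: "b \<in> Basis" and "\<exists>f\<in>schwartz_space. \<exists>g\<in>schwartz_space. h = (\<lambda>x. f x + g x)"
  then obtain f g where fg: "f \<in> schwartz_space" "g \<in> schwartz_space" "h = (\<lambda>x. f x + g x)" by blast
  have "partial_deriv b h x = partial_deriv b f x + partial_deriv b g x" for x
    unfolding fg by (subst partial_deriv_eq, rule has_derivative_add)
      (auto intro!: schwartz_has_derivative_frechet fg simp: partial_deriv_def)
  then show "\<exists>f\<in>schwartz_space. \<exists>g\<in>schwartz_space. partial_deriv b h = (\<lambda>x. f x + g x)"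
    using fg b schwartz_partial by blast
qed (use assms in \<open>auto intro: rapid_add schwartz_rapid intro!: differentiable_add[OF schwartz_differentiable schwartz_differentiable]\<close>)

lemma schwartz_cmult:
  assumes "f \<in> schwartz_space"
  shows "(\<lambda>x. c * f x) \<in> schwartz_space"
proof (rule schwartz_coinduct[where X="\<lambda>h. \<exists>f\<in>schwartz_space. h = (\<lambda>x. c * f x)"])
  fix h :: "'a \<Rightarrow> complex" and b :: 'a
  assume b: "b \<in> Basis" and "\<exists>f\<in>schwartz_space. h = (\<lambda>x. c * f x)"
  then obtain f where fg: "f \<in> schwartz_space" "h = (\<lambda>x. c * f x)" by blast
  have "partial_deriv b h x = c * partial_deriv b f x" for x
    unfolding fg by (subst partial_deriv_eq, rule has_derivative_mult_right)
      (auto intro!: schwartz_has_derivative_frechet fg simp: partial_deriv_def)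
  then show "\<exists>f\<in>schwartz_space. partial_deriv b h = (\<lambda>x. c * f x)"
    using fg b schwartz_partial by blast
qed (use assms in \<open>auto intro: rapid_cmult schwartz_rapid intro!: differentiable_mult[OF differentiable_const schwartz_differentiable]\<close>)

lemma schwartz_diff:
  assumes "f \<in> schwartz_space" "g \<in> schwartz_space"
  shows "(\<lambda>x. f x - g x) \<in> schwartz_space"
  using schwartz_add[OF assms(1) schwartz_cmult[OF assms(2), of "-1"]] by simp

text \<open>
  The product rule turns a product into a sum of two products, so the class for the coinduction
  consists of finite sums of products.
\<close>

inductive schwartz_prod_sum :: "('a::euclidean_space \<Rightarrow> complex) \<Rightarrow> bool" where
  "f \<in> schwartz_space \<Longrightarrow> g \<in> schwartz_space \<Longrightarrow> schwartz_prod_sum (\<lambda>x. f x * g x)"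
| "schwartz_prod_sum f \<Longrightarrow> schwartz_prod_sum g \<Longrightarrow> schwartz_prod_sum (\<lambda>x. f x + g x)"

lemma schwartz_bounded:
  assumes "f \<in> schwartz_space" obtains C where "C > 0" "\<And>x. norm (f x) \<le> C"
  using rapidE[OF schwartz_rapid[OF assms], of 0] by (metis mult_1 power_0)

lemma schwartz_mult:
  assumes "f \<in> schwartz_space" "g \<in> schwartz_space"
  shows "(\<lambda>x. f x * g x) \<in> schwartz_space"
proof (rule schwartz_coinduct[where X=schwartz_prod_sum])
  show "schwartz_prod_sum (\<lambda>x. f x * g x)" using assms by (rule schwartz_prod_sum.intros)
  show "rapid h" if "schwartz_prod_sum h" for h :: "'a \<Rightarrow> complex"
    using that
  proof induction
    case (1 f g)
    obtain C where "C > 0" "\<And>x. norm (f x) \<le> C" using schwartz_bounded 1 by blast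
    then show ?case using 1 by (intro rapid_mult[where K=C and M=0] schwartz_rapid) auto
  qed (rule rapid_add)
  show d: "h differentiable (at x)" if "schwartz_prod_sum h" for h :: "'a \<Rightarrow> complex" and x
    using that by induction (auto intro: differentiable_mult differentiable_add schwartz_differentiable)
  fix h :: "'a \<Rightarrow> complex" and b :: 'a
  assume b: "b \<in> Basis"
  assume "schwartz_prod_sum h"
  then show "schwartz_prod_sum (partial_deriv b h)"
  proof (induction rule: schwartz_prod_sum.induct)
    case (1 f g)
    have "partial_deriv b (\<lambda>x. f x * g x) = (\<lambda>x. f x * partial_deriv b g x + partial_deriv b f x * g x)"
      by (rule ext, subst partial_deriv_eq, rule has_derivative_mult)
       (auto intro!: schwartz_has_derivative_frechet 1 simp: partial_deriv_def)
    then show ?case using 1 b by (auto intro!: schwartz_prod_sum.intros schwartz_partial)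
  next
    case (2 f g)
    have "partial_deriv b (\<lambda>x. f x + g x) = (\<lambda>x. partial_deriv b f x + partial_deriv b g x)"
      by (rule ext, subst partial_deriv_eq, rule has_derivative_add)
       (use d frechet_derivative_works 2 in \<open>auto simp: partial_deriv_def\<close>)
    then show ?case using 2 b by (auto intro!: schwartz_prod_sum.intros)
  qed
qed

text \<open>
  Comparison of the weights at \<open>x\<close> and at its affine image, in product form so that it survives
  taking powers.
\<close>

lemma norm_affine_weight:
  fixes x a :: "'a::real_normed_vector" and c :: real
  assumes "c \<noteq> 0"
  shows "1 + norm x \<le> (1 + 1/\<bar>c\<bar>) * (1 + norm a) * (1 + norm (c *\<^sub>R x + a))"
proof -
  have "c *\<^sub>R x = (c *\<^sub>R x + a) - a" by simp
  then have "\<bar>c\<bar> * norm x \<le> norm (c *\<^sub>R x + a) + norm a" by (metis norm_scaleR norm_triangle_ineq4)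
  then have "norm x \<le> (1/\<bar>c\<bar>) * (norm (c *\<^sub>R x + a) + norm a)" using assms by (simp add: field_simps)
  also have "\<dots> \<le> (1/\<bar>c\<bar>) * ((1 + norm a) * (1 + norm (c *\<^sub>R x + a)))"
    by (intro mult_left_mono) (auto simp: algebra_simps)
  finally have "1 + norm x \<le> 1 + (1/\<bar>c\<bar>) * ((1 + norm a) * (1 + norm (c *\<^sub>R x + a)))" by simp
  also have "\<dots> \<le> (1 + 1/\<bar>c\<bar>) * ((1 + norm a) * (1 + norm (c *\<^sub>R x + a)))"
    unfolding distrib_right[of 1] by (auto simp: algebra_simps)
  finally show ?thesis by (simp add: mult.assoc)
qed

lemma rapid_affine:
  assumes "rapid f" "c \<noteq> 0" shows "rapid (\<lambda>x. f (c *\<^sub>R x + a))"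
  unfolding rapid_def
proof
  fix N
  obtain C where C: "\<And>x. (1 + norm x) ^ N * norm (f x) \<le> C" using assms(1) unfolding rapid_def by blast
  let ?K = "((1 + 1/\<bar>c\<bar>) * (1 + norm a)) ^ N"
  have "(1 + norm x) ^ N * norm (f (c *\<^sub>R x + a)) \<le> ?K * C" for x
  proof -
    have "(1 + norm x) ^ N \<le> ((1 + 1/\<bar>c\<bar>) * (1 + norm a) * (1 + norm (c *\<^sub>R x + a))) ^ N"
      by (intro power_mono norm_affine_weight assms) auto
    then have "(1 + norm x) ^ N * norm (f (c *\<^sub>R x + a)) \<le> ?K * ((1 + norm (c *\<^sub>R x + a)) ^ N * norm (f (c *\<^sub>R x + a)))"
      unfolding power_mult_distrib by (metis mult.assoc mult_right_mono norm_ge_zero)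
    also have "\<dots> \<le> ?K * C" by (intro mult_left_mono C) auto
    finally show ?thesis .
  qed
  then show "\<exists>C. \<forall>x. (1 + norm x) ^ N * norm (f (c *\<^sub>R x + a)) \<le> C" by blast
qed

lemma has_derivative_affine:
  assumes "(f has_derivative D) (at (c *\<^sub>R x + a))"
  shows "((\<lambda>x. f (c *\<^sub>R x + a)) has_derivative (\<lambda>h. D (c *\<^sub>R h))) (at x)"
  by (rule has_derivative_compose[where f="\<lambda>x. c *\<^sub>R x + a" and g=f, OF _ assms])
     (auto intro!: derivative_eq_intros)

lemma partial_deriv_affine:
  assumes "f differentiable (at (c *\<^sub>R x + a))"
  shows "partial_deriv b (\<lambda>x. f (c *\<^sub>R x + a)) x = of_real c * partial_deriv b f (c *\<^sub>R x + a)"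
proof -
  have D: "(f has_derivative frechet_derivative f (at (c *\<^sub>R x + a))) (at (c *\<^sub>R x + a))"
    using assms frechet_derivative_works by blast
  show ?thesis
    by (subst partial_deriv_eq[OF has_derivative_affine[OF D]])
       (simp add: partial_deriv_def linear_cmul[OF has_derivative_linear[OF D]] scaleR_conv_of_real)
qed

lemma schwartz_affine:
  fixes f :: "'a::euclidean_space \<Rightarrow> complex"
  assumes "f \<in> schwartz_space" and c: "c \<noteq> 0"
  shows "(\<lambda>x. f (c *\<^sub>R x + a)) \<in> schwartz_space"
proof (rule schwartz_coinduct[where X="\<lambda>h. \<exists>f\<in>schwartz_space. h = (\<lambda>x. f (c *\<^sub>R x + a))"])
  fix h :: "'a \<Rightarrow> complex" and b :: 'a
  assume b: "b \<in> Basis" and "\<exists>f\<in>schwartz_space. h = (\<lambda>x. f (c *\<^sub>R x + a))"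
  then obtain f where f: "f \<in> schwartz_space" "h = (\<lambda>x. f (c *\<^sub>R x + a))" by blast
  have "partial_deriv b h = (\<lambda>x. of_real c * partial_deriv b f (c *\<^sub>R x + a))"
    unfolding f by (rule ext, rule partial_deriv_affine[OF schwartz_differentiable[OF f(1)]])
  then show "\<exists>f\<in>schwartz_space. partial_deriv b h = (\<lambda>x. f (c *\<^sub>R x + a))"
    by (intro bexI[OF _ schwartz_cmult[OF schwartz_partial[OF f(1) b], of "of_real c"]]) simp
next
  fix h :: "'a \<Rightarrow> complex" and x
  assume "\<exists>f\<in>schwartz_space. h = (\<lambda>x. f (c *\<^sub>R x + a))"
  then obtain f where f: "f \<in> schwartz_space" "h = (\<lambda>x. f (c *\<^sub>R x + a))" by blast
  show "h differentiable (at x)"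
    unfolding f by (rule differentiableI, rule has_derivative_affine, rule schwartz_has_derivative_frechet[OF f(1)])
qed (use assms in \<open>auto intro: rapid_affine schwartz_rapid\<close>)

lemma schwartz_translate: "f \<in> schwartz_space \<Longrightarrow> (\<lambda>y. f (y - x)) \<in> schwartz_space"
  using schwartz_affine[of f 1 "-x"] by simp

lemma schwartz_reflect: "f \<in> schwartz_space \<Longrightarrow> (\<lambda>y. f (- y)) \<in> schwartz_space"
  using schwartz_affine[of f "-1" 0] by simp

lemma schwartz_dilate: "f \<in> schwartz_space \<Longrightarrow> c \<noteq> 0 \<Longrightarrow> (\<lambda>y. f (c *\<^sub>R y)) \<in> schwartz_space"
  using schwartz_affine[of f c 0] by simp

inductive schwartz_coord_sum :: "('a::euclidean_space \<Rightarrow> complex) \<Rightarrow> bool" where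
  "f \<in> schwartz_space \<Longrightarrow> schwartz_coord_sum f"
| "f \<in> schwartz_space \<Longrightarrow> b \<in> Basis \<Longrightarrow> schwartz_coord_sum (\<lambda>x. of_real (x \<bullet> b) * f x)"
| "schwartz_coord_sum f \<Longrightarrow> schwartz_coord_sum g \<Longrightarrow> schwartz_coord_sum (\<lambda>x. f x + g x)"

lemma has_derivative_coord_mult:
  fixes f :: "'a::euclidean_space \<Rightarrow> complex"
  assumes "(f has_derivative D) (at x)"
  shows "((\<lambda>x. of_real (x \<bullet> b) * f x) has_derivative (\<lambda>h. of_real (x \<bullet> b) * D h + of_real (h \<bullet> b) * f x)) (at x)"
  by (rule has_derivative_mult) (auto intro!: derivative_eq_intros assms)

lemma schwartz_coord_mult:
  assumes "f \<in> schwartz_space" "b \<in> Basis"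
  shows "(\<lambda>x. of_real (x \<bullet> b) * f x) \<in> schwartz_space"
proof (rule schwartz_coinduct[where X=schwartz_coord_sum])
  show "schwartz_coord_sum (\<lambda>x. of_real (x \<bullet> b) * f x)" using assms by (intro schwartz_coord_sum.intros)
  show "rapid h" if "schwartz_coord_sum h" for h :: "'a \<Rightarrow> complex"
    using that
  proof induction
    case (2 f b)
    have "norm (complex_of_real (x \<bullet> b)) \<le> 1 * (1 + norm x)^1" for x
      using Basis_le_norm[OF 2(2), of x] by simp
    then show ?case using 2 by (intro rapid_mult schwartz_rapid) blast+
  qed (auto intro: rapid_add schwartz_rapid)
  show d: "h differentiable (at x)" if "schwartz_coord_sum h" for h :: "'a \<Rightarrow> complex" and x
    using that
  proof induction
    case (2 f b) then show ?case
      by (intro differentiableI[OF has_derivative_coord_mult[OF schwartz_has_derivative_frechet]])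
  qed (auto intro: differentiable_add schwartz_differentiable)
  fix h :: "'a \<Rightarrow> complex" and c :: 'a
  assume c: "c \<in> Basis"
  assume "schwartz_coord_sum h"
  then show "schwartz_coord_sum (partial_deriv c h)"
  proof (induction rule: schwartz_coord_sum.induct)
    case (1 f)
    then show ?case using c by (intro schwartz_coord_sum.intros schwartz_partial)
  next
    case (2 f b)
    have "partial_deriv c (\<lambda>x. of_real (x \<bullet> b) * f x) = (\<lambda>x. of_real (x \<bullet> b) * partial_deriv c f x + of_real (c \<bullet> b) * f x)"
      by (rule ext, subst partial_deriv_eq, rule has_derivative_coord_mult)
       (auto intro!: schwartz_has_derivative_frechet 2 simp: partial_deriv_def)
    then show ?case
      using 2 c
      by (simp, intro schwartz_coord_sum.intros(3)[OF schwartz_coord_sum.intros(2) schwartz_coord_sum.intros(1)]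
          schwartz_partial schwartz_cmult)
  next
    case (3 f g)
    have "partial_deriv c (\<lambda>x. f x + g x) = (\<lambda>x. partial_deriv c f x + partial_deriv c g x)"
      by (rule ext, subst partial_deriv_eq, rule has_derivative_add)
       (use d frechet_derivative_works 3 in \<open>auto simp: partial_deriv_def\<close>)
    then show ?case using 3 c by (simp add: schwartz_coord_sum.intros(3))
  qed
qed

text \<open>
  As \<open>norm x \<le> \<Sum>b. \<bar>x \<bullet> b\<bar>\<close>, each power of the weight is paid for by one multiplication with the
  coordinates. For Fourier transforms, where this multiplication amounts to a derivative of the
  original function, decay thus reduces to boundedness.
\<close>

lemma rapid_coordinates:
  fixes f :: "'a::euclidean_space \<Rightarrow> complex"
  assumes "X f" and "\<And>f. X f \<Longrightarrow> \<exists>C. \<forall>x. norm (f x) \<le> C"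
    and "\<And>f b. X f \<Longrightarrow> b \<in> Basis \<Longrightarrow> X (\<lambda>x. of_real (x \<bullet> b) * f x)"
  shows "rapid f"
  unfolding rapid_def
proof
  fix N
  show "\<exists>C. \<forall>x. (1 + norm x) ^ N * norm (f x) \<le> C"
    using \<open>X f\<close>
  proof (induction N arbitrary: f)
    case 0 then show ?case using assms(2) by simp
  next
    case (Suc N)
    obtain C where C: "\<And>x. (1 + norm x) ^ N * norm (f x) \<le> C" using Suc by blast
    have "\<forall>b. \<exists>C. b \<in> Basis \<longrightarrow> (\<forall>x. (1 + norm x) ^ N * norm (of_real (x \<bullet> b) * f x) \<le> C)"
      using Suc assms(3) by blast
    then obtain D where D: "\<And>b x. b \<in> Basis \<Longrightarrow> (1 + norm x) ^ N * norm (of_real (x \<bullet> b) * f x) \<le> D b" by metis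
    have "(1 + norm x) ^ Suc N * norm (f x) \<le> C + (\<Sum>b\<in>Basis. D b)" for x
    proof -
      have "norm x \<le> (\<Sum>b\<in>Basis. \<bar>x \<bullet> b\<bar>)" by (rule norm_le_l1)
      then have "(1 + norm x)^N * norm (f x) * (1 + norm x) \<le> (1 + norm x)^N * norm (f x) * (1 + (\<Sum>b\<in>Basis. \<bar>x \<bullet> b\<bar>))"
        by (intro mult_left_mono) auto
      then have "(1 + norm x) ^ Suc N * norm (f x) \<le> (1 + norm x)^N * norm (f x) * (1 + (\<Sum>b\<in>Basis. \<bar>x \<bullet> b\<bar>))"
        by (simp add: mult_ac)
      also have "\<dots> = (1 + norm x)^N * norm (f x) + (\<Sum>b\<in>Basis. (1 + norm x) ^ N * norm (of_real (x \<bullet> b) * f x))"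
        by (simp add: distrib_left norm_mult sum_distrib_left mult_ac)
      also have "\<dots> \<le> C + (\<Sum>b\<in>Basis. D b)" by (intro add_mono sum_mono C D)
      finally show ?thesis .
    qed
    then show ?case by blast
  qed
qed

section \<open>Integration\<close>

lemma integral_affine:
  fixes f :: "'a::euclidean_space \<Rightarrow> 'b::{banach, second_countable_topology}"
  assumes c: "c \<noteq> 0" and [measurable]: "f \<in> borel_measurable borel"
  shows "(\<integral>x. f x \<partial>lborel) = \<bar>c\<bar> ^ DIM('a) *\<^sub>R (\<integral>x. f (t + c *\<^sub>R x) \<partial>lborel)"
  by (subst lborel_affine[OF c, of t]) (simp add: integral_density integral_distr)

lemma nn_integral_affine:
  fixes f :: "'a::euclidean_space \<Rightarrow> ennreal"
  assumes c: "c \<noteq> 0" and [measurable]: "f \<in> borel_measurable borel"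
  shows "(\<integral>\<^sup>+x. f x \<partial>lborel) = ennreal (\<bar>c\<bar> ^ DIM('a)) * (\<integral>\<^sup>+x. f (t + c *\<^sub>R x) \<partial>lborel)"
  by (subst lborel_affine[OF c, of t]) (simp add: nn_integral_density nn_integral_distr nn_integral_cmult)

lemma integrable_inverse_one_plus_square: "integrable lborel (\<lambda>t::real. 1 / (1 + t\<^sup>2))"
  using integrable_inverse_1_plus_square
  by (simp add: set_integrable_def einterval_iff inverse_eq_divide)

text \<open>
  Domination by the product over the coordinates of the integrable functions \<open>1 / (1 + t\<^sup>2)\<close>;
  this explains the exponent \<open>2 * DIM('a)\<close>.
\<close>

lemma integrable_weight:
  "integrable lborel (\<lambda>x::'a::euclidean_space. 1 / (1 + norm x) ^ (2 * DIM('a)))"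
proof (rule integrableI_bounded)
  have le: "1 / (1 + norm x) ^ (2 * DIM('a)) \<le> (\<Prod>b\<in>Basis. 1 / (1 + (x \<bullet> b)\<^sup>2))" for x :: 'a
  proof -
    have "(\<Prod>b\<in>(Basis::'a set). 1 / (1 + norm x)\<^sup>2) \<le> (\<Prod>b\<in>Basis. 1 / (1 + (x \<bullet> b)\<^sup>2))"
    proof (intro prod_mono conjI divide_left_mono)
      fix b :: 'a assume b: "b \<in> Basis"
      have "(x \<bullet> b)\<^sup>2 \<le> (norm x)\<^sup>2" using power_mono[OF Basis_le_norm[OF b, of x], of 2] by simp
      moreover have "(1 + norm x)\<^sup>2 = 1 + (norm x)\<^sup>2 + 2 * norm x" by (simp add: power2_eq_square algebra_simps)
      ultimately show "1 + (x \<bullet> b)\<^sup>2 \<le> (1 + norm x)\<^sup>2" using norm_ge_zero[of x] by linarith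
      show "0 < (1 + norm x)\<^sup>2 * (1 + (x \<bullet> b)\<^sup>2)"
        by (intro mult_pos_pos zero_less_power add_pos_nonneg) auto
    qed auto
    then show ?thesis by (simp add: power_one_over power_mult)
  qed
  have "(\<integral>\<^sup>+x. ennreal (norm (1 / (1 + norm x) ^ (2 * DIM('a)))) \<partial>(lborel::'a measure))
      \<le> (\<integral>\<^sup>+x. (\<Prod>b\<in>Basis. ennreal (1 / (1 + (x \<bullet> b)\<^sup>2))) \<partial>(lborel::'a measure))"
    by (intro nn_integral_mono) (use le in \<open>auto simp: prod_ennreal intro!: ennreal_leI\<close>)
  also have "\<dots> = (\<Prod>b\<in>(Basis::'a set). (\<integral>\<^sup>+t. ennreal (1 / (1 + t\<^sup>2)) \<partial>lborel))"
    by (rule nn_integral_lborel_prod) auto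
  also have "\<dots> < \<infinity>"
    using integrable_inverse_one_plus_square
    by (subst nn_integral_eq_integral) (auto simp: prod_ennreal ennreal_power[symmetric] integral_nonneg less_top[symmetric] power_eq_top_ennreal)
  finally show "(\<integral>\<^sup>+x. ennreal (norm (1 / (1 + norm x) ^ (2 * DIM('a)))) \<partial>(lborel::'a measure)) < \<infinity>" .
qed measurable

lemma integrable_rapid_weight:
  fixes f :: "'a::euclidean_space \<Rightarrow> complex"
  assumes "rapid f" and [measurable]: "f \<in> borel_measurable borel"
  shows "integrable lborel (\<lambda>x. (1 + norm x) ^ N * norm (f x))"
proof -
  obtain C where C: "\<And>x. (1 + norm x) ^ (N + 2 * DIM('a)) * norm (f x) \<le> C"
    using rapidE[OF assms(1)] by metis
  then have C0: "0 \<le> C" using order_trans[OF _ C[of 0]] by simp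
  show ?thesis
  proof (rule Bochner_Integration.integrable_bound[OF integrable_mult_right[OF integrable_weight, of C]])
    show "AE x in lborel. norm ((1 + norm x) ^ N * norm (f x)) \<le> norm (C * (1 / (1 + norm x) ^ (2 * DIM('a))))"
    proof (rule AE_I2)
      fix x :: 'a
      have p: "(1 + norm x) ^ k > 0" for k by (intro zero_less_power add_pos_nonneg) auto
      have "(1 + norm x) ^ N * norm (f x) \<le> C / (1 + norm x) ^ (2 * DIM('a))"
        using C[of x] by (subst pos_le_divide_eq[OF p]) (simp add: power_add mult_ac)
      then show "norm ((1 + norm x) ^ N * norm (f x)) \<le> norm (C * (1 / (1 + norm x) ^ (2 * DIM('a))))"
        using C0 by (simp add: abs_mult)
    qed
  qed measurable
qed

lemma integrable_rapid:
  fixes f :: "'a::euclidean_space \<Rightarrow> complex"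
  assumes "rapid f" and [measurable]: "f \<in> borel_measurable borel"
  shows "integrable lborel f"
  using integrable_rapid_weight[OF assms, of 0] by (simp add: integrable_norm_iff)

lemma schwartz_integrable: "f \<in> schwartz_space \<Longrightarrow> integrable lborel f"
  by (intro integrable_rapid schwartz_rapid schwartz_measurable)

lemma schwartz_integrable_weight: "f \<in> schwartz_space \<Longrightarrow> integrable lborel (\<lambda>x. (1 + norm x) ^ N * norm (f x))"
  by (intro integrable_rapid_weight schwartz_rapid schwartz_measurable)

text \<open>
  The integral of a non-integrable \<open>f\<close> is \<open>0\<close> by convention, so the bound extends to it.
\<close>

lemma norm_integral_le:
  fixes f :: "'c \<Rightarrow> 'b::{banach, second_countable_topology}"
  assumes "integrable M g" and le: "\<And>x. norm (f x) \<le> g x"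
  shows "norm (\<integral>x. f x \<partial>M) \<le> (\<integral>x. g x \<partial>M)"
proof (cases "integrable M f")
  case True
  have "norm (\<integral>x. f x \<partial>M) \<le> (\<integral>x. norm (f x) \<partial>M)" by (rule integral_norm_bound)
  also have "\<dots> \<le> (\<integral>x. g x \<partial>M)" by (intro integral_mono integrable_norm True assms)
  finally show ?thesis .
next
  case False
  have "0 \<le> g x" for x using le[of x] norm_ge_zero order_trans by blast
  then show ?thesis using False by (simp add: not_integrable_integral_eq integral_nonneg)
qed

lemma fubini_dominated:
  fixes F :: "'a::euclidean_space \<Rightarrow> 'b::euclidean_space \<Rightarrow> complex"
  assumes [measurable]: "(\<lambda>(x, y). F x y) \<in> borel_measurable (borel \<Otimes>\<^sub>M borel)"
    and g: "integrable lborel g" and h: "integrable lborel h"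
    and le: "\<And>x y. norm (F x y) \<le> g x * h y"
  shows "(\<integral>y. (\<integral>x. F x y \<partial>lborel) \<partial>lborel) = (\<integral>x. (\<integral>y. F x y \<partial>lborel) \<partial>lborel)"
proof -
  have [measurable]: "(\<lambda>(x, y). F x y) \<in> borel_measurable (lborel \<Otimes>\<^sub>M lborel)"
    using assms(1) by simp
  have [measurable]: "g \<in> borel_measurable borel" "h \<in> borel_measurable borel"
    using borel_measurable_integrable[OF g] borel_measurable_integrable[OF h] by simp_all
  have i2: "integrable lborel (\<lambda>y. F x y)" for x
    by (rule Bochner_Integration.integrable_bound[OF integrable_mult_right[OF h, of "g x"]])
       (use le in \<open>auto intro: order_trans[OF _ abs_ge_self]\<close>)
  have "integrable (lborel \<Otimes>\<^sub>M lborel) (\<lambda>(x, y). F x y)"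
  proof (rule lborel_pair.Fubini_integrable)
    show "integrable lborel (\<lambda>x. \<integral>y. norm (case (x, y) of (x, y) \<Rightarrow> F x y) \<partial>lborel)"
    proof (rule Bochner_Integration.integrable_bound[OF integrable_mult_left[OF g, of "\<integral>y. h y \<partial>lborel"]])
      show "AE x in lborel. norm (\<integral>y. norm (case (x, y) of (x, y) \<Rightarrow> F x y) \<partial>lborel) \<le> norm (g x * (\<integral>y. h y \<partial>lborel))"
      proof (rule AE_I2)
        fix x
        have "(\<integral>y. norm (F x y) \<partial>lborel) \<le> (\<integral>y. g x * h y \<partial>lborel)"
          by (intro integral_mono integrable_norm i2 integrable_mult_right h le)
        then show "norm (\<integral>y. norm (case (x, y) of (x, y) \<Rightarrow> F x y) \<partial>lborel) \<le> norm (g x * (\<integral>y. h y \<partial>lborel))"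
          by (simp add: integral_nonneg)
      qed
    qed measurable
  qed (use i2 in auto)
  then show ?thesis by (rule lborel_pair.Fubini_integral)
qed

lemma integrable_nn_integral_le:
  assumes "integrable M f" "\<And>x. 0 \<le> f x"
  obtains C :: real where "C > 0" "(\<integral>\<^sup>+x. ennreal (f x) \<partial>M) \<le> ennreal C"
proof
  show "max 1 (\<integral>x. f x \<partial>M) > 0" by simp
  show "(\<integral>\<^sup>+x. ennreal (f x) \<partial>M) \<le> ennreal (max 1 (\<integral>x. f x \<partial>M))"
    using assms by (subst nn_integral_eq_integral) (auto intro!: ennreal_leI)
qed

section \<open>Taylor estimates for Schwartz functions\<close>

lemma weight_shift:
  fixes z w :: "'a::real_normed_vector"
  assumes "norm (w - z) \<le> 1"
  shows "(1 + norm z) ^ N \<le> 2 ^ N * (1 + norm w) ^ N"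
proof -
  have "norm z \<le> norm w + norm (w - z)" by (metis norm_minus_commute norm_triangle_sub)
  then have "1 + norm z \<le> 2 * (1 + norm w)" using assms by (smt (verit) norm_ge_zero)
  then have "(1 + norm z) ^ N \<le> (2 * (1 + norm w)) ^ N" by (intro power_mono) auto
  then show ?thesis unfolding power_mult_distrib .
qed

text \<open>
  Peetre's inequality: the polynomial weight is submultiplicative. It moves weights across
  convolutions and translations.
\<close>

lemma weight_mult:
  fixes x y :: "'a::real_normed_vector"
  shows "(1 + norm (x + y)) ^ N \<le> (1 + norm x) ^ N * (1 + norm y) ^ N"
proof -
  have "1 + norm (x + y) \<le> (1 + norm x) * (1 + norm y)"
  proof -
    have "(1 + norm x) * (1 + norm y) = 1 + norm x + norm y + norm x * norm y" by (simp add: algebra_simps)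
    then show ?thesis using norm_triangle_ineq[of x y] mult_nonneg_nonneg[OF norm_ge_zero norm_ge_zero, of x y] by linarith
  qed
  then show ?thesis unfolding power_mult_distrib[symmetric] by (intro power_mono) auto
qed

lemma onorm_partial_sum:
  fixes p :: "'a::euclidean_space \<Rightarrow> complex"
  shows "onorm (\<lambda>h. \<Sum>b\<in>Basis. (h \<bullet> b) *\<^sub>R p b) \<le> (\<Sum>b\<in>Basis. norm (p b))"
proof (rule onorm_bound)
  fix h :: 'a
  have "norm (\<Sum>b\<in>Basis. (h \<bullet> b) *\<^sub>R p b) \<le> (\<Sum>b\<in>Basis. norm (p b) * norm h)"
    by (rule sum_norm_le) (use Basis_le_norm[of _ h] in \<open>auto simp: mult.commute[of _ "norm h"] intro!: mult_right_mono\<close>)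
  then show "norm (\<Sum>b\<in>Basis. (h \<bullet> b) *\<^sub>R p b) \<le> (\<Sum>b\<in>Basis. norm (p b)) * norm h"
    by (simp add: sum_distrib_right)
qed (auto intro: sum_nonneg)

lemma norm_between:
  fixes z h w :: "'a::real_normed_vector"
  assumes "norm h \<le> 1" "w \<in> closed_segment z (z + h)"
  shows "norm (w - z) \<le> norm h" "norm (w - z) \<le> 1"
proof -
  show "norm (w - z) \<le> norm h" using segment_bound(1)[OF assms(2)] by (simp add: norm_minus_commute)
  then show "norm (w - z) \<le> 1" using assms(1) by simp
qed

text \<open>
  The mean value inequality on the segment from \<open>z\<close> to \<open>z + h\<close>. Because \<open>norm h \<le> 1\<close>, the weight at any
  intermediate point is comparable with the weight at \<open>z\<close>, so the decay of the derivatives is kept.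
\<close>

lemma schwartz_lipschitz:
  fixes f :: "'a::euclidean_space \<Rightarrow> complex"
  assumes f: "f \<in> schwartz_space"
  obtains C where "C > 0" "\<And>z h. norm h \<le> 1 \<Longrightarrow> (1 + norm z) ^ N * norm (f (z + h) - f z) \<le> C * norm h"
proof -
  have "\<forall>b. \<exists>C. b \<in> Basis \<longrightarrow> (\<forall>x. (1 + norm x) ^ N * norm (partial_deriv b f x) \<le> C)"
    using schwartz_rapid[OF schwartz_partial[OF f]] unfolding rapid_def by blast
  then obtain D where D: "\<And>b x. b \<in> Basis \<Longrightarrow> (1 + norm x) ^ N * norm (partial_deriv b f x) \<le> D b" by metis
  define C where "C = 2 ^ N * (\<Sum>b\<in>Basis. D b)"
  have "(1 + norm z) ^ N * norm (f (z + h) - f z) \<le> C * norm h" if h: "norm h \<le> 1" for z h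
  proof -
    have p: "(1 + norm x) ^ k > 0" for k and x :: 'a by (intro zero_less_power add_pos_nonneg) auto
    have "norm (f (z + h) - f z) \<le> (C / (1 + norm z) ^ N) * norm ((z + h) - z)"
    proof (rule differentiable_bound[where S="closed_segment z (z + h)"])
      show "(f has_derivative (\<lambda>h. \<Sum>b\<in>Basis. (h \<bullet> b) *\<^sub>R partial_deriv b f x)) (at x within closed_segment z (z + h))" for x
        by (rule has_derivative_at_withinI[OF schwartz_has_derivative[OF f]])
      fix w assume w: "w \<in> closed_segment z (z + h)"
      note 1 = norm_between[OF h w]
      have "(1 + norm z) ^ N * (\<Sum>b\<in>Basis. norm (partial_deriv b f w)) \<le> 2^N * (1 + norm w) ^ N * (\<Sum>b\<in>Basis. norm (partial_deriv b f w))"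
        by (intro mult_right_mono weight_shift 1 sum_nonneg) auto
      also have "\<dots> = 2^N * (\<Sum>b\<in>Basis. (1 + norm w) ^ N * norm (partial_deriv b f w))" by (simp add: sum_distrib_left mult_ac)
      also have "\<dots> \<le> C" unfolding C_def by (intro mult_left_mono sum_mono D) auto
      finally have "(\<Sum>b\<in>Basis. norm (partial_deriv b f w)) \<le> C / (1 + norm z) ^ N"
        by (subst pos_le_divide_eq[OF p]) (simp add: mult_ac)
      then show "onorm (\<lambda>h. \<Sum>b\<in>Basis. (h \<bullet> b) *\<^sub>R partial_deriv b f w) \<le> C / (1 + norm z) ^ N"
        by (rule order_trans[OF onorm_partial_sum])
    qed auto
    then show ?thesis by (simp add: pos_le_divide_eq[OF p] mult_ac)
  qed
  moreover have "C * norm h \<le> max C 1 * norm h" for h :: 'a by (intro mult_right_mono) auto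
  ultimately show ?thesis by (intro that[of "max C 1"]) (auto intro: order_trans)
qed

text \<open>
  As in \<open>schwartz_lipschitz\<close>, now with the increment of the derivative, which is itself small of first
  order by that lemma.
\<close>

lemma schwartz_taylor:
  fixes f :: "'a::euclidean_space \<Rightarrow> complex"
  assumes f: "f \<in> schwartz_space"
  obtains C where "\<And>z h. norm h \<le> 1 \<Longrightarrow>
    (1 + norm z) ^ N * norm (f (z + h) - f z - (\<Sum>b\<in>Basis. (h \<bullet> b) *\<^sub>R partial_deriv b f z)) \<le> C * (norm h)\<^sup>2"
proof -
  have "\<forall>b. \<exists>C. b \<in> Basis \<longrightarrow> (\<forall>z h. norm h \<le> 1 \<longrightarrow> (1 + norm z) ^ N * norm (partial_deriv b f (z + h) - partial_deriv b f z) \<le> C * norm h)"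
  proof
    fix b :: 'a
    show "\<exists>C. b \<in> Basis \<longrightarrow> (\<forall>z h. norm h \<le> 1 \<longrightarrow> (1 + norm z) ^ N * norm (partial_deriv b f (z + h) - partial_deriv b f z) \<le> C * norm h)"
      by (cases "b \<in> Basis") (metis schwartz_lipschitz[OF schwartz_partial[OF f]], blast)
  qed
  then obtain D where D: "\<And>b z h. b \<in> Basis \<Longrightarrow> norm h \<le> 1 \<Longrightarrow> (1 + norm z) ^ N * norm (partial_deriv b f (z + h) - partial_deriv b f z) \<le> D b * norm h"
    by metis
  define C where "C = (\<Sum>b\<in>Basis. \<bar>D b\<bar>)"
  have "(1 + norm z) ^ N * norm (f (z + h) - f z - (\<Sum>b\<in>Basis. (h \<bullet> b) *\<^sub>R partial_deriv b f z)) \<le> C * (norm h)\<^sup>2" if h: "norm h \<le> 1" for z h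
  proof -
    have p: "(1 + norm x) ^ k > 0" for k and x :: 'a by (intro zero_less_power add_pos_nonneg) auto
    define f' where "f' = (\<lambda>x h. \<Sum>b\<in>Basis. (h \<bullet> b) *\<^sub>R partial_deriv b f x)"
    have "norm (f (z + h) - f z - f' z ((z + h) - z)) \<le> norm ((z + h) - z) * (C * norm h / (1 + norm z) ^ N)"
    proof (rule differentiable_bound_linearization[where S="closed_segment z (z + h)"])
      show "z + t *\<^sub>R (z + h - z) \<in> closed_segment z (z + h)" if "t \<in> {0..1}" for t
        using that by (auto simp: closed_segment_def algebra_simps intro!: exI[of _ t])
      show "(f has_derivative f' x) (at x within closed_segment z (z + h))" for x
        unfolding f'_def by (rule has_derivative_at_withinI[OF schwartz_has_derivative[OF f]])
      fix w assume w: "w \<in> closed_segment z (z + h)"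
      note 1 = norm_between[OF h w]
      have eq: "f' w - f' z = (\<lambda>h. \<Sum>b\<in>Basis. (h \<bullet> b) *\<^sub>R (partial_deriv b f w - partial_deriv b f z))"
        by (auto simp: f'_def scaleR_diff_right sum_subtractf)
      have "(1 + norm z) ^ N * (\<Sum>b\<in>Basis. norm (partial_deriv b f w - partial_deriv b f z))
          = (\<Sum>b\<in>Basis. (1 + norm z) ^ N * norm (partial_deriv b f (z + (w - z)) - partial_deriv b f z))"
        by (simp add: sum_distrib_left)
      also have "\<dots> \<le> (\<Sum>b\<in>Basis. \<bar>D b\<bar> * norm h)"
      proof (rule sum_mono)
        fix b :: 'a assume b: "b \<in> Basis"
        have "(1 + norm z) ^ N * norm (partial_deriv b f (z + (w - z)) - partial_deriv b f z) \<le> D b * norm (w - z)"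
          by (rule D[OF b 1(2)])
        also have "\<dots> \<le> \<bar>D b\<bar> * norm h" by (intro mult_mono 1) auto
        finally show "(1 + norm z) ^ N * norm (partial_deriv b f (z + (w - z)) - partial_deriv b f z) \<le> \<bar>D b\<bar> * norm h" .
      qed
      also have "\<dots> = C * norm h" by (simp add: C_def sum_distrib_right)
      finally have "(\<Sum>b\<in>Basis. norm (partial_deriv b f w - partial_deriv b f z)) \<le> C * norm h / (1 + norm z) ^ N"
        by (subst pos_le_divide_eq[OF p]) (simp add: mult_ac)
      then show "onorm (f' w - f' z) \<le> C * norm h / (1 + norm z) ^ N"
        unfolding eq by (rule order_trans[OF onorm_partial_sum])
    qed auto
    then show ?thesis by (simp add: pos_le_divide_eq[OF p] mult_ac f'_def power2_eq_square)
  qed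
  then show ?thesis by (rule that)
qed

lemma has_derivative_quadratic:
  fixes F :: "'a::real_normed_vector \<Rightarrow> 'b::real_normed_vector"
  assumes "bounded_linear D" and K: "\<And>h. norm h \<le> 1 \<Longrightarrow> norm (F (y + h) - F y - D h) \<le> K * (norm h)\<^sup>2"
  shows "(F has_derivative D) (at y)"
  unfolding has_derivative_at
proof (intro conjI assms(1))
  have l: "((\<lambda>h::'a. K * norm h) \<longlongrightarrow> 0) (at 0)"
    by (rule tendsto_mult_right_zero[OF tendsto_norm_zero[OF tendsto_ident_at]])
  have ev: "eventually (\<lambda>h::'a. norm h < 1 \<and> h \<noteq> 0) (at 0)"
    unfolding eventually_at by (rule exI[of _ 1]) auto
  show "(\<lambda>h. norm (F (y + h) - F y - D h) / norm h) \<midarrow>0\<rightarrow> 0"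
  proof (rule tendsto_sandwich[OF _ _ tendsto_const l])
    show "eventually (\<lambda>h. norm (F (y + h) - F y - D h) / norm h \<le> K * norm h) (at 0)"
      using ev by eventually_elim (use K in \<open>auto simp: divide_le_eq power2_eq_square mult_ac\<close>)
  qed (auto intro!: always_eventually)
qed

text \<open>
  Differentiation under the integral sign with an integrable quadratic error bound. The Fourier
  transform and convolutions satisfy it by Taylor's formula.
\<close>

lemma has_derivative_integral_quadratic:
  fixes F :: "'a::euclidean_space \<Rightarrow> 'c \<Rightarrow> complex"
  assumes F: "\<And>y. integrable M (F y)" and G: "\<And>b. b \<in> Basis \<Longrightarrow> integrable M (G b)"
    and B: "integrable M B"
    and le: "\<And>h x. norm h \<le> 1 \<Longrightarrow> norm (F (y + h) x - F y x - (\<Sum>b\<in>Basis. (h \<bullet> b) *\<^sub>R G b x)) \<le> B x * (norm h)\<^sup>2"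
  shows "((\<lambda>y. \<integral>x. F y x \<partial>M) has_derivative (\<lambda>h. \<Sum>b\<in>Basis. (h \<bullet> b) *\<^sub>R (\<integral>x. G b x \<partial>M))) (at y)"
proof (rule has_derivative_quadratic[where K="\<integral>x. B x \<partial>M"])
  show "bounded_linear (\<lambda>h. \<Sum>b\<in>Basis. (h \<bullet> b) *\<^sub>R (\<integral>x. G b x \<partial>M))"
    by (intro bounded_linear_sum bounded_linear_scaleR_const bounded_linear_inner_left)
  fix h :: 'a assume h: "norm h \<le> 1"
  have iG: "integrable M (\<lambda>x. \<Sum>b\<in>Basis. (h \<bullet> b) *\<^sub>R G b x)"
    by (intro Bochner_Integration.integrable_sum integrable_scaleR_right G)
  have "(\<integral>x. F (y + h) x \<partial>M) - (\<integral>x. F y x \<partial>M) - (\<Sum>b\<in>Basis. (h \<bullet> b) *\<^sub>R (\<integral>x. G b x \<partial>M))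
      = (\<integral>x. F (y + h) x - F y x - (\<Sum>b\<in>Basis. (h \<bullet> b) *\<^sub>R G b x) \<partial>M)"
    using F iG G by (simp add: Bochner_Integration.integral_sum)
  also have "norm \<dots> \<le> (\<integral>x. B x * (norm h)\<^sup>2 \<partial>M)"
    by (intro norm_integral_le integrable_mult_left B le h)
  also have "\<dots> = (\<integral>x. B x \<partial>M) * (norm h)\<^sup>2" using B by simp
  finally show "norm ((\<integral>x. F (y + h) x \<partial>M) - (\<integral>x. F y x \<partial>M) - (\<Sum>b\<in>Basis. (h \<bullet> b) *\<^sub>R (\<integral>x. G b x \<partial>M)))
     \<le> (\<integral>x. B x \<partial>M) * (norm h)\<^sup>2" .
qed

section \<open>The Fourier transform on the Schwartz space\<close>

lemma norm_exp_minus_i [simp]: "norm (exp (- (\<i> * complex_of_real t))) = 1"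
  by (simp add: norm_exp_eq_Re)

definition fourier_const :: "'a::euclidean_space itself \<Rightarrow> complex" where
  "fourier_const _ = complex_of_real ((2 * pi) powr (- (real DIM('a) / 2)))"

lemma fourier_altdef:
  "fourier (f :: 'a::euclidean_space \<Rightarrow> complex) \<xi> =
     fourier_const TYPE('a) * (\<integral>x. exp (- (\<i> * complex_of_real (x \<bullet> \<xi>))) * f x \<partial>lborel)"
  by (simp add: fourier_def fourier_const_def)

lemma inv_fourier_altdef:
  "inv_fourier (f :: 'a::euclidean_space \<Rightarrow> complex) x =
     fourier_const TYPE('a) * (\<integral>\<xi>. exp (\<i> * complex_of_real (x \<bullet> \<xi>)) * f \<xi> \<partial>lborel)"
  by (simp add: inv_fourier_def fourier_const_def)

text \<open>
  Hence properties of the inverse transform follow from those of the transform by reflection.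
\<close>

lemma inv_fourier_eq: "inv_fourier f x = fourier f (- x)"
  by (simp add: inv_fourier_altdef fourier_altdef inner_commute)

lemma integrable_character_mult:
  fixes f :: "'a::euclidean_space \<Rightarrow> complex"
  assumes "integrable lborel f"
  shows "integrable lborel (\<lambda>x. exp (- (\<i> * complex_of_real (x \<bullet> \<xi>))) * f x)"
proof (rule Bochner_Integration.integrable_bound[OF assms])
  have [measurable]: "f \<in> borel_measurable borel" using borel_measurable_integrable[OF assms] by simp
  show "(\<lambda>x. exp (- (\<i> * complex_of_real (x \<bullet> \<xi>))) * f x) \<in> borel_measurable lborel" by measurable
qed (simp add: norm_mult)

lemma character_taylor:
  "norm (exp (- (\<i> * complex_of_real (a + t))) - exp (- (\<i> * complex_of_real a))
      - (- \<i> * complex_of_real t * exp (- (\<i> * complex_of_real a)))) \<le> t\<^sup>2"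
proof -
  have "exp (- (\<i> * complex_of_real (a + t))) - exp (- (\<i> * complex_of_real a))
      - (- \<i> * complex_of_real t * exp (- (\<i> * complex_of_real a)))
      = exp (- (\<i> * complex_of_real a)) * (iexp (- t) - (\<Sum>k\<le>1. (\<i> * complex_of_real (- t)) ^ k / fact k))"
    by (simp add: exp_add[symmetric] ring_distribs)
  also have "norm \<dots> \<le> \<bar>- t\<bar> ^ Suc 1 / fact (Suc 1)"
    unfolding norm_mult using iexp_approx1[of "- t" 1] by simp
  also have "\<dots> \<le> t\<^sup>2" by (simp add: power2_eq_square)
  finally show ?thesis .
qed

lemma fourier_has_derivative:
  fixes f :: "'a::euclidean_space \<Rightarrow> complex"
  assumes f: "f \<in> schwartz_space"
  shows "(fourier f has_derivative (\<lambda>h. \<Sum>b\<in>Basis. (h \<bullet> b) *\<^sub>R fourier (\<lambda>x. - \<i> * (of_real (x \<bullet> b) * f x)) \<xi>)) (at \<xi>)"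
proof -
  let ?e = "\<lambda>\<xi> x. exp (- (\<i> * complex_of_real (x \<bullet> \<xi>)))"
  have fb: "(\<lambda>x. - \<i> * (of_real (x \<bullet> b) * f x)) \<in> schwartz_space" if "b \<in> Basis" for b
    by (intro schwartz_cmult schwartz_coord_mult f that)
  have *: "((\<lambda>\<xi>. \<integral>x. ?e \<xi> x * f x \<partial>lborel) has_derivative
      (\<lambda>h. \<Sum>b\<in>Basis. (h \<bullet> b) *\<^sub>R (\<integral>x. ?e \<xi> x * (- \<i> * (of_real (x \<bullet> b) * f x)) \<partial>lborel))) (at \<xi>)"
  proof (rule has_derivative_integral_quadratic)
    show "integrable lborel (\<lambda>x. ?e \<xi> x * f x)" for \<xi>
      by (intro integrable_character_mult schwartz_integrable f)
    show "integrable lborel (\<lambda>x. ?e \<xi> x * (- \<i> * (of_real (x \<bullet> b) * f x)))" if "b \<in> Basis" for b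
      by (intro integrable_character_mult schwartz_integrable fb that)
    show "integrable lborel (\<lambda>x. (1 + norm x) ^ 2 * norm (f x))"
      by (rule schwartz_integrable_weight[OF f])
    fix h x :: 'a
    have hx: "(\<Sum>b\<in>Basis. complex_of_real (h \<bullet> b) * complex_of_real (x \<bullet> b)) = of_real (x \<bullet> h)"
      by (subst (2) euclidean_inner) (simp add: mult.commute)
    have "(\<Sum>b\<in>Basis. (h \<bullet> b) *\<^sub>R (?e \<xi> x * (- \<i> * (of_real (x \<bullet> b) * f x))))
       = - \<i> * (\<Sum>b\<in>Basis. complex_of_real (h \<bullet> b) * complex_of_real (x \<bullet> b)) * ?e \<xi> x * f x"
      unfolding sum_distrib_left sum_distrib_right scaleR_conv_of_real by (intro sum.cong) (auto simp: mult_ac)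
    then have "?e (\<xi> + h) x * f x - ?e \<xi> x * f x - (\<Sum>b\<in>Basis. (h \<bullet> b) *\<^sub>R (?e \<xi> x * (- \<i> * (of_real (x \<bullet> b) * f x))))
       = (?e (\<xi> + h) x - ?e \<xi> x - (- \<i> * of_real (x \<bullet> h) * ?e \<xi> x)) * f x"
      unfolding hx by (simp add: algebra_simps)
    also have "norm \<dots> \<le> (x \<bullet> h)\<^sup>2 * norm (f x)"
      unfolding norm_mult inner_add_right by (intro mult_right_mono character_taylor) auto
    also have "\<dots> \<le> ((1 + norm x) * norm h)\<^sup>2 * norm (f x)"
    proof (intro mult_right_mono)
      have "\<bar>x \<bullet> h\<bar> \<le> norm x * norm h" by (rule Cauchy_Schwarz_ineq2)
      also have "\<dots> \<le> (1 + norm x) * norm h" by (intro mult_right_mono) auto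
      finally have "\<bar>x \<bullet> h\<bar>\<^sup>2 \<le> ((1 + norm x) * norm h)\<^sup>2" by (intro power_mono) auto
      then show "(x \<bullet> h)\<^sup>2 \<le> ((1 + norm x) * norm h)\<^sup>2" by simp
    qed auto
    finally show "norm (?e (\<xi> + h) x * f x - ?e \<xi> x * f x - (\<Sum>b\<in>Basis. (h \<bullet> b) *\<^sub>R (?e \<xi> x * (- \<i> * (of_real (x \<bullet> b) * f x)))))
      \<le> (1 + norm x) ^ 2 * norm (f x) * (norm h)\<^sup>2" by (simp add: power_mult_distrib mult_ac)
  qed
  show ?thesis
    using has_derivative_mult_right[OF *, of "fourier_const TYPE('a)"]
    unfolding fourier_altdef[abs_def] by (simp add: sum_distrib_left)
qed

lemma partial_deriv_fourier:
  fixes f :: "'a::euclidean_space \<Rightarrow> complex"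
  assumes f: "f \<in> schwartz_space" and b: "b \<in> Basis"
  shows "partial_deriv b (fourier f) = fourier (\<lambda>x. - \<i> * (of_real (x \<bullet> b) * f x))"
proof
  fix \<xi>
  show "partial_deriv b (fourier f) \<xi> = fourier (\<lambda>x. - \<i> * (of_real (x \<bullet> b) * f x)) \<xi>"
    by (subst partial_deriv_eq[OF fourier_has_derivative[OF f]])
       (use b in \<open>simp add: inner_Basis if_distrib[of "\<lambda>t. t *\<^sub>R _"] cong: if_cong\<close>)
qed

text \<open>
  Instead of integrating by parts, the translation formula for the Fourier transform is differentiated
  at \<open>0\<close> in two ways: under the integral sign, and through the exponential factor that translation
  produces.
\<close>

lemma fourier_partial_deriv:
  fixes f :: "'a::euclidean_space \<Rightarrow> complex"
  assumes f: "f \<in> schwartz_space" and b: "b \<in> Basis"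
  shows "fourier (partial_deriv b f) \<xi> = \<i> * of_real (\<xi> \<bullet> b) * fourier f \<xi>"
proof -
  let ?e = "\<lambda>x. exp (- (\<i> * complex_of_real (x \<bullet> \<xi>)))"
  let ?I = "\<integral>x. ?e x * f x \<partial>lborel"
  note [measurable] = schwartz_measurable[OF f]
  obtain C where C: "\<And>z h. norm h \<le> 1 \<Longrightarrow>
      (1 + norm z) ^ (2 * DIM('a)) * norm (f (z + h) - f z - (\<Sum>b\<in>Basis. (h \<bullet> b) *\<^sub>R partial_deriv b f z)) \<le> C * (norm h)\<^sup>2"
    using schwartz_taylor[OF f] by blast
  \<comment> \<open>derivative of the shifted integral, computed under the integral sign\<close>
  have D1: "((\<lambda>y. \<integral>x. ?e x * f (x + y) \<partial>lborel) has_derivative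
      (\<lambda>h. \<Sum>b\<in>Basis. (h \<bullet> b) *\<^sub>R (\<integral>x. ?e x * partial_deriv b f x \<partial>lborel))) (at 0)"
  proof (rule has_derivative_integral_quadratic)
    show "integrable lborel (\<lambda>x. ?e x * f (x + y))" for y
      by (intro integrable_character_mult schwartz_integrable) (use schwartz_affine[OF f, of 1 y] in simp)
    show "integrable lborel (\<lambda>x. ?e x * partial_deriv b f x)" if "b \<in> Basis" for b
      by (intro integrable_character_mult schwartz_integrable schwartz_partial f that)
    show "integrable lborel (\<lambda>x::'a. C * (1 / (1 + norm x) ^ (2 * DIM('a))))"
      by (intro integrable_mult_right integrable_weight)
    fix h x :: 'a assume h: "norm h \<le> 1"
    have p: "(1 + norm x) ^ (2 * DIM('a)) > 0" by (intro zero_less_power add_pos_nonneg) auto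
    have "?e x * f (x + (0 + h)) - ?e x * f (x + 0) - (\<Sum>b\<in>Basis. (h \<bullet> b) *\<^sub>R (?e x * partial_deriv b f x))
        = ?e x * (f (x + h) - f x - (\<Sum>b\<in>Basis. (h \<bullet> b) *\<^sub>R partial_deriv b f x))"
      by (simp add: right_diff_distrib sum_distrib_left)
    also have "norm \<dots> = norm (f (x + h) - f x - (\<Sum>b\<in>Basis. (h \<bullet> b) *\<^sub>R partial_deriv b f x))"
      by (simp add: norm_mult)
    also have "\<dots> \<le> C * (1 / (1 + norm x) ^ (2 * DIM('a))) * (norm h)\<^sup>2"
      using C[OF h, of x] p by (simp add: pos_le_divide_eq mult_ac)
    finally show "norm (?e x * f (x + (0 + h)) - ?e x * f (x + 0) - (\<Sum>b\<in>Basis. (h \<bullet> b) *\<^sub>R (?e x * partial_deriv b f x)))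
        \<le> C * (1 / (1 + norm x) ^ (2 * DIM('a))) * (norm h)\<^sup>2" .
  qed
  have shift: "(\<integral>x. ?e x * f (x + y) \<partial>lborel) = exp (\<i> * complex_of_real (y \<bullet> \<xi>)) * ?I" for y
  proof -
    have "(\<integral>x. ?e x * f (x + y) \<partial>lborel) = (\<integral>x. ?e (x - y) * f x \<partial>lborel)"
      using integral_affine[of 1 "\<lambda>x. ?e (x - y) * f x" y] by (simp add: add.commute)
    also have "\<dots> = (\<integral>x. exp (\<i> * complex_of_real (y \<bullet> \<xi>)) * (?e x * f x) \<partial>lborel)"
    proof (intro Bochner_Integration.integral_cong refl)
      fix x
      have "?e (x - y) = exp (\<i> * complex_of_real (y \<bullet> \<xi>)) * ?e x"
        by (simp add: exp_add[symmetric] inner_diff_left right_diff_distrib)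
      then show "?e (x - y) * f x = exp (\<i> * complex_of_real (y \<bullet> \<xi>)) * (?e x * f x)" by simp
    qed
    finally show ?thesis by simp
  qed
  have "((\<lambda>y. \<i> * complex_of_real (y \<bullet> \<xi>)) has_derivative (\<lambda>h. \<i> * complex_of_real (h \<bullet> \<xi>))) (at 0)"
    by (auto intro!: derivative_eq_intros)
  from has_derivative_compose[OF this DERIV_exp[unfolded has_field_derivative_def]]
  have "((\<lambda>y. exp (\<i> * complex_of_real (y \<bullet> \<xi>)) * ?I) has_derivative (\<lambda>h. \<i> * of_real (h \<bullet> \<xi>) * ?I)) (at 0)"
    by (auto intro!: derivative_eq_intros)
  \<comment> \<open>the same derivative, computed from the exponential factor\<close>
  then have D2: "((\<lambda>y. \<integral>x. ?e x * f (x + y) \<partial>lborel) has_derivative (\<lambda>h. \<i> * of_real (h \<bullet> \<xi>) * ?I)) (at 0)"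
    unfolding shift .
  have "(\<integral>x. ?e x * partial_deriv b f x \<partial>lborel) = \<i> * of_real (b \<bullet> \<xi>) * ?I"
    using fun_cong[OF has_derivative_unique[OF D1 D2], of b] b
    by (simp add: inner_Basis if_distrib[of "\<lambda>t. t *\<^sub>R _"] cong: if_cong)
  then show ?thesis unfolding fourier_altdef by (simp add: inner_commute mult_ac)
qed

lemma fourier_cmult: "fourier (\<lambda>x. c * f x) \<xi> = c * fourier f \<xi>"
  unfolding fourier_altdef by (simp add: mult.left_commute[of _ c])

text \<open>
  The class of Fourier transforms of Schwartz functions consists of bounded functions and is closed
  under coordinate multiplication and under partial derivatives, each of which the Fourier transform turns into
  the other.
\<close>

lemma fourier_schwartz:
  fixes f :: "'a::euclidean_space \<Rightarrow> complex"
  assumes "f \<in> schwartz_space" shows "fourier f \<in> schwartz_space"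
proof (rule schwartz_coinduct[where X="\<lambda>h. \<exists>f\<in>schwartz_space. h = fourier f"])
  fix h :: "'a \<Rightarrow> complex"
  assume h: "\<exists>f\<in>schwartz_space. h = fourier f"
  show "rapid h"
  proof (rule rapid_coordinates[where X="\<lambda>h. \<exists>f\<in>schwartz_space. h = fourier f", OF h])
    fix h :: "'a \<Rightarrow> complex"
    assume "\<exists>f\<in>schwartz_space. h = fourier f"
    then obtain f where f: "f \<in> schwartz_space" "h = fourier f" by blast
    have "norm (h x) \<le> norm (fourier_const TYPE('a)) * (\<integral>x. norm (f x) \<partial>lborel)" for x
      unfolding f(2) fourier_altdef norm_mult
      by (intro mult_left_mono norm_integral_le integrable_norm schwartz_integrable f) (auto simp: norm_mult)
    then show "\<exists>C. \<forall>x. norm (h x) \<le> C" by blast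
    fix b :: 'a assume b: "b \<in> Basis"
    have "(\<lambda>x. of_real (x \<bullet> b) * h x) = fourier (\<lambda>x. - \<i> * partial_deriv b f x)"
      unfolding f(2) fourier_cmult[abs_def] fourier_partial_deriv[OF f(1) b] by (rule ext) (simp flip: mult.assoc)
    moreover have "(\<lambda>x. - \<i> * partial_deriv b f x) \<in> schwartz_space"
      by (intro schwartz_cmult schwartz_partial f b)
    ultimately show "\<exists>f\<in>schwartz_space. (\<lambda>x. of_real (x \<bullet> b) * h x) = fourier f" by blast
  qed
  show "h differentiable (at x)" for x
    using h fourier_has_derivative differentiableI by blast
  fix b :: 'a assume b: "b \<in> Basis"
  obtain f where f: "f \<in> schwartz_space" "h = fourier f" using h by blast
  show "\<exists>f\<in>schwartz_space. partial_deriv b h = fourier f"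
    unfolding f(2) partial_deriv_fourier[OF f(1) b]
    using schwartz_cmult[OF schwartz_coord_mult[OF f(1) b], of "- \<i>"] by blast
qed (use assms in blast)

lemma inv_fourier_schwartz:
  "f \<in> schwartz_space \<Longrightarrow> inv_fourier f \<in> schwartz_space"
  unfolding inv_fourier_eq[abs_def] by (intro schwartz_reflect fourier_schwartz)

subsection \<open>Fourier inversion\<close>

lemma integral_lborel_prod:
  fixes f :: "'a::euclidean_space \<Rightarrow> real \<Rightarrow> complex"
  assumes f: "\<And>b. b \<in> Basis \<Longrightarrow> integrable lborel (f b)"
  shows "(\<integral>x. (\<Prod>b\<in>Basis. f b (x \<bullet> b)) \<partial>lborel) = (\<Prod>b\<in>Basis. (\<integral>t. f b t \<partial>lborel))"
proof -
  interpret product_sigma_finite "\<lambda>b::'a. lborel :: real measure" ..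
  have [measurable]: "f b \<in> borel_measurable borel" if "b \<in> Basis" for b
    using borel_measurable_integrable[OF f[OF that]] by simp
  have "(\<integral>x. (\<Prod>b\<in>Basis. f b (x \<bullet> b)) \<partial>lborel)
      = (\<integral>g. (\<Prod>b\<in>Basis. f b ((\<Sum>b\<in>Basis. g b *\<^sub>R b) \<bullet> b)) \<partial>(\<Pi>\<^sub>M b\<in>(Basis::'a set). lborel))"
    by (subst lborel_eq, subst integral_distr) auto
  also have "\<dots> = (\<integral>g. (\<Prod>b\<in>Basis. f b (g b)) \<partial>(\<Pi>\<^sub>M b\<in>(Basis::'a set). lborel))"
    by (intro Bochner_Integration.integral_cong prod.cong) (auto simp: inner_sum_left inner_Basis if_distrib cong: if_cong)
  also have "\<dots> = (\<Prod>b\<in>Basis. (\<integral>t. f b t \<partial>lborel))"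
    by (rule product_integral_prod) (auto intro: f)
  finally show ?thesis .
qed

text \<open>
  The standard Gaussian is, up to a constant, its own Fourier transform. Scaled copies serve as
  an approximate identity in the proof of the inversion formula.
\<close>

definition gauss :: "'a::euclidean_space \<Rightarrow> real" where
  "gauss x = exp (- (norm x)\<^sup>2 / 2)"

lemma gauss_prod: "gauss (x::'a::euclidean_space) = (\<Prod>b\<in>Basis. exp (- (x \<bullet> b)\<^sup>2 / 2))"
proof -
  have "- (norm x)\<^sup>2 / 2 = (\<Sum>b\<in>Basis. - (x \<bullet> b)\<^sup>2 / 2)"
    by (simp add: norm_eq_sqrt_inner euclidean_inner[of x x] power2_eq_square[symmetric] sum_nonneg
          sum_divide_distrib[symmetric] sum_negf)
  then show ?thesis unfolding gauss_def by (simp add: exp_sum)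
qed

lemma gauss_measurable [measurable]: "gauss \<in> borel_measurable borel"
  unfolding gauss_def[abs_def] by measurable

lemma gauss_1d:
  "integrable lborel (\<lambda>t. iexp (w * t) * complex_of_real (exp (- t\<^sup>2 / 2)))"
  "(\<integral>t. iexp (w * t) * complex_of_real (exp (- t\<^sup>2 / 2)) \<partial>lborel) = complex_of_real (sqrt (2 * pi) * exp (- w\<^sup>2 / 2))"
proof -
  have eq: "complex_of_real (exp (- t\<^sup>2 / 2)) = of_real (sqrt (2 * pi)) * of_real (std_normal_density t)" for t
    unfolding of_real_mult[symmetric] std_normal_density_def by simp
  have int: "integrable lborel (\<lambda>t. std_normal_density t *\<^sub>R iexp (w * t))"
    by (rule Bochner_Integration.integrable_bound[OF integrable_normal_density[of 1 0]]) auto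
  show "integrable lborel (\<lambda>t. iexp (w * t) * complex_of_real (exp (- t\<^sup>2 / 2)))"
    unfolding eq using integrable_mult_right[OF int, of "of_real (sqrt (2 * pi))"]
    by (simp add: scaleR_conv_of_real mult_ac)
  have "(\<integral>t. std_normal_density t *\<^sub>R iexp (w * t) \<partial>lborel) = char std_normal_distribution w"
    unfolding char_def by (subst integral_density) auto
  also have "\<dots> = complex_of_real (exp (- (w\<^sup>2) / 2))" by (simp add: char_std_normal_distribution)
  finally have *: "of_real (sqrt (2 * pi)) * (\<integral>t. std_normal_density t *\<^sub>R iexp (w * t) \<partial>lborel) = of_real (sqrt (2 * pi)) * complex_of_real (exp (- (w\<^sup>2) / 2))"
    by simp
  have "(\<integral>t. iexp (w * t) * complex_of_real (exp (- t\<^sup>2 / 2)) \<partial>lborel)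
      = (\<integral>t. of_real (sqrt (2 * pi)) * (std_normal_density t *\<^sub>R iexp (w * t)) \<partial>lborel)"
    unfolding eq by (simp add: scaleR_conv_of_real mult_ac)
  also have "\<dots> = complex_of_real (sqrt (2 * pi) * exp (- w\<^sup>2 / 2))"
    unfolding integral_mult_right_zero using * by simp
  finally show "(\<integral>t. iexp (w * t) * complex_of_real (exp (- t\<^sup>2 / 2)) \<partial>lborel) = complex_of_real (sqrt (2 * pi) * exp (- w\<^sup>2 / 2))" .
qed

lemma gauss_fourier:
  fixes w :: "'a::euclidean_space"
  shows "(\<integral>z. exp (\<i> * complex_of_real (w \<bullet> z)) * of_real (gauss z) \<partial>lborel) = of_real (sqrt (2 * pi) ^ DIM('a) * gauss w)"
proof -
  have "exp (\<i> * complex_of_real (w \<bullet> z)) * of_real (gauss z)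
     = (\<Prod>b\<in>Basis. iexp ((w \<bullet> b) * (z \<bullet> b)) * complex_of_real (exp (- (z \<bullet> b)\<^sup>2 / 2)))" for z
  proof -
    have "exp (\<i> * complex_of_real (w \<bullet> z)) = (\<Prod>b\<in>Basis. iexp ((w \<bullet> b) * (z \<bullet> b)))"
      by (simp add: euclidean_inner[of w z] sum_distrib_left exp_sum)
    then show ?thesis unfolding gauss_prod by (simp add: prod.distrib)
  qed
  then have "(\<integral>z. exp (\<i> * complex_of_real (w \<bullet> z)) * of_real (gauss z) \<partial>lborel)
     = (\<integral>z. (\<Prod>b\<in>Basis. iexp ((w \<bullet> b) * (z \<bullet> b)) * complex_of_real (exp (- (z \<bullet> b)\<^sup>2 / 2))) \<partial>lborel)"
    by (intro Bochner_Integration.integral_cong) blast+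
  also have "\<dots> = (\<Prod>b\<in>Basis. (\<integral>t. iexp ((w \<bullet> b) * t) * complex_of_real (exp (- t\<^sup>2 / 2)) \<partial>lborel))"
    by (rule integral_lborel_prod) (rule gauss_1d(1))
  also have "\<dots> = of_real (sqrt (2 * pi) ^ DIM('a) * gauss w)"
    unfolding gauss_1d(2) gauss_prod by (simp add: prod.distrib)
  finally show ?thesis .
qed

text \<open>
  The integral of a non-integrable function is \<open>0\<close>, so a nonzero value proves integrability.
\<close>

lemma integrable_gauss: "integrable lborel (gauss :: 'a::euclidean_space \<Rightarrow> real)"
proof -
  have "(\<integral>z. exp (\<i> * complex_of_real (0 \<bullet> z)) * of_real (gauss z) \<partial>(lborel :: 'a measure)) \<noteq> 0"
    by (subst gauss_fourier) (simp add: gauss_def)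
  then have "integrable lborel (\<lambda>z::'a. complex_of_real (gauss z))"
    using not_integrable_integral_eq by fastforce
  then show ?thesis by (simp add: complex_of_real_integrable_eq)
qed


lemma gauss_scaled_fourier:
  fixes w :: "'a::euclidean_space"
  assumes e: "\<epsilon> > 0"
  shows "(\<integral>\<xi>. exp (\<i> * complex_of_real (w \<bullet> \<xi>)) * of_real (gauss (\<epsilon> *\<^sub>R \<xi>)) \<partial>lborel)
    = of_real ((1 / \<epsilon>) ^ DIM('a) * sqrt (2 * pi) ^ DIM('a) * gauss (w /\<^sub>R \<epsilon>))"
proof -
  have "(\<integral>\<xi>. exp (\<i> * complex_of_real (w \<bullet> \<xi>)) * of_real (gauss (\<epsilon> *\<^sub>R \<xi>)) \<partial>lborel)
     = \<bar>1 / \<epsilon>\<bar> ^ DIM('a) *\<^sub>R (\<integral>z. exp (\<i> * complex_of_real (w \<bullet> (0 + (1/\<epsilon>) *\<^sub>R z))) * of_real (gauss (\<epsilon> *\<^sub>R (0 + (1/\<epsilon>) *\<^sub>R z))) \<partial>lborel)"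
    by (rule integral_affine) (use e in auto)
  also have "(\<integral>z. exp (\<i> * complex_of_real (w \<bullet> (0 + (1/\<epsilon>) *\<^sub>R z))) * of_real (gauss (\<epsilon> *\<^sub>R (0 + (1/\<epsilon>) *\<^sub>R z))) \<partial>lborel)
     = (\<integral>z. exp (\<i> * complex_of_real ((w /\<^sub>R \<epsilon>) \<bullet> z)) * of_real (gauss z) \<partial>lborel)"
    using e by (simp add: field_simps)
  finally show ?thesis unfolding gauss_fourier using e by (simp add: scaleR_conv_of_real mult_ac)
qed

lemma gauss_bounds: "0 \<le> gauss x" "gauss x \<le> 1" "gauss 0 = 1"
  by (auto simp: gauss_def)

lemma gauss_isCont: "isCont gauss x"
  unfolding gauss_def[abs_def] by (intro continuous_intros) simp

lemma fourier_const_square: "fourier_const TYPE('a::euclidean_space) * fourier_const TYPE('a) * of_real (sqrt (2 * pi) ^ (2 * DIM('a))) = 1"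
proof -
  have "(2 * pi) powr (- (real DIM('a) / 2)) * (2 * pi) powr (- (real DIM('a) / 2)) * sqrt (2 * pi) ^ (2 * DIM('a)) = 1"
  proof -
    have "sqrt (2 * pi) ^ (2 * DIM('a)) = (2 * pi) powr (real DIM('a))"
      by (simp add: power_mult powr_realpow)
    then show ?thesis by (simp add: powr_add[symmetric] field_simps del: powr_realpow')
  qed
  then show ?thesis unfolding fourier_const_def of_real_mult[symmetric] by (simp del: of_real_mult)
qed

text \<open>
  Insert the factor \<open>gauss (\<epsilon> *\<^sub>R \<xi>)\<close> into the inversion integral. It tends to the integral without
  the factor by dominated convergence; on the other hand Fubini's theorem and the transform of the scaled
  Gaussian turn it into an average of \<open>f\<close> near \<open>x\<close> at scale \<open>\<epsilon>\<close>, which tends to \<open>f x\<close>.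
\<close>

theorem inv_fourier_fourier:
  fixes f :: "'a::euclidean_space \<Rightarrow> complex"
  assumes f: "f \<in> schwartz_space"
  shows "inv_fourier (fourier f) = f"
proof
  fix x :: 'a
  let ?c = "fourier_const TYPE('a)"
  let ?K = "complex_of_real (sqrt (2 * pi) ^ DIM('a))"
  note [measurable] = schwartz_measurable[OF f] schwartz_measurable[OF fourier_schwartz[OF f]]
  obtain B where B: "\<And>x. norm (f x) \<le> B" using schwartz_bounded[OF f] by blast
  have B0: "0 \<le> B" using B[of 0] norm_ge_zero order_trans by blast
  define \<epsilon> :: "nat \<Rightarrow> real" where "\<epsilon> k = 1 / real (Suc k)" for k
  have e: "\<epsilon> k > 0" "\<epsilon> \<longlonglongrightarrow> 0" for k
    using LIMSEQ_inverse_real_of_nat by (simp_all add: \<epsilon>_def[abs_def] inverse_eq_divide)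
  define I where "I k = (\<integral>\<xi>. exp (\<i> * complex_of_real (x \<bullet> \<xi>)) * of_real (gauss (\<epsilon> k *\<^sub>R \<xi>)) * fourier f \<xi> \<partial>lborel)" for k
  have "(\<lambda>k. I k) \<longlonglongrightarrow> (\<integral>\<xi>. exp (\<i> * complex_of_real (x \<bullet> \<xi>)) * fourier f \<xi> \<partial>lborel)"
    unfolding I_def
  proof (rule integral_dominated_convergence[where w="\<lambda>\<xi>. norm (fourier f \<xi>)"])
    show "AE \<xi> in lborel. (\<lambda>k. exp (\<i> * complex_of_real (x \<bullet> \<xi>)) * of_real (gauss (\<epsilon> k *\<^sub>R \<xi>)) * fourier f \<xi>)
        \<longlonglongrightarrow> exp (\<i> * complex_of_real (x \<bullet> \<xi>)) * fourier f \<xi>"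
    proof (rule AE_I2)
      fix \<xi> :: 'a
      have "(\<lambda>k. \<epsilon> k *\<^sub>R \<xi>) \<longlonglongrightarrow> 0 *\<^sub>R \<xi>" by (intro tendsto_intros e)
      then have "(\<lambda>k. gauss (\<epsilon> k *\<^sub>R \<xi>)) \<longlonglongrightarrow> gauss (0 :: 'a)"
        by (intro isCont_tendsto_compose[OF gauss_isCont]) simp
      then have "(\<lambda>k. exp (\<i> * complex_of_real (x \<bullet> \<xi>)) * of_real (gauss (\<epsilon> k *\<^sub>R \<xi>)) * fourier f \<xi>)
        \<longlonglongrightarrow> exp (\<i> * complex_of_real (x \<bullet> \<xi>)) * of_real (gauss (0::'a)) * fourier f \<xi>"
        by (intro tendsto_mult tendsto_of_real tendsto_const)
      then show "(\<lambda>k. exp (\<i> * complex_of_real (x \<bullet> \<xi>)) * of_real (gauss (\<epsilon> k *\<^sub>R \<xi>)) * fourier f \<xi>)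
        \<longlonglongrightarrow> exp (\<i> * complex_of_real (x \<bullet> \<xi>)) * fourier f \<xi>" by (simp add: gauss_bounds)
    qed
    show "AE \<xi> in lborel. norm (exp (\<i> * complex_of_real (x \<bullet> \<xi>)) * of_real (gauss (\<epsilon> k *\<^sub>R \<xi>)) * fourier f \<xi>) \<le> norm (fourier f \<xi>)" for k
      by (rule AE_I2) (auto simp: norm_mult gauss_bounds intro!: mult_left_le_one_le)
  qed (auto intro: integrable_norm schwartz_integrable fourier_schwartz f)
  then have lim1: "(\<lambda>k. ?c * I k) \<longlonglongrightarrow> inv_fourier (fourier f) x"
    unfolding inv_fourier_altdef by (intro tendsto_mult tendsto_const)
  \<comment> \<open>the regularised integral is a Gaussian average of \<open>f\<close> at scale \<open>\<epsilon> k\<close>\<close>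
  have I: "I k = ?c * ?K * (\<integral>z. of_real (gauss z) * f (x - \<epsilon> k *\<^sub>R z) \<partial>lborel)" for k
  proof -
    let ?\<epsilon> = "\<epsilon> k"
    let ?F = "\<lambda>y \<xi>. exp (\<i> * complex_of_real (x \<bullet> \<xi>)) * of_real (gauss (?\<epsilon> *\<^sub>R \<xi>)) * (exp (- (\<i> * complex_of_real (y \<bullet> \<xi>))) * f y)"
    have ig: "integrable lborel (\<lambda>\<xi>::'a. gauss (?\<epsilon> *\<^sub>R \<xi>))"
    proof -
      have "(\<integral>\<xi>. exp (\<i> * complex_of_real (0 \<bullet> \<xi>)) * of_real (gauss (?\<epsilon> *\<^sub>R \<xi>)) \<partial>(lborel :: 'a measure)) \<noteq> 0"
        by (subst gauss_scaled_fourier[OF e(1)]) (use e(1)[of k] in \<open>auto simp: gauss_def\<close>)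
      then have "integrable lborel (\<lambda>z::'a. complex_of_real (gauss (?\<epsilon> *\<^sub>R z)))"
        using not_integrable_integral_eq by fastforce
      then show ?thesis by (simp add: complex_of_real_integrable_eq)
    qed
    have "I k = (\<integral>\<xi>. ?c * (\<integral>y. ?F y \<xi> \<partial>lborel) \<partial>lborel)"
      unfolding I_def fourier_altdef integral_mult_right_zero by (simp only: mult.left_commute integral_mult_right_zero)
    also have "\<dots> = ?c * (\<integral>\<xi>. (\<integral>y. ?F y \<xi> \<partial>lborel) \<partial>lborel)" by simp
    also have "(\<integral>\<xi>. (\<integral>y. ?F y \<xi> \<partial>lborel) \<partial>lborel) = (\<integral>y. (\<integral>\<xi>. ?F y \<xi> \<partial>lborel) \<partial>lborel)"
    proof (rule fubini_dominated)
      show "(\<lambda>(y, \<xi>). ?F y \<xi>) \<in> borel_measurable (borel \<Otimes>\<^sub>M borel)" by measurable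
      show "integrable lborel (\<lambda>y. norm (f y))" by (intro integrable_norm schwartz_integrable f)
      show "integrable lborel (\<lambda>\<xi>::'a. gauss (?\<epsilon> *\<^sub>R \<xi>))" by (rule ig)
    qed (simp add: norm_mult gauss_bounds)
    also have "(\<integral>y. (\<integral>\<xi>. ?F y \<xi> \<partial>lborel) \<partial>lborel)
        = (\<integral>y. f y * of_real ((1 / ?\<epsilon>) ^ DIM('a) * sqrt (2 * pi) ^ DIM('a) * gauss ((x - y) /\<^sub>R ?\<epsilon>)) \<partial>lborel)"
    proof (intro Bochner_Integration.integral_cong refl)
      fix y
      have "(\<integral>\<xi>. ?F y \<xi> \<partial>lborel) = (\<integral>\<xi>. f y * (exp (\<i> * complex_of_real ((x - y) \<bullet> \<xi>)) * of_real (gauss (?\<epsilon> *\<^sub>R \<xi>))) \<partial>lborel)"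
      proof (intro Bochner_Integration.integral_cong refl)
        fix \<xi>
        have "exp (\<i> * complex_of_real ((x - y) \<bullet> \<xi>)) = exp (\<i> * complex_of_real (x \<bullet> \<xi>)) * exp (- (\<i> * complex_of_real (y \<bullet> \<xi>)))"
          by (simp add: exp_add[symmetric] inner_diff_left right_diff_distrib)
        then show "?F y \<xi> = f y * (exp (\<i> * complex_of_real ((x - y) \<bullet> \<xi>)) * of_real (gauss (?\<epsilon> *\<^sub>R \<xi>)))" by simp
      qed
      also have "\<dots> = f y * of_real ((1 / ?\<epsilon>) ^ DIM('a) * sqrt (2 * pi) ^ DIM('a) * gauss ((x - y) /\<^sub>R ?\<epsilon>))"
        by (subst integral_mult_right_zero, subst gauss_scaled_fourier[OF e(1)]) simp
      finally show "(\<integral>\<xi>. ?F y \<xi> \<partial>lborel) = f y * of_real ((1 / ?\<epsilon>) ^ DIM('a) * sqrt (2 * pi) ^ DIM('a) * gauss ((x - y) /\<^sub>R ?\<epsilon>))" .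
    qed
    also have "\<dots> = \<bar>- ?\<epsilon>\<bar> ^ DIM('a) *\<^sub>R (\<integral>z. f (x + (- ?\<epsilon>) *\<^sub>R z) *
         of_real ((1 / ?\<epsilon>) ^ DIM('a) * sqrt (2 * pi) ^ DIM('a) * gauss ((x - (x + (- ?\<epsilon>) *\<^sub>R z)) /\<^sub>R ?\<epsilon>)) \<partial>lborel)"
      by (rule integral_affine) (use e(1)[of k] in auto)
    also have "\<dots> = \<bar>- ?\<epsilon>\<bar> ^ DIM('a) *\<^sub>R (\<integral>z. of_real ((1 / ?\<epsilon>) ^ DIM('a)) * ?K * (of_real (gauss z) * f (x - ?\<epsilon> *\<^sub>R z)) \<partial>lborel)"
      using e(1)[of k] by (simp add: mult_ac)
    also have "\<dots> = ?K * (\<integral>z. of_real (gauss z) * f (x - ?\<epsilon> *\<^sub>R z) \<partial>lborel)"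
      unfolding integral_mult_right_zero using e(1)[of k]
      by (simp add: scaleR_conv_of_real power_divide)
    finally show ?thesis by simp
  qed
  have "(\<lambda>k. \<integral>z. of_real (gauss z) * f (x - \<epsilon> k *\<^sub>R z) \<partial>lborel) \<longlonglongrightarrow> (\<integral>z. of_real (gauss z) * f x \<partial>(lborel :: 'a measure))"
  proof (rule integral_dominated_convergence[where w="\<lambda>z. gauss z * B"])
    show "AE z in lborel. (\<lambda>k. complex_of_real (gauss z) * f (x - \<epsilon> k *\<^sub>R z)) \<longlonglongrightarrow> of_real (gauss z) * f x"
    proof (rule AE_I2)
      fix z :: 'a
      have "(\<lambda>k. x - \<epsilon> k *\<^sub>R z) \<longlonglongrightarrow> x - 0 *\<^sub>R z" by (intro tendsto_intros e)
      then have "(\<lambda>k. f (x - \<epsilon> k *\<^sub>R z)) \<longlonglongrightarrow> f x"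
        by (intro isCont_tendsto_compose[OF differentiable_imp_continuous_within[OF schwartz_differentiable[OF f]]]) simp
      then show "(\<lambda>k. complex_of_real (gauss z) * f (x - \<epsilon> k *\<^sub>R z)) \<longlonglongrightarrow> of_real (gauss z) * f x"
        by (intro tendsto_mult tendsto_const)
    qed
    show "AE z in lborel. norm (complex_of_real (gauss z) * f (x - \<epsilon> k *\<^sub>R z)) \<le> gauss z * B" for k
      by (rule AE_I2) (auto simp: norm_mult gauss_bounds intro!: mult_left_mono B)
  qed (auto intro: integrable_mult_left integrable_gauss)
  also have "(\<integral>z. of_real (gauss z) * f x \<partial>(lborel :: 'a measure)) = ?K * f x"
    using gauss_fourier[of "0 :: 'a"] by (simp add: gauss_bounds)
  finally have "(\<lambda>k. ?c * I k) \<longlonglongrightarrow> ?c * (?c * ?K * (?K * f x))"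
    unfolding I by (intro tendsto_mult tendsto_const)
  also have "?c * (?c * ?K * (?K * f x)) = (?c * ?c * of_real (sqrt (2 * pi) ^ (2 * DIM('a)))) * f x"
    unfolding mult_2 power_add of_real_mult by (simp only: mult_ac)
  also have "\<dots> = f x" unfolding fourier_const_square by simp
  finally show "inv_fourier (fourier f) x = f x" using lim1 LIMSEQ_unique by blast
qed

lemma fourier_inv_fourier:
  fixes f :: "'a::euclidean_space \<Rightarrow> complex"
  assumes f: "f \<in> schwartz_space"
  shows "fourier (inv_fourier f) = f"
proof
  fix x
  note [measurable] = schwartz_measurable[OF f] schwartz_measurable[OF inv_fourier_schwartz[OF f]]
  have "fourier (inv_fourier f) x = fourier_const TYPE('a) * (\<integral>y. exp (- (\<i> * complex_of_real ((0 + (-1) *\<^sub>R y) \<bullet> x))) * inv_fourier f (0 + (-1) *\<^sub>R y) \<partial>lborel)"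
    unfolding fourier_altdef by (subst integral_affine[of "-1" _ 0]) auto
  also have "\<dots> = inv_fourier (fourier f) x"
    unfolding inv_fourier_altdef[of "fourier f"] by (simp add: inv_fourier_eq inner_commute)
  finally show "fourier (inv_fourier f) x = f x" unfolding inv_fourier_fourier[OF f] .
qed

section \<open>Convolution with Schwartz functions and tempered distributions\<close>

definition convolution :: "('a::euclidean_space \<Rightarrow> complex) \<Rightarrow> ('a \<Rightarrow> complex) \<Rightarrow> 'a \<Rightarrow> complex" where
  "convolution f \<kappa> y = (\<integral>x. f x * \<kappa> (y - x) \<partial>lborel)"

text \<open>
  The functions that can be paired with anything of polynomial growth. Unlike the Schwartz functions
  they are stable under restriction to a Borel set, which the proof of the interchange theorem exploits.
\<close>

definition rapid_L1 :: "('a::euclidean_space \<Rightarrow> complex) \<Rightarrow> bool" where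
  "rapid_L1 f \<longleftrightarrow> f \<in> borel_measurable borel \<and> (\<forall>N. integrable lborel (\<lambda>x. (1 + norm x) ^ N * norm (f x)))"

lemma schwartz_rapid_L1: "f \<in> schwartz_space \<Longrightarrow> rapid_L1 f"
  by (simp add: rapid_L1_def schwartz_integrable_weight schwartz_measurable)

lemma rapid_L1D:
  assumes "rapid_L1 f"
  shows "f \<in> borel_measurable borel" "integrable lborel (\<lambda>x. (1 + norm x) ^ N * norm (f x))" "integrable lborel (\<lambda>x. norm (f x))"
proof -
  show 1: "integrable lborel (\<lambda>x. (1 + norm x) ^ N * norm (f x))" for N using assms by (simp add: rapid_L1_def)
  show "integrable lborel (\<lambda>x. norm (f x))" using 1[of 0] by simp
qed (use assms in \<open>simp add: rapid_L1_def\<close>)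

lemma rapid_L1_indicator:
  assumes f: "rapid_L1 f" and [measurable]: "A \<in> sets borel"
  shows "rapid_L1 (\<lambda>x. indicator A x * f x)"
  unfolding rapid_L1_def
proof (intro conjI allI)
  note [measurable] = rapid_L1D(1)[OF f]
  show "(\<lambda>x. indicator A x * f x) \<in> borel_measurable borel" by measurable
  fix N
  show "integrable lborel (\<lambda>x. (1 + norm x) ^ N * norm (indicator A x * f x))"
    by (rule Bochner_Integration.integrable_bound[OF rapid_L1D(2)[OF f, of N]])
       (measurable, auto simp: norm_mult indicator_def)
qed

lemma integrable_convolution:
  assumes f: "rapid_L1 f" and k: "\<kappa> \<in> schwartz_space"
  shows "integrable lborel (\<lambda>x. f x * \<kappa> (y - x))"
proof -
  note [measurable] = rapid_L1D(1)[OF f] schwartz_measurable[OF k]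
  obtain C where C: "\<And>x. norm (\<kappa> x) \<le> C" using schwartz_bounded[OF k] by blast
  show ?thesis
    by (rule Bochner_Integration.integrable_bound[OF integrable_mult_left[OF rapid_L1D(3)[OF f], of C]])
       (measurable, auto simp: norm_mult abs_mult intro!: mult_left_mono order_trans[OF C])
qed

lemma convolution_weight_bound:
  assumes f: "rapid_L1 f" and k: "\<And>z. (1 + norm z) ^ N * norm (\<kappa> z) \<le> C"
  shows "(1 + norm y) ^ N * norm (convolution f \<kappa> y) \<le> (\<integral>x. (1 + norm x) ^ N * norm (f x) \<partial>lborel) * C"
proof -
  have p: "0 \<le> (1 + norm y) ^ N" by simp
  have "(1 + norm y) ^ N * norm (convolution f \<kappa> y) = norm (\<integral>x. of_real ((1 + norm y) ^ N) * (f x * \<kappa> (y - x)) \<partial>lborel)"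
    unfolding integral_mult_right_zero norm_mult convolution_def[symmetric] norm_of_real abs_of_nonneg[OF p] ..
  also have "\<dots> \<le> (\<integral>x. ((1 + norm x) ^ N * norm (f x)) * C \<partial>lborel)"
  proof (rule norm_integral_le)
    show "integrable lborel (\<lambda>x. ((1 + norm x) ^ N * norm (f x)) * C)"
      by (intro integrable_mult_left rapid_L1D f)
    fix x
    have "norm (of_real ((1 + norm y) ^ N) * (f x * \<kappa> (y - x))) = (1 + norm y) ^ N * (norm (f x) * norm (\<kappa> (y - x)))"
      unfolding norm_mult norm_of_real abs_of_nonneg[OF p] ..
    also have "\<dots> \<le> ((1 + norm x) ^ N * (1 + norm (y - x)) ^ N) * (norm (f x) * norm (\<kappa> (y - x)))"
      using weight_mult[of x "y - x" N] by (intro mult_right_mono) auto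
    also have "\<dots> = ((1 + norm x) ^ N * norm (f x)) * ((1 + norm (y - x)) ^ N * norm (\<kappa> (y - x)))" by (simp add: mult_ac)
    also have "\<dots> \<le> ((1 + norm x) ^ N * norm (f x)) * C" by (intro mult_left_mono k) auto
    finally show "norm (of_real ((1 + norm y) ^ N) * (f x * \<kappa> (y - x))) \<le> ((1 + norm x) ^ N * norm (f x)) * C" .
  qed
  also have "\<dots> = (\<integral>x. (1 + norm x) ^ N * norm (f x) \<partial>lborel) * C" by simp
  finally show ?thesis .
qed

lemma convolution_has_derivative:
  assumes f: "rapid_L1 f" and k: "\<kappa> \<in> schwartz_space"
  shows "(convolution f \<kappa> has_derivative (\<lambda>h. \<Sum>b\<in>Basis. (h \<bullet> b) *\<^sub>R convolution f (partial_deriv b \<kappa>) y)) (at y)"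
proof -
  obtain C where C: "\<And>z h. norm h \<le> 1 \<Longrightarrow>
      (1 + norm z) ^ 0 * norm (\<kappa> (z + h) - \<kappa> z - (\<Sum>b\<in>Basis. (h \<bullet> b) *\<^sub>R partial_deriv b \<kappa> z)) \<le> C * (norm h)\<^sup>2"
    using schwartz_taylor[OF k] by blast
  show ?thesis
    unfolding convolution_def[abs_def]
  proof (rule has_derivative_integral_quadratic)
    show "integrable lborel (\<lambda>x. norm (f x) * C)" by (intro integrable_mult_left rapid_L1D f)
    fix h x :: 'a assume h: "norm h \<le> 1"
    have "f x * \<kappa> (y + h - x) - f x * \<kappa> (y - x) - (\<Sum>b\<in>Basis. (h \<bullet> b) *\<^sub>R (f x * partial_deriv b \<kappa> (y - x)))
       = f x * (\<kappa> ((y - x) + h) - \<kappa> (y - x) - (\<Sum>b\<in>Basis. (h \<bullet> b) *\<^sub>R partial_deriv b \<kappa> (y - x)))"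
      by (simp add: right_diff_distrib sum_distrib_left algebra_simps)
    also have "norm \<dots> \<le> norm (f x) * (C * (norm h)\<^sup>2)"
      unfolding norm_mult using C[OF h, of "y - x"] by (intro mult_left_mono) auto
    finally show "norm (f x * \<kappa> (y + h - x) - f x * \<kappa> (y - x) - (\<Sum>b\<in>Basis. (h \<bullet> b) *\<^sub>R (f x * partial_deriv b \<kappa> (y - x))))
        \<le> norm (f x) * C * (norm h)\<^sup>2" by (simp add: mult_ac)
  qed (intro integrable_convolution f k schwartz_partial; assumption)+
qed

lemma partial_deriv_convolution:
  assumes f: "rapid_L1 f" and k: "\<kappa> \<in> schwartz_space" and b: "b \<in> Basis"
  shows "partial_deriv b (convolution f \<kappa>) = convolution f (partial_deriv b \<kappa>)"
  by (rule ext, subst partial_deriv_eq[OF convolution_has_derivative[OF f k]])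
     (use b in \<open>simp add: inner_Basis if_distrib[of "\<lambda>t. t *\<^sub>R _"] cong: if_cong\<close>)

lemma iter_deriv_convolution:
  assumes f: "rapid_L1 f" and k: "\<kappa> \<in> schwartz_space" and "set bs \<subseteq> Basis"
  shows "iter_deriv bs (convolution f \<kappa>) = convolution f (iter_deriv bs \<kappa>)"
  using assms(3) by (induction bs) (simp_all add: partial_deriv_convolution f k schwartz_iter_deriv)

text \<open>
  Derivatives fall on the Schwartz factor, so decay of the other factor in the mean is enough.
\<close>

lemma convolution_schwartz:
  assumes f: "rapid_L1 f" and k: "\<kappa> \<in> schwartz_space"
  shows "convolution f \<kappa> \<in> schwartz_space"
proof (rule schwartz_coinduct[where X="\<lambda>h. \<exists>\<kappa>\<in>schwartz_space. h = convolution f \<kappa>"])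
  fix h assume "\<exists>\<kappa>\<in>schwartz_space. h = convolution f \<kappa>"
  then obtain \<kappa> where k: "\<kappa> \<in> schwartz_space" "h = convolution f \<kappa>" by blast
  show "rapid h" unfolding rapid_def k(2)
  proof
    fix N
    obtain C where "\<And>x. (1 + norm x) ^ N * norm (\<kappa> x) \<le> C"
      using rapidE[OF schwartz_rapid[OF k(1)]] by metis
    then show "\<exists>C. \<forall>x. (1 + norm x) ^ N * norm (convolution f \<kappa> x) \<le> C"
      using convolution_weight_bound[OF f] by blast
  qed
  show "h differentiable (at x)" for x
    unfolding k(2) using convolution_has_derivative[OF f k(1)] differentiableI by blast
  fix b :: 'a assume b: "b \<in> Basis"
  show "\<exists>\<kappa>\<in>schwartz_space. partial_deriv b h = convolution f \<kappa>"
    unfolding k(2) partial_deriv_convolution[OF f k(1) b] using schwartz_partial[OF k(1) b] by blast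
qed (use k in blast)

lemma iter_deriv_translate:
  assumes "\<kappa> \<in> schwartz_space" "set bs \<subseteq> Basis"
  shows "iter_deriv bs (\<lambda>y. \<kappa> (y - x)) = (\<lambda>y. iter_deriv bs \<kappa> (y - x))"
  using assms(2)
proof (induction bs)
  case (Cons b bs)
  have "partial_deriv b (\<lambda>y. iter_deriv bs \<kappa> (1 *\<^sub>R y + - x)) y = of_real 1 * partial_deriv b (iter_deriv bs \<kappa>) (1 *\<^sub>R y + - x)" for y
    using Cons by (intro partial_deriv_affine schwartz_differentiable schwartz_iter_deriv assms) auto
  then show ?case using Cons by auto
qed simp

lemma iter_deriv_diff:
  assumes "f \<in> schwartz_space" "g \<in> schwartz_space" "set bs \<subseteq> Basis"
  shows "iter_deriv bs (\<lambda>y. f y - g y) = (\<lambda>y. iter_deriv bs f y - iter_deriv bs g y)"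
  using assms(3)
proof (induction bs)
  case (Cons b bs)
  have "partial_deriv b (\<lambda>y. iter_deriv bs f y - iter_deriv bs g y) y = partial_deriv b (iter_deriv bs f) y - partial_deriv b (iter_deriv bs g) y" for y
    using Cons unfolding partial_deriv_def
    by (subst frechet_derivative_at[OF has_derivative_diff[OF schwartz_has_derivative_frechet schwartz_has_derivative_frechet], symmetric])
       (auto intro: schwartz_iter_deriv assms)
  then show ?case using Cons by auto
qed simp

lemma iter_deriv_cmult:
  assumes "f \<in> schwartz_space" "set bs \<subseteq> Basis"
  shows "iter_deriv bs (\<lambda>y. c * f y) = (\<lambda>y. c * iter_deriv bs f y)"
  using assms(2)
proof (induction bs)
  case (Cons b bs)
  have "partial_deriv b (\<lambda>y. c * iter_deriv bs f y) y = c * partial_deriv b (iter_deriv bs f) y" for y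
    using Cons unfolding partial_deriv_def
    by (subst frechet_derivative_at[OF has_derivative_mult_right[OF schwartz_has_derivative_frechet], symmetric])
       (auto intro: schwartz_iter_deriv assms)
  then show ?case using Cons by auto
qed simp

subsection \<open>Tempered distributions\<close>

lemma tempered_add: "u \<in> tempered_distributions \<Longrightarrow> f \<in> schwartz_space \<Longrightarrow> g \<in> schwartz_space \<Longrightarrow> u (\<lambda>x. f x + g x) = u f + u g"
  and tempered_cmult: "u \<in> tempered_distributions \<Longrightarrow> f \<in> schwartz_space \<Longrightarrow> u (\<lambda>x. c * f x) = c * u f"
  by (auto simp: tempered_distributions_def)

lemma tempered_diff:
  assumes "u \<in> tempered_distributions" "f \<in> schwartz_space" "g \<in> schwartz_space"
  shows "u (\<lambda>x. f x - g x) = u f - u g"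
  using tempered_add[OF assms(1,2) schwartz_cmult[OF assms(3), of "-1"]] tempered_cmult[OF assms(1,3), of "-1"] by simp

text \<open>
  The continuity of a tempered distribution in a form adapted to estimating derivative by derivative: the
  seminorm, a supremum of a sum, is replaced by a common bound \<open>B\<close> for its terms.
\<close>

lemma tempered_bound:
  fixes u :: "'a::euclidean_space functional"
  assumes "u \<in> tempered_distributions"
  obtains N C where "C > 0"
    "\<forall>f B. f \<in> schwartz_space \<longrightarrow>
       (\<forall>bs x. bs \<in> deriv_lists N \<longrightarrow> (1 + norm x) ^ N * norm (iter_deriv bs f x) \<le> B) \<longrightarrow> norm (u f) \<le> C * B"
proof -
  obtain N C where C: "\<And>f. f \<in> schwartz_space \<Longrightarrow> norm (u f) \<le> C * schwartz_seminorm N f"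
    using assms unfolding tempered_distributions_def by blast
  let ?n = "real (card (deriv_lists N :: 'a list set))"
  have "norm (u f) \<le> ((\<bar>C\<bar> + 1) * (?n + 1)) * B"
    if f: "f \<in> schwartz_space" and le: "\<And>bs x. bs \<in> deriv_lists N \<Longrightarrow> (1 + norm x) ^ N * norm (iter_deriv bs f x) \<le> B" for f B
  proof -
    have "[] \<in> deriv_lists N" by (simp add: deriv_lists_def)
    from le[OF this, of 0] have B: "0 \<le> B" by (simp add: order_trans[OF norm_ge_zero])
    have le': "schwartz_weight N f x \<le> ?n * B" for x
      unfolding schwartz_weight_def sum_distrib_left by (intro sum_bounded_above le)
    then have 1: "schwartz_seminorm N f \<le> ?n * B"
      unfolding schwartz_seminorm_def by (intro cSUP_least) auto
    have 0: "0 \<le> schwartz_seminorm N f"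
      unfolding schwartz_seminorm_def
      by (rule order_trans[OF _ cSUP_upper[of 0]])
         (auto simp: schwartz_weight_def sum_nonneg bdd_above_def intro!: exI[of _ "?n * B"] le'[unfolded schwartz_weight_def])
    have "norm (u f) \<le> C * schwartz_seminorm N f" by (rule C[OF f])
    also have "\<dots> \<le> (\<bar>C\<bar> + 1) * schwartz_seminorm N f" by (intro mult_right_mono 0) simp
    also have "\<dots> \<le> (\<bar>C\<bar> + 1) * (?n * B)" by (intro mult_left_mono 1) simp
    also have "\<dots> \<le> (\<bar>C\<bar> + 1) * ((?n + 1) * B)" using B by (intro mult_left_mono mult_right_mono) auto
    finally show ?thesis by (simp add: mult.assoc)
  qed
  moreover have "(\<bar>C\<bar> + 1) * (?n + 1) > 0" by (intro mult_pos_pos) auto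
  ultimately show ?thesis using that[of "(\<bar>C\<bar> + 1) * (?n + 1)" N] by blast
qed

text \<open>
  Translating a Schwartz function by \<open>x\<close> increases the seminorms at most by the factor
  \<open>(1 + norm x) ^ N\<close>, and they depend on \<open>x\<close> in a Lipschitz way with the same growth.
\<close>

lemma translate_bounds:
  fixes \<kappa> :: "'a::euclidean_space \<Rightarrow> complex"
  assumes k: "\<kappa> \<in> schwartz_space"
  obtains C where "C > 0"
    "\<forall>bs x y. bs \<in> deriv_lists N \<longrightarrow> (1 + norm y) ^ N * norm (iter_deriv bs \<kappa> (y - x)) \<le> C * (1 + norm x) ^ N"
    "\<forall>bs x x0 y. bs \<in> deriv_lists N \<longrightarrow> norm (x - x0) \<le> 1 \<longrightarrow>
       (1 + norm y) ^ N * norm (iter_deriv bs \<kappa> (y - x) - iter_deriv bs \<kappa> (y - x0)) \<le> C * (1 + norm x) ^ N * norm (x - x0)"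
proof -
  have kb: "iter_deriv bs \<kappa> \<in> schwartz_space" if "bs \<in> deriv_lists N" for bs
    using that k by (auto intro: schwartz_iter_deriv simp: deriv_lists_def)
  have "\<forall>bs. \<exists>C. bs \<in> deriv_lists N \<longrightarrow> C > 0 \<and> (\<forall>x. (1 + norm x) ^ N * norm (iter_deriv bs \<kappa> x) \<le> C)"
    using rapidE[OF schwartz_rapid[OF kb]] by metis
  then obtain C1 where C1: "\<And>bs. bs \<in> deriv_lists N \<Longrightarrow> C1 bs > 0" "\<And>bs x. bs \<in> deriv_lists N \<Longrightarrow> (1 + norm x) ^ N * norm (iter_deriv bs \<kappa> x) \<le> C1 bs"
    by metis
  have "\<forall>bs. \<exists>C. bs \<in> deriv_lists N \<longrightarrow> C > 0 \<and> (\<forall>z h. norm h \<le> 1 \<longrightarrow> (1 + norm z) ^ N * norm (iter_deriv bs \<kappa> (z + h) - iter_deriv bs \<kappa> z) \<le> C * norm h)"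
  proof
    fix bs :: "'a list"
    show "\<exists>C. bs \<in> deriv_lists N \<longrightarrow> C > 0 \<and> (\<forall>z h. norm h \<le> 1 \<longrightarrow> (1 + norm z) ^ N * norm (iter_deriv bs \<kappa> (z + h) - iter_deriv bs \<kappa> z) \<le> C * norm h)"
    proof (cases "bs \<in> deriv_lists N")
      case True
      obtain C where "C > 0" "\<And>z h. norm h \<le> 1 \<Longrightarrow> (1 + norm z) ^ N * norm (iter_deriv bs \<kappa> (z + h) - iter_deriv bs \<kappa> z) \<le> C * norm h"
        by (rule schwartz_lipschitz[OF kb[OF True], where N=N]) blast
      then show ?thesis by blast
    qed simp
  qed
  then obtain C2 where C2: "\<And>bs. bs \<in> deriv_lists N \<Longrightarrow> C2 bs > 0" "\<And>bs z h. bs \<in> deriv_lists N \<Longrightarrow> norm h \<le> 1 \<Longrightarrow> (1 + norm z) ^ N * norm (iter_deriv bs \<kappa> (z + h) - iter_deriv bs \<kappa> z) \<le> C2 bs * norm h"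
    by metis
  define C where "C = (\<Sum>bs\<in>deriv_lists N. C1 bs + C2 bs)"
  have le: "C1 bs + C2 bs \<le> C" if "bs \<in> deriv_lists N" for bs
    unfolding C_def using that C1(1) C2(1) by (intro member_le_sum finite_deriv_lists) (auto simp: less_imp_le add_nonneg_nonneg)
  have nil: "[] \<in> deriv_lists N" by (simp add: deriv_lists_def)
  have w: "(1 + norm y) ^ N * t \<le> (1 + norm x) ^ N * ((1 + norm (y - x)) ^ N * t)" if "0 \<le> t" for x y :: 'a and t
    using mult_right_mono[OF weight_mult[of x "y - x" N] that] by (simp add: mult.assoc)
  show ?thesis
  proof (rule that[of C]; (intro allI impI)?)
    show "C > 0" using le[OF nil] C1(1)[OF nil] C2(1)[OF nil] by simp
    fix bs :: "'a list" and x y :: 'a assume bs: "bs \<in> deriv_lists N"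
    have "(1 + norm y) ^ N * norm (iter_deriv bs \<kappa> (y - x)) \<le> (1 + norm x) ^ N * ((1 + norm (y - x)) ^ N * norm (iter_deriv bs \<kappa> (y - x)))"
      by (rule w) simp
    also have "\<dots> \<le> (1 + norm x) ^ N * C"
      using C1(2)[OF bs, of "y - x"] le[OF bs] C2(1)[OF bs] by (intro mult_left_mono) auto
    finally show "(1 + norm y) ^ N * norm (iter_deriv bs \<kappa> (y - x)) \<le> C * (1 + norm x) ^ N" by (simp add: mult.commute)
  next
    fix bs :: "'a list" and x x0 y :: 'a assume bs: "bs \<in> deriv_lists N" and x0: "norm (x - x0) \<le> 1"
    have "(1 + norm y) ^ N * norm (iter_deriv bs \<kappa> (y - x) - iter_deriv bs \<kappa> (y - x0))
       \<le> (1 + norm x) ^ N * ((1 + norm (y - x)) ^ N * norm (iter_deriv bs \<kappa> ((y - x) + (x - x0)) - iter_deriv bs \<kappa> (y - x)))"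
      using w[of "norm (iter_deriv bs \<kappa> (y - x) - iter_deriv bs \<kappa> (y - x0))" y x] by (simp add: norm_minus_commute)
    also have "\<dots> \<le> (1 + norm x) ^ N * (C2 bs * norm (x - x0))"
      by (intro mult_left_mono C2 bs x0) auto
    also have "\<dots> \<le> (1 + norm x) ^ N * (C * norm (x - x0))"
      using le[OF bs] C1(1)[OF bs] by (intro mult_left_mono mult_right_mono) auto
    finally show "(1 + norm y) ^ N * norm (iter_deriv bs \<kappa> (y - x) - iter_deriv bs \<kappa> (y - x0)) \<le> C * (1 + norm x) ^ N * norm (x - x0)"
      by (simp add: mult_ac)
  qed
qed

text \<open>
  The four bounds that the interchange theorem requires, with one common pair of constants. The last
  one says that a function concentrated within \<open>\<delta>\<close> of a point \<open>x0\<close> may be replaced by a point mass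
  at \<open>x0\<close>, with an error of order \<open>\<delta>\<close> relative to its weighted integral.
\<close>

lemma translate_pairing_bounds:
  fixes u :: "'a::euclidean_space functional"
  assumes u: "u \<in> tempered_distributions" and k: "\<kappa> \<in> schwartz_space"
  obtains N C where "C > 0" "\<forall>x. norm (u (\<lambda>y. \<kappa> (y - x))) \<le> C * (1 + norm x) ^ N"
    "\<forall>x x0. norm (x - x0) \<le> 1 \<longrightarrow> norm (u (\<lambda>y. \<kappa> (y - x)) - u (\<lambda>y. \<kappa> (y - x0))) \<le> C * (1 + norm x) ^ N * norm (x - x0)"
    "\<forall>f. rapid_L1 f \<longrightarrow> norm (u (convolution f \<kappa>)) \<le> C * (\<integral>x. (1 + norm x) ^ N * norm (f x) \<partial>lborel)"
    "\<forall>f x0 \<delta>. rapid_L1 f \<longrightarrow> \<delta> \<le> 1 \<longrightarrow> (\<forall>x. f x \<noteq> 0 \<longrightarrow> norm (x - x0) \<le> \<delta>) \<longrightarrow>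
       norm (u (\<lambda>y. convolution f \<kappa> y - (\<integral>x. f x \<partial>lborel) * \<kappa> (y - x0))) \<le> C * \<delta> * (\<integral>x. (1 + norm x) ^ N * norm (f x) \<partial>lborel)"
proof -
  obtain N C where C': "C > 0" "\<forall>f B. f \<in> schwartz_space \<longrightarrow>
       (\<forall>bs x. bs \<in> deriv_lists N \<longrightarrow> (1 + norm x) ^ N * norm (iter_deriv bs f x) \<le> B) \<longrightarrow> norm (u f) \<le> C * B"
    by (rule tempered_bound[OF u])
  note C = C'(1) C'(2)[rule_format]
  obtain D where D': "D > 0"
    "\<forall>bs x y. bs \<in> deriv_lists N \<longrightarrow> (1 + norm y) ^ N * norm (iter_deriv bs \<kappa> (y - x)) \<le> D * (1 + norm x) ^ N"
    "\<forall>bs x x0 y. bs \<in> deriv_lists N \<longrightarrow> norm (x - x0) \<le> 1 \<longrightarrow>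
       (1 + norm y) ^ N * norm (iter_deriv bs \<kappa> (y - x) - iter_deriv bs \<kappa> (y - x0)) \<le> D * (1 + norm x) ^ N * norm (x - x0)"
    by (rule translate_bounds[OF k])
  note D = D'(1) D'(2,3)[rule_format]
  have bsD: "set bs \<subseteq> Basis" if "bs \<in> deriv_lists N" for bs :: "'a list" using that by (simp add: deriv_lists_def)
  note kt = schwartz_translate[OF k]
  show ?thesis
  proof (rule that[of "C * D" N]; (intro allI impI)?)
    show "C * D > 0" using C D by simp
    show "norm (u (\<lambda>y. \<kappa> (y - x))) \<le> C * D * (1 + norm x) ^ N" for x
      unfolding mult.assoc
    proof (rule C(2)[OF kt])
      fix bs :: "'a list" and y :: 'a assume bs: "bs \<in> deriv_lists N"
      show "(1 + norm y) ^ N * norm (iter_deriv bs (\<lambda>y. \<kappa> (y - x)) y) \<le> D * (1 + norm x) ^ N"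
        unfolding iter_deriv_translate[OF k bsD[OF bs]] by (rule D(2)[OF bs])
    qed
    show "norm (u (\<lambda>y. \<kappa> (y - x)) - u (\<lambda>y. \<kappa> (y - x0))) \<le> C * D * (1 + norm x) ^ N * norm (x - x0)" if x0: "norm (x - x0) \<le> 1" for x x0
    proof -
      have "norm (u (\<lambda>y. \<kappa> (y - x) - \<kappa> (y - x0))) \<le> C * (D * (1 + norm x) ^ N * norm (x - x0))"
      proof (rule C(2)[OF schwartz_diff[OF kt kt]])
        fix bs :: "'a list" and y :: 'a assume bs: "bs \<in> deriv_lists N"
        show "(1 + norm y) ^ N * norm (iter_deriv bs (\<lambda>y. \<kappa> (y - x) - \<kappa> (y - x0)) y) \<le> D * (1 + norm x) ^ N * norm (x - x0)"
          unfolding iter_deriv_diff[OF kt kt bsD[OF bs]] iter_deriv_translate[OF k bsD[OF bs]] by (rule D(3)[OF bs x0])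
      qed
      then show ?thesis unfolding tempered_diff[OF u kt kt] by (simp add: mult.assoc)
    qed
    fix f :: "'a \<Rightarrow> complex" assume f: "rapid_L1 f"
    let ?W = "\<integral>x. (1 + norm x) ^ N * norm (f x) \<partial>lborel"
    show "norm (u (convolution f \<kappa>)) \<le> C * D * ?W"
      unfolding mult.assoc
    proof (rule C(2)[OF convolution_schwartz[OF f k]])
      fix bs :: "'a list" and y :: 'a assume bs: "bs \<in> deriv_lists N"
      have "(1 + norm z) ^ N * norm (iter_deriv bs \<kappa> z) \<le> D" for z
        using D(2)[OF bs, of z 0] by simp
      from convolution_weight_bound[OF f this, of y]
      show "(1 + norm y) ^ N * norm (iter_deriv bs (convolution f \<kappa>) y) \<le> D * ?W"
        by (simp add: iter_deriv_convolution[OF f k bsD[OF bs]] mult.commute)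
    qed
  next
    fix f :: "'a \<Rightarrow> complex" and x0 :: 'a and \<delta>
    assume f: "rapid_L1 f" and \<delta>: "\<delta> \<le> 1" and supp': "\<forall>x. f x \<noteq> 0 \<longrightarrow> norm (x - x0) \<le> \<delta>"
    note supp = supp'[rule_format]
    let ?W = "\<integral>x. (1 + norm x) ^ N * norm (f x) \<partial>lborel"
    let ?c = "\<integral>x. f x \<partial>lborel"
    note S1 = convolution_schwartz[OF f k] and S2 = schwartz_cmult[OF kt, of ?c x0]
    show "norm (u (\<lambda>y. convolution f \<kappa> y - ?c * \<kappa> (y - x0))) \<le> C * D * \<delta> * ?W"
      unfolding mult.assoc
    proof (rule C(2)[OF schwartz_diff[OF S1 S2]])
      fix bs :: "'a list" and y :: 'a assume bs: "bs \<in> deriv_lists N"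
      let ?k = "iter_deriv bs \<kappa>"
      have kb: "?k \<in> schwartz_space" by (intro schwartz_iter_deriv k bsD bs)
      have p: "0 \<le> (1 + norm y) ^ N" by simp
      have "iter_deriv bs (\<lambda>y. convolution f \<kappa> y - ?c * \<kappa> (y - x0)) y = convolution f ?k y - ?c * ?k (y - x0)"
        unfolding iter_deriv_diff[OF S1 S2 bsD[OF bs]] iter_deriv_convolution[OF f k bsD[OF bs]]
          iter_deriv_cmult[OF kt bsD[OF bs]] iter_deriv_translate[OF k bsD[OF bs]] ..
      also have "\<dots> = (\<integral>x. f x * (?k (y - x) - ?k (y - x0)) \<partial>lborel)"
        unfolding convolution_def right_diff_distrib
        using rapid_L1D(3)[OF f] rapid_L1D(1)[OF f] integrable_convolution[OF f kb]
        by (subst Bochner_Integration.integral_diff) (auto simp: integrable_norm_iff)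
      finally have eq: "iter_deriv bs (\<lambda>y. convolution f \<kappa> y - ?c * \<kappa> (y - x0)) y = (\<integral>x. f x * (?k (y - x) - ?k (y - x0)) \<partial>lborel)" .
      have "(1 + norm y) ^ N * norm (\<integral>x. f x * (?k (y - x) - ?k (y - x0)) \<partial>lborel)
          = norm (\<integral>x. of_real ((1 + norm y) ^ N) * (f x * (?k (y - x) - ?k (y - x0))) \<partial>lborel)"
        unfolding integral_mult_right_zero norm_mult norm_of_real abs_of_nonneg[OF p] ..
      also have "\<dots> \<le> (\<integral>x. (D * \<delta>) * ((1 + norm x) ^ N * norm (f x)) \<partial>lborel)"
      proof (rule norm_integral_le)
        show "integrable lborel (\<lambda>x. (D * \<delta>) * ((1 + norm x) ^ N * norm (f x)))"
          by (intro integrable_mult_right rapid_L1D f)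
        fix x
        show "norm (of_real ((1 + norm y) ^ N) * (f x * (?k (y - x) - ?k (y - x0)))) \<le> (D * \<delta>) * ((1 + norm x) ^ N * norm (f x))"
        proof (cases "f x = 0")
          case False
          have "norm (x - x0) \<le> 1" using supp[OF False] \<delta> by simp
          note D(3)[OF bs this, of y]
          also have "D * (1 + norm x) ^ N * norm (x - x0) \<le> D * (1 + norm x) ^ N * \<delta>"
            using D(1) supp[OF False] by (intro mult_left_mono) auto
          finally have "((1 + norm y) ^ N * norm (?k (y - x) - ?k (y - x0))) * norm (f x) \<le> (D * (1 + norm x) ^ N * \<delta>) * norm (f x)"
            by (rule mult_right_mono) simp
          then show ?thesis unfolding norm_mult norm_of_real abs_of_nonneg[OF p] by (simp add: mult_ac)
        qed simp
      qed
      also have "\<dots> = D * (\<delta> * ?W)" by simp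
      finally show "(1 + norm y) ^ N * norm (iter_deriv bs (\<lambda>y. convolution f \<kappa> y - ?c * \<kappa> (y - x0)) y) \<le> D * (\<delta> * ?W)"
        unfolding eq .
    qed
  qed
qed

section \<open>Pairing a tempered distribution with a convolution\<close>

lemma continuous_locally_lipschitz:
  fixes v :: "'a::real_normed_vector \<Rightarrow> 'b::real_normed_vector"
  assumes "\<And>x x0. norm (x - x0) \<le> 1 \<Longrightarrow> norm (v x - v x0) \<le> B x0 * norm (x - x0)"
  shows "continuous_on S v"
proof (rule continuous_at_imp_continuous_on, rule ballI)
  fix x0 :: 'a
  have "((\<lambda>x. norm (x - x0)) \<longlongrightarrow> 0) (at x0)"
    by (rule tendsto_eq_intros | simp)+
  then have "((\<lambda>x. B x0 * norm (x - x0)) \<longlongrightarrow> 0) (at x0)" by (rule tendsto_mult_right_zero)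
  moreover have "eventually (\<lambda>x. norm (v x - v x0) \<le> B x0 * norm (x - x0)) (at x0)"
    unfolding eventually_at by (rule exI[of _ 1]) (auto simp: dist_norm intro!: assms)
  ultimately have "((\<lambda>x. v x - v x0) \<longlongrightarrow> 0) (at x0)"
    by (rule Lim_null_comparison[rotated])
  then show "isCont v x0" unfolding isCont_def by (rule LIM_zero_cancel)
qed

lemma translate_pairing_continuous:
  assumes u: "u \<in> tempered_distributions" and k: "\<kappa> \<in> schwartz_space"
  shows "continuous_on S (\<lambda>x. u (\<lambda>y. \<kappa> (y - x)))"
proof -
  obtain N C where C: "C > 0" "\<forall>x. norm (u (\<lambda>y. \<kappa> (y - x))) \<le> C * (1 + norm x) ^ N"
    "\<forall>x x0. norm (x - x0) \<le> 1 \<longrightarrow> norm (u (\<lambda>y. \<kappa> (y - x)) - u (\<lambda>y. \<kappa> (y - x0))) \<le> C * (1 + norm x) ^ N * norm (x - x0)"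
    by (rule translate_pairing_bounds[OF u k])
  show ?thesis
  proof (rule continuous_locally_lipschitz)
    fix x x0 :: 'a assume "norm (x - x0) \<le> 1"
    then have 1: "norm (x0 - x) \<le> 1" by (simp add: norm_minus_commute)
    then have "norm (u (\<lambda>y. \<kappa> (y - x0)) - u (\<lambda>y. \<kappa> (y - x))) \<le> C * (1 + norm x0) ^ N * norm (x0 - x)"
      using C(3) by blast
    then show "norm (u (\<lambda>y. \<kappa> (y - x)) - u (\<lambda>y. \<kappa> (y - x0))) \<le> (C * (1 + norm x0) ^ N) * norm (x - x0)"
      by (simp add: norm_minus_commute)
  qed
qed

lemma countable_small_partition:
  assumes "\<delta> > 0"
  obtains A :: "nat \<Rightarrow> 'a::euclidean_space set" and c where "\<And>i. A i \<in> sets borel" "disjoint_family A"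
    "(\<Union>i. A i) = UNIV" "\<And>i. A i \<subseteq> ball (c i) \<delta>"
proof -
  obtain D :: "'a set" where D: "countable D" "\<And>X. open X \<Longrightarrow> X \<noteq> {} \<Longrightarrow> \<exists>d\<in>D. d \<in> X"
    using countable_dense_setE by blast
  have "D \<noteq> {}" using D(2)[of UNIV] by auto
  then obtain c :: "nat \<Rightarrow> 'a" where c: "D = range c" using D(1) uncountable_def by metis
  define B where "B i = ball (c i) \<delta>" for i
  have "\<exists>i. x \<in> B i" for x
    using D(2)[of "ball x \<delta>"] assms unfolding c B_def by (auto simp: dist_commute)
  then have "(\<Union>i. disjointed B i) = UNIV" unfolding UN_disjointed_eq by auto
  moreover have "disjointed B i \<in> sets borel" for i
    unfolding disjointed_def B_def by auto
  ultimately show ?thesis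
    using that[of "disjointed B" c] disjoint_family_disjointed[of B] disjointed_subset[of B] unfolding B_def by blast
qed

text \<open>
  A tempered distribution may be moved under the integral sign of a convolution. Consider the defect
  \<open>D\<close>, the difference of both sides as a function of \<open>f\<close>. It is additive, and on a piece of \<open>f\<close>
  supported in a ball of radius \<open>\<delta>\<close> both sides are close to their value for a point mass, whence
  \<open>norm (D f) \<le> 2 * C * \<delta> * W f\<close> with a weighted integral \<open>W\<close>, which is additive over disjoint
  pieces. Cutting \<open>f\<close> along a countable partition into small sets gives the same bound for every \<open>f\<close>, and
  \<open>\<delta>\<close> is arbitrary.
\<close>

theorem tempered_convolution_interchange:
  fixes u :: "'a::euclidean_space functional"
  assumes u: "u \<in> tempered_distributions" and f: "rapid_L1 f" and k: "\<kappa> \<in> schwartz_space"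
  shows "integrable lborel (\<lambda>x. f x * u (\<lambda>y. \<kappa> (y - x)))"
    and "u (convolution f \<kappa>) = (\<integral>x. f x * u (\<lambda>y. \<kappa> (y - x)) \<partial>lborel)"
proof -
  define v where "v x = u (\<lambda>y. \<kappa> (y - x))" for x
  obtain N C where C': "C > 0" "\<forall>x. norm (u (\<lambda>y. \<kappa> (y - x))) \<le> C * (1 + norm x) ^ N"
    "\<forall>x x0. norm (x - x0) \<le> 1 \<longrightarrow> norm (u (\<lambda>y. \<kappa> (y - x)) - u (\<lambda>y. \<kappa> (y - x0))) \<le> C * (1 + norm x) ^ N * norm (x - x0)"
    "\<forall>f. rapid_L1 f \<longrightarrow> norm (u (convolution f \<kappa>)) \<le> C * (\<integral>x. (1 + norm x) ^ N * norm (f x) \<partial>lborel)"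
    "\<forall>f x0 \<delta>. rapid_L1 f \<longrightarrow> \<delta> \<le> 1 \<longrightarrow> (\<forall>x. f x \<noteq> 0 \<longrightarrow> norm (x - x0) \<le> \<delta>) \<longrightarrow>
       norm (u (\<lambda>y. convolution f \<kappa> y - (\<integral>x. f x \<partial>lborel) * \<kappa> (y - x0))) \<le> C * \<delta> * (\<integral>x. (1 + norm x) ^ N * norm (f x) \<partial>lborel)"
    by (rule translate_pairing_bounds[OF u k])
  note C = C'(1) C'(2-5)[rule_format, folded v_def]
  have [measurable]: "v \<in> borel_measurable borel"
    unfolding v_def[abs_def] by (intro borel_measurable_continuous_onI translate_pairing_continuous u k)
  note [measurable] = rapid_L1D(1)[OF f]
  define W where "W g = (\<integral>x. (1 + norm x) ^ N * norm (g x) \<partial>lborel)" for g :: "'a \<Rightarrow> complex"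
  have int: "integrable lborel (\<lambda>x. g x * v x)" if g: "rapid_L1 g" for g
  proof (rule Bochner_Integration.integrable_bound[OF integrable_mult_right[OF rapid_L1D(2)[OF g, of N], of C]])
    note [measurable] = rapid_L1D(1)[OF g]
    show "(\<lambda>x. g x * v x) \<in> borel_measurable lborel" by measurable
    show "AE x in lborel. norm (g x * v x) \<le> norm (C * ((1 + norm x) ^ N * norm (g x)))"
    proof (rule AE_I2)
      fix x
      have "norm (g x * v x) \<le> norm (g x) * (C * (1 + norm x) ^ N)" unfolding norm_mult by (intro mult_left_mono C(2)) auto
      also have "\<dots> \<le> norm (C * ((1 + norm x) ^ N * norm (g x)))" using C(1) by (simp add: mult_ac abs_mult)
      finally show "norm (g x * v x) \<le> norm (C * ((1 + norm x) ^ N * norm (g x)))" .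
    qed
  qed
  show "integrable lborel (\<lambda>x. f x * u (\<lambda>y. \<kappa> (y - x)))" using int[OF f] by (simp add: v_def)
  \<comment> \<open>the defect, for an arbitrary function in place of \<open>f\<close>\<close>
  define D where "D g = u (convolution g \<kappa>) - (\<integral>x. g x * v x \<partial>lborel)" for g :: "'a \<Rightarrow> complex"
  have D_add: "D (\<lambda>x. g x + h x) = D g + D h" if g: "rapid_L1 g" and h: "rapid_L1 h" for g h
  proof -
    have "convolution (\<lambda>x. g x + h x) \<kappa> = (\<lambda>y. convolution g \<kappa> y + convolution h \<kappa> y)"
      using integrable_convolution[OF g k] integrable_convolution[OF h k]
      by (auto simp: convolution_def distrib_right)
    then have "u (convolution (\<lambda>x. g x + h x) \<kappa>) = u (convolution g \<kappa>) + u (convolution h \<kappa>)"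
      using tempered_add[OF u convolution_schwartz[OF g k] convolution_schwartz[OF h k]] by simp
    then show ?thesis using int[OF g] int[OF h] by (simp add: D_def distrib_right)
  qed
  have D_bound: "norm (D g) \<le> 2 * C * W g" if g: "rapid_L1 g" for g
  proof -
    have "norm (\<integral>x. g x * v x \<partial>lborel) \<le> (\<integral>x. C * ((1 + norm x) ^ N * norm (g x)) \<partial>lborel)"
    proof (rule norm_integral_le)
      show "norm (g x * v x) \<le> C * ((1 + norm x) ^ N * norm (g x))" for x
        using mult_left_mono[OF C(2)[of x] norm_ge_zero[of "g x"]] by (simp add: norm_mult mult_ac)
    qed (intro integrable_mult_right rapid_L1D g)
    then have "norm (\<integral>x. g x * v x \<partial>lborel) \<le> C * W g" by (simp add: W_def)
    then show ?thesis using C(4)[OF g] norm_triangle_ineq4[of "u (convolution g \<kappa>)" "\<integral>x. g x * v x \<partial>lborel"]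
      unfolding D_def W_def by linarith
  qed
  have D_small: "norm (D g) \<le> 2 * C * \<delta> * W g"
    if g: "rapid_L1 g" and \<delta>: "\<delta> \<le> 1" and supp: "\<And>x. g x \<noteq> 0 \<Longrightarrow> norm (x - x0) \<le> \<delta>" for g x0 \<delta>
  proof -
    let ?c = "\<integral>x. g x \<partial>lborel"
    note kt = schwartz_translate[OF k]
    have ig: "integrable lborel g" using rapid_L1D(1,3)[OF g] by (simp add: integrable_norm_iff)
    have u1: "u (\<lambda>y. convolution g \<kappa> y - ?c * \<kappa> (y - x0)) = u (convolution g \<kappa>) - ?c * v x0"
      unfolding tempered_diff[OF u convolution_schwartz[OF g k] schwartz_cmult[OF kt]] tempered_cmult[OF u kt] v_def ..
    have "(\<integral>x. g x * v x \<partial>lborel) - ?c * v x0 = (\<integral>x. g x * (v x - v x0) \<partial>lborel)"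
      unfolding right_diff_distrib using int[OF g] ig by simp
    also have "norm \<dots> \<le> (\<integral>x. (C * \<delta>) * ((1 + norm x) ^ N * norm (g x)) \<partial>lborel)"
    proof (rule norm_integral_le)
      fix x
      show "norm (g x * (v x - v x0)) \<le> (C * \<delta>) * ((1 + norm x) ^ N * norm (g x))"
      proof (cases "g x = 0")
        case False
        have "norm (v x - v x0) \<le> C * (1 + norm x) ^ N * norm (x - x0)"
          using C(3) supp[OF False] \<delta> by simp
        also have "\<dots> \<le> C * (1 + norm x) ^ N * \<delta>" using C(1) supp[OF False] by (intro mult_left_mono) auto
        finally show ?thesis
          unfolding norm_mult using mult_left_mono[OF _ norm_ge_zero[of "g x"]] by (fastforce simp: mult_ac)
      qed simp
    qed (intro integrable_mult_right rapid_L1D g)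
    finally have "norm ((\<integral>x. g x * v x \<partial>lborel) - ?c * v x0) \<le> C * \<delta> * W g" by (simp add: W_def)
    moreover have "norm (u (convolution g \<kappa>) - ?c * v x0) \<le> C * \<delta> * W g"
      using C(5)[OF g \<delta> supp] unfolding u1 W_def by blast
    moreover have "D g = (u (convolution g \<kappa>) - ?c * v x0) - ((\<integral>x. g x * v x \<partial>lborel) - ?c * v x0)"
      by (simp add: D_def)
    ultimately show ?thesis using norm_triangle_ineq4[of "u (convolution g \<kappa>) - ?c * v x0" "(\<integral>x. g x * v x \<partial>lborel) - ?c * v x0"]
      by (simp add: )
  qed
  have fI: "rapid_L1 (\<lambda>x. indicator A x * f x)" if "A \<in> sets borel" for A
    by (rule rapid_L1_indicator[OF f that])
  have W_add: "W (\<lambda>x. indicator (A \<union> B) x * f x) = W (\<lambda>x. indicator A x * f x) + W (\<lambda>x. indicator B x * f x)"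
    if A: "A \<in> sets borel" and B: "B \<in> sets borel" and "A \<inter> B = {}" for A B
    unfolding W_def
    using that(3)
    by (subst Bochner_Integration.integral_add[symmetric, OF rapid_L1D(2)[OF fI[OF A]] rapid_L1D(2)[OF fI[OF B]]])
       (intro Bochner_Integration.integral_cong; auto simp: indicator_def)
  have main: "norm (D f) \<le> 2 * C * \<delta> * W f" if \<delta>: "0 < \<delta>" "\<delta> \<le> 1" for \<delta>
  proof -
    obtain A :: "nat \<Rightarrow> 'a set" and c where A: "\<And>i. A i \<in> sets borel" "disjoint_family A"
      "(\<Union>i. A i) = UNIV" "\<And>i. A i \<subseteq> ball (c i) \<delta>"
      using countable_small_partition[OF \<delta>(1)] by blast
    define U where "U n = (\<Union>i<n. A i)" for n
    have U[measurable]: "U n \<in> sets borel" for n unfolding U_def using A(1) by auto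
    have D_U: "norm (D (\<lambda>x. indicator (U n) x * f x)) \<le> 2 * C * \<delta> * W (\<lambda>x. indicator (U n) x * f x)" for n
    proof (induction n)
      case 0
      have "rapid_L1 (\<lambda>x::'a. 0)" by (simp add: rapid_L1_def)
      from D_small[OF this \<delta>(2)] show ?case by (simp add: U_def)
    next
      case (Suc n)
      have eq: "U (Suc n) = U n \<union> A n" by (auto simp: U_def less_Suc_eq)
      have dj: "U n \<inter> A n = {}" using A(2) unfolding U_def disjoint_family_on_def
        by (metis (no_types, lifting) Int_UN_distrib2 UN_iff disjoint_iff lessThan_iff less_irrefl UNIV_I)
      have "(\<lambda>x. indicator (U (Suc n)) x * f x) = (\<lambda>x. indicator (U n) x * f x + indicator (A n) x * f x)"
        using dj unfolding eq by (intro ext) (auto simp: indicator_def)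
      then have "D (\<lambda>x. indicator (U (Suc n)) x * f x) = D (\<lambda>x. indicator (U n) x * f x) + D (\<lambda>x. indicator (A n) x * f x)"
        using D_add[OF fI[OF U] fI[OF A(1)]] by simp
      moreover have "norm (D (\<lambda>x. indicator (A n) x * f x)) \<le> 2 * C * \<delta> * W (\<lambda>x. indicator (A n) x * f x)"
      proof (rule D_small[OF fI[OF A(1)] \<delta>(2)])
        fix x assume "indicator (A n) x * f x \<noteq> 0"
        then have "x \<in> A n" by (auto simp: indicator_def split: if_splits)
        then show "norm (x - c n) \<le> \<delta>" using A(4)[of n] by (auto simp: dist_norm norm_minus_commute less_imp_le)
      qed
      ultimately show ?case
        unfolding eq W_add[OF U A(1) dj] distrib_left using Suc
        by (smt (verit) norm_triangle_ineq)
    qed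
    \<comment> \<open>finitely many pieces are small by \<open>D_U\<close>; on the rest the crude bound \<open>D_bound\<close> suffices,
      because its weighted integral tends to \<open>0\<close>\<close>
    have comp: "norm (D f) \<le> 2 * C * \<delta> * W f + 2 * C * W (\<lambda>x. indicator (- U n) x * f x)" for n
    proof -
      have feq: "f = (\<lambda>x. indicator (U n) x * f x + indicator (- U n) x * f x)" by (auto simp: indicator_def)
      have Wf: "W f = W (\<lambda>x. indicator (U n) x * f x) + W (\<lambda>x. indicator (- U n) x * f x)"
        using W_add[of "U n" "- U n"] by simp
      have "0 \<le> W (\<lambda>x. indicator (- U n) x * f x)" unfolding W_def by (intro Bochner_Integration.integral_nonneg) auto
      then have "W (\<lambda>x. indicator (U n) x * f x) \<le> W f" using Wf by simp
      then have "2 * C * \<delta> * W (\<lambda>x. indicator (U n) x * f x) \<le> 2 * C * \<delta> * W f" using C(1) \<delta> by (intro mult_left_mono) auto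
      moreover have "D f = D (\<lambda>x. indicator (U n) x * f x) + D (\<lambda>x. indicator (- U n) x * f x)"
        by (rule trans[OF arg_cong[OF feq, of D] D_add[OF fI[OF U] fI]]) simp
      moreover have "norm (D (\<lambda>x. indicator (- U n) x * f x)) \<le> 2 * C * W (\<lambda>x. indicator (- U n) x * f x)"
        by (rule D_bound[OF fI]) simp
      ultimately show ?thesis using D_U[of n] by (smt (verit) norm_triangle_ineq)
    qed
    have "(\<lambda>n. W (\<lambda>x. indicator (- U n) x * f x)) \<longlonglongrightarrow> (\<integral>x. (0::real) \<partial>(lborel :: 'a measure))"
      unfolding W_def
    proof (rule integral_dominated_convergence[where w="\<lambda>x. (1 + norm x) ^ N * norm (f x)"])
      show "AE x in lborel. (\<lambda>n. (1 + norm x) ^ N * norm (indicator (- U n) x * f x)) \<longlonglongrightarrow> 0"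
      proof (rule AE_I2)
        fix x
        obtain i where i: "x \<in> A i" using A(3) by blast
        have "eventually (\<lambda>n. (1 + norm x) ^ N * norm (indicator (- U n) x * f x) = 0) sequentially"
          using eventually_gt_at_top[of i] by eventually_elim (use i in \<open>auto simp: U_def indicator_def\<close>)
        then show "(\<lambda>n. (1 + norm x) ^ N * norm (indicator (- U n) x * f x)) \<longlonglongrightarrow> 0"
          by (rule tendsto_eventually)
      qed
    qed (auto simp: norm_mult indicator_def intro!: rapid_L1D f)
    then have "(\<lambda>n. 2 * C * \<delta> * W f + 2 * C * W (\<lambda>x. indicator (- U n) x * f x)) \<longlonglongrightarrow> 2 * C * \<delta> * W f + 2 * C * 0"
      by (intro tendsto_intros) simp
    then have "norm (D f) \<le> 2 * C * \<delta> * W f + 2 * C * 0" by (rule LIMSEQ_le_const) (use comp in auto)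
    then show ?thesis by simp
  qed
  have "norm (D f) \<le> 0"
  proof (rule field_le_epsilon)
    fix e :: real assume e: "e > 0"
    let ?M = "2 * C * W f"
    have M: "0 \<le> ?M" unfolding W_def using C(1) by (intro mult_nonneg_nonneg Bochner_Integration.integral_nonneg) auto
    define \<delta> where "\<delta> = min 1 (e / (?M + 1))"
    have d: "0 < \<delta>" "\<delta> \<le> 1" using e M by (auto simp: \<delta>_def)
    have "\<delta> * ?M \<le> e / (?M + 1) * (?M + 1)" using M e d by (intro mult_mono) (auto simp: \<delta>_def)
    also have "\<dots> = e" using M by simp
    finally show "norm (D f) \<le> 0 + e" using main[OF d] by (simp add: mult_ac)
  qed
  then show "u (convolution f \<kappa>) = (\<integral>x. f x * u (\<lambda>y. \<kappa> (y - x)) \<partial>lborel)" by (simp add: D_def v_def)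
qed

section \<open>Fourier multipliers\<close>

text \<open>
  The kernel of the multiplier with symbol \<open>\<sigma>\<close>, reflected: the multiplier sends a function \<open>g\<close> to the
  integral of \<open>g y\<close> against \<open>mkernel \<sigma> (y - x)\<close>. The reflection allows the same formula for functions
  (\<open>smoothing\<close>) and for distributions, where the kernel is the test function.
\<close>

definition mkernel :: "('a::euclidean_space \<Rightarrow> complex) \<Rightarrow> 'a \<Rightarrow> complex" where
  "mkernel \<sigma> z = fourier_const TYPE('a) * fourier \<sigma> z"

definition multiplier_fun :: "('a::euclidean_space \<Rightarrow> complex) \<Rightarrow> 'a functional \<Rightarrow> 'a \<Rightarrow> complex" where
  "multiplier_fun \<sigma> u x = u (\<lambda>y. mkernel \<sigma> (y - x))"

lemma mkernel_schwartz: "\<sigma> \<in> schwartz_space \<Longrightarrow> mkernel \<sigma> \<in> schwartz_space"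
  unfolding mkernel_def[abs_def] by (intro schwartz_cmult fourier_schwartz)

text \<open>
  The test function that \<open>fourier_multiplier\<close> hands to the distribution is a convolution. So the
  interchange theorem applies to it.
\<close>

lemma fourier_mult_inv_fourier:
  fixes \<sigma> f :: "'a::euclidean_space \<Rightarrow> complex"
  assumes s: "\<sigma> \<in> schwartz_space" and f: "f \<in> schwartz_space"
  shows "fourier (\<lambda>\<xi>. \<sigma> \<xi> * inv_fourier f \<xi>) = convolution f (mkernel \<sigma>)"
proof
  fix y :: 'a
  note [measurable] = schwartz_measurable[OF s] schwartz_measurable[OF f]
  let ?c = "fourier_const TYPE('a)"
  let ?e = "\<lambda>x \<xi>. exp (\<i> * complex_of_real (\<xi> \<bullet> x))" and ?e' = "\<lambda>\<xi>. exp (- (\<i> * complex_of_real (\<xi> \<bullet> y)))"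
  let ?F = "\<lambda>x \<xi>. ?e' \<xi> * \<sigma> \<xi> * ?c * (?e x \<xi> * f x)"
  have "fourier (\<lambda>\<xi>. \<sigma> \<xi> * inv_fourier f \<xi>) y = ?c * (\<integral>\<xi>. (\<integral>x. ?F x \<xi> \<partial>lborel) \<partial>lborel)"
    unfolding fourier_altdef inv_fourier_altdef integral_mult_right_zero by (simp only: mult.assoc)
  also have "(\<integral>\<xi>. (\<integral>x. ?F x \<xi> \<partial>lborel) \<partial>lborel) = (\<integral>x. (\<integral>\<xi>. ?F x \<xi> \<partial>lborel) \<partial>lborel)"
  proof (rule fubini_dominated)
    show "(\<lambda>(x, \<xi>). ?F x \<xi>) \<in> borel_measurable (borel \<Otimes>\<^sub>M borel)" by measurable
    show "integrable lborel (\<lambda>x. norm (f x))" by (intro integrable_norm schwartz_integrable f)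
    show "integrable lborel (\<lambda>\<xi>. norm (?c * \<sigma> \<xi>))" by (intro integrable_norm integrable_mult_right schwartz_integrable s)
  qed (simp add: norm_mult mult_ac)
  also have "?c * \<dots> = (\<integral>x. ?c * (\<integral>\<xi>. ?F x \<xi> \<partial>lborel) \<partial>lborel)" by simp
  also have "\<dots> = convolution f (mkernel \<sigma>) y"
    unfolding convolution_def
  proof (intro Bochner_Integration.integral_cong refl)
    fix x
    have "?F x \<xi> = f x * ?c * (exp (- (\<i> * complex_of_real (\<xi> \<bullet> (y - x)))) * \<sigma> \<xi>)" for \<xi>
    proof -
      have "exp (- (\<i> * complex_of_real (\<xi> \<bullet> (y - x)))) = ?e' \<xi> * ?e x \<xi>"
        by (simp add: exp_add[symmetric] inner_diff_right right_diff_distrib)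
      then show ?thesis by (simp only: mult_ac)
    qed
    then have "(\<integral>\<xi>. ?F x \<xi> \<partial>lborel) = f x * ?c * (\<integral>\<xi>. exp (- (\<i> * complex_of_real (\<xi> \<bullet> (y - x)))) * \<sigma> \<xi> \<partial>lborel)"
      by (simp only: integral_mult_right_zero)
    then show "?c * (\<integral>\<xi>. ?F x \<xi> \<partial>lborel) = f x * mkernel \<sigma> (y - x)"
      unfolding mkernel_def fourier_altdef by (simp only: mult_ac)
  qed
  finally show "fourier (\<lambda>\<xi>. \<sigma> \<xi> * inv_fourier f \<xi>) y = convolution f (mkernel \<sigma>) y" .
qed

lemma fourier_multiplier_apply: "fourier_multiplier \<sigma> u f = u (fourier (\<lambda>\<xi>. \<sigma> \<xi> * inv_fourier f \<xi>))"
  by (simp add: fourier_multiplier_def inv_fourier_dist_def mult_dist_def fourier_dist_def)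

lemma multiplier_fun_represents:
  assumes "u \<in> tempered_distributions" "\<sigma> \<in> schwartz_space"
  shows "represents (multiplier_fun \<sigma> u) (fourier_multiplier \<sigma> u)"
  unfolding represents_def fourier_multiplier_apply
  using tempered_convolution_interchange[OF assms(1) schwartz_rapid_L1 mkernel_schwartz[OF assms(2)]] assms(2)
  by (auto simp: fourier_mult_inv_fourier multiplier_fun_def[abs_def] mult.commute)

lemma multiplier_fun_continuous:
  "u \<in> tempered_distributions \<Longrightarrow> \<sigma> \<in> schwartz_space \<Longrightarrow> continuous_on S (multiplier_fun \<sigma> u)"
  unfolding multiplier_fun_def[abs_def] by (intro translate_pairing_continuous mkernel_schwartz)

lemma multiplier_fun_growth:
  assumes "u \<in> tempered_distributions" "\<sigma> \<in> schwartz_space"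
  obtains N C where "C > 0" "\<forall>x. norm (multiplier_fun \<sigma> u x) \<le> C * (1 + norm x) ^ N"
  unfolding multiplier_fun_def by (rule translate_pairing_bounds[OF assms(1) mkernel_schwartz[OF assms(2)]])

lemma schwartz_cnj:
  assumes "f \<in> schwartz_space" shows "(\<lambda>x. cnj (f x)) \<in> schwartz_space"
proof (rule schwartz_coinduct[where X="\<lambda>h. \<exists>f\<in>schwartz_space. h = (\<lambda>x. cnj (f x))"])
  fix h :: "'a \<Rightarrow> complex"
  assume "\<exists>f\<in>schwartz_space. h = (\<lambda>x. cnj (f x))"
  then obtain f where f: "f \<in> schwartz_space" "h = (\<lambda>x. cnj (f x))" by blast
  show "rapid h" using schwartz_rapid[OF f(1)] by (simp add: f(2) rapid_def)
  have D: "(h has_derivative (\<lambda>t. cnj (frechet_derivative f (at x) t))) (at x)" for x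
    unfolding f(2) by (rule has_derivative_cnj[OF schwartz_has_derivative_frechet[OF f(1)]])
  then show "h differentiable (at x)" for x using differentiableI by blast
  fix b :: 'a assume b: "b \<in> Basis"
  have "partial_deriv b h = (\<lambda>x. cnj (partial_deriv b f x))"
    using partial_deriv_eq[OF D] by (auto simp: partial_deriv_def)
  then show "\<exists>f\<in>schwartz_space. partial_deriv b h = (\<lambda>x. cnj (f x))" using schwartz_partial[OF f(1) b] by blast
qed (use assms in blast)

text \<open>
  If the continuous functions differed at a point, the normalised difference would have real part at least
  one half nearby, and testing with a nonnegative bump function supported there would give a positive integral.
  The bump is \<open>\<bar>\<Psi>\<bar>\<^sup>2\<close>, rescaled; the square makes it nonnegative.
\<close>

lemma represents_unique:
  fixes g h \<Psi> :: "'a::euclidean_space \<Rightarrow> complex"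
  assumes \<Psi>: "resolution_generator \<Psi>" and g: "continuous_on UNIV g" "represents g u"
    and h: "continuous_on UNIV h" "represents h u"
  shows "g = h"
proof (rule ccontr)
  assume "g \<noteq> h"
  then obtain x0 where x0: "g x0 \<noteq> h x0" by blast
  define e where "e x = (g x - h x) / (g x0 - h x0)" for x
  have "continuous_on UNIV e" unfolding e_def[abs_def] using x0 by (intro continuous_intros g h) auto
  then have "isCont e x0" by (simp add: continuous_on_eq_continuous_at)
  moreover have e0: "e x0 = 1" using x0 by (simp add: e_def)
  ultimately obtain d where d: "d > 0" "\<And>x. dist x x0 < d \<Longrightarrow> dist (e x) 1 < 1/2"
    unfolding continuous_at_eps_delta using half_gt_zero[OF zero_less_one] by metis
  \<comment> \<open>the support radius \<open>3/2\<close> of \<open>\<Psi>\<close> is scaled below \<open>d\<close>, its plateau radius \<open>1\<close> to \<open>d / 2\<close>\<close>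
  define r where "r = 2 / d"
  have r: "r > 0" using d by (simp add: r_def)
  define \<eta> where "\<eta> = (\<lambda>x. \<Psi> (r *\<^sub>R x + (- r) *\<^sub>R x0) * cnj (\<Psi> (r *\<^sub>R x + (- r) *\<^sub>R x0)))"
  have PsiS: "\<Psi> \<in> schwartz_space" using \<Psi> by (simp add: resolution_generator_def)
  have \<eta>S: "\<eta> \<in> schwartz_space"
    unfolding \<eta>_def using r by (intro schwartz_mult schwartz_cnj schwartz_affine PsiS) auto
  have nr: "norm (r *\<^sub>R x + (- r) *\<^sub>R x0) = r * dist x x0" for x
  proof -
    have "r *\<^sub>R x + (- r) *\<^sub>R x0 = r *\<^sub>R (x - x0)" by (simp add: scaleR_diff_right)
    then show ?thesis using r by (simp add: dist_norm)
  qed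
  have \<eta>_eq: "\<eta> x = of_real ((norm (\<Psi> (r *\<^sub>R x + (- r) *\<^sub>R x0)))\<^sup>2)" for x
    unfolding \<eta>_def by (simp only: complex_norm_square)
  have supp: "\<eta> x = 0" if "dist x x0 \<ge> d" for x
  proof -
    have "r * dist x x0 \<ge> r * d" using that r by (intro mult_left_mono) auto
    then have "norm (r *\<^sub>R x + (- r) *\<^sub>R x0) \<ge> 3/2" unfolding nr using d by (simp add: r_def)
    then show ?thesis unfolding \<eta>_def using \<Psi> by (simp add: resolution_generator_def)
  qed
  have one: "\<eta> x = 1" if "dist x x0 \<le> d/2" for x
  proof -
    have "r * dist x x0 \<le> r * (d/2)" using that r by (intro mult_left_mono) auto
    then have "norm (r *\<^sub>R x + (- r) *\<^sub>R x0) \<le> 1" unfolding nr using d by (simp add: r_def)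
    then show ?thesis unfolding \<eta>_def using \<Psi> by (simp add: resolution_generator_def)
  qed
  have ig: "integrable lborel (\<lambda>x. g x * \<eta> x)" "integrable lborel (\<lambda>x. h x * \<eta> x)"
    and eq: "(\<integral>x. g x * \<eta> x \<partial>lborel) = (\<integral>x. h x * \<eta> x \<partial>lborel)"
    using g(2) h(2) \<eta>S unfolding represents_def by auto
  have edef: "e x * \<eta> x = (g x * \<eta> x - h x * \<eta> x) / (g x0 - h x0)" for x by (simp add: e_def algebra_simps)
  have ie: "integrable lborel (\<lambda>x. e x * \<eta> x)" unfolding edef by (intro integrable_divide Bochner_Integration.integrable_diff ig)
  have "(\<integral>x. e x * \<eta> x \<partial>lborel) = 0" unfolding edef using ig eq by simp
  then have "(\<integral>x. Re (e x * \<eta> x) \<partial>lborel) = 0" using integral_Re[OF ie] by simp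
  moreover have "(\<integral>x. indicator (ball x0 (d/2)) x * (1/2) \<partial>lborel) \<le> (\<integral>x. Re (e x * \<eta> x) \<partial>lborel)"
  proof (rule integral_mono)
    show "integrable lborel (\<lambda>x. indicator (ball x0 (d/2)) x * (1/2) :: real)"
      by (intro integrable_mult_left integrable_real_indicator) (use emeasure_lborel_ball_finite[of x0 "d/2"] in auto)
    show "integrable lborel (\<lambda>x. Re (e x * \<eta> x))" by (rule integrable_Re[OF ie])
    fix x
    have Re: "Re (e x * \<eta> x) = Re (e x) * Re (\<eta> x)" "0 \<le> Re (\<eta> x)" by (simp_all add: \<eta>_eq)
    have big: "Re (e x) \<ge> 1/2" if "dist x x0 < d"
    proof -
      have "\<bar>Re (e x - 1)\<bar> \<le> norm (e x - 1)" by (rule abs_Re_le_cmod)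
      then show ?thesis using d(2)[OF that] by (simp add: dist_norm)
    qed
    show "indicator (ball x0 (d/2)) x * (1/2) \<le> Re (e x * \<eta> x)"
    proof (cases "dist x x0 < d/2")
      case True
      then show ?thesis using one[of x] big d(1) unfolding Re(1) by (simp add: indicator_def dist_commute)
    next
      case False
      then have "indicator (ball x0 (d/2)) x = (0::real)" by (simp add: indicator_def dist_commute)
      moreover have "0 \<le> Re (e x * \<eta> x)"
        by (cases "dist x x0 < d") (use big Re supp in \<open>auto intro!: mult_nonneg_nonneg\<close>)
      ultimately show ?thesis by simp
    qed
  qed
  moreover have "(\<integral>x. indicator (ball x0 (d/2)) x * (1/2) \<partial>lborel) = measure lborel (ball x0 (d/2)) / 2"
    by simp
  moreover have "measure lborel (ball x0 (d/2)) > 0"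
    using content_ball_pos[of "d/2" x0] d(1) by (simp add: measure_completion)
  ultimately show False by linarith
qed

lemma as_function_eq:
  fixes g \<Psi> :: "'a::euclidean_space \<Rightarrow> complex"
  assumes "resolution_generator \<Psi>" "continuous_on UNIV g" "represents g u"
  shows "as_function u = g"
  unfolding as_function_def
proof (rule the_equality)
  fix h assume "continuous_on UNIV h \<and> represents h u"
  then show "h = g" using represents_unique[OF assms(1)] assms(2,3) by blast
qed (use assms in blast)

lemma as_function_fourier_multiplier:
  fixes \<sigma> \<Psi> :: "'a::euclidean_space \<Rightarrow> complex"
  assumes "resolution_generator \<Psi>" "u \<in> tempered_distributions" "\<sigma> \<in> schwartz_space"
  shows "as_function (fourier_multiplier \<sigma> u) = multiplier_fun \<sigma> u"
  by (intro as_function_eq[OF assms(1)] multiplier_fun_represents multiplier_fun_continuous assms)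

subsection \<open>Linearity and composition\<close>

lemma mkernel_diff:
  assumes "\<sigma> \<in> schwartz_space" "\<tau> \<in> schwartz_space"
  shows "mkernel (\<lambda>x. \<sigma> x - \<tau> x) z = mkernel \<sigma> z - mkernel \<tau> z"
  unfolding mkernel_def fourier_altdef right_diff_distrib
  by (simp add: Bochner_Integration.integral_diff integrable_character_mult schwartz_integrable assms right_diff_distrib)

lemma mkernel_zero: "mkernel (\<lambda>x. 0) z = 0"
  by (simp add: mkernel_def fourier_altdef)

lemma multiplier_fun_diff:
  assumes "u \<in> tempered_distributions" "\<sigma> \<in> schwartz_space" "\<tau> \<in> schwartz_space"
  shows "multiplier_fun (\<lambda>x. \<sigma> x - \<tau> x) u x = multiplier_fun \<sigma> u x - multiplier_fun \<tau> u x"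
  unfolding multiplier_fun_def mkernel_diff[OF assms(2,3)]
  by (intro tempered_diff assms schwartz_translate mkernel_schwartz)

lemma multiplier_fun_zero:
  fixes u :: "'a::euclidean_space functional"
  assumes "u \<in> tempered_distributions"
  shows "multiplier_fun (\<lambda>x. 0) u x = 0"
proof -
  have "(\<lambda>x::'a. 0) \<in> schwartz_space"
    by (rule schwartz_coinduct[where X="\<lambda>f. f = (\<lambda>x. 0)"])
       (auto simp: rapid_def partial_deriv_def)
  from tempered_cmult[OF assms this, of 0] show ?thesis
    unfolding multiplier_fun_def mkernel_zero by simp
qed

lemma inv_fourier_translate:
  fixes f :: "'a::euclidean_space \<Rightarrow> complex"
  assumes f: "f \<in> schwartz_space"
  shows "inv_fourier (\<lambda>y. f (y - x)) \<xi> = exp (\<i> * complex_of_real (\<xi> \<bullet> x)) * inv_fourier f \<xi>"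
proof -
  note [measurable] = schwartz_measurable[OF f]
  have "(\<integral>y. exp (\<i> * complex_of_real (\<xi> \<bullet> y)) * f (y - x) \<partial>lborel)
      = (\<integral>y. exp (\<i> * complex_of_real (\<xi> \<bullet> x)) * (exp (\<i> * complex_of_real (\<xi> \<bullet> y)) * f y) \<partial>lborel)"
    using integral_affine[of 1 "\<lambda>y. exp (\<i> * complex_of_real (\<xi> \<bullet> y)) * f (y - x)" x]
    by (simp add: inner_add_right exp_add ring_distribs mult.assoc)
  then show ?thesis unfolding inv_fourier_altdef by simp
qed

lemma inv_fourier_mkernel_translate:
  fixes \<tau> :: "'a::euclidean_space \<Rightarrow> complex"
  assumes t: "\<tau> \<in> schwartz_space"
  shows "inv_fourier (\<lambda>y. mkernel \<tau> (y - x)) \<xi> = fourier_const TYPE('a) * (exp (\<i> * complex_of_real (\<xi> \<bullet> x)) * \<tau> \<xi>)"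
proof -
  have "inv_fourier (mkernel \<tau>) \<xi> = fourier_const TYPE('a) * inv_fourier (fourier \<tau>) \<xi>"
    unfolding mkernel_def[abs_def] inv_fourier_altdef[of "\<lambda>z. _ z * _ z"]
    by (subst inv_fourier_altdef) (simp add: inv_fourier_altdef mult.left_commute)
  then show ?thesis unfolding inv_fourier_translate[OF mkernel_schwartz[OF t]] inv_fourier_fourier[OF t]
    by (simp add: mult.left_commute)
qed

text \<open>
  Multipliers compose by multiplying their symbols; this is the instance of that fact on the side of the
  test functions.
\<close>

lemma fourier_mult_mkernel_translate:
  fixes \<tau> \<sigma> :: "'a::euclidean_space \<Rightarrow> complex"
  assumes t: "\<tau> \<in> schwartz_space"
  shows "fourier (\<lambda>\<xi>. \<sigma> \<xi> * inv_fourier (\<lambda>y. mkernel \<tau> (y - x)) \<xi>) = (\<lambda>y. mkernel (\<lambda>\<xi>. \<tau> \<xi> * \<sigma> \<xi>) (y - x))"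
proof
  fix y
  have eq: "exp (- (\<i> * complex_of_real (\<xi> \<bullet> y))) * (\<sigma> \<xi> * (fourier_const TYPE('a) * (exp (\<i> * complex_of_real (\<xi> \<bullet> x)) * \<tau> \<xi>)))
      = fourier_const TYPE('a) * (exp (- (\<i> * complex_of_real (\<xi> \<bullet> (y - x)))) * (\<tau> \<xi> * \<sigma> \<xi>))" for \<xi>
  proof -
    have "exp (- (\<i> * complex_of_real (\<xi> \<bullet> (y - x)))) = exp (- (\<i> * complex_of_real (\<xi> \<bullet> y))) * exp (\<i> * complex_of_real (\<xi> \<bullet> x))"
      by (simp add: exp_add[symmetric] inner_diff_right right_diff_distrib)
    then show ?thesis by (simp only: mult_ac)
  qed
  show "fourier (\<lambda>\<xi>. \<sigma> \<xi> * inv_fourier (\<lambda>y. mkernel \<tau> (y - x)) \<xi>) y = mkernel (\<lambda>\<xi>. \<tau> \<xi> * \<sigma> \<xi>) (y - x)"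
    unfolding inv_fourier_mkernel_translate[OF t] unfolding mkernel_def fourier_altdef
    by (simp only: eq integral_mult_right_zero)
qed

definition smoothing :: "('a::euclidean_space \<Rightarrow> complex) \<Rightarrow> ('a \<Rightarrow> complex) \<Rightarrow> 'a \<Rightarrow> complex" where
  "smoothing \<tau> g x = (\<integral>y. g y * mkernel \<tau> (y - x) \<partial>lborel)"

lemma smoothing_multiplier_fun:
  assumes u: "u \<in> tempered_distributions" and s: "\<sigma> \<in> schwartz_space" and t: "\<tau> \<in> schwartz_space"
  shows "integrable lborel (\<lambda>y. multiplier_fun \<sigma> u y * mkernel \<tau> (y - x))"
    and "smoothing \<tau> (multiplier_fun \<sigma> u) x = multiplier_fun (\<lambda>\<xi>. \<tau> \<xi> * \<sigma> \<xi>) u x"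
proof -
  let ?f = "\<lambda>y. mkernel \<tau> (y - x)"
  have f: "?f \<in> schwartz_space" by (intro schwartz_translate mkernel_schwartz t)
  note * = multiplier_fun_represents[OF u s, unfolded represents_def, THEN bspec, OF f]
  show "integrable lborel (\<lambda>y. multiplier_fun \<sigma> u y * mkernel \<tau> (y - x))" using * by blast
  have "smoothing \<tau> (multiplier_fun \<sigma> u) x = fourier_multiplier \<sigma> u ?f"
    unfolding smoothing_def using * by simp
  also have "\<dots> = multiplier_fun (\<lambda>\<xi>. \<tau> \<xi> * \<sigma> \<xi>) u x"
    unfolding fourier_multiplier_apply fourier_mult_mkernel_translate[OF t] multiplier_fun_def ..
  finally show "smoothing \<tau> (multiplier_fun \<sigma> u) x = multiplier_fun (\<lambda>\<xi>. \<tau> \<xi> * \<sigma> \<xi>) u x" .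
qed

subsection \<open>Band-limited functions\<close>

text \<open>
  The condition on the integrals says that the distributional Fourier transform of \<open>g\<close> vanishes on every
  test function \<open>\<tau>\<close> that is zero on the ball of radius \<open>A\<close>. Stated by duality, it makes sense for
  bounded functions that need not be integrable.
\<close>

definition bandlimited :: "real \<Rightarrow> ('a::euclidean_space \<Rightarrow> complex) \<Rightarrow> bool" where
  "bandlimited A g \<longleftrightarrow> continuous_on UNIV g \<and> (\<exists>B. \<forall>x. norm (g x) \<le> B) \<and>
     (\<forall>\<tau>\<in>schwartz_space. (\<forall>\<xi>. norm \<xi> \<le> A \<longrightarrow> \<tau> \<xi> = 0) \<longrightarrow> (\<integral>y. g y * fourier \<tau> y \<partial>lborel) = 0)"

lemma bandlimited_multiplier_fun:
  assumes u: "u \<in> tempered_distributions" and s: "\<sigma> \<in> schwartz_space"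
    and supp: "\<And>\<xi>. norm \<xi> > A \<Longrightarrow> \<sigma> \<xi> = 0" and "\<exists>B. \<forall>x. norm (multiplier_fun \<sigma> u x) \<le> B"
  shows "bandlimited A (multiplier_fun \<sigma> u)"
  unfolding bandlimited_def
proof (intro conjI ballI impI assms multiplier_fun_continuous)
  fix \<tau> :: "'a \<Rightarrow> complex" assume t: "\<tau> \<in> schwartz_space" and z: "\<forall>\<xi>. norm \<xi> \<le> A \<longrightarrow> \<tau> \<xi> = 0"
  have "(\<integral>y. multiplier_fun \<sigma> u y * fourier \<tau> y \<partial>lborel) = u (fourier (\<lambda>\<xi>. \<sigma> \<xi> * \<tau> \<xi>))"
    using multiplier_fun_represents[OF u s, unfolded represents_def, THEN bspec, OF fourier_schwartz[OF t]]
    unfolding fourier_multiplier_apply inv_fourier_fourier[OF t] by simp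
  also have "(\<lambda>\<xi>. \<sigma> \<xi> * \<tau> \<xi>) = (\<lambda>\<xi>. 0)" using z supp by (metis mult_zero_left mult_zero_right not_le)
  also have "fourier (\<lambda>\<xi>::'a. 0) = (\<lambda>x. 0 * fourier \<tau> x)" by (rule ext) (simp add: fourier_altdef)
  also have "u \<dots> = 0" by (subst tempered_cmult[OF u fourier_schwartz[OF t]]) simp
  finally show "(\<integral>y. multiplier_fun \<sigma> u y * fourier \<tau> y \<partial>lborel) = 0" .
qed

text \<open>
  The inverse transform turns products into convolutions. One factor is given as a Fourier transform
  because that is how it arises in \<open>bandlimited_mult\<close>.
\<close>

lemma inv_fourier_mult_fourier:
  fixes \<alpha> f :: "'a::euclidean_space \<Rightarrow> complex"
  assumes a: "\<alpha> \<in> schwartz_space" and f: "f \<in> schwartz_space"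
  shows "inv_fourier (\<lambda>y. fourier \<alpha> y * f y) \<xi> = fourier_const TYPE('a) * (\<integral>\<eta>. \<alpha> \<eta> * inv_fourier f (\<xi> - \<eta>) \<partial>lborel)"
proof -
  note [measurable] = schwartz_measurable[OF a] schwartz_measurable[OF f]
  let ?c = "fourier_const TYPE('a)"
  let ?F = "\<lambda>\<eta> y. exp (\<i> * complex_of_real (\<xi> \<bullet> y)) * (?c * (exp (- (\<i> * complex_of_real (\<eta> \<bullet> y))) * \<alpha> \<eta>) * f y)"
  have "inv_fourier (\<lambda>y. fourier \<alpha> y * f y) \<xi> = ?c * (\<integral>y. (\<integral>\<eta>. ?F \<eta> y \<partial>lborel) \<partial>lborel)"
    unfolding fourier_altdef inv_fourier_altdef integral_mult_right_zero integral_mult_left_zero ..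
  also have "(\<integral>y. (\<integral>\<eta>. ?F \<eta> y \<partial>lborel) \<partial>lborel) = (\<integral>\<eta>. (\<integral>y. ?F \<eta> y \<partial>lborel) \<partial>lborel)"
  proof (rule fubini_dominated)
    show "(\<lambda>(\<eta>, y). ?F \<eta> y) \<in> borel_measurable (borel \<Otimes>\<^sub>M borel)" by measurable
    show "integrable lborel (\<lambda>\<eta>. norm (\<alpha> \<eta>))" by (intro integrable_norm schwartz_integrable a)
    show "integrable lborel (\<lambda>y. norm (?c * f y))" by (intro integrable_norm integrable_mult_right schwartz_integrable f)
  qed (simp add: norm_mult mult_ac)
  also have "\<dots> = (\<integral>\<eta>. \<alpha> \<eta> * inv_fourier f (\<xi> - \<eta>) \<partial>lborel)"
  proof (intro Bochner_Integration.integral_cong refl)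
    fix \<eta>
    have "?F \<eta> y = \<alpha> \<eta> * (?c * (exp (\<i> * complex_of_real ((\<xi> - \<eta>) \<bullet> y)) * f y))" for y
    proof -
      have "exp (\<i> * complex_of_real ((\<xi> - \<eta>) \<bullet> y)) = exp (\<i> * complex_of_real (\<xi> \<bullet> y)) * exp (- (\<i> * complex_of_real (\<eta> \<bullet> y)))"
        by (simp add: exp_add[symmetric] inner_diff_left right_diff_distrib)
      then show ?thesis by (simp only: mult_ac)
    qed
    then show "(\<integral>y. ?F \<eta> y \<partial>lborel) = \<alpha> \<eta> * inv_fourier f (\<xi> - \<eta>)"
      unfolding inv_fourier_altdef by (simp only: integral_mult_right_zero)
  qed
  finally show ?thesis .
qed

lemma inv_fourier_reflect:
  fixes f :: "'a::euclidean_space \<Rightarrow> complex"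
  assumes f: "f \<in> schwartz_space"
  shows "inv_fourier (\<lambda>y. f (z - y)) \<xi> = exp (\<i> * complex_of_real (\<xi> \<bullet> z)) * inv_fourier f (- \<xi>)"
proof -
  note [measurable] = schwartz_measurable[OF f]
  have "(\<integral>y. exp (\<i> * complex_of_real (\<xi> \<bullet> y)) * f (z - y) \<partial>lborel)
      = (\<integral>y. exp (\<i> * complex_of_real (\<xi> \<bullet> z)) * (exp (\<i> * complex_of_real (- \<xi> \<bullet> y)) * f y) \<partial>lborel)"
    using integral_affine[of "-1" "\<lambda>y. exp (\<i> * complex_of_real (\<xi> \<bullet> y)) * f (z - y)" z]
    by (simp add: inner_diff_right right_diff_distrib exp_diff exp_minus divide_inverse mult.assoc)
  then show ?thesis unfolding inv_fourier_altdef by simp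
qed

text \<open>
  Spectra add under multiplication. As \<open>h\<close> reproduces itself under \<open>\<sigma>\<close>, it is a superposition of
  translates of the kernel of \<open>\<sigma>\<close>. So the pairing of \<open>g h\<close> with a test function becomes a superposition
  of pairings of \<open>g\<close> with products of this test function and a translated kernel, and on the Fourier side such
  a product lives at distance at most \<open>B\<close> from the support of \<open>\<tau>\<close>, hence outside the ball of radius \<open>A\<close>.
\<close>

lemma bandlimited_mult:
  fixes g :: "'a::euclidean_space \<Rightarrow> complex"
  assumes g: "bandlimited A g" and h: "continuous_on UNIV h" "\<forall>x. norm (h x) \<le> H"
    and s: "\<sigma> \<in> schwartz_space" and supp: "\<And>\<xi>. norm \<xi> > B \<Longrightarrow> \<sigma> \<xi> = 0"
    and rep: "\<And>x. smoothing \<sigma> h x = h x"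
  shows "bandlimited (A + B) (\<lambda>x. g x * h x)"
  unfolding bandlimited_def
proof (intro conjI ballI impI)
  have gc: "continuous_on UNIV g" using g by (simp add: bandlimited_def)
  obtain G where G: "\<forall>x. norm (g x) \<le> G" using g by (auto simp: bandlimited_def)
  have gint: "(\<integral>y. g y * fourier \<tau> y \<partial>lborel) = 0" if "\<tau>\<in>schwartz_space" "\<And>\<xi>. norm \<xi> \<le> A \<Longrightarrow> \<tau> \<xi> = 0" for \<tau>
    using g that by (auto simp: bandlimited_def)
  have G0: "0 \<le> G" and H0: "0 \<le> H" using G h(2) norm_ge_zero order_trans by blast+
  show "continuous_on UNIV (\<lambda>x. g x * h x)" by (intro continuous_on_mult gc h)
  have "\<forall>x. norm (g x * h x) \<le> G * H" using G h(2) G0 by (auto simp: norm_mult intro!: mult_mono)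
  then show "\<exists>B. \<forall>x. norm (g x * h x) \<le> B" by blast
  fix \<tau> :: "'a \<Rightarrow> complex" assume t: "\<tau> \<in> schwartz_space" and z: "\<forall>\<xi>. norm \<xi> \<le> A + B \<longrightarrow> \<tau> \<xi> = 0"
  have k: "mkernel \<sigma> \<in> schwartz_space" and Ft: "fourier \<tau> \<in> schwartz_space" by (intro mkernel_schwartz fourier_schwartz s t)+
  have [measurable]: "g \<in> borel_measurable borel" "h \<in> borel_measurable borel" "mkernel \<sigma> \<in> borel_measurable borel" "fourier \<tau> \<in> borel_measurable borel"
    using gc h k Ft by (auto intro!: borel_measurable_continuous_onI schwartz_continuous)
  let ?F = "\<lambda>z y. h z * (g y * (fourier \<tau> y * mkernel \<sigma> (z - y)))"
  have "(\<integral>y. g y * h y * fourier \<tau> y \<partial>lborel) = (\<integral>y. (\<integral>z. ?F z y \<partial>lborel) \<partial>lborel)"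
  proof (intro Bochner_Integration.integral_cong refl)
    fix y
    have "g y * h y * fourier \<tau> y = (\<integral>z. (g y * fourier \<tau> y) * (h z * mkernel \<sigma> (z - y)) \<partial>lborel)"
      unfolding integral_mult_right_zero smoothing_def[symmetric] rep by (simp add: mult_ac)
    then show "g y * h y * fourier \<tau> y = (\<integral>z. ?F z y \<partial>lborel)" by (simp add: mult_ac)
  qed
  also have "\<dots> = (\<integral>z. (\<integral>y. ?F z y \<partial>lborel) \<partial>lborel)"
  proof -
    define N where "N = 2 * DIM('a)"
    obtain C where C: "C > 0" "\<And>x. (1 + norm x) ^ N * norm (mkernel \<sigma> x) \<le> C"
      by (rule rapidE[OF schwartz_rapid[OF k], where N=N]) blast
    show ?thesis
    proof (rule fubini_dominated)
      show "(\<lambda>(z, y). ?F z y) \<in> borel_measurable (borel \<Otimes>\<^sub>M borel)" by measurable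
      show "integrable lborel (\<lambda>z::'a. (H * C) * (1 / (1 + norm z) ^ N))"
        unfolding N_def by (intro integrable_mult_right integrable_weight)
      show "integrable lborel (\<lambda>y. G * ((1 + norm y) ^ N * norm (fourier \<tau> y)))"
        by (intro integrable_mult_right schwartz_integrable_weight Ft)
      fix z y :: 'a
      have p: "(1 + norm z) ^ N > 0" by (intro zero_less_power add_pos_nonneg) auto
      have "(1 + norm z) ^ N * norm (mkernel \<sigma> (z - y)) \<le> ((1 + norm y) ^ N * (1 + norm (z - y)) ^ N) * norm (mkernel \<sigma> (z - y))"
        using weight_mult[of y "z - y" N] by (intro mult_right_mono) auto
      also have "\<dots> = (1 + norm y) ^ N * ((1 + norm (z - y)) ^ N * norm (mkernel \<sigma> (z - y)))" by simp
      also have "\<dots> \<le> (1 + norm y) ^ N * C" by (intro mult_left_mono C) auto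
      finally have kz: "norm (mkernel \<sigma> (z - y)) \<le> C * (1 / (1 + norm z) ^ N) * (1 + norm y) ^ N"
        using p by (simp add: pos_le_divide_eq mult_ac)
      have "norm (?F z y) = (norm (h z) * norm (g y)) * norm (fourier \<tau> y) * norm (mkernel \<sigma> (z - y))" by (simp add: norm_mult mult_ac)
      also have "\<dots> \<le> (H * G) * norm (fourier \<tau> y) * (C * (1 / (1 + norm z) ^ N) * (1 + norm y) ^ N)"
        using G h(2) G0 H0 by (intro mult_mono mult_right_mono kz) auto
      finally show "norm (?F z y) \<le> (H * C) * (1 / (1 + norm z) ^ N) * (G * ((1 + norm y) ^ N * norm (fourier \<tau> y)))"
        by (simp add: mult_ac)
    qed
  qed
  also have "\<dots> = (\<integral>z. 0 \<partial>(lborel :: 'a measure))"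
  proof (intro Bochner_Integration.integral_cong refl)
    fix z :: 'a
    have kz: "(\<lambda>y. mkernel \<sigma> (z - y)) \<in> schwartz_space" using schwartz_affine[OF k, of "-1" z] by simp
    have w: "(\<lambda>y. fourier \<tau> y * mkernel \<sigma> (z - y)) \<in> schwartz_space" by (intro schwartz_mult Ft kz)
    have "inv_fourier (\<lambda>y. fourier \<tau> y * mkernel \<sigma> (z - y)) \<xi> = 0" if \<xi>: "norm \<xi> \<le> A" for \<xi>
    proof -
      have "\<tau> \<eta> * inv_fourier (\<lambda>y. mkernel \<sigma> (z - y)) (\<xi> - \<eta>) = 0" for \<eta>
      proof (cases "norm \<eta> \<le> A + B")
        case False
        have "norm \<eta> \<le> norm \<xi> + norm (\<xi> - \<eta>)" by (metis norm_minus_commute norm_triangle_sub)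
        then have "norm (- (\<xi> - \<eta>)) > B" using False \<xi> by (simp add: norm_minus_commute)
        then have "\<sigma> (- (\<xi> - \<eta>)) = 0" by (rule supp)
        then show ?thesis
          unfolding inv_fourier_reflect[OF k] inv_fourier_mkernel_translate[OF s, of 0, simplified] by simp
      qed (use z in simp)
      then show ?thesis unfolding inv_fourier_mult_fourier[OF t kz] by (simp only: integral_zero mult_zero_right)
    qed
    from gint[OF inv_fourier_schwartz[OF w] this]
    have "(\<integral>y. g y * (fourier \<tau> y * mkernel \<sigma> (z - y)) \<partial>lborel) = 0" unfolding fourier_inv_fourier[OF w] .
    then show "(\<integral>y. ?F z y \<partial>lborel) = 0" unfolding integral_mult_right_zero by simp
  qed
  finally show "(\<integral>y. g y * h y * fourier \<tau> y \<partial>lborel) = 0" by simp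
qed

lemma smoothing_bandlimited:
  assumes "bandlimited A g" and t: "\<tau> \<in> schwartz_space" and "\<And>\<xi>. norm \<xi> \<le> A \<Longrightarrow> \<tau> \<xi> = 0"
  shows "smoothing \<tau> g x = 0"
proof -
  let ?w = "\<lambda>y. mkernel \<tau> (y - x)"
  have w: "?w \<in> schwartz_space" by (intro schwartz_translate mkernel_schwartz t)
  have "inv_fourier ?w \<xi> = 0" if "norm \<xi> \<le> A" for \<xi>
    unfolding inv_fourier_mkernel_translate[OF t] using assms(3)[OF that] by simp
  then have "(\<integral>y. g y * fourier (inv_fourier ?w) y \<partial>lborel) = 0"
    using assms(1) inv_fourier_schwartz[OF w] unfolding bandlimited_def by blast
  then show ?thesis unfolding smoothing_def fourier_inv_fourier[OF w] .
qed

section \<open>Bounds for Lebesgue norms\<close>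

text \<open>
  For \<open>\<beta> = 1/p\<close> this bounds the norm of \<open>f\<close> in \<open>L\<^sub>p\<close> by \<open>A\<close>, for every \<open>p > 0\<close>. The reciprocal is used
  because the exponents add in Hoelder's inequality and enter the conditions on the smoothness linearly.
\<close>

definition Lnorm_le :: "'b measure \<Rightarrow> real \<Rightarrow> ('b \<Rightarrow> real) \<Rightarrow> real \<Rightarrow> bool" where
  "Lnorm_le M \<beta> f A \<longleftrightarrow> f \<in> borel_measurable M \<and> (\<forall>x. 0 \<le> f x) \<and> 0 \<le> A \<and>
     (\<integral>\<^sup>+x. ennreal (f x powr (1 / \<beta>)) \<partial>M) \<le> ennreal (A powr (1 / \<beta>))"

lemma Lnorm_leD:
  assumes "Lnorm_le M \<beta> f A"
  shows "f \<in> borel_measurable M" "0 \<le> f x" "0 \<le> A" "(\<integral>\<^sup>+x. ennreal (f x powr (1 / \<beta>)) \<partial>M) \<le> ennreal (A powr (1 / \<beta>))"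
  using assms by (auto simp: Lnorm_le_def)

lemma Lnorm_le_mono:
  assumes g: "Lnorm_le M \<beta> g A" and "f \<in> borel_measurable M" "\<And>x. 0 \<le> f x" "\<And>x. f x \<le> g x" "A \<le> B" "0 < \<beta>"
  shows "Lnorm_le M \<beta> f B"
  unfolding Lnorm_le_def
proof (intro conjI allI)
  show "0 \<le> B" using Lnorm_leD(3)[OF g] assms(5) by simp
  have "(\<integral>\<^sup>+x. ennreal (f x powr (1 / \<beta>)) \<partial>M) \<le> (\<integral>\<^sup>+x. ennreal (g x powr (1 / \<beta>)) \<partial>M)"
    using assms by (intro nn_integral_mono ennreal_leI powr_mono2) auto
  also have "\<dots> \<le> ennreal (A powr (1 / \<beta>))" by (rule Lnorm_leD(4)[OF g])
  also have "\<dots> \<le> ennreal (B powr (1 / \<beta>))" using assms Lnorm_leD(3)[OF g] by (intro ennreal_leI powr_mono2) auto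
  finally show "(\<integral>\<^sup>+x. ennreal (f x powr (1 / \<beta>)) \<partial>M) \<le> ennreal (B powr (1 / \<beta>))" .
qed (use assms in auto)

lemma Lnorm_le_weaken: "Lnorm_le M \<beta> f A \<Longrightarrow> A \<le> B \<Longrightarrow> 0 < \<beta> \<Longrightarrow> Lnorm_le M \<beta> f B"
  by (rule Lnorm_le_mono) (auto dest: Lnorm_leD)

lemma Lnorm_le_cmult:
  assumes f: "Lnorm_le M \<beta> f A" and c: "0 \<le> c"
  shows "Lnorm_le M \<beta> (\<lambda>x. c * f x) (c * A)"
  unfolding Lnorm_le_def
proof (intro conjI allI)
  note [measurable] = Lnorm_leD(1)[OF f]
  have "(\<integral>\<^sup>+x. ennreal ((c * f x) powr (1 / \<beta>)) \<partial>M) = (\<integral>\<^sup>+x. ennreal (c powr (1 / \<beta>)) * ennreal (f x powr (1 / \<beta>)) \<partial>M)"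
    using c Lnorm_leD(2)[OF f] by (intro nn_integral_cong) (simp add: powr_mult ennreal_mult)
  also have "\<dots> = ennreal (c powr (1 / \<beta>)) * (\<integral>\<^sup>+x. ennreal (f x powr (1 / \<beta>)) \<partial>M)" by (rule nn_integral_cmult) measurable
  also have "\<dots> \<le> ennreal (c powr (1 / \<beta>)) * ennreal (A powr (1 / \<beta>))" by (intro mult_left_mono Lnorm_leD(4)[OF f]) auto
  also have "\<dots> = ennreal ((c * A) powr (1 / \<beta>))" using c Lnorm_leD(3)[OF f] by (simp add: powr_mult ennreal_mult)
  finally show "(\<integral>\<^sup>+x. ennreal ((c * f x) powr (1 / \<beta>)) \<partial>M) \<le> ennreal ((c * A) powr (1 / \<beta>))" .
  show "(\<lambda>x. c * f x) \<in> borel_measurable M" by measurable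
qed (use c Lnorm_leD(2,3)[OF f] in auto)

lemma young_powr:
  fixes a b :: real
  assumes "0 \<le> a" "0 \<le> b" "0 < \<theta>" "\<theta> < 1"
  shows "a powr \<theta> * b powr (1 - \<theta>) \<le> \<theta> * a + (1 - \<theta>) * b"
proof (cases "a = 0 \<or> b = 0")
  case False
  then show ?thesis using Youngs_inequality_0[of \<theta> "1 - \<theta>" a b] assms by auto
qed (use assms in auto)

lemma Lnorm_le_zero_AE:
  assumes "Lnorm_le M \<beta> f 0" "0 < \<beta>"
  shows "AE x in M. f x = 0"
proof -
  note [measurable] = Lnorm_leD(1)[OF assms(1)]
  have "(\<integral>\<^sup>+x. ennreal (f x powr (1 / \<beta>)) \<partial>M) = 0" using Lnorm_leD(4)[OF assms(1)] assms(2) by simp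
  then have "AE x in M. ennreal (f x powr (1 / \<beta>)) = 0" by (subst (asm) nn_integral_0_iff_AE) auto
  then show ?thesis
  proof eventually_elim
    case (elim x)
    then have "f x powr (1 / \<beta>) \<le> 0" by (simp add: ennreal_eq_0_iff)
    then have "f x powr (1 / \<beta>) = 0" by (intro order_antisym) auto
    then show ?case by simp
  qed
qed

text \<open>
  Hoelder's inequality on the whole scale of exponents: normalise by \<open>A\<close> and \<open>B\<close> and apply Young's
  inequality pointwise.
\<close>

lemma Lnorm_le_mult:
  assumes f: "Lnorm_le M \<beta> f A" and g: "Lnorm_le M \<gamma> g B" and b: "0 < \<beta>" "0 < \<gamma>"
  shows "Lnorm_le M (\<beta> + \<gamma>) (\<lambda>x. f x * g x) (A * B)"
  unfolding Lnorm_le_def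
proof (intro conjI allI)
  note [measurable] = Lnorm_leD(1)[OF f] Lnorm_leD(1)[OF g]
  let ?p = "1 / (\<beta> + \<gamma>)"
  show "(\<lambda>x. f x * g x) \<in> borel_measurable M" by measurable
  show "0 \<le> f x * g x" for x using Lnorm_leD(2)[OF f] Lnorm_leD(2)[OF g] by simp
  show AB: "0 \<le> A * B" using Lnorm_leD(3)[OF f] Lnorm_leD(3)[OF g] by simp
  show "(\<integral>\<^sup>+x. ennreal ((f x * g x) powr ?p) \<partial>M) \<le> ennreal ((A * B) powr ?p)"
  proof (cases "A = 0 \<or> B = 0")
    case True
    have "AE x in M. f x * g x = 0"
      using True
    proof
      assume "A = 0"
      then have "AE x in M. f x = 0" using Lnorm_le_zero_AE f b by blast
      then show ?thesis by eventually_elim simp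
    next
      assume "B = 0"
      then have "AE x in M. g x = 0" using Lnorm_le_zero_AE g b by blast
      then show ?thesis by eventually_elim simp
    qed
    then have "AE x in M. ennreal ((f x * g x) powr ?p) = 0" by eventually_elim simp
    then have "(\<integral>\<^sup>+x. ennreal ((f x * g x) powr ?p) \<partial>M) = 0" by (subst nn_integral_0_iff_AE) auto
    then show ?thesis by simp
  next
    case False
    then have A: "A > 0" and B: "B > 0" using Lnorm_leD(3)[OF f] Lnorm_leD(3)[OF g] by auto
    define \<theta> where "\<theta> = \<beta> / (\<beta> + \<gamma>)"
    have th: "0 < \<theta>" "\<theta> < 1" "1 - \<theta> = \<gamma> / (\<beta> + \<gamma>)" using b by (auto simp: \<theta>_def field_simps)
    have pt: "(f x * g x) powr ?p \<le> (A * B) powr ?p * (\<theta> * (f x powr (1/\<beta>) / A powr (1/\<beta>)) + (1 - \<theta>) * (g x powr (1/\<gamma>) / B powr (1/\<gamma>)))" for x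
    proof -
      have fg: "0 \<le> f x" "0 \<le> g x" using Lnorm_leD(2)[OF f] Lnorm_leD(2)[OF g] by auto
      have 1: "((f x / A) powr (1/\<beta>)) powr \<theta> = (f x / A) powr ?p" unfolding powr_powr \<theta>_def using b by (simp add: field_simps)
      have 2: "((g x / B) powr (1/\<gamma>)) powr (1 - \<theta>) = (g x / B) powr ?p" unfolding powr_powr th(3) using b by (simp add: field_simps)
      have m: "(f x / A) powr ?p * (g x / B) powr ?p \<le> \<theta> * (f x / A) powr (1/\<beta>) + (1 - \<theta>) * (g x / B) powr (1/\<gamma>)"
        using young_powr[of "(f x / A) powr (1/\<beta>)" "(g x / B) powr (1/\<gamma>)" \<theta>] th unfolding 1 2 by auto
      have 3: "(f x / A) powr (1/\<beta>) = f x powr (1/\<beta>) / A powr (1/\<beta>)" "(g x / B) powr (1/\<gamma>) = g x powr (1/\<gamma>) / B powr (1/\<gamma>)"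
        using A B fg by (simp_all add: powr_divide)
      have "(f x * g x) powr ?p = ((A * B) * ((f x / A) * (g x / B))) powr ?p"
        using A B by simp
      also have "\<dots> = (A * B) powr ?p * ((f x / A) powr ?p * (g x / B) powr ?p)"
        using A B fg by (simp only: powr_mult)
      also have "\<dots> \<le> (A * B) powr ?p * (\<theta> * (f x / A) powr (1/\<beta>) + (1 - \<theta>) * (g x / B) powr (1/\<gamma>))"
        by (intro mult_left_mono m) auto
      finally show ?thesis unfolding 3 .
    qed
    have iA: "(\<integral>\<^sup>+x. ennreal (\<theta> * (f x powr (1/\<beta>) / A powr (1/\<beta>))) \<partial>M) \<le> ennreal \<theta>"
    proof -
      have "(\<integral>\<^sup>+x. ennreal (\<theta> * (f x powr (1/\<beta>) / A powr (1/\<beta>))) \<partial>M) = (\<integral>\<^sup>+x. ennreal (\<theta> / A powr (1/\<beta>)) * ennreal (f x powr (1/\<beta>)) \<partial>M)"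
        using th by (intro nn_integral_cong) (simp add: ennreal_mult[symmetric] mult_ac)
      also have "\<dots> = ennreal (\<theta> / A powr (1/\<beta>)) * (\<integral>\<^sup>+x. ennreal (f x powr (1/\<beta>)) \<partial>M)" by (rule nn_integral_cmult) measurable
      also have "\<dots> \<le> ennreal (\<theta> / A powr (1/\<beta>)) * ennreal (A powr (1/\<beta>))" by (intro mult_left_mono Lnorm_leD(4)[OF f]) auto
      also have "\<dots> = ennreal \<theta>" using A th by (simp add: ennreal_mult[symmetric])
      finally show ?thesis .
    qed
    have iB: "(\<integral>\<^sup>+x. ennreal ((1 - \<theta>) * (g x powr (1/\<gamma>) / B powr (1/\<gamma>))) \<partial>M) \<le> ennreal (1 - \<theta>)"
    proof -
      have "(\<integral>\<^sup>+x. ennreal ((1 - \<theta>) * (g x powr (1/\<gamma>) / B powr (1/\<gamma>))) \<partial>M) = (\<integral>\<^sup>+x. ennreal ((1 - \<theta>) / B powr (1/\<gamma>)) * ennreal (g x powr (1/\<gamma>)) \<partial>M)"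
        using th(1,2) by (intro nn_integral_cong) (simp add: ennreal_mult[symmetric] mult_ac)
      also have "\<dots> = ennreal ((1 - \<theta>) / B powr (1/\<gamma>)) * (\<integral>\<^sup>+x. ennreal (g x powr (1/\<gamma>)) \<partial>M)" by (rule nn_integral_cmult) measurable
      also have "\<dots> \<le> ennreal ((1 - \<theta>) / B powr (1/\<gamma>)) * ennreal (B powr (1/\<gamma>))" by (intro mult_left_mono Lnorm_leD(4)[OF g]) auto
      also have "\<dots> = ennreal (1 - \<theta>)" using B th(1,2) by (simp add: ennreal_mult[symmetric])
      finally show ?thesis .
    qed
    have "(\<integral>\<^sup>+x. ennreal ((f x * g x) powr ?p) \<partial>M)
      \<le> (\<integral>\<^sup>+x. ennreal ((A * B) powr ?p) * (ennreal (\<theta> * (f x powr (1/\<beta>) / A powr (1/\<beta>))) + ennreal ((1 - \<theta>) * (g x powr (1/\<gamma>) / B powr (1/\<gamma>)))) \<partial>M)"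
      using th(1,2) by (intro nn_integral_mono order_trans[OF ennreal_leI[OF pt]]) (simp add: ennreal_mult ennreal_plus)
    also have "\<dots> = ennreal ((A * B) powr ?p) * ((\<integral>\<^sup>+x. ennreal (\<theta> * (f x powr (1/\<beta>) / A powr (1/\<beta>))) \<partial>M) + (\<integral>\<^sup>+x. ennreal ((1 - \<theta>) * (g x powr (1/\<gamma>) / B powr (1/\<gamma>))) \<partial>M))"
      by (subst nn_integral_cmult, measurable, subst nn_integral_add) auto
    also have "\<dots> \<le> ennreal ((A * B) powr ?p) * (ennreal \<theta> + ennreal (1 - \<theta>))"
      by (intro mult_left_mono add_mono iA iB) auto
    also have "\<dots> = ennreal ((A * B) powr ?p)" using th(1,2) by (simp add: ennreal_plus[symmetric] del: ennreal_plus)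
    finally show ?thesis .
  qed
qed

lemma Lnorm_le_prod:
  assumes "finite I" "I \<noteq> {}" "\<And>i. i \<in> I \<Longrightarrow> Lnorm_le M (\<beta> i) (f i) (A i)" "\<And>i. i \<in> I \<Longrightarrow> 0 < \<beta> i"
  shows "Lnorm_le M (\<Sum>i\<in>I. \<beta> i) (\<lambda>x. \<Prod>i\<in>I. f i x) (\<Prod>i\<in>I. A i)"
  using assms
proof (induction I rule: finite_ne_induct)
  case (insert i I)
  then have "Lnorm_le M (\<beta> i + (\<Sum>i\<in>I. \<beta> i)) (\<lambda>x. f i x * (\<Prod>i\<in>I. f i x)) (A i * (\<Prod>i\<in>I. A i))"
    by (intro Lnorm_le_mult) (auto intro: sum_pos)
  then show ?case using insert by simp
qed simp

text \<open>
  The constant is not the best one, but the same formula is valid above and below the exponent one.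
\<close>

lemma Lnorm_le_sum:
  assumes I: "finite I" and f: "\<And>i. i \<in> I \<Longrightarrow> Lnorm_le M \<beta> (f i) A" and b: "0 < \<beta>" and A: "0 \<le> A"
  shows "Lnorm_le M \<beta> (\<lambda>x. \<Sum>i\<in>I. f i x) (real (card I) powr (1 + \<beta>) * A)"
  unfolding Lnorm_le_def
proof (intro conjI allI)
  have [measurable]: "f i \<in> borel_measurable M" if "i \<in> I" for i by (rule Lnorm_leD(1)[OF f[OF that]])
  have nn: "0 \<le> f i x" if "i \<in> I" for i x by (rule Lnorm_leD(2)[OF f[OF that]])
  let ?p = "1 / \<beta>" and ?n = "real (card I)"
  show "(\<lambda>x. \<Sum>i\<in>I. f i x) \<in> borel_measurable M" by measurable
  show "0 \<le> (\<Sum>i\<in>I. f i x)" for x by (intro sum_nonneg nn)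
  show "0 \<le> ?n powr (1 + \<beta>) * A" using A by simp
  have pt: "(\<Sum>i\<in>I. f i x) powr ?p \<le> ?n powr ?p * (\<Sum>i\<in>I. f i x powr ?p)" for x
  proof (cases "I = {}")
    case False
    define S where "S = Max ((\<lambda>i. f i x) ` I)"
    have "S \<in> (\<lambda>i. f i x) ` I" unfolding S_def using I False by (intro Max_in) auto
    then obtain k where k: "k \<in> I" "S = f k x" by auto
    have "(\<Sum>i\<in>I. f i x) \<le> ?n * S"
      by (rule sum_bounded_above) (use I in \<open>auto simp: S_def\<close>)
    then have "(\<Sum>i\<in>I. f i x) powr ?p \<le> (?n * S) powr ?p" using b by (intro powr_mono2 sum_nonneg nn) auto
    also have "\<dots> = ?n powr ?p * S powr ?p" using nn k by (simp add: powr_mult)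
    also have "\<dots> \<le> ?n powr ?p * (\<Sum>i\<in>I. f i x powr ?p)"
      unfolding k(2) by (intro mult_left_mono member_le_sum k I) auto
    finally show ?thesis .
  qed (use b in simp)
  have "(\<integral>\<^sup>+x. ennreal ((\<Sum>i\<in>I. f i x) powr ?p) \<partial>M) \<le> (\<integral>\<^sup>+x. ennreal (?n powr ?p) * (\<Sum>i\<in>I. ennreal (f i x powr ?p)) \<partial>M)"
    by (intro nn_integral_mono order_trans[OF ennreal_leI[OF pt]]) (simp add: ennreal_mult sum_nonneg)
  also have "\<dots> = ennreal (?n powr ?p) * (\<Sum>i\<in>I. (\<integral>\<^sup>+x. ennreal (f i x powr ?p) \<partial>M))"
    by (subst nn_integral_cmult, measurable, subst nn_integral_sum) auto
  also have "\<dots> \<le> ennreal (?n powr ?p) * (\<Sum>i\<in>I. ennreal (A powr ?p))"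
    by (intro mult_left_mono sum_mono Lnorm_leD(4)[OF f]) auto
  also have "\<dots> = ennreal (?n powr ?p * (?n * A powr ?p))"
    by (simp add: ennreal_mult ennreal_of_nat_eq_real_of_nat)
  also have "?n powr ?p * (?n * A powr ?p) = (?n powr (1 + \<beta>) * A) powr ?p"
  proof -
    have "(?n powr (1 + \<beta>)) powr ?p = ?n powr ?p * ?n"
    proof -
      have "(1 + \<beta>) * ?p = ?p + 1" using b by (simp add: field_simps)
      then show ?thesis unfolding powr_powr by (simp add: powr_add)
    qed
    then show ?thesis using A by (simp add: powr_mult mult_ac)
  qed
  finally show "(\<integral>\<^sup>+x. ennreal ((\<Sum>i\<in>I. f i x) powr ?p) \<partial>M) \<le> ennreal ((?n powr (1 + \<beta>) * A) powr ?p)" .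
qed

lemma geometric_tail_sum:
  fixes t :: real
  assumes "finite F" "\<And>k. k \<in> F \<Longrightarrow> L \<le> k" "0 < t" "t < 1"
  shows "(\<Sum>k\<in>F. t ^ k) \<le> t ^ L / (1 - t)"
proof -
  have "(\<Sum>k\<in>F. t ^ k) = t ^ L * (\<Sum>k\<in>F. t ^ (k - L))"
    unfolding sum_distrib_left using assms(2) by (intro sum.cong refl) (simp add: power_add[symmetric])
  also have "(\<Sum>k\<in>F. t ^ (k - L)) = (\<Sum>j\<in>(\<lambda>k. k - L) ` F. t ^ j)"
    by (rule sum.reindex_cong[symmetric, of "\<lambda>k. k - L" F]) (use assms(2) in \<open>auto intro: inj_on_diff_nat\<close>)
  also have "\<dots> \<le> (\<Sum>j. t ^ j)" using assms by (intro sum_le_suminf summable_geometric) auto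
  also have "\<dots> = 1 / (1 - t)" using assms by (intro suminf_geometric) auto
  finally show ?thesis using assms by (simp add: mult_left_mono)
qed

text \<open>
  The constant of the next lemma: the first factor sums the auxiliary weights \<open>2 powr (- k * \<delta> / 2)\<close>, the second one what is
  left of the decay, in the power \<open>1 / \<beta>\<close>.
\<close>

definition geometric_const :: "real \<Rightarrow> real \<Rightarrow> real" where
  "geometric_const \<beta> \<delta> = (1 / (1 - 2 powr (- \<delta> / 2))) * (1 / (1 - 2 powr (- \<delta> / (2 * \<beta>)))) powr \<beta>"

lemma geometric_const_pos: "0 < \<delta> \<Longrightarrow> 0 < \<beta> \<Longrightarrow> 0 < geometric_const \<beta> \<delta>"
  unfolding geometric_const_def
  by (intro mult_pos_pos divide_pos_pos) (auto simp: powr_less_one)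

text \<open>
  A substitute for the triangle inequality which also holds below the exponent one. Half of the decay is
  spent on bounding the sum pointwise by the maximum over \<open>k\<close> of \<open>2 powr (k * \<delta> / 2) * f k x\<close>, up to a constant. A power of this
  maximum is at most the sum of the powers, and the sum of the integrals converges by the other half.
\<close>

lemma Lnorm_le_geometric:
  assumes F: "finite F" "\<And>k. k \<in> F \<Longrightarrow> L \<le> k" and b: "0 < \<beta>" and d: "0 < \<delta>" and A: "0 \<le> A"
    and f: "\<And>k. k \<in> F \<Longrightarrow> Lnorm_le M \<beta> (f k) (A * 2 powr (- real k * \<delta>))"
  shows "Lnorm_le M \<beta> (\<lambda>x. \<Sum>k\<in>F. f k x) (geometric_const \<beta> \<delta> * A * 2 powr (- real L * \<delta>))"
  unfolding Lnorm_le_def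
proof (intro conjI allI)
  have [measurable]: "f i \<in> borel_measurable M" if "i \<in> F" for i by (rule Lnorm_leD(1)[OF f[OF that]])
  have nn: "0 \<le> f i x" if "i \<in> F" for i x by (rule Lnorm_leD(2)[OF f[OF that]])
  let ?p = "1 / \<beta>"
  define t where "t = 2 powr (- \<delta> / 2)"
  define w where "w = 2 powr (- \<delta> / (2 * \<beta>))"
  have t: "0 < t" "t < 1" and w: "0 < w" "w < 1" using b d by (auto simp: t_def w_def powr_less_one)
  have tk: "t ^ k = 2 powr (- real k * \<delta> / 2)" and wk: "w ^ k = 2 powr (- real k * \<delta> / (2 * \<beta>))" for k
    by (simp_all add: t_def w_def powr_realpow[symmetric] powr_powr mult_ac)
  have pt1: "(t ^ k) powr (- ?p) * (A * 2 powr (- real k * \<delta>)) powr ?p = A powr ?p * w ^ k" for k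
  proof -
    have "(t ^ k) powr (- ?p) * (A * 2 powr (- real k * \<delta>)) powr ?p = A powr ?p * (2 powr (real k * \<delta> / (2 * \<beta>)) * 2 powr (- real k * \<delta> / \<beta>))"
      unfolding tk using A by (simp add: powr_mult powr_powr)
    also have "2 powr (real k * \<delta> / (2 * \<beta>)) * 2 powr (- real k * \<delta> / \<beta>) = w ^ k"
      unfolding wk powr_add[symmetric] using b by (simp add: field_simps)
    finally show ?thesis .
  qed
  show "(\<lambda>x. \<Sum>i\<in>F. f i x) \<in> borel_measurable M" by measurable
  show "0 \<le> (\<Sum>i\<in>F. f i x)" for x by (intro sum_nonneg nn)
  show "0 \<le> geometric_const \<beta> \<delta> * A * 2 powr (- real L * \<delta>)"
    using A geometric_const_pos[OF d b] by simp
  let ?T = "t ^ L / (1 - t)"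
  have T0: "0 \<le> ?T" using t by simp
  have pt: "(\<Sum>k\<in>F. f k x) powr ?p \<le> ?T powr ?p * (\<Sum>k\<in>F. (t ^ k) powr (- ?p) * f k x powr ?p)" for x
  proof (cases "F = {}")
    case False
    define S where "S = Max ((\<lambda>k. f k x / t ^ k) ` F)"
    have "S \<in> (\<lambda>k. f k x / t ^ k) ` F" unfolding S_def using F False by (intro Max_in) auto
    then obtain k where k: "k \<in> F" "S = f k x / t ^ k" by auto
    have S0: "0 \<le> S" using k nn t by simp
    have "(\<Sum>k\<in>F. f k x) \<le> (\<Sum>k\<in>F. t ^ k * S)"
    proof (rule sum_mono)
      fix i assume i: "i \<in> F"
      have "f i x / t ^ i \<le> S" unfolding S_def using i F by (intro Max_ge) auto
      then show "f i x \<le> t ^ i * S" using t by (simp add: divide_le_eq mult.commute)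
    qed
    also have "\<dots> = (\<Sum>k\<in>F. t ^ k) * S" by (simp add: sum_distrib_right)
    also have "\<dots> \<le> ?T * S" by (intro mult_right_mono geometric_tail_sum F t S0) auto
    finally have "(\<Sum>k\<in>F. f k x) powr ?p \<le> (?T * S) powr ?p" using b by (intro powr_mono2 sum_nonneg nn) auto
    also have "\<dots> = ?T powr ?p * S powr ?p" by (simp only: powr_mult T0 S0)
    also have "S powr ?p = (t ^ k) powr (- ?p) * f k x powr ?p"
      unfolding k(2) using t nn[OF k(1)] by (simp add: powr_divide powr_minus field_simps)
    also have "?T powr ?p * \<dots> \<le> ?T powr ?p * (\<Sum>k\<in>F. (t ^ k) powr (- ?p) * f k x powr ?p)"
      by (intro mult_left_mono member_le_sum[of k F "\<lambda>k. (t ^ k) powr (- ?p) * f k x powr ?p"] k F) auto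
    finally show ?thesis .
  qed (use b in simp)
  have "(\<integral>\<^sup>+x. ennreal ((\<Sum>i\<in>F. f i x) powr ?p) \<partial>M) \<le> (\<integral>\<^sup>+x. ennreal (?T powr ?p) * (\<Sum>k\<in>F. ennreal ((t ^ k) powr (- ?p)) * ennreal (f k x powr ?p)) \<partial>M)"
    by (intro nn_integral_mono order_trans[OF ennreal_leI[OF pt]]) (simp add: ennreal_mult sum_nonneg flip: sum_ennreal)
  also have "\<dots> = ennreal (?T powr ?p) * (\<Sum>k\<in>F. ennreal ((t ^ k) powr (- ?p)) * (\<integral>\<^sup>+x. ennreal (f k x powr ?p) \<partial>M))"
    by (subst nn_integral_cmult, measurable, subst nn_integral_sum) (auto simp: nn_integral_cmult)
  also have "\<dots> \<le> ennreal (?T powr ?p) * (\<Sum>k\<in>F. ennreal ((t ^ k) powr (- ?p)) * ennreal ((A * 2 powr (- real k * \<delta>)) powr ?p))"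
    by (intro mult_left_mono sum_mono Lnorm_leD(4)[OF f]) auto
  also have "\<dots> = ennreal (?T powr ?p) * (\<Sum>k\<in>F. ennreal (A powr ?p * w ^ k))"
    by (intro arg_cong2[where f="(*)"] refl sum.cong) (simp only: ennreal_mult[symmetric] powr_ge_zero pt1)
  also have "\<dots> = ennreal (?T powr ?p * (A powr ?p * (\<Sum>k\<in>F. w ^ k)))"
    using w by (subst sum_ennreal, simp) (simp add: sum_distrib_left[symmetric] ennreal_mult[symmetric] sum_nonneg)
  also have "\<dots> \<le> ennreal (?T powr ?p * (A powr ?p * (w ^ L / (1 - w))))"
    by (intro ennreal_leI mult_left_mono geometric_tail_sum F w) auto
  also have "?T powr ?p * (A powr ?p * (w ^ L / (1 - w))) = (geometric_const \<beta> \<delta> * A * 2 powr (- real L * \<delta>)) powr ?p"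
  proof -
    have 1: "((1 / (1 - w)) powr \<beta>) powr ?p = 1 / (1 - w)" using b w by (simp add: powr_powr)
    have 2: "(2 powr (- real L * \<delta>)) powr ?p = (t ^ L) powr ?p * w ^ L"
      unfolding tk wk powr_powr powr_add[symmetric] using b by (simp add: field_simps)
    have "(geometric_const \<beta> \<delta> * A * 2 powr (- real L * \<delta>)) powr ?p
       = (1 / (1 - t)) powr ?p * ((1 / (1 - w)) powr \<beta>) powr ?p * A powr ?p * (2 powr (- real L * \<delta>)) powr ?p"
      unfolding geometric_const_def t_def[symmetric] w_def[symmetric] by (simp only: powr_mult)
    also have "\<dots> = ?T powr ?p * (A powr ?p * (w ^ L / (1 - w)))"
      unfolding 1 2 using t by (simp add: powr_divide)
    finally show ?thesis ..
  qed
  finally show "(\<integral>\<^sup>+x. ennreal ((\<Sum>i\<in>F. f i x) powr ?p) \<partial>M) \<le> ennreal ((geometric_const \<beta> \<delta> * A * 2 powr (- real L * \<delta>)) powr ?p)" .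
qed

text \<open>Fatou's lemma.\<close>

lemma Lnorm_le_limit:
  assumes f: "\<And>n. Lnorm_le M \<beta> (f n) A" and lim: "\<And>x. (\<lambda>n. f n x) \<longlonglongrightarrow> g x" and b: "0 < \<beta>"
  shows "Lnorm_le M \<beta> g A"
  unfolding Lnorm_le_def
proof (intro conjI allI)
  note m[measurable] = Lnorm_leD(1)[OF f]
  show [measurable]: "g \<in> borel_measurable M" by (rule borel_measurable_LIMSEQ_metric[OF m lim])
  show "0 \<le> g x" for x by (rule LIMSEQ_le_const[OF lim]) (use Lnorm_leD(2)[OF f] in auto)
  show "0 \<le> A" by (rule Lnorm_leD(3)[OF f])
  have "(\<lambda>n. ennreal (f n x powr (1 / \<beta>))) \<longlonglongrightarrow> ennreal (g x powr (1 / \<beta>))" for x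
    by (intro tendsto_ennrealI tendsto_powr' lim tendsto_const) (use b Lnorm_leD(2)[OF f] in auto)
  then have "(\<integral>\<^sup>+x. ennreal (g x powr (1 / \<beta>)) \<partial>M) = (\<integral>\<^sup>+x. liminf (\<lambda>n. ennreal (f n x powr (1 / \<beta>))) \<partial>M)"
    by (intro nn_integral_cong) (metis lim_imp_Liminf sequentially_bot)
  also have "\<dots> \<le> liminf (\<lambda>n. (\<integral>\<^sup>+x. ennreal (f n x powr (1 / \<beta>)) \<partial>M))"
    by (rule nn_integral_liminf) measurable
  also have "\<dots> \<le> liminf (\<lambda>n::nat. ennreal (A powr (1 / \<beta>)))"
    by (intro Liminf_mono always_eventually allI Lnorm_leD(4)[OF f])
  also have "\<dots> = ennreal (A powr (1 / \<beta>))" by (simp add: Liminf_const)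
  finally show "(\<integral>\<^sup>+x. ennreal (g x powr (1 / \<beta>)) \<partial>M) \<le> ennreal (A powr (1 / \<beta>))" .
qed

lemma Lnorm_le_translate:
  fixes f :: "'a::euclidean_space \<Rightarrow> real"
  assumes f: "Lnorm_le lborel \<beta> f A"
  shows "Lnorm_le lborel \<beta> (\<lambda>x. f (x + z)) A"
proof -
  have [measurable]: "f \<in> borel_measurable borel" using Lnorm_leD(1)[OF f] by simp
  have "(\<integral>\<^sup>+x. ennreal (f (x + z) powr (1 / \<beta>)) \<partial>lborel) = (\<integral>\<^sup>+x. ennreal (f x powr (1 / \<beta>)) \<partial>lborel)"
    using nn_integral_affine[of 1 "\<lambda>x. ennreal (f x powr (1 / \<beta>))" z] by (simp add: add.commute)
  then show ?thesis using Lnorm_leD[OF f] unfolding Lnorm_le_def by simp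
qed

text \<open>
  Jensen's inequality for the measure with density \<open>K\<close>, whose mass is only known to be at most \<open>B\<close>.
  The power is linearised by Young's inequality with a parameter \<open>l\<close>, which is then optimised; the
  small \<open>e\<close> keeps the optimal \<open>l\<close> positive.
\<close>

lemma jensen_powr:
  assumes [measurable]: "K \<in> borel_measurable M" "h \<in> borel_measurable M"
    and nn: "\<And>y. 0 \<le> K y" "\<And>y. 0 \<le> h y" "0 \<le> F" and p: "1 \<le> p" and B: "0 \<le> B" "(\<integral>\<^sup>+y. ennreal (K y) \<partial>M) \<le> ennreal B"
    and F: "ennreal F \<le> (\<integral>\<^sup>+y. ennreal (K y * h y) \<partial>M)"
  shows "ennreal (F powr p) \<le> ennreal (B powr (p - 1)) * (\<integral>\<^sup>+y. ennreal (K y * h y powr p) \<partial>M)"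
proof (cases "B = 0 \<or> p = 1")
  case True
  show ?thesis
  proof (cases "B = 0")
    case True
    then have "(\<integral>\<^sup>+y. ennreal (K y) \<partial>M) = 0" using B by simp
    then have "AE y in M. ennreal (K y) = 0" by (subst (asm) nn_integral_0_iff_AE) auto
    then have "AE y in M. ennreal (K y * h y) = 0"
    proof eventually_elim
      case (elim y)
      then have "K y = 0" using nn(1)[of y] by (simp add: ennreal_eq_0_iff)
      then show ?case by simp
    qed
    then have "(\<integral>\<^sup>+y. ennreal (K y * h y) \<partial>M) = 0" by (subst nn_integral_0_iff_AE) auto
    then have "F = 0" using F nn by simp
    then show ?thesis using p by simp
  next
    case False
    then show ?thesis using True F nn by simp
  qed
next
  case False
  then have B0: "B > 0" and p1: "p > 1" using B p by auto
  define T where "T = (\<integral>\<^sup>+y. ennreal (K y * h y powr p) \<partial>M)"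
  show ?thesis
  proof (cases "T = \<infinity>")
    case True
    then show ?thesis unfolding T_def[symmetric] using B0 by (simp add: ennreal_mult_top)
  next
    case False
    then obtain t where t: "0 \<le> t" "T = ennreal t" by (cases T) auto
    have bound: "F powr p \<le> B powr (p - 1) * (t + e)" if e: "0 < e" for e
    proof -
      define l where "l = ((t + e) / B) powr (1 / p)"
      have l: "l > 0" using B0 t e by (simp add: l_def)
      have lp: "l powr p = (t + e) / B" using B0 t e p1 by (simp add: l_def powr_powr)
      have h: "h y \<le> (1/p) * (l powr (1 - p) * h y powr p) + (1 - 1/p) * l" for y
      proof -
        have "(l powr (1 - p) * h y powr p) powr (1/p) * l powr (1 - 1/p) \<le> (1/p) * (l powr (1 - p) * h y powr p) + (1 - 1/p) * l"
          by (rule young_powr) (use p1 l in auto)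
        also have "(l powr (1 - p) * h y powr p) powr (1/p) * l powr (1 - 1/p) = h y * (l powr ((1 - p) * (1/p)) * l powr (1 - 1/p))"
          using p1 nn(2)[of y] by (simp add: powr_mult powr_powr)
        also have "l powr ((1 - p) * (1/p)) * l powr (1 - 1/p) = l powr 0"
          unfolding powr_add[symmetric] using p1 by (simp add: field_simps)
        finally show ?thesis using l by simp
      qed
      have "ennreal F \<le> (\<integral>\<^sup>+y. ennreal (K y * h y) \<partial>M)" by (rule F)
      also have "\<dots> \<le> (\<integral>\<^sup>+y. ennreal ((1/p) * l powr (1 - p)) * ennreal (K y * h y powr p) + ennreal ((1 - 1/p) * l) * ennreal (K y) \<partial>M)"
      proof (rule nn_integral_mono)
        fix y
        have "K y * h y \<le> K y * ((1/p) * (l powr (1 - p) * h y powr p) + (1 - 1/p) * l)" by (intro mult_left_mono h nn)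
        also have "\<dots> = ((1/p) * l powr (1 - p)) * (K y * h y powr p) + ((1 - 1/p) * l) * K y" by (simp add: algebra_simps)
        finally have "ennreal (K y * h y) \<le> ennreal (((1/p) * l powr (1 - p)) * (K y * h y powr p) + ((1 - 1/p) * l) * K y)" by (rule ennreal_leI)
        also have "\<dots> = ennreal ((1/p) * l powr (1 - p)) * ennreal (K y * h y powr p) + ennreal ((1 - 1/p) * l) * ennreal (K y)"
          using nn p1 l by (subst ennreal_plus) (auto simp: ennreal_mult[symmetric])
        finally show "ennreal (K y * h y) \<le> ennreal ((1/p) * l powr (1 - p)) * ennreal (K y * h y powr p) + ennreal ((1 - 1/p) * l) * ennreal (K y)" .
      qed
      also have "\<dots> = ennreal ((1/p) * l powr (1 - p)) * T + ennreal ((1 - 1/p) * l) * (\<integral>\<^sup>+y. ennreal (K y) \<partial>M)"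
        unfolding T_def by (subst nn_integral_add) (auto simp: nn_integral_cmult)
      also have "\<dots> \<le> ennreal ((1/p) * l powr (1 - p)) * ennreal (t + e) + ennreal ((1 - 1/p) * l) * ennreal B"
        unfolding t(2) using e by (intro add_mono mult_left_mono B ennreal_leI) auto
      also have "\<dots> = ennreal ((1/p) * l powr (1 - p) * (t + e) + (1 - 1/p) * l * B)"
        using p1 l t e B by (subst ennreal_plus) (auto simp: ennreal_mult[symmetric] simp del: ennreal_plus)
      also have "(1/p) * l powr (1 - p) * (t + e) + (1 - 1/p) * l * B = l * B"
      proof -
        have "l powr (1 - p) * (t + e) = l powr (1 - p) * (l powr p * B)" unfolding lp using B0 by simp
        also have "\<dots> = l * B" using l by (simp add: powr_add[symmetric] mult.assoc[symmetric])
        finally show ?thesis by (simp add: algebra_simps)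
      qed
      finally have "F \<le> l * B" using l B0 by (simp add: ennreal_le_iff)
      then have "F powr p \<le> (l * B) powr p" using nn p1 by (intro powr_mono2) auto
      also have "\<dots> = (t + e) / B * B powr p" using l B0 lp by (simp add: powr_mult)
      also have "\<dots> = B powr (p - 1) * (t + e)" using B0 by (simp add: powr_diff)
      finally show ?thesis .
    qed
    have "F powr p \<le> B powr (p - 1) * t"
    proof (rule field_le_epsilon)
      fix e :: real assume e: "e > 0"
      have "F powr p \<le> B powr (p - 1) * (t + e / B powr (p - 1))" using bound[of "e / B powr (p - 1)"] e B0 by simp
      then show "F powr p \<le> B powr (p - 1) * t + e" using B0 by (simp add: algebra_simps)
    qed
    then have "ennreal (F powr p) \<le> ennreal (B powr (p - 1) * t)" by (rule ennreal_leI)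
    then show ?thesis unfolding T_def[symmetric] t(2) using t by (simp add: ennreal_mult)
  qed
qed

text \<open>
  Minkowski's integral inequality in the form in which it is applied: \<open>h x y\<close> is bounded in the norm over
  \<open>x\<close> by \<open>a y\<close>, and the average of \<open>a\<close> against \<open>K\<close> enters through its power mean.
\<close>

lemma Lnorm_le_integral:
  fixes h :: "'a::euclidean_space \<Rightarrow> 'a \<Rightarrow> real"
  assumes [measurable]: "K \<in> borel_measurable borel" "(\<lambda>(x, y). h x y) \<in> borel_measurable (borel \<Otimes>\<^sub>M borel)" "F \<in> borel_measurable borel"
    and nn: "\<And>y. 0 \<le> K y" "\<And>x. 0 \<le> F x" "0 \<le> D" and b: "0 < \<beta>" "\<beta> \<le> 1"
    and B: "0 \<le> B" "(\<integral>\<^sup>+y. ennreal (K y) \<partial>lborel) \<le> ennreal B"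
    and F: "\<And>x. ennreal (F x) \<le> (\<integral>\<^sup>+y. ennreal (K y * h x y) \<partial>lborel)"
    and h: "\<And>y. Lnorm_le lborel \<beta> (\<lambda>x. h x y) (a y)"
    and a: "(\<integral>\<^sup>+y. ennreal (K y * a y powr (1 / \<beta>)) \<partial>lborel) \<le> ennreal (B * D powr (1 / \<beta>))"
  shows "Lnorm_le lborel \<beta> F (B * D)"
  unfolding Lnorm_le_def
proof (intro conjI allI)
  let ?p = "1 / \<beta>"
  have hn: "0 \<le> h x y" for x y by (rule Lnorm_leD(2)[OF h])
  have p: "1 \<le> ?p" using b by simp
  interpret pair_sigma_finite "lborel :: 'a measure" "lborel :: 'a measure" ..
  have [measurable]: "h x \<in> borel_measurable borel" for x by measurable
  have "(\<integral>\<^sup>+x. ennreal (F x powr ?p) \<partial>lborel) \<le> (\<integral>\<^sup>+x. ennreal (B powr (?p - 1)) * (\<integral>\<^sup>+y. ennreal (K y * h x y powr ?p) \<partial>lborel) \<partial>lborel)"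
    by (intro nn_integral_mono jensen_powr nn hn p B F) measurable
  also have "\<dots> = ennreal (B powr (?p - 1)) * (\<integral>\<^sup>+x. (\<integral>\<^sup>+y. ennreal (K y * h x y powr ?p) \<partial>lborel) \<partial>lborel)"
    by (rule nn_integral_cmult) measurable
  also have "(\<integral>\<^sup>+x. (\<integral>\<^sup>+y. ennreal (K y * h x y powr ?p) \<partial>lborel) \<partial>lborel) = (\<integral>\<^sup>+y. (\<integral>\<^sup>+x. ennreal (K y * h x y powr ?p) \<partial>lborel) \<partial>lborel)"
    by (rule lborel_pair.Fubini'[symmetric]) measurable
  also have "\<dots> \<le> (\<integral>\<^sup>+y. ennreal (K y * a y powr ?p) \<partial>lborel)"
  proof (rule nn_integral_mono)
    fix y
    have "(\<integral>\<^sup>+x. ennreal (K y * h x y powr ?p) \<partial>lborel) = ennreal (K y) * (\<integral>\<^sup>+x. ennreal (h x y powr ?p) \<partial>lborel)"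
      by (subst nn_integral_cmult[symmetric]) (auto simp: ennreal_mult nn)
    also have "\<dots> \<le> ennreal (K y) * ennreal (a y powr ?p)" by (intro mult_left_mono Lnorm_leD(4)[OF h]) auto
    finally show "(\<integral>\<^sup>+x. ennreal (K y * h x y powr ?p) \<partial>lborel) \<le> ennreal (K y * a y powr ?p)" by (simp add: ennreal_mult nn)
  qed
  also note a
  finally have "(\<integral>\<^sup>+x. ennreal (F x powr ?p) \<partial>lborel) \<le> ennreal (B powr (?p - 1)) * ennreal (B * D powr ?p)"
    by (simp add: mult_left_mono)
  also have "\<dots> = ennreal ((B * D) powr ?p)"
  proof (cases "B = 0")
    case False
    then have "B powr (?p - 1) * (B * D powr ?p) = (B * D) powr ?p" using B nn by (simp add: powr_diff powr_mult)
    then show ?thesis by (simp add: ennreal_mult[symmetric] nn B)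
  qed simp
  finally show "(\<integral>\<^sup>+x. ennreal (F x powr ?p) \<partial>lborel) \<le> ennreal ((B * D) powr ?p)" .
qed (use nn B in auto)

section \<open>Littlewood--Paley kernels\<close>

lemma fourier_dilate:
  fixes \<sigma> :: "'a::euclidean_space \<Rightarrow> complex"
  assumes s: "\<sigma> \<in> schwartz_space" and c: "c > 0"
  shows "fourier (\<lambda>\<xi>. \<sigma> (c *\<^sub>R \<xi>)) z = of_real ((1 / c) ^ DIM('a)) * fourier \<sigma> ((1 / c) *\<^sub>R z)"
proof -
  note [measurable] = schwartz_measurable[OF s]
  have "(\<integral>x. exp (- (\<i> * complex_of_real (x \<bullet> z))) * \<sigma> (c *\<^sub>R x) \<partial>lborel)
     = \<bar>1 / c\<bar> ^ DIM('a) *\<^sub>R (\<integral>x. exp (- (\<i> * complex_of_real ((0 + (1/c) *\<^sub>R x) \<bullet> z))) * \<sigma> (c *\<^sub>R (0 + (1/c) *\<^sub>R x)) \<partial>lborel)"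
    by (rule integral_affine) (use c in auto)
  then show ?thesis unfolding fourier_altdef using c by (simp add: scaleR_conv_of_real mult_ac)
qed

locale resolution =
  fixes \<Psi> :: "'a::euclidean_space \<Rightarrow> complex"
  assumes gen: "resolution_generator \<Psi>"
begin

definition low :: "nat \<Rightarrow> 'a \<Rightarrow> complex" where
  "low l \<xi> = \<Psi> ((2 powr (- real l)) *\<^sub>R \<xi>)"

lemma gen_schwartz: "\<Psi> \<in> schwartz_space"
  using gen by (simp add: resolution_generator_def)

lemma low_schwartz: "low l \<in> schwartz_space"
  unfolding low_def[abs_def] by (intro schwartz_dilate gen_schwartz) simp

lemma norm_low_arg: "norm ((2 powr (- real l)) *\<^sub>R (\<xi> :: 'a)) = norm \<xi> / 2 ^ l"
  by (simp add: powr_minus powr_realpow divide_inverse mult.commute)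

lemma low_eq_1:
  assumes "norm \<xi> \<le> 2 ^ l" shows "low l \<xi> = 1"
proof -
  have "norm ((2 powr (- real l)) *\<^sub>R \<xi>) \<le> 1" unfolding norm_low_arg using assms by (simp add: divide_le_eq)
  then show ?thesis using gen unfolding resolution_generator_def low_def by blast
qed

lemma low_eq_0:
  assumes "norm \<xi> \<ge> 3/2 * 2 ^ l" shows "low l \<xi> = 0"
proof -
  have "norm ((2 powr (- real l)) *\<^sub>R \<xi>) \<ge> 3/2" unfolding norm_low_arg using assms by (simp add: le_divide_eq)
  then show ?thesis using gen unfolding resolution_generator_def low_def by blast
qed

lemma lp_symbol_0: "lp_symbol \<Psi> 0 = low 0"
  by (rule ext) (simp add: lp_symbol_def low_def)

lemma lp_symbol_Suc: "lp_symbol \<Psi> (Suc j) = (\<lambda>\<xi>. low (Suc j) \<xi> - low j \<xi>)"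
proof
  fix \<xi> :: 'a
  have "(2::real) powr (- real (Suc j)) = 2 powr (- 1 + - real j)" by simp
  also have "\<dots> = inverse 2 * 2 powr (- real j)" unfolding powr_add by (simp add: powr_minus)
  finally have e: "1 - real (Suc j) = - real j" "(2::real) powr (- real (Suc j)) = inverse 2 * 2 powr (- real j)" by simp_all
  show "lp_symbol \<Psi> (Suc j) \<xi> = low (Suc j) \<xi> - low j \<xi>"
    unfolding lp_symbol_def lp_symbol1_def low_def e by simp
qed

lemma lp_symbol_schwartz: "lp_symbol \<Psi> j \<in> schwartz_space"
  by (cases j) (auto simp: lp_symbol_0 lp_symbol_Suc intro: low_schwartz schwartz_diff)

lemma lp_symbol_eq_0_high: "norm \<xi> \<ge> 3/2 * 2 ^ j \<Longrightarrow> lp_symbol \<Psi> j \<xi> = 0"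
proof (cases j)
  case (Suc i)
  assume "norm \<xi> \<ge> 3/2 * 2 ^ j"
  moreover have "(3/2 * 2 ^ i :: real) \<le> 3/2 * 2 ^ j" using Suc by simp
  ultimately have "norm \<xi> \<ge> 3/2 * 2 ^ i" by linarith
  then show ?thesis using \<open>norm \<xi> \<ge> 3/2 * 2 ^ j\<close> Suc low_eq_0 by (simp add: lp_symbol_Suc)
qed (simp add: lp_symbol_0 low_eq_0)

lemma lp_symbol_eq_0_low: "norm \<xi> \<le> 2 ^ i \<Longrightarrow> i < j \<Longrightarrow> lp_symbol \<Psi> j \<xi> = 0"
proof (cases j)
  case (Suc k)
  assume *: "norm \<xi> \<le> 2 ^ i" "i < j"
  have "(2 ^ i :: real) \<le> 2 ^ k" "(2 ^ i :: real) \<le> 2 ^ j" by (rule power_increasing; use *(2) Suc in simp)+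
  then have "norm \<xi> \<le> 2 ^ k" "norm \<xi> \<le> 2 ^ j" using *(1) order_trans by blast+
  then show ?thesis using Suc low_eq_1 by (simp add: lp_symbol_Suc)
qed simp

lemma lp_block_eq: "u \<in> tempered_distributions \<Longrightarrow> lp_block \<Psi> j u = multiplier_fun (lp_symbol \<Psi> j) u"
  unfolding lp_block_def by (intro as_function_fourier_multiplier[OF gen] lp_symbol_schwartz)

lemma lp_lowpass_eq: "u \<in> tempered_distributions \<Longrightarrow> lp_lowpass \<Psi> j u = multiplier_fun (low j) u"
  unfolding lp_lowpass_def low_def[symmetric, abs_def] by (intro as_function_fourier_multiplier[OF gen] low_schwartz)

text \<open>
  Here \<open>T\<close> counts blocks, so the index is shifted by one against \<open>lp_lowpass\<close>. The empty sum \<open>T = 0\<close>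
  occurs below as \<open>T = j - 2 * m\<close> for small \<open>j\<close>.
\<close>

definition partial_sum :: "'a functional \<Rightarrow> nat \<Rightarrow> 'a \<Rightarrow> complex" where
  "partial_sum u T x = (\<Sum>k<T. lp_block \<Psi> k u x)"

lemma partial_sum_Suc:
  assumes u: "u \<in> tempered_distributions"
  shows "partial_sum u (Suc J) = multiplier_fun (low J) u"
proof
  fix x
  show "partial_sum u (Suc J) x = multiplier_fun (low J) u x"
  proof (induction J)
    case 0
    then show ?case by (simp add: partial_sum_def lp_block_eq[OF u] lp_symbol_0)
  next
    case (Suc J)
    have "partial_sum u (Suc (Suc J)) x = partial_sum u (Suc J) x + lp_block \<Psi> (Suc J) u x" by (simp add: partial_sum_def)
    then show ?case unfolding Suc lp_block_eq[OF u] lp_symbol_Suc multiplier_fun_diff[OF u low_schwartz low_schwartz] by simp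
  qed
qed

lemma lp_lowpass_partial_sum: "u \<in> tempered_distributions \<Longrightarrow> lp_lowpass \<Psi> J u = partial_sum u (Suc J)"
  by (simp add: lp_lowpass_eq partial_sum_Suc)

lemma lp_block_continuous: "u \<in> tempered_distributions \<Longrightarrow> continuous_on S (lp_block \<Psi> j u)"
  by (simp add: lp_block_eq multiplier_fun_continuous lp_symbol_schwartz)

lemma lp_block_measurable: "u \<in> tempered_distributions \<Longrightarrow> lp_block \<Psi> j u \<in> borel_measurable borel"
  by (intro borel_measurable_continuous_onI lp_block_continuous)

text \<open>
  The symbol \<open>low (Suc k)\<close> equals one on the support of \<open>lp_symbol \<Psi> k\<close>, so a block equals its average against a
  kernel of scale \<open>2 powr (- k)\<close>. All estimates for single blocks start from this identity.
\<close>

lemma lp_block_reproducing: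
  assumes u: "u \<in> tempered_distributions"
  shows "integrable lborel (\<lambda>y. lp_block \<Psi> k u y * mkernel (low (Suc k)) (y - x))"
    and "smoothing (low (Suc k)) (lp_block \<Psi> k u) x = lp_block \<Psi> k u x"
proof -
  show "integrable lborel (\<lambda>y. lp_block \<Psi> k u y * mkernel (low (Suc k)) (y - x))"
    unfolding lp_block_eq[OF u] by (rule smoothing_multiplier_fun(1)[OF u lp_symbol_schwartz low_schwartz])
  have "(\<lambda>\<xi>. low (Suc k) \<xi> * lp_symbol \<Psi> k \<xi>) = lp_symbol \<Psi> k"
  proof
    fix \<xi>
    show "low (Suc k) \<xi> * lp_symbol \<Psi> k \<xi> = lp_symbol \<Psi> k \<xi>"
    proof (cases "norm \<xi> \<le> 2 ^ Suc k")
      case False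
      have "(3/2 * 2 ^ k :: real) \<le> 2 ^ Suc k" by simp
      then have "norm \<xi> \<ge> 3/2 * 2 ^ k" using False by linarith
      then show ?thesis using lp_symbol_eq_0_high by simp
    qed (simp add: low_eq_1)
  qed
  then show "smoothing (low (Suc k)) (lp_block \<Psi> k u) x = lp_block \<Psi> k u x"
    unfolding lp_block_eq[OF u] smoothing_multiplier_fun(2)[OF u lp_symbol_schwartz low_schwartz] by (simp only:)
qed

subsection \<open>Kernel bounds\<close>

abbreviation \<kappa> :: "nat \<Rightarrow> 'a \<Rightarrow> complex" where "\<kappa> l \<equiv> mkernel (low l)"

lemma kappa_schwartz: "\<kappa> l \<in> schwartz_space"
  by (intro mkernel_schwartz low_schwartz)

lemma kappa_measurable [measurable]: "\<kappa> l \<in> borel_measurable borel"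
  by (intro schwartz_measurable kappa_schwartz)

lemma kappa_dilate: "\<kappa> l z = of_real (2 ^ (l * DIM('a))) * \<kappa> 0 (2 ^ l *\<^sub>R z)"
proof -
  have "low 0 = \<Psi>" by (simp add: low_def[abs_def])
  moreover have "1 / 2 powr (- real l) = (2::real) ^ l" by (simp add: powr_minus powr_realpow divide_inverse)
  moreover have "fourier (low l) z = of_real ((1 / 2 powr (- real l)) ^ DIM('a)) * fourier \<Psi> ((1 / 2 powr (- real l)) *\<^sub>R z)"
    unfolding low_def[abs_def] by (rule fourier_dilate[OF gen_schwartz]) simp
  ultimately show ?thesis unfolding mkernel_def by (simp add: power_mult)
qed

lemma norm_kappa_dilate: "norm (\<kappa> l z) = 2 ^ (l * DIM('a)) * norm (\<kappa> 0 (2 ^ l *\<^sub>R z))"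
  by (subst kappa_dilate) (simp add: norm_mult norm_power)

lemma kappa_bounded: "\<exists>C>0. \<forall>l z. norm (\<kappa> l z) \<le> C * 2 ^ (l * DIM('a))"
proof -
  obtain C where C: "C > 0" "\<And>z. norm (\<kappa> 0 z) \<le> C" using schwartz_bounded[OF kappa_schwartz] by metis
  have "norm (\<kappa> l z) \<le> C * 2 ^ (l * DIM('a))" for l z
    unfolding norm_kappa_dilate[of l] using C(2)[of "2 ^ l *\<^sub>R z"] by (simp add: mult.commute[of C])
  then show ?thesis using C(1) by blast
qed

text \<open>The dilated kernels are normalised in \<open>L\<^sub>1\<close>, hence integrals against them reduce to the scale one.\<close>

lemma nn_integral_kappa_dilate:
  assumes [measurable]: "G \<in> borel_measurable borel" and nn: "\<And>z. 0 \<le> G z"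
  shows "(\<integral>\<^sup>+z. ennreal (2 ^ (l * DIM('a)) * G (2 ^ l *\<^sub>R z)) \<partial>lborel) = (\<integral>\<^sup>+z. ennreal (G z) \<partial>(lborel :: 'a measure))"
proof -
  have "(\<integral>\<^sup>+z. ennreal (G z) \<partial>(lborel :: 'a measure)) = ennreal (\<bar>2 ^ l\<bar> ^ DIM('a)) * (\<integral>\<^sup>+z. ennreal (G (0 + 2 ^ l *\<^sub>R z)) \<partial>lborel)"
    by (rule nn_integral_affine) auto
  also have "\<dots> = (\<integral>\<^sup>+z. ennreal (2 ^ (l * DIM('a)) * G (2 ^ l *\<^sub>R z)) \<partial>lborel)"
    by (subst nn_integral_cmult[symmetric]) (auto simp: ennreal_mult nn power_mult)
  finally show ?thesis ..
qed

lemma kappa_L1: "\<exists>C>0. \<forall>l. (\<integral>\<^sup>+z. ennreal (norm (\<kappa> l z)) \<partial>lborel) \<le> ennreal C"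
proof -
  obtain C where C: "C > 0" "(\<integral>\<^sup>+z. ennreal (norm (\<kappa> 0 z)) \<partial>lborel) \<le> ennreal C"
    by (rule integrable_nn_integral_le[of lborel "\<lambda>z. norm (\<kappa> 0 z)"])
       (auto intro: integrable_norm schwartz_integrable kappa_schwartz)
  have "(\<integral>\<^sup>+z. ennreal (norm (\<kappa> l z)) \<partial>lborel) = (\<integral>\<^sup>+z. ennreal (norm (\<kappa> 0 z)) \<partial>lborel)" for l
    unfolding norm_kappa_dilate[of l]
    using nn_integral_kappa_dilate[of "\<lambda>z. norm (\<kappa> 0 z)" l] by simp
  then have "\<forall>l. (\<integral>\<^sup>+z. ennreal (norm (\<kappa> l z)) \<partial>lborel) \<le> ennreal C" using C(2) by metis
  then show ?thesis using C(1) by blast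
qed

lemma kappa_moment:
  assumes a: "0 \<le> a"
  shows "\<exists>C>0. \<forall>l. (\<integral>\<^sup>+z. ennreal (norm (\<kappa> l z) * norm z powr a) \<partial>lborel) \<le> ennreal (C * 2 powr (- real l * a))"
proof -
  obtain N :: nat where N: "a \<le> real N" using real_arch_simple by blast
  have "integrable lborel (\<lambda>z. norm (\<kappa> 0 z) * norm z powr a)"
  proof (rule Bochner_Integration.integrable_bound[OF schwartz_integrable_weight[OF kappa_schwartz, of N 0]])
    show "AE z in lborel. norm (norm (\<kappa> 0 z) * norm z powr a) \<le> norm ((1 + norm z) ^ N * norm (\<kappa> 0 z))"
    proof (rule AE_I2)
      fix z :: 'a
      have "norm z powr a \<le> (1 + norm z) powr a" using a by (intro powr_mono2) auto
      also have "\<dots> \<le> (1 + norm z) powr real N" using N by (intro powr_mono) auto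
      also have "\<dots> = (1 + norm z) ^ N" by (intro powr_realpow add_pos_nonneg) auto
      finally show "norm (norm (\<kappa> 0 z) * norm z powr a) \<le> norm ((1 + norm z) ^ N * norm (\<kappa> 0 z))"
        by (simp add: abs_mult mult.commute[of "norm (\<kappa> 0 z)"] mult_right_mono)
    qed
  qed measurable
  then obtain C where C: "C > 0" "(\<integral>\<^sup>+z. ennreal (norm (\<kappa> 0 z) * norm z powr a) \<partial>lborel) \<le> ennreal C"
    by (rule integrable_nn_integral_le) auto
  have "(\<integral>\<^sup>+z. ennreal (norm (\<kappa> l z) * norm z powr a) \<partial>lborel) \<le> ennreal (C * 2 powr (- real l * a))" for l
  proof -
    have "norm (\<kappa> l z) * norm z powr a = 2 powr (- real l * a) * (2 ^ (l * DIM('a)) * (norm (\<kappa> 0 (2 ^ l *\<^sub>R z)) * norm (2 ^ l *\<^sub>R z) powr a))" for z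
    proof -
      have "norm (2 ^ l *\<^sub>R z) powr a = 2 powr (real l * a) * norm z powr a"
        by (simp add: powr_mult powr_powr powr_realpow[symmetric])
      then show ?thesis unfolding norm_kappa_dilate[of l] by (simp add: powr_minus field_simps)
    qed
    then have "(\<integral>\<^sup>+z. ennreal (norm (\<kappa> l z) * norm z powr a) \<partial>lborel)
      = (\<integral>\<^sup>+z. ennreal (2 powr (- real l * a)) * ennreal (2 ^ (l * DIM('a)) * (norm (\<kappa> 0 (2 ^ l *\<^sub>R z)) * norm (2 ^ l *\<^sub>R z) powr a)) \<partial>lborel)"
      by (simp add: ennreal_mult)
    also have "\<dots> = ennreal (2 powr (- real l * a)) * (\<integral>\<^sup>+z. ennreal (2 ^ (l * DIM('a)) * (norm (\<kappa> 0 (2 ^ l *\<^sub>R z)) * norm (2 ^ l *\<^sub>R z) powr a)) \<partial>lborel)"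
      by (rule nn_integral_cmult) measurable
    also have "\<dots> = ennreal (2 powr (- real l * a)) * (\<integral>\<^sup>+z. ennreal (norm (\<kappa> 0 z) * norm z powr a) \<partial>lborel)"
      by (subst nn_integral_kappa_dilate[of "\<lambda>z. norm (\<kappa> 0 z) * norm z powr a" l]) auto
    also have "\<dots> \<le> ennreal (2 powr (- real l * a)) * ennreal C" by (intro mult_left_mono C) auto
    finally show ?thesis using C(1) by (simp add: ennreal_mult[symmetric] mult.commute)
  qed
  then show ?thesis using C(1) by blast
qed

text \<open>
  At scale one the bound is Lipschitz for \<open>norm z \<le> 1\<close> and trivial otherwise, so it holds with every
  exponent \<open>\<epsilon> \<le> 1\<close>; the general case follows by dilation.
\<close>

lemma kappa_modulus:
  assumes e: "0 < \<epsilon>" "\<epsilon> \<le> 1"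
  shows "\<exists>C>0. \<forall>l z. (\<integral>\<^sup>+y. ennreal (norm (\<kappa> l (y - z) - \<kappa> l y)) \<partial>lborel) \<le> ennreal (C * (2 ^ l * norm z) powr \<epsilon>)"
proof -
  obtain C1 where C1: "C1 > 0" "\<And>l. (\<integral>\<^sup>+z. ennreal (norm (\<kappa> l z)) \<partial>lborel) \<le> ennreal C1" using kappa_L1 by blast
  obtain D where D: "D > 0" "\<And>z h. norm h \<le> 1 \<Longrightarrow> (1 + norm z) ^ (2 * DIM('a)) * norm (\<kappa> 0 (z + h) - \<kappa> 0 z) \<le> D * norm h"
    by (rule schwartz_lipschitz[OF kappa_schwartz, of "2 * DIM('a)" 0]) blast
  obtain W where W: "W > 0" "(\<integral>\<^sup>+z. ennreal (1 / (1 + norm z) ^ (2 * DIM('a))) \<partial>(lborel :: 'a measure)) \<le> ennreal W"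
    by (rule integrable_nn_integral_le[OF integrable_weight]) auto
  define C where "C = 2 * C1 + D * W"
  have C: "C > 0" "2 * C1 \<le> C" "D * W \<le> C" using C1(1) D(1) W(1) by (auto simp: C_def add_pos_pos)
  have unit: "(\<integral>\<^sup>+y. ennreal (norm (\<kappa> 0 (y - z) - \<kappa> 0 y)) \<partial>lborel) \<le> ennreal (C * norm z powr \<epsilon>)" for z
  proof (cases "norm z \<le> 1")
    case True
    have "(\<integral>\<^sup>+y. ennreal (norm (\<kappa> 0 (y - z) - \<kappa> 0 y)) \<partial>lborel) \<le> (\<integral>\<^sup>+y. ennreal (D * norm z) * ennreal (1 / (1 + norm y) ^ (2 * DIM('a))) \<partial>(lborel :: 'a measure))"
    proof (rule nn_integral_mono)
      fix y :: 'a
      have p: "(1 + norm y) ^ (2 * DIM('a)) > 0" by (intro zero_less_power add_pos_nonneg) auto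
      have "norm (\<kappa> 0 (y - z) - \<kappa> 0 y) \<le> D * norm z * (1 / (1 + norm y) ^ (2 * DIM('a)))"
        using D(2)[of "- z" y] True p by (simp add: pos_le_divide_eq mult_ac)
      then show "ennreal (norm (\<kappa> 0 (y - z) - \<kappa> 0 y)) \<le> ennreal (D * norm z) * ennreal (1 / (1 + norm y) ^ (2 * DIM('a)))"
        using D(1) by (subst ennreal_mult[symmetric]) (auto intro: ennreal_leI)
    qed
    also have "\<dots> = ennreal (D * norm z) * (\<integral>\<^sup>+y. ennreal (1 / (1 + norm y) ^ (2 * DIM('a))) \<partial>(lborel :: 'a measure))"
      by (rule nn_integral_cmult) measurable
    also have "\<dots> \<le> ennreal (D * norm z) * ennreal W" by (intro mult_left_mono W) auto
    also have "\<dots> = ennreal (D * W * norm z)" using D(1) W(1) by (simp add: ennreal_mult[symmetric] mult_ac)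
    also have "\<dots> \<le> ennreal (C * norm z powr \<epsilon>)"
    proof (intro ennreal_leI mult_mono C)
      show "norm z \<le> norm z powr \<epsilon>"
        using powr_mono'[of \<epsilon> 1 "norm z"] e True by simp
    qed (use C in auto)
    finally show ?thesis .
  next
    case False
    have "(\<integral>\<^sup>+y. ennreal (norm (\<kappa> 0 (y - z) - \<kappa> 0 y)) \<partial>lborel) \<le> (\<integral>\<^sup>+y. ennreal (norm (\<kappa> 0 (y - z))) + ennreal (norm (\<kappa> 0 y)) \<partial>lborel)"
      by (intro nn_integral_mono) (auto intro!: ennreal_leI norm_triangle_ineq4 simp flip: ennreal_plus)
    also have "\<dots> = (\<integral>\<^sup>+y. ennreal (norm (\<kappa> 0 (y - z))) \<partial>lborel) + (\<integral>\<^sup>+y. ennreal (norm (\<kappa> 0 y)) \<partial>lborel)"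
      by (rule nn_integral_add) measurable
    also have "(\<integral>\<^sup>+y. ennreal (norm (\<kappa> 0 (y - z))) \<partial>lborel) = (\<integral>\<^sup>+y. ennreal (norm (\<kappa> 0 y)) \<partial>lborel)"
      using nn_integral_affine[of 1 "\<lambda>y. ennreal (norm (\<kappa> 0 (y - z)))" z] by simp
    also have "(\<integral>\<^sup>+y. ennreal (norm (\<kappa> 0 y)) \<partial>lborel) + (\<integral>\<^sup>+y. ennreal (norm (\<kappa> 0 y)) \<partial>lborel) \<le> ennreal C1 + ennreal C1"
      by (intro add_mono C1)
    also have "\<dots> = ennreal (2 * C1)" using C1(1) by (simp add: ennreal_plus[symmetric] del: ennreal_plus)
    also have "\<dots> \<le> ennreal (C * norm z powr \<epsilon>)"
    proof (rule ennreal_leI)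
      have "1 \<le> norm z powr \<epsilon>" using False e by (intro ge_one_powr_ge_zero) auto
      then have "2 * C1 * 1 \<le> C * norm z powr \<epsilon>" using C C1(1) by (intro mult_mono) auto
      then show "2 * C1 \<le> C * norm z powr \<epsilon>" by simp
    qed
    finally show ?thesis .
  qed
  have "(\<integral>\<^sup>+y. ennreal (norm (\<kappa> l (y - z) - \<kappa> l y)) \<partial>lborel) \<le> ennreal (C * (2 ^ l * norm z) powr \<epsilon>)" for l z
  proof -
    have "norm (\<kappa> l (y - z) - \<kappa> l y) = 2 ^ (l * DIM('a)) * norm (\<kappa> 0 (2 ^ l *\<^sub>R y - 2 ^ l *\<^sub>R z) - \<kappa> 0 (2 ^ l *\<^sub>R y))" for y
      unfolding kappa_dilate[of l] right_diff_distrib[symmetric] norm_mult by (simp add: scaleR_diff_right norm_power)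
    then have "(\<integral>\<^sup>+y. ennreal (norm (\<kappa> l (y - z) - \<kappa> l y)) \<partial>lborel) = (\<integral>\<^sup>+y. ennreal (norm (\<kappa> 0 (y - 2 ^ l *\<^sub>R z) - \<kappa> 0 y)) \<partial>lborel)"
      using nn_integral_kappa_dilate[of "\<lambda>y. norm (\<kappa> 0 (y - 2 ^ l *\<^sub>R z) - \<kappa> 0 y)" l] by simp
    then show ?thesis using unit[of "2 ^ l *\<^sub>R z"] by simp
  qed
  then show ?thesis using C(1) by blast
qed

text \<open>
  Transfers weighted bounds from the low-pass kernels to the blocks, whose kernels are differences of two
  consecutive ones.
\<close>

lemma mkernel_symbol_bound:
  assumes "\<And>l. (\<integral>\<^sup>+z. ennreal (norm (\<kappa> l z) * w z) \<partial>lborel) \<le> ennreal (b l)" and [measurable]: "w \<in> borel_measurable borel"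
    and w: "\<And>z. 0 \<le> w z" and b: "\<And>l. 0 \<le> b l" "\<And>l. b l \<le> c * b (Suc l)" "1 \<le> c"
  shows "(\<integral>\<^sup>+z. ennreal (norm (mkernel (lp_symbol \<Psi> j) z) * w z) \<partial>lborel) \<le> ennreal (2 * c * b j)"
proof (cases j)
  case 0
  have "b 0 \<le> c * b 0" using mult_right_mono[OF b(3) b(1)[of 0]] by simp
  also have "\<dots> \<le> 2 * c * b 0" using b(1)[of 0] b(3) by (simp add: mult_left_mono)
  finally show ?thesis using assms(1)[of 0] 0 by (simp add: lp_symbol_0 order_trans ennreal_leI)
next
  case (Suc i)
  have "(\<integral>\<^sup>+z. ennreal (norm (mkernel (lp_symbol \<Psi> j) z) * w z) \<partial>lborel)
    \<le> (\<integral>\<^sup>+z. ennreal (norm (\<kappa> (Suc i) z) * w z) + ennreal (norm (\<kappa> i z) * w z) \<partial>lborel)"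
  proof (rule nn_integral_mono)
    fix z
    have "norm (mkernel (lp_symbol \<Psi> j) z) * w z \<le> (norm (\<kappa> (Suc i) z) + norm (\<kappa> i z)) * w z"
      unfolding Suc lp_symbol_Suc mkernel_diff[OF low_schwartz low_schwartz] by (intro mult_right_mono norm_triangle_ineq4 w)
    then have "ennreal (norm (mkernel (lp_symbol \<Psi> j) z) * w z) \<le> ennreal (norm (\<kappa> (Suc i) z) * w z + norm (\<kappa> i z) * w z)"
      by (intro ennreal_leI) (simp add: distrib_right)
    then show "ennreal (norm (mkernel (lp_symbol \<Psi> j) z) * w z) \<le> ennreal (norm (\<kappa> (Suc i) z) * w z) + ennreal (norm (\<kappa> i z) * w z)"
      using w by (simp add: ennreal_plus)
  qed
  also have "\<dots> = (\<integral>\<^sup>+z. ennreal (norm (\<kappa> (Suc i) z) * w z) \<partial>lborel) + (\<integral>\<^sup>+z. ennreal (norm (\<kappa> i z) * w z) \<partial>lborel)"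
    by (rule nn_integral_add) measurable
  also have "\<dots> \<le> ennreal (b (Suc i)) + ennreal (b i)" by (intro add_mono assms)
  also have "\<dots> = ennreal (b (Suc i) + b i)" using b by (simp add: ennreal_plus)
  also have "\<dots> \<le> ennreal (2 * c * b j)"
  proof (rule ennreal_leI)
    have "1 * b (Suc i) \<le> c * b (Suc i)" by (intro mult_right_mono b)
    then show "b (Suc i) + b i \<le> 2 * c * b j" using b(2)[of i] Suc by simp
  qed
  finally show ?thesis .
qed

lemma symbol_kernel_L1: "\<exists>C>0. \<forall>j. (\<integral>\<^sup>+z. ennreal (norm (mkernel (lp_symbol \<Psi> j) z)) \<partial>lborel) \<le> ennreal C"
proof -
  obtain C where C: "C > 0" "\<And>l. (\<integral>\<^sup>+z. ennreal (norm (\<kappa> l z)) \<partial>lborel) \<le> ennreal C" using kappa_L1 by blast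
  have "(\<integral>\<^sup>+z. ennreal (norm (mkernel (lp_symbol \<Psi> j) z) * 1) \<partial>lborel) \<le> ennreal (2 * 1 * C)" for j
    by (rule mkernel_symbol_bound) (use C in auto)
  then show ?thesis using C(1) by (intro exI[of _ "2 * C"]) auto
qed

lemma symbol_kernel_moment:
  assumes a: "0 \<le> a"
  shows "\<exists>C>0. \<forall>j. (\<integral>\<^sup>+z. ennreal (norm (mkernel (lp_symbol \<Psi> j) z) * norm z powr a) \<partial>lborel) \<le> ennreal (C * 2 powr (- real j * a))"
proof -
  obtain C where C: "C > 0" "\<And>l. (\<integral>\<^sup>+z. ennreal (norm (\<kappa> l z) * norm z powr a) \<partial>lborel) \<le> ennreal (C * 2 powr (- real l * a))"
    using kappa_moment[OF a] by blast
  have "(\<integral>\<^sup>+z. ennreal (norm (mkernel (lp_symbol \<Psi> j) z) * norm z powr a) \<partial>lborel) \<le> ennreal (2 * 2 powr a * (C * 2 powr (- real j * a)))" for j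
  proof (rule mkernel_symbol_bound)
    show "C * 2 powr (- real l * a) \<le> 2 powr a * (C * 2 powr (- real (Suc l) * a))" for l
      by (simp add: powr_add[symmetric] mult.left_commute algebra_simps)
  qed (use C a in \<open>auto intro: ge_one_powr_ge_zero\<close>)
  then show ?thesis using C(1) by (intro exI[of _ "2 * 2 powr a * C"]) (auto simp: mult.assoc)
qed

end

section \<open>Nikol'skij inequality, moduli of continuity and commutators\<close>

lemma norm_integral_le_nn_integral:
  fixes f :: "'b \<Rightarrow> complex"
  shows "ennreal (norm (\<integral>x. f x \<partial>M)) \<le> (\<integral>\<^sup>+x. ennreal (norm (f x)) \<partial>M)"
  by (cases "integrable M f") (auto simp: integral_norm_bound_ennreal not_integrable_integral_eq)

lemma powr_split_unit: "0 \<le> (t::real) \<Longrightarrow> t powr (1 - q) * t powr q = t"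
  by (cases "t = 0") (auto simp: powr_add[symmetric])

text \<open>
  A supremum bound from an integral bound of exponent at most one, that is \<open>1 \<le> \<alpha>\<close>. Write
  \<open>\<bar>g\<bar> = \<bar>g\<bar> powr (1 - q) * \<bar>g\<bar> powr q\<close> with \<open>q = 1 / \<alpha>\<close> in the reproducing formula: the first factor is bounded by the
  supremum \<open>S\<close>, the second one is integrable. This gives \<open>S \<le> K * S powr (1 - q) * A powr q\<close>, and dividing by
  the power of \<open>S\<close> gives the claim if \<open>S\<close> is finite. For a function that is only known to grow at most
  polynomially this is achieved by the weight \<open>(1 + \<delta> * norm x) ^ N\<close>, which the kernel tolerates.
\<close>

lemma weighted_sup_bound:
  fixes g :: "'a::euclidean_space \<Rightarrow> complex" and k :: "'a \<Rightarrow> real"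
  assumes L: "Lnorm_le lborel \<alpha> (\<lambda>x. norm (g x)) A" and \<alpha>: "1 \<le> \<alpha>"
    and rep: "\<And>x. ennreal (norm (g x)) \<le> (\<integral>\<^sup>+y. ennreal (k (y - x) * norm (g y)) \<partial>lborel)"
    and k: "\<And>z. 0 \<le> k z" "\<And>z. (1 + norm z) ^ N * k z \<le> K"
    and growth: "\<And>x. norm (g x) \<le> G * (1 + norm x) ^ N" and \<delta>: "0 < \<delta>" "\<delta> \<le> 1"
  shows "norm (g x) \<le> (1 + \<delta> * norm x) ^ N * (K powr \<alpha> * A)"
proof -
  define q where "q = 1 / \<alpha>"
  have q: "0 < q" "q \<le> 1" "q * \<alpha> = 1" using \<alpha> by (auto simp: q_def)
  have [measurable]: "(\<lambda>x. norm (g x)) \<in> borel_measurable borel" using Lnorm_leD(1)[OF L] by simp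
  have A: "0 \<le> A" by (rule Lnorm_leD(3)[OF L])
  have K: "0 \<le> K" using order_trans[OF _ k(2)[of 0]] k(1)[of 0] by simp
  define W where "W x = (1 + \<delta> * norm x) ^ N" for x :: 'a
  have b1: "1 \<le> 1 + \<delta> * norm x" for x :: 'a using \<delta> by simp
  have W: "W x > 0" "1 \<le> W x" for x
    unfolding W_def using b1[of x] by (auto intro!: zero_less_power one_le_power)
  have Wshift: "W y \<le> (1 + norm (y - x)) ^ N * W x" for x y
  proof -
    have "norm y \<le> norm x + norm (y - x)" by (metis norm_minus_commute norm_triangle_sub)
    then have "\<delta> * norm y \<le> \<delta> * norm x + \<delta> * norm (y - x)"
      using \<delta> by (metis distrib_left less_imp_le mult_left_mono)
    moreover have "\<delta> * norm (y - x) \<le> norm (y - x)" using \<delta> mult_right_mono[of \<delta> 1 "norm (y - x)"] by simp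
    moreover have "(1 + norm (y - x)) * (1 + \<delta> * norm x) = 1 + \<delta> * norm x + norm (y - x) + norm (y - x) * (\<delta> * norm x)"
      by (simp add: algebra_simps)
    moreover have "0 \<le> norm (y - x) * (\<delta> * norm x)" using \<delta> by simp
    ultimately have "1 + \<delta> * norm y \<le> (1 + norm (y - x)) * (1 + \<delta> * norm x)" by linarith
    then show ?thesis unfolding W_def power_mult_distrib[symmetric] using b1[of y] by (intro power_mono) auto
  qed
  define v where "v x = norm (g x) / W x" for x
  have v0: "0 \<le> v x" for x unfolding v_def using W by (simp add: less_imp_le)
  have vG: "v x \<le> G / \<delta> ^ N" for x
  proof -
    have "\<delta> * (1 + norm x) \<le> 1 + \<delta> * norm x" using \<delta> by (simp add: distrib_left)
    then have "(\<delta> * (1 + norm x)) ^ N \<le> W x" unfolding W_def using \<delta> by (intro power_mono) auto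
    then have m: "\<delta> ^ N * (1 + norm x) ^ N \<le> W x" by (simp add: power_mult_distrib)
    have "norm (g x) * \<delta> ^ N \<le> G * (1 + norm x) ^ N * \<delta> ^ N" using growth \<delta> by (intro mult_right_mono) auto
    also have "\<dots> = G * (\<delta> ^ N * (1 + norm x) ^ N)" by simp
    also have "\<dots> \<le> G * W x" using order_trans[OF norm_ge_zero growth[of 0]] by (intro mult_left_mono m) simp
    finally show ?thesis unfolding v_def using W \<delta> by (simp add: field_simps)
  qed
  define S where "S = (SUP x. v x)"
  have bdd: "bdd_above (range v)" using vG by (auto simp: bdd_above_def)
  have vS: "v x \<le> S" for x unfolding S_def by (intro cSUP_upper bdd) simp
  have S0: "0 \<le> S" using v0[of 0] vS[of 0] by simp
  have "v x \<le> K * S powr (1 - q) * A powr q" for x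
  proof -
    have "ennreal (norm (g x)) \<le> (\<integral>\<^sup>+y. ennreal (k (y - x) * norm (g y)) \<partial>lborel)" by (rule rep)
    also have "\<dots> \<le> (\<integral>\<^sup>+y. ennreal (W x * K * S powr (1 - q)) * ennreal (norm (g y) powr (1 / \<alpha>)) \<partial>lborel)"
    proof (rule nn_integral_mono)
      fix y
      have "k (y - x) * norm (g y) = k (y - x) * (W y * v y)" unfolding v_def using W(1)[of y] by simp
      also have "\<dots> \<le> k (y - x) * (((1 + norm (y - x)) ^ N * W x) * v y)"
        by (intro mult_left_mono mult_right_mono Wshift v0 k)
      also have "\<dots> = ((1 + norm (y - x)) ^ N * k (y - x)) * (W x * v y)" by simp
      also have "\<dots> \<le> K * (W x * v y)" using W(1)[of x] v0[of y] by (intro mult_right_mono k) (auto simp: less_imp_le)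
      also have "v y = v y powr (1 - q) * v y powr q" using powr_split_unit[OF v0] by simp
      also have "K * (W x * (v y powr (1 - q) * v y powr q)) \<le> K * (W x * (S powr (1 - q) * norm (g y) powr q))"
      proof (intro mult_left_mono mult_mono K)
        show "v y powr (1 - q) \<le> S powr (1 - q)" using q v0 vS by (intro powr_mono2) auto
        have "v y \<le> norm (g y)" unfolding v_def using W[of y] by (simp add: divide_le_eq mult_le_cancel_left1)
        then show "v y powr q \<le> norm (g y) powr q" using q v0 by (intro powr_mono2) auto
      qed (use W in \<open>auto simp: less_imp_le\<close>)
      finally have "k (y - x) * norm (g y) \<le> (W x * K * S powr (1 - q)) * norm (g y) powr q" by (simp add: mult_ac)
      then have "ennreal (k (y - x) * norm (g y)) \<le> ennreal ((W x * K * S powr (1 - q)) * norm (g y) powr q)" by (rule ennreal_leI)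
      also have "\<dots> = ennreal (W x * K * S powr (1 - q)) * ennreal (norm (g y) powr (1 / \<alpha>))"
        unfolding q_def using W(1)[of x] K by (intro ennreal_mult) auto
      finally show "ennreal (k (y - x) * norm (g y)) \<le> ennreal (W x * K * S powr (1 - q)) * ennreal (norm (g y) powr (1 / \<alpha>))" .
    qed
    also have "\<dots> = ennreal (W x * K * S powr (1 - q)) * (\<integral>\<^sup>+y. ennreal (norm (g y) powr (1 / \<alpha>)) \<partial>lborel)"
      by (rule nn_integral_cmult) measurable
    also have "\<dots> \<le> ennreal (W x * K * S powr (1 - q)) * ennreal (A powr (1 / \<alpha>))"
      by (intro mult_left_mono Lnorm_leD(4)[OF L]) simp
    also have "\<dots> = ennreal (W x * (K * S powr (1 - q) * A powr q))"
      using W(1)[of x] K by (simp add: q_def ennreal_mult[symmetric] mult.assoc)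
    finally have "norm (g x) \<le> W x * (K * S powr (1 - q) * A powr q)"
      using W(1)[of x] K by (subst (asm) ennreal_le_iff) (auto simp: less_imp_le)
    then show ?thesis unfolding v_def using W(1)[of x] by (simp add: divide_le_eq mult.commute)
  qed
  then have S_le: "S \<le> K * S powr (1 - q) * A powr q" unfolding S_def[symmetric] by (subst S_def) (intro cSUP_least; simp)
  have "S \<le> K powr \<alpha> * A"
  proof (cases "S = 0")
    case False
    then have S: "S > 0" using S0 by simp
    have "S powr (1 - q) * S powr q \<le> S powr (1 - q) * (K * A powr q)" using S_le powr_split_unit[OF S0, of q] by (simp add: mult_ac)
    then have "S powr q \<le> K * A powr q" using S by simp
    then have "(S powr q) powr \<alpha> \<le> (K * A powr q) powr \<alpha>" using \<alpha> by (intro powr_mono2) auto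
    then show ?thesis using S0 A q by (simp add: powr_mult powr_powr)
  qed (use A in simp)
  then have "v x \<le> K powr \<alpha> * A" using vS order_trans by blast
  then show ?thesis unfolding v_def W_def[symmetric] using W(1)[of x] by (simp add: divide_le_eq mult.commute)
qed

text \<open>
  Two applications of the weighted bound. With the growth exponent \<open>N\<close> and \<open>\<delta>\<close> tending to \<open>0\<close> it
  yields boundedness, with a constant that depends on \<open>N\<close>; knowing that \<open>g\<close> is bounded, the trivial weight
  yields the constant \<open>K powr \<alpha>\<close>, which scales correctly.
\<close>

lemma sup_bound_quasi:
  fixes g :: "'a::euclidean_space \<Rightarrow> complex" and k :: "'a \<Rightarrow> real"
  assumes L: "Lnorm_le lborel \<alpha> (\<lambda>x. norm (g x)) A" and \<alpha>: "1 \<le> \<alpha>"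
    and rep: "\<And>x. ennreal (norm (g x)) \<le> (\<integral>\<^sup>+y. ennreal (k (y - x) * norm (g y)) \<partial>lborel)"
    and k: "\<And>z. 0 \<le> k z" "\<And>N. \<exists>K. \<forall>z. (1 + norm z) ^ N * k z \<le> K" "\<And>z. k z \<le> K"
    and growth: "\<And>x. norm (g x) \<le> G * (1 + norm x) ^ N"
  shows "norm (g x) \<le> K powr \<alpha> * A"
proof -
  obtain K' where K': "\<And>z. (1 + norm z) ^ N * k z \<le> K'" using k(2) by blast
  define M where "M = K' powr \<alpha> * A"
  have 1: "norm (g x) \<le> (1 + \<delta> * norm x) ^ N * M" if "0 < \<delta>" "\<delta> \<le> 1" for \<delta> x
    unfolding M_def by (rule weighted_sup_bound[OF L \<alpha> rep k(1) K' growth that])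
  have gM: "norm (g x) \<le> M" for x
  proof (rule LIMSEQ_le_const)
    have "(\<lambda>n. (1 + inverse (real (Suc n)) * norm x) ^ N * M) \<longlonglongrightarrow> (1 + 0 * norm x) ^ N * M"
      by (intro tendsto_intros LIMSEQ_inverse_real_of_nat)
    then show "(\<lambda>n. (1 + inverse (real (Suc n)) * norm x) ^ N * M) \<longlonglongrightarrow> M" by simp
    show "\<exists>N'. \<forall>n\<ge>N'. norm (g x) \<le> (1 + inverse (real (Suc n)) * norm x) ^ N * M"
      by (intro exI[of _ 0] allI impI 1) (auto simp: inverse_le_1_iff)
  qed
  have "norm (g x) \<le> (1 + 1 * norm x) ^ 0 * (K powr \<alpha> * A)"
    by (rule weighted_sup_bound[OF L \<alpha> rep k(1), where G=M]) (use k gM in auto)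
  then show ?thesis by simp
qed

text \<open>
  The complementary range \<open>\<alpha> \<le> 1\<close>, where Jensen's inequality applies to the reproducing formula.
\<close>

lemma sup_bound_normed:
  fixes g :: "'a::euclidean_space \<Rightarrow> complex" and k :: "'a \<Rightarrow> real"
  assumes L: "Lnorm_le lborel \<alpha> (\<lambda>x. norm (g x)) A" and \<alpha>: "0 < \<alpha>" "\<alpha> \<le> 1"
    and rep: "\<And>x. ennreal (norm (g x)) \<le> (\<integral>\<^sup>+y. ennreal (k (y - x) * norm (g y)) \<partial>lborel)"
    and k: "k \<in> borel_measurable borel" "\<And>z. 0 \<le> k z" "\<And>z. k z \<le> K" "(\<integral>\<^sup>+z. ennreal (k z) \<partial>lborel) \<le> ennreal B"
    and B: "0 \<le> B"
  shows "norm (g x) \<le> B powr (1 - \<alpha>) * K powr \<alpha> * A"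
proof -
  let ?p = "1 / \<alpha>"
  note [measurable] = k(1)
  have [measurable]: "(\<lambda>x. norm (g x)) \<in> borel_measurable borel" using Lnorm_leD(1)[OF L] by simp
  have A: "0 \<le> A" by (rule Lnorm_leD(3)[OF L])
  have K: "0 \<le> K" using k(2,3)[of 0] by simp
  have "(\<integral>\<^sup>+y. ennreal (k (y - x)) \<partial>lborel) = (\<integral>\<^sup>+y. ennreal (k y) \<partial>lborel)"
    using nn_integral_affine[of 1 "\<lambda>y. ennreal (k (y - x))" x] by simp
  then have kB: "(\<integral>\<^sup>+y. ennreal (k (y - x)) \<partial>lborel) \<le> ennreal B" using k(4) by simp
  have "ennreal (norm (g x) powr ?p) \<le> ennreal (B powr (?p - 1)) * (\<integral>\<^sup>+y. ennreal (k (y - x) * norm (g y) powr ?p) \<partial>lborel)"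
    by (rule jensen_powr) (use k(2) \<alpha> B kB rep in auto)
  also have "\<dots> \<le> ennreal (B powr (?p - 1)) * (\<integral>\<^sup>+y. ennreal K * ennreal (norm (g y) powr ?p) \<partial>lborel)"
    using k by (intro mult_left_mono nn_integral_mono) (auto simp: ennreal_mult[symmetric] K intro!: ennreal_leI mult_right_mono)
  also have "(\<integral>\<^sup>+y. ennreal K * ennreal (norm (g y) powr ?p) \<partial>lborel) = ennreal K * (\<integral>\<^sup>+y. ennreal (norm (g y) powr ?p) \<partial>lborel)"
    by (rule nn_integral_cmult) measurable
  also have "ennreal (B powr (?p - 1)) * \<dots> \<le> ennreal (B powr (?p - 1)) * (ennreal K * ennreal (A powr ?p))"
    by (intro mult_left_mono Lnorm_leD(4)[OF L]) auto
  also have "\<dots> = ennreal (B powr (?p - 1) * K * A powr ?p)" using K by (simp add: ennreal_mult[symmetric] mult.assoc)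
  finally have "norm (g x) powr ?p \<le> B powr (?p - 1) * K * A powr ?p" using K by (subst (asm) ennreal_le_iff) auto
  then have "(norm (g x) powr ?p) powr \<alpha> \<le> (B powr (?p - 1) * K * A powr ?p) powr \<alpha>" using \<alpha> by (intro powr_mono2) auto
  moreover have "(?p - 1) * \<alpha> = 1 - \<alpha>" using \<alpha> by (simp add: field_simps)
  ultimately show ?thesis using A \<alpha> by (simp add: powr_mult powr_powr)
qed

lemma Lnorm_le_interpolate:
  assumes L: "Lnorm_le M \<alpha> f A" and b: "0 < \<beta>" "\<beta> \<le> \<alpha>" and sup: "\<And>x. f x \<le> S" and S: "0 \<le> S"
  shows "Lnorm_le M \<beta> f (S powr (1 - \<beta> / \<alpha>) * A powr (\<beta> / \<alpha>))"
  unfolding Lnorm_le_def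
proof (intro conjI allI Lnorm_leD[OF L])
  note [measurable] = Lnorm_leD(1)[OF L]
  let ?q = "\<beta> / \<alpha>"
  have A: "0 \<le> A" by (rule Lnorm_leD(3)[OF L])
  have pt: "f x powr (1 / \<beta>) \<le> S powr ((1 - ?q) / \<beta>) * f x powr (1 / \<alpha>)" for x
  proof -
    have f0: "0 \<le> f x" by (rule Lnorm_leD(2)[OF L])
    have "f x powr (1 / \<beta>) = (f x powr (1 - ?q) * f x powr ?q) powr (1 / \<beta>)" unfolding powr_split_unit[OF f0] ..
    also have "\<dots> \<le> (S powr (1 - ?q) * f x powr ?q) powr (1 / \<beta>)"
      using b f0 sup[of x] by (intro powr_mono2 mult_right_mono) auto
    also have "\<dots> = S powr ((1 - ?q) / \<beta>) * f x powr (1 / \<alpha>)" using b by (simp add: powr_mult powr_powr)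
    finally show ?thesis .
  qed
  have "(\<integral>\<^sup>+x. ennreal (f x powr (1 / \<beta>)) \<partial>M) \<le> (\<integral>\<^sup>+x. ennreal (S powr ((1 - ?q) / \<beta>)) * ennreal (f x powr (1 / \<alpha>)) \<partial>M)"
    by (intro nn_integral_mono order_trans[OF ennreal_leI[OF pt]]) (simp add: ennreal_mult)
  also have "\<dots> = ennreal (S powr ((1 - ?q) / \<beta>)) * (\<integral>\<^sup>+x. ennreal (f x powr (1 / \<alpha>)) \<partial>M)" by (rule nn_integral_cmult) measurable
  also have "\<dots> \<le> ennreal (S powr ((1 - ?q) / \<beta>)) * ennreal (A powr (1 / \<alpha>))" by (intro mult_left_mono Lnorm_leD(4)[OF L]) auto
  also have "\<dots> = ennreal ((S powr (1 - ?q) * A powr ?q) powr (1 / \<beta>))" using b by (simp add: ennreal_mult[symmetric] powr_mult powr_powr)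
  finally show "(\<integral>\<^sup>+x. ennreal (f x powr (1 / \<beta>)) \<partial>M) \<le> ennreal ((S powr (1 - ?q) * A powr ?q) powr (1 / \<beta>))" .
qed simp

context resolution
begin

lemma lp_block_reproducing_bound:
  assumes u: "u \<in> tempered_distributions"
  shows "ennreal (norm (lp_block \<Psi> k u x)) \<le> (\<integral>\<^sup>+y. ennreal (norm (\<kappa> (Suc k) (y - x)) * norm (lp_block \<Psi> k u y)) \<partial>lborel)"
  using norm_integral_le_nn_integral[of lborel "\<lambda>y. lp_block \<Psi> k u y * \<kappa> (Suc k) (y - x)"]
  unfolding smoothing_def[symmetric] lp_block_reproducing(2)[OF u] by (simp add: norm_mult mult.commute)

text \<open>
  The exponent \<open>n \<alpha>\<close> comes from the size \<open>2 powr (k * n)\<close> of the reproducing kernel, taken to the power \<open>\<alpha>\<close>.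
\<close>

lemma lp_block_sup:
  assumes \<alpha>: "0 < \<alpha>"
  shows "\<exists>C>0. \<forall>u k A x. u \<in> tempered_distributions \<longrightarrow> Lnorm_le lborel \<alpha> (\<lambda>x. norm (lp_block \<Psi> k u x)) A \<longrightarrow>
     norm (lp_block \<Psi> k u x) \<le> C * 2 powr (real k * real DIM('a) * \<alpha>) * A"
proof -
  obtain C0 where C0: "C0 > 0" "\<And>l z. norm (\<kappa> l z) \<le> C0 * 2 ^ (l * DIM('a))" using kappa_bounded by blast
  obtain B where B: "B > 0" "\<And>l. (\<integral>\<^sup>+z. ennreal (norm (\<kappa> l z)) \<partial>lborel) \<le> ennreal B" using kappa_L1 by blast
  define C where "C = max 1 (B powr (1 - \<alpha>)) * (C0 powr \<alpha> * 2 powr (real DIM('a) * \<alpha>))"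
  have main: "norm (lp_block \<Psi> k u x) \<le> C * 2 powr (real k * real DIM('a) * \<alpha>) * A"
    if u: "u \<in> tempered_distributions" and L: "Lnorm_le lborel \<alpha> (\<lambda>x. norm (lp_block \<Psi> k u x)) A" for u k A x
  proof -
    let ?K = "C0 * 2 ^ (Suc k * DIM('a))"
    have A: "0 \<le> A" by (rule Lnorm_leD(3)[OF L])
    have Kp: "?K powr \<alpha> = C0 powr \<alpha> * 2 powr (real DIM('a) * \<alpha>) * 2 powr (real k * real DIM('a) * \<alpha>)"
    proof -
      have "(2 ^ (Suc k * DIM('a)) :: real) = 2 powr (real DIM('a) + real k * real DIM('a))"
        by (simp add: powr_realpow[symmetric] powr_add)
      then show ?thesis by (simp add: powr_mult powr_powr powr_add distrib_right)
    qed
    have "norm (lp_block \<Psi> k u x) \<le> max 1 (B powr (1 - \<alpha>)) * ?K powr \<alpha> * A"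
    proof (cases "1 \<le> \<alpha>")
      case True
      obtain N G where "\<forall>x. norm (multiplier_fun (lp_symbol \<Psi> k) u x) \<le> G * (1 + norm x) ^ N"
        by (rule multiplier_fun_growth[OF u lp_symbol_schwartz])
      then have G: "norm (lp_block \<Psi> k u x) \<le> G * (1 + norm x) ^ N" for x by (simp add: lp_block_eq[OF u])
      have "norm (lp_block \<Psi> k u x) \<le> ?K powr \<alpha> * A"
      proof (rule sup_bound_quasi[OF L True lp_block_reproducing_bound[OF u] _ _ C0(2) G])
        show "\<exists>K. \<forall>z. (1 + norm z) ^ N * norm (\<kappa> (Suc k) z) \<le> K" for N
          using schwartz_rapid[OF kappa_schwartz] unfolding rapid_def by blast
      qed simp
      also have "\<dots> \<le> max 1 (B powr (1 - \<alpha>)) * (?K powr \<alpha> * A)"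
        using A mult_right_mono[of 1 "max 1 (B powr (1 - \<alpha>))" "?K powr \<alpha> * A"] by simp
      finally show ?thesis by (simp add: mult.assoc)
    next
      case False
      have "norm (lp_block \<Psi> k u x) \<le> B powr (1 - \<alpha>) * ?K powr \<alpha> * A"
        by (rule sup_bound_normed[OF L \<alpha> _ lp_block_reproducing_bound[OF u] _ _ C0(2) B(2)]) (use False B(1) in auto)
      also have "\<dots> \<le> max 1 (B powr (1 - \<alpha>)) * ?K powr \<alpha> * A"
        using A by (intro mult_right_mono) auto
      finally show ?thesis .
    qed
    then show ?thesis unfolding Kp C_def by (simp add: mult_ac)
  qed
  have "C > 0" unfolding C_def using C0(1) by (intro mult_pos_pos) auto
  then show ?thesis using main by blast
qed

text \<open>Nikol'skij's inequality, by interpolation between the given norm and the supremum.\<close>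

lemma lp_block_nikolskii:
  assumes \<alpha>: "0 < \<alpha>"
  shows "\<exists>C>0. \<forall>u k A \<beta>. u \<in> tempered_distributions \<longrightarrow> 0 < \<beta> \<longrightarrow> \<beta> \<le> \<alpha> \<longrightarrow>
     Lnorm_le lborel \<alpha> (\<lambda>x. norm (lp_block \<Psi> k u x)) A \<longrightarrow>
     Lnorm_le lborel \<beta> (\<lambda>x. norm (lp_block \<Psi> k u x)) (C * 2 powr (real k * real DIM('a) * (\<alpha> - \<beta>)) * A)"
proof -
  obtain C where C: "C > 0" "\<And>u k A x. u \<in> tempered_distributions \<Longrightarrow> Lnorm_le lborel \<alpha> (\<lambda>x. norm (lp_block \<Psi> k u x)) A \<Longrightarrow>
     norm (lp_block \<Psi> k u x) \<le> C * 2 powr (real k * real DIM('a) * \<alpha>) * A"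
    using lp_block_sup[OF \<alpha>] by blast
  have "Lnorm_le lborel \<beta> (\<lambda>x. norm (lp_block \<Psi> k u x)) (max 1 C * 2 powr (real k * real DIM('a) * (\<alpha> - \<beta>)) * A)"
    if u: "u \<in> tempered_distributions" and b: "0 < \<beta>" "\<beta> \<le> \<alpha>" and L: "Lnorm_le lborel \<alpha> (\<lambda>x. norm (lp_block \<Psi> k u x)) A" for u k A \<beta>
  proof -
    let ?q = "\<beta> / \<alpha>" and ?S = "C * 2 powr (real k * real DIM('a) * \<alpha>) * A"
    have A: "0 \<le> A" by (rule Lnorm_leD(3)[OF L])
    have q: "0 \<le> 1 - ?q" "1 - ?q \<le> 1" using b \<alpha> by auto
    have "Lnorm_le lborel \<beta> (\<lambda>x. norm (lp_block \<Psi> k u x)) (?S powr (1 - ?q) * A powr ?q)"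
      by (rule Lnorm_le_interpolate[OF L b C(2)[OF u L]]) (use C(1) A in auto)
    moreover have "?S powr (1 - ?q) * A powr ?q \<le> max 1 C * 2 powr (real k * real DIM('a) * (\<alpha> - \<beta>)) * A"
    proof -
      have e: "real k * real DIM('a) * \<alpha> * (1 - ?q) = real k * real DIM('a) * (\<alpha> - \<beta>)" using \<alpha> by (simp add: field_simps)
      have "?S powr (1 - ?q) * A powr ?q = C powr (1 - ?q) * 2 powr (real k * real DIM('a) * (\<alpha> - \<beta>)) * (A powr (1 - ?q) * A powr ?q)"
        by (simp add: powr_mult powr_powr e)
      also have "\<dots> = C powr (1 - ?q) * 2 powr (real k * real DIM('a) * (\<alpha> - \<beta>)) * A" unfolding powr_split_unit[OF A] ..
      also have "C powr (1 - ?q) \<le> max 1 C"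
      proof -
        have "C powr (1 - ?q) \<le> max 1 C powr (1 - ?q)" using C(1) q by (intro powr_mono2) auto
        also have "\<dots> \<le> max 1 C powr 1" using q by (intro powr_mono) auto
        finally show ?thesis by simp
      qed
      then have "C powr (1 - ?q) * 2 powr (real k * real DIM('a) * (\<alpha> - \<beta>)) * A \<le> max 1 C * 2 powr (real k * real DIM('a) * (\<alpha> - \<beta>)) * A"
        using A by (intro mult_right_mono) auto
      finally show ?thesis .
    qed
    ultimately show ?thesis using b(1) by (rule Lnorm_le_weaken)
  qed
  then show ?thesis by (intro exI[of _ "max 1 C"]) auto
qed

text \<open>
  The difference of a block and its translate is an average of the block against the difference of two kernels.
\<close>

lemma lp_block_modulus:
  assumes e: "0 < \<epsilon>" "\<epsilon> \<le> 1"
  shows "\<exists>C>0. \<forall>u k A \<beta> z. u \<in> tempered_distributions \<longrightarrow> 0 < \<beta> \<longrightarrow> \<beta> \<le> 1 \<longrightarrow>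
     Lnorm_le lborel \<beta> (\<lambda>x. norm (lp_block \<Psi> k u x)) A \<longrightarrow>
     Lnorm_le lborel \<beta> (\<lambda>x. norm (lp_block \<Psi> k u (x + z) - lp_block \<Psi> k u x)) (C * (2 ^ k * norm z) powr \<epsilon> * A)"
proof -
  obtain C where C: "C > 0" "\<And>l z. (\<integral>\<^sup>+y. ennreal (norm (\<kappa> l (y - z) - \<kappa> l y)) \<partial>lborel) \<le> ennreal (C * (2 ^ l * norm z) powr \<epsilon>)"
    using kappa_modulus[OF e] by blast
  have "Lnorm_le lborel \<beta> (\<lambda>x. norm (lp_block \<Psi> k u (x + z) - lp_block \<Psi> k u x)) ((C * 2 powr \<epsilon>) * (2 ^ k * norm z) powr \<epsilon> * A)"
    if u: "u \<in> tempered_distributions" and b: "0 < \<beta>" "\<beta> \<le> 1" and L: "Lnorm_le lborel \<beta> (\<lambda>x. norm (lp_block \<Psi> k u x)) A" for u k A \<beta> z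
  proof -
    let ?g = "lp_block \<Psi> k u" and ?\<kappa> = "\<kappa> (Suc k)"
    let ?B = "C * (2 ^ Suc k * norm z) powr \<epsilon>"
    note [measurable] = lp_block_measurable[OF u, of k]
    have A: "0 \<le> A" by (rule Lnorm_leD(3)[OF L])
    have shift: "?g (x + w) = (\<integral>y. ?g (x + y) * ?\<kappa> (y - w) \<partial>lborel)" "integrable lborel (\<lambda>y. ?g (x + y) * ?\<kappa> (y - w))" for x w
    proof -
      have "?g (x + w) = (\<integral>y. ?g y * ?\<kappa> (y - (x + w)) \<partial>lborel)"
        using lp_block_reproducing(2)[OF u, of k "x + w"] by (simp add: smoothing_def)
      also have "\<dots> = (\<integral>y. ?g (x + y) * ?\<kappa> (y - w) \<partial>lborel)"
        using integral_affine[of 1 "\<lambda>y. ?g y * ?\<kappa> (y - (x + w))" x] by simp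
      finally show "?g (x + w) = (\<integral>y. ?g (x + y) * ?\<kappa> (y - w) \<partial>lborel)" .
      have "integrable (distr lborel borel (\<lambda>y. x + y)) (\<lambda>y. ?g y * ?\<kappa> (y - (x + w)))"
        using lp_block_reproducing(1)[OF u, of k "x + w"] by (simp add: lborel_distr_plus)
      then show "integrable lborel (\<lambda>y. ?g (x + y) * ?\<kappa> (y - w))" by (subst (asm) integrable_distr_eq) auto
    qed
    have "Lnorm_le lborel \<beta> (\<lambda>x. norm (?g (x + z) - ?g x)) (?B * A)"
    proof (rule Lnorm_le_integral[where K="\<lambda>y. norm (?\<kappa> (y - z) - ?\<kappa> y)" and h="\<lambda>x y. norm (?g (x + y))" and a="\<lambda>_. A"])
      show "Lnorm_le lborel \<beta> (\<lambda>x. norm (?g (x + y))) A" for y by (rule Lnorm_le_translate[OF L])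
      show "(\<integral>\<^sup>+y. ennreal (norm (?\<kappa> (y - z) - ?\<kappa> y)) \<partial>lborel) \<le> ennreal ?B" by (rule C(2))
      show "ennreal (norm (?g (x + z) - ?g x)) \<le> (\<integral>\<^sup>+y. ennreal (norm (?\<kappa> (y - z) - ?\<kappa> y) * norm (?g (x + y))) \<partial>lborel)" for x
      proof -
        have "?g (x + z) - ?g x = (\<integral>y. ?g (x + y) * (?\<kappa> (y - z) - ?\<kappa> y) \<partial>lborel)"
          using shift[of x z] shift[of x 0] by (simp add: right_diff_distrib)
        then show ?thesis
          using norm_integral_le_nn_integral[of lborel "\<lambda>y. ?g (x + y) * (?\<kappa> (y - z) - ?\<kappa> y)"] by (simp add: norm_mult mult.commute)
      qed
      have "(\<integral>\<^sup>+y. ennreal (norm (?\<kappa> (y - z) - ?\<kappa> y) * A powr (1 / \<beta>)) \<partial>lborel)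
         = (\<integral>\<^sup>+y. ennreal (norm (?\<kappa> (y - z) - ?\<kappa> y)) \<partial>lborel) * ennreal (A powr (1 / \<beta>))"
        by (subst nn_integral_multc[symmetric]) (auto simp: ennreal_mult)
      also have "\<dots> \<le> ennreal ?B * ennreal (A powr (1 / \<beta>))" by (intro mult_right_mono C) auto
      finally show "(\<integral>\<^sup>+y. ennreal (norm (?\<kappa> (y - z) - ?\<kappa> y) * A powr (1 / \<beta>)) \<partial>lborel) \<le> ennreal (?B * A powr (1 / \<beta>))"
        using C(1) by (simp add: ennreal_mult)
    qed (use b A C(1) in auto)
    moreover have "(2 ^ Suc k * norm z) powr \<epsilon> = 2 powr \<epsilon> * (2 ^ k * norm z) powr \<epsilon>" by (simp add: powr_mult)
    ultimately show ?thesis by (simp add: mult_ac)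
  qed
  then show ?thesis using C(1) by (intro exI[of _ "C * 2 powr \<epsilon>"]) auto
qed

lemma smoothing_shift:
  assumes "continuous_on UNIV g" "\<tau> \<in> schwartz_space"
  shows "smoothing \<tau> g x = (\<integral>z. g (x + z) * mkernel \<tau> z \<partial>lborel)"
proof -
  have [measurable]: "g \<in> borel_measurable borel" "mkernel \<tau> \<in> borel_measurable borel"
    using assms by (auto intro: borel_measurable_continuous_onI schwartz_measurable mkernel_schwartz)
  show ?thesis unfolding smoothing_def using integral_affine[of 1 "\<lambda>y. g y * mkernel \<tau> (y - x)" x] by simp
qed

lemma integrable_smoothing:
  assumes "continuous_on UNIV g" "\<tau> \<in> schwartz_space" "\<And>x. norm (g x) \<le> G"
  shows "integrable lborel (\<lambda>z. g (x + z) * mkernel \<tau> z)"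
proof -
  have [measurable]: "g \<in> borel_measurable borel" "mkernel \<tau> \<in> borel_measurable borel"
    using assms by (auto intro: borel_measurable_continuous_onI schwartz_measurable mkernel_schwartz)
  show ?thesis
  proof (rule Bochner_Integration.integrable_bound[OF integrable_mult_right[OF integrable_norm[OF schwartz_integrable[OF mkernel_schwartz[OF assms(2)]]], of G]])
    show "AE z in lborel. norm (g (x + z) * mkernel \<tau> z) \<le> norm (G * norm (mkernel \<tau> z))"
      by (rule AE_I2) (auto simp: norm_mult abs_mult intro!: mult_right_mono order_trans[OF assms(3)])
  qed measurable
qed

lemma smoothing_measurable:
  assumes "continuous_on UNIV g" "\<tau> \<in> schwartz_space"
  shows "smoothing \<tau> g \<in> borel_measurable borel"
proof -
  have [measurable]: "g \<in> borel_measurable borel" "mkernel \<tau> \<in> borel_measurable borel"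
    using assms by (auto intro: borel_measurable_continuous_onI schwartz_measurable mkernel_schwartz)
  show ?thesis unfolding smoothing_def[abs_def] by measurable
qed

lemma smoothing_Lnorm:
  "\<exists>C>0. \<forall>j g A \<beta>. 0 < \<beta> \<longrightarrow> \<beta> \<le> 1 \<longrightarrow> continuous_on UNIV g \<longrightarrow> Lnorm_le lborel \<beta> (\<lambda>x. norm (g x)) A \<longrightarrow>
     Lnorm_le lborel \<beta> (\<lambda>x. norm (smoothing (lp_symbol \<Psi> j) g x)) (C * A)"
proof -
  obtain C where C: "C > 0" "\<And>j. (\<integral>\<^sup>+z. ennreal (norm (mkernel (lp_symbol \<Psi> j) z)) \<partial>lborel) \<le> ennreal C" using symbol_kernel_L1 by blast
  have "Lnorm_le lborel \<beta> (\<lambda>x. norm (smoothing (lp_symbol \<Psi> j) g x)) (C * A)"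
    if b: "0 < \<beta>" "\<beta> \<le> 1" and g: "continuous_on UNIV g" and L: "Lnorm_le lborel \<beta> (\<lambda>x. norm (g x)) A" for j g A \<beta>
  proof -
    let ?k = "mkernel (lp_symbol \<Psi> j)"
    have [measurable]: "g \<in> borel_measurable borel" "?k \<in> borel_measurable borel" "smoothing (lp_symbol \<Psi> j) g \<in> borel_measurable borel"
      using g by (auto intro: borel_measurable_continuous_onI schwartz_measurable mkernel_schwartz lp_symbol_schwartz smoothing_measurable)
    show ?thesis
    proof (rule Lnorm_le_integral[where K="\<lambda>z. norm (?k z)" and h="\<lambda>x z. norm (g (x + z))" and a="\<lambda>_. A"])
      show "Lnorm_le lborel \<beta> (\<lambda>x. norm (g (x + y))) A" for y by (rule Lnorm_le_translate[OF L])
      show "ennreal (norm (smoothing (lp_symbol \<Psi> j) g x)) \<le> (\<integral>\<^sup>+z. ennreal (norm (?k z) * norm (g (x + z))) \<partial>lborel)" for x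
        using norm_integral_le_nn_integral[of lborel "\<lambda>z. g (x + z) * ?k z"]
        unfolding smoothing_shift[OF g lp_symbol_schwartz] by (simp add: norm_mult mult.commute)
      have "(\<integral>\<^sup>+y. ennreal (norm (?k y) * A powr (1 / \<beta>)) \<partial>lborel) = (\<integral>\<^sup>+y. ennreal (norm (?k y)) \<partial>lborel) * ennreal (A powr (1 / \<beta>))"
        by (subst nn_integral_multc[symmetric]) (auto simp: ennreal_mult)
      also have "\<dots> \<le> ennreal C * ennreal (A powr (1 / \<beta>))" by (intro mult_right_mono C) auto
      finally show "(\<integral>\<^sup>+y. ennreal (norm (?k y) * A powr (1 / \<beta>)) \<partial>lborel) \<le> ennreal (C * A powr (1 / \<beta>))"
        using C(1) by (simp add: ennreal_mult)
    qed (use b C Lnorm_leD(3)[OF L] in auto)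
  qed
  then show ?thesis using C(1) by blast
qed

text \<open>
  At the point \<open>x\<close> the commutator is the integral of \<open>H (x + z) * (R (x + z) - R x)\<close> against the
  kernel, which is concentrated at \<open>norm z\<close> of order \<open>2 powr (- j)\<close>; there the modulus
  of continuity of \<open>R\<close> is of order \<open>2 powr (- j * \<epsilon>)\<close>. Boundedness of \<open>H\<close> and \<open>R\<close> serves to split the integral; the constant is independent of their bounds.
\<close>

lemma commutator_Lnorm:
  assumes e: "0 < \<epsilon>" and b: "0 < \<beta>" "0 < \<gamma>" "\<beta> + \<gamma> \<le> 1"
  shows "\<exists>C>0. \<forall>j H R A A' B B'. continuous_on UNIV H \<longrightarrow> continuous_on UNIV R \<longrightarrow> (\<forall>x. norm (H x) \<le> B) \<longrightarrow> (\<forall>x. norm (R x) \<le> B') \<longrightarrow>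
     0 \<le> A' \<longrightarrow> Lnorm_le lborel \<beta> (\<lambda>x. norm (H x)) A \<longrightarrow>
     (\<forall>z. Lnorm_le lborel \<gamma> (\<lambda>x. norm (R (x + z) - R x)) (A' * norm z powr \<epsilon>)) \<longrightarrow>
     Lnorm_le lborel (\<beta> + \<gamma>) (\<lambda>x. norm (smoothing (lp_symbol \<Psi> j) (\<lambda>x. H x * R x) x - R x * smoothing (lp_symbol \<Psi> j) H x))
       (C * 2 powr (- real j * \<epsilon>) * A * A')"
proof -
  let ?p = "1 / (\<beta> + \<gamma>)"
  obtain C1 where C1: "C1 > 0" "\<And>j. (\<integral>\<^sup>+z. ennreal (norm (mkernel (lp_symbol \<Psi> j) z)) \<partial>lborel) \<le> ennreal C1" using symbol_kernel_L1 by blast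
  have "0 \<le> \<epsilon> * ?p" using e b by simp
  then obtain C2 where C2: "C2 > 0" "\<And>j. (\<integral>\<^sup>+z. ennreal (norm (mkernel (lp_symbol \<Psi> j) z) * norm z powr (\<epsilon> * ?p)) \<partial>lborel) \<le> ennreal (C2 * 2 powr (- real j * (\<epsilon> * ?p)))"
    using symbol_kernel_moment by blast
  define C where "C = max C1 C2"
  have C: "C > 0" "C1 \<le> C" "C2 \<le> C" using C1 C2 by (auto simp: C_def)
  have "Lnorm_le lborel (\<beta> + \<gamma>) (\<lambda>x. norm (smoothing (lp_symbol \<Psi> j) (\<lambda>x. H x * R x) x - R x * smoothing (lp_symbol \<Psi> j) H x))
       (C * (2 powr (- real j * \<epsilon>) * A * A'))"
    if H: "continuous_on UNIV H" "\<And>x. norm (H x) \<le> B" and R: "continuous_on UNIV R" "\<And>x. norm (R x) \<le> B'" and A': "0 \<le> A'"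
      and LH: "Lnorm_le lborel \<beta> (\<lambda>x. norm (H x)) A" and LR: "\<And>z. Lnorm_le lborel \<gamma> (\<lambda>x. norm (R (x + z) - R x)) (A' * norm z powr \<epsilon>)"
    for j H R A A' B B'
  proof -
    let ?k = "mkernel (lp_symbol \<Psi> j)"
    let ?D = "2 powr (- real j * \<epsilon>) * A * A'"
    have A: "0 \<le> A" by (rule Lnorm_leD(3)[OF LH])
    have HR: "continuous_on UNIV (\<lambda>x. H x * R x)" by (intro continuous_on_mult H R)
    have B: "0 \<le> B" using order_trans[OF norm_ge_zero H(2)] .
    have HRb: "norm (H x * R x) \<le> B * B'" for x unfolding norm_mult by (intro mult_mono H R B) auto
    have [measurable]: "H \<in> borel_measurable borel" "R \<in> borel_measurable borel" "?k \<in> borel_measurable borel"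
      "smoothing (lp_symbol \<Psi> j) H \<in> borel_measurable borel" "smoothing (lp_symbol \<Psi> j) (\<lambda>x. H x * R x) \<in> borel_measurable borel"
      using H R HR by (auto intro: borel_measurable_continuous_onI schwartz_measurable mkernel_schwartz lp_symbol_schwartz smoothing_measurable)
    show ?thesis
    proof (rule Lnorm_le_integral[where K="\<lambda>z. norm (?k z)" and h="\<lambda>x z. norm (H (x + z)) * norm (R (x + z) - R x)" and a="\<lambda>z. A * (A' * norm z powr \<epsilon>)"])
      show "Lnorm_le lborel (\<beta> + \<gamma>) (\<lambda>x. norm (H (x + z)) * norm (R (x + z) - R x)) (A * (A' * norm z powr \<epsilon>))" for z
        by (intro Lnorm_le_mult Lnorm_le_translate[OF LH] LR b)
      show "(\<integral>\<^sup>+z. ennreal (norm (?k z)) \<partial>lborel) \<le> ennreal C" using C1(2)[of j] C(2) by (meson ennreal_leI order_trans)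
      show "ennreal (norm (smoothing (lp_symbol \<Psi> j) (\<lambda>x. H x * R x) x - R x * smoothing (lp_symbol \<Psi> j) H x))
        \<le> (\<integral>\<^sup>+z. ennreal (norm (?k z) * (norm (H (x + z)) * norm (R (x + z) - R x))) \<partial>lborel)" for x
      proof -
        have "smoothing (lp_symbol \<Psi> j) (\<lambda>x. H x * R x) x - R x * smoothing (lp_symbol \<Psi> j) H x
           = (\<integral>z. H (x + z) * R (x + z) * ?k z - R x * (H (x + z) * ?k z) \<partial>lborel)"
          unfolding smoothing_shift[OF HR lp_symbol_schwartz] smoothing_shift[OF H(1) lp_symbol_schwartz]
          using integrable_smoothing[OF HR lp_symbol_schwartz HRb, of x] integrable_smoothing[OF H(1) lp_symbol_schwartz H(2), of x]
          by simp
        also have "\<dots> = (\<integral>z. ?k z * (H (x + z) * (R (x + z) - R x)) \<partial>lborel)" by (simp add: algebra_simps)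
        finally show ?thesis
          using norm_integral_le_nn_integral[of lborel "\<lambda>z. ?k z * (H (x + z) * (R (x + z) - R x))"] by (simp add: norm_mult)
      qed
      show "(\<integral>\<^sup>+z. ennreal (norm (?k z) * (A * (A' * norm z powr \<epsilon>)) powr ?p) \<partial>lborel) \<le> ennreal (C * ?D powr ?p)"
      proof -
        have "(\<integral>\<^sup>+z. ennreal (norm (?k z) * (A * (A' * norm z powr \<epsilon>)) powr ?p) \<partial>lborel)
          = (\<integral>\<^sup>+z. ennreal ((A * A') powr ?p) * ennreal (norm (?k z) * norm z powr (\<epsilon> * ?p)) \<partial>lborel)"
          by (intro nn_integral_cong) (simp add: ennreal_mult[symmetric] powr_mult powr_powr mult_ac)
        also have "\<dots> = ennreal ((A * A') powr ?p) * (\<integral>\<^sup>+z. ennreal (norm (?k z) * norm z powr (\<epsilon> * ?p)) \<partial>lborel)"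
          by (rule nn_integral_cmult) measurable
        also have "\<dots> \<le> ennreal ((A * A') powr ?p) * ennreal (C2 * 2 powr (- real j * (\<epsilon> * ?p)))" by (intro mult_left_mono C2) auto
        also have "\<dots> = ennreal (C2 * ((A * A') powr ?p * 2 powr (- real j * (\<epsilon> * ?p))))"
          using C2(1) by (simp add: ennreal_mult[symmetric] mult_ac)
        also have "\<dots> \<le> ennreal (C * ((A * A') powr ?p * 2 powr (- real j * (\<epsilon> * ?p))))"
          using C by (intro ennreal_leI mult_right_mono) auto
        also have "(A * A') powr ?p * 2 powr (- real j * (\<epsilon> * ?p)) = ?D powr ?p"
          by (simp add: powr_mult powr_powr mult_ac)
        finally show ?thesis .
      qed
    qed (use b A A' C in auto)
  qed
  note main = this
  show ?thesis
  proof (intro exI[of _ C] conjI allI impI C(1))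
    fix j A A' B B' and H R :: "'a \<Rightarrow> complex"
    assume H: "continuous_on UNIV H" and R: "continuous_on UNIV R" and B: "\<forall>x. norm (H x) \<le> B" and B': "\<forall>x. norm (R x) \<le> B'"
      and A': "0 \<le> A'" and LH: "Lnorm_le lborel \<beta> (\<lambda>x. norm (H x)) A"
      and LR: "\<forall>z. Lnorm_le lborel \<gamma> (\<lambda>x. norm (R (x + z) - R x)) (A' * norm z powr \<epsilon>)"
    show "Lnorm_le lborel (\<beta> + \<gamma>) (\<lambda>x. norm (smoothing (lp_symbol \<Psi> j) (\<lambda>x. H x * R x) x - R x * smoothing (lp_symbol \<Psi> j) H x))
       (C * 2 powr (- real j * \<epsilon>) * A * A')"
      using main[OF H B[rule_format] R B'[rule_format] A' LH LR[rule_format], of j] by (simp only: mult.assoc)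
  qed
qed

end

section \<open>Products of partial sums\<close>

text \<open>The factors are exchanged one after another, from the first to the last.\<close>

lemma prod_diff_telescope:
  fixes a b :: "nat \<Rightarrow> 'b::comm_ring_1"
  assumes "p \<le> Suc m"
  shows "(\<Prod>i=p..m. a i) - (\<Prod>i=p..m. b i) = (\<Sum>r=p..m. \<Prod>i=p..m. if i < r then a i else if i = r then a i - b i else b i)"
  using assms
proof (induction m)
  case 0
  then show ?case by (cases "p = 0") auto
next
  case (Suc m)
  show ?case
  proof (cases "p = Suc (Suc m)")
    case False
    then have p: "p \<le> Suc m" using Suc by simp
    let ?c = "\<lambda>r i. if i < r then a i else if i = r then a i - b i else b i"
    have 1: "(\<Prod>i=p..Suc m. ?c r i) = (\<Prod>i=p..m. ?c r i) * b (Suc m)" if "r \<in> {p..m}" for r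
      using p that by (simp add: prod.cl_ivl_Suc)
    have "(\<Prod>i=p..m. ?c (Suc m) i) = (\<Prod>i=p..m. a i)" by (intro prod.cong) auto
    then have 2: "(\<Prod>i=p..Suc m. ?c (Suc m) i) = (\<Prod>i=p..m. a i) * (a (Suc m) - b (Suc m))"
      using p by (simp add: prod.cl_ivl_Suc)
    have "(\<Sum>r=p..Suc m. \<Prod>i=p..Suc m. ?c r i) = (\<Sum>r=p..m. \<Prod>i=p..Suc m. ?c r i) + (\<Prod>i=p..Suc m. ?c (Suc m) i)"
      using p by (simp add: sum.cl_ivl_Suc)
    also have "\<dots> = (\<Sum>r=p..m. (\<Prod>i=p..m. ?c r i) * b (Suc m)) + (\<Prod>i=p..m. a i) * (a (Suc m) - b (Suc m))"
      unfolding 2 using 1 by simp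
    also have "(\<Sum>r=p..m. (\<Prod>i=p..m. ?c r i) * b (Suc m)) = ((\<Prod>i=p..m. a i) - (\<Prod>i=p..m. b i)) * b (Suc m)"
      unfolding Suc.IH[OF p] by (simp add: sum_distrib_right)
    finally show ?thesis using p by (simp add: algebra_simps prod.cl_ivl_Suc)
  qed simp
qed

text \<open>
  The exponents \<open>\<gamma> r i\<close> may depend on the summand \<open>r\<close> as long as their sum is the same. This freedom is
  what the treatment of the remainder depends on.
\<close>

lemma Lnorm_le_prod_terms:
  fixes c :: "nat \<Rightarrow> nat \<Rightarrow> 'b \<Rightarrow> complex"
  assumes S: "finite S" and I: "finite I" "I \<noteq> {}" and c: "\<And>r i. r \<in> S \<Longrightarrow> i \<in> I \<Longrightarrow> Lnorm_le M (\<gamma> r i) (\<lambda>x. norm (c r i x)) (B r i)"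
    and \<gamma>: "\<And>r i. r \<in> S \<Longrightarrow> i \<in> I \<Longrightarrow> 0 < \<gamma> r i" "\<And>r. r \<in> S \<Longrightarrow> (\<Sum>i\<in>I. \<gamma> r i) = g" and g: "0 < g"
    and D: "\<And>r. r \<in> S \<Longrightarrow> (\<Prod>i\<in>I. B r i) \<le> D" "0 \<le> D"
    and F: "F \<in> borel_measurable M" "\<And>x. F x = (\<Sum>r\<in>S. \<Prod>i\<in>I. c r i x)"
  shows "Lnorm_le M g (\<lambda>x. norm (F x)) (real (card S) powr (1 + g) * D)"
proof -
  have L: "Lnorm_le M g (\<lambda>x. \<Sum>r\<in>S. \<Prod>i\<in>I. norm (c r i x)) (real (card S) powr (1 + g) * D)"
  proof (rule Lnorm_le_sum[OF S _ g D(2)])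
    fix r assume r: "r \<in> S"
    have "Lnorm_le M (\<Sum>i\<in>I. \<gamma> r i) (\<lambda>x. \<Prod>i\<in>I. norm (c r i x)) (\<Prod>i\<in>I. B r i)"
      by (rule Lnorm_le_prod[OF I]) (use r c \<gamma> in auto)
    then show "Lnorm_le M g (\<lambda>x. \<Prod>i\<in>I. norm (c r i x)) D"
      unfolding \<gamma>(2)[OF r] by (rule Lnorm_le_weaken[OF _ D(1)[OF r] g])
  qed
  have le: "norm (F x) \<le> (\<Sum>r\<in>S. \<Prod>i\<in>I. norm (c r i x))" for x
    unfolding F(2) by (rule order_trans[OF norm_sum]) (simp add: prod_norm)
  have "(\<lambda>x. norm (F x)) \<in> borel_measurable M" using F(1) by measurable
  from Lnorm_le_mono[OF L this norm_ge_zero le order_refl g] show ?thesis .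
qed

context resolution
begin

lemma partial_sum_continuous: "u \<in> tempered_distributions \<Longrightarrow> continuous_on S (partial_sum u T)"
  unfolding partial_sum_def[abs_def] by (intro continuous_on_sum lp_block_continuous)

lemma partial_sum_measurable: "u \<in> tempered_distributions \<Longrightarrow> partial_sum u T \<in> borel_measurable borel"
  by (intro borel_measurable_continuous_onI partial_sum_continuous)

lemma partial_sum_0: "partial_sum u 0 = (\<lambda>x. 0)"
  by (simp add: partial_sum_def fun_eq_iff)

lemma three_halves_power_le: "j < J \<Longrightarrow> (3/2 * 2 ^ j :: real) \<le> 2 ^ J"
proof -
  assume "j < J"
  then have "(2 ^ Suc j :: real) \<le> 2 ^ J" by (intro power_increasing) auto
  moreover have "(3/2 * 2 ^ j :: real) \<le> 2 ^ Suc j" by simp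
  ultimately show ?thesis by linarith
qed

lemma lp_symbol_times_low: "j < J \<Longrightarrow> (\<lambda>\<xi>. lp_symbol \<Psi> j \<xi> * low J \<xi>) = lp_symbol \<Psi> j"
proof
  fix \<xi> :: 'a assume "j < J"
  from three_halves_power_le[OF this] have "norm \<xi> \<le> 2 ^ J" if "norm \<xi> < 3/2 * 2 ^ j" using that by linarith
  then show "lp_symbol \<Psi> j \<xi> * low J \<xi> = lp_symbol \<Psi> j \<xi>"
    using lp_symbol_eq_0_high[of j \<xi>] low_eq_1[of \<xi> J] by (cases "norm \<xi> \<ge> 3/2 * 2 ^ j") auto
qed

lemma lp_symbol_times_low_0: "Suc l < j \<Longrightarrow> (\<lambda>\<xi>. lp_symbol \<Psi> j \<xi> * low l \<xi>) = (\<lambda>\<xi>. 0)"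
proof
  fix \<xi> :: 'a assume j: "Suc l < j"
  have "norm \<xi> \<le> 2 ^ Suc l" if "norm \<xi> < 3/2 * 2 ^ l" using that three_halves_power_le[of l "Suc l"] by linarith
  then show "lp_symbol \<Psi> j \<xi> * low l \<xi> = 0"
    using lp_symbol_eq_0_low[OF _ j, of \<xi>] low_eq_0[of l \<xi>] by (cases "norm \<xi> \<ge> 3/2 * 2 ^ l") auto
qed

lemma low_times_low: "l < J \<Longrightarrow> (\<lambda>\<xi>. low J \<xi> * low l \<xi>) = low l"
proof
  fix \<xi> :: 'a assume "l < J"
  from three_halves_power_le[OF this] have "norm \<xi> \<le> 2 ^ J" if "norm \<xi> < 3/2 * 2 ^ l" using that by linarith
  then show "low J \<xi> * low l \<xi> = low l \<xi>"
    using low_eq_0[of l \<xi>] low_eq_1[of \<xi> J] by (cases "norm \<xi> \<ge> 3/2 * 2 ^ l") auto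
qed

lemma smoothing_partial_sum_high:
  assumes u: "u \<in> tempered_distributions" and "Suc j < T"
  shows "smoothing (lp_symbol \<Psi> j) (partial_sum u T) x = lp_block \<Psi> j u x"
proof -
  obtain J where J: "T = Suc J" "j < J" using assms(2) by (cases T) auto
  show ?thesis
    unfolding J(1) partial_sum_Suc[OF u] smoothing_multiplier_fun(2)[OF u low_schwartz lp_symbol_schwartz]
      lp_symbol_times_low[OF J(2)] lp_block_eq[OF u] ..
qed

lemma smoothing_partial_sum_low:
  assumes u: "u \<in> tempered_distributions" and "l < j \<or> l = 0"
  shows "smoothing (lp_symbol \<Psi> j) (partial_sum u l) x = 0"
proof (cases l)
  case 0
  then show ?thesis by (simp add: partial_sum_0 smoothing_def)
next
  case (Suc k)
  then have "Suc k < j" using assms(2) by simp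
  then show ?thesis
    unfolding Suc partial_sum_Suc[OF u] smoothing_multiplier_fun(2)[OF u low_schwartz lp_symbol_schwartz]
    by (simp only: lp_symbol_times_low_0 multiplier_fun_zero[OF u])
qed

text \<open>
  Each partial sum has its spectrum in a ball of radius \<open>3/2 * 2^l\<close>, and the radii add. The radius is twice
  the true one, which leaves room for a symbol that reproduces the partial sum.
\<close>

lemma prod_partial_sum_bandlimited:
  assumes u: "\<And>i. i \<in> {1..m} \<Longrightarrow> u i \<in> tempered_distributions" and l: "0 < l"
    and bd: "\<And>i. i \<in> {1..m} \<Longrightarrow> \<exists>B. \<forall>x. norm (partial_sum (u i) l x) \<le> B" and k: "1 \<le> k" "k \<le> m"
  shows "bandlimited (real k * (3/2 * 2 ^ l)) (\<lambda>x. \<Prod>i=1..k. partial_sum (u i) l x)"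
  using k
proof (induction k rule: dec_induct)
  case base
  have l: "l = Suc (l - 1)" using l by simp
  have u1: "u 1 \<in> tempered_distributions" using u base by simp
  have "bandlimited (3/2 * 2 ^ l) (multiplier_fun (low (l - 1)) (u 1))"
  proof (rule bandlimited_multiplier_fun[OF u1 low_schwartz])
    show "\<exists>B. \<forall>x. norm (multiplier_fun (low (l - 1)) (u 1) x) \<le> B"
      using bd[of 1] base unfolding partial_sum_Suc[OF u1, of "l - 1", folded l] by simp
    fix \<xi> :: 'a assume "norm \<xi> > 3/2 * 2 ^ l"
    moreover have "(2 ^ (l - 1) :: real) \<le> 2 ^ l" by (intro power_increasing) auto
    ultimately show "low (l - 1) \<xi> = 0" by (intro low_eq_0) linarith
  qed
  then show ?case unfolding partial_sum_Suc[OF u1, of "l - 1", folded l, symmetric] by simp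
next
  case (step k)
  have l': "l = Suc (l - 1)" using l by simp
  have uk: "u (Suc k) \<in> tempered_distributions" using u step by simp
  obtain B where B: "\<forall>x. norm (partial_sum (u (Suc k)) l x) \<le> B" using bd[of "Suc k"] step by auto
  have *: "bandlimited (real k * (3/2 * 2 ^ l) + 3/2 * 2 ^ l) (\<lambda>x. (\<Prod>i=1..k. partial_sum (u i) l x) * partial_sum (u (Suc k)) l x)"
  proof (rule bandlimited_mult[OF _ partial_sum_continuous[OF uk] B low_schwartz])
    show "bandlimited (real k * (3/2 * 2 ^ l)) (\<lambda>x. \<Prod>i=1..k. partial_sum (u i) l x)" using step by simp
    show "low l \<xi> = 0" if "norm \<xi> > 3/2 * 2 ^ l" for \<xi> using that by (intro low_eq_0) simp
    show "smoothing (low l) (partial_sum (u (Suc k)) l) x = partial_sum (u (Suc k)) l x" for x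
    proof -
      have "partial_sum (u (Suc k)) l = multiplier_fun (low (l - 1)) (u (Suc k))" using partial_sum_Suc[OF uk, of "l - 1"] l by simp
      then show ?thesis
        using smoothing_multiplier_fun(2)[OF uk low_schwartz low_schwartz, of l "l - 1" x] low_times_low[of "l - 1" l] l by simp
    qed
  qed
  have e: "real (Suc k) * (3/2 * 2 ^ l) = real k * (3/2 * 2 ^ l) + 3/2 * 2 ^ l" by (simp add: algebra_simps add_divide_distrib)
  have pe: "(\<lambda>x. \<Prod>i=1..Suc k. partial_sum (u i) l x) = (\<lambda>x. (\<Prod>i=1..k. partial_sum (u i) l x) * partial_sum (u (Suc k)) l x)"
    by (simp add: prod.cl_ivl_Suc)
  show ?case unfolding e pe by (rule *)
qed

end

section \<open>Partial sums under the exponent conditions\<close>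

text \<open>
  The exponents as reciprocals: \<open>\<alpha> i = 1/p\<^sub>i\<close> measures the blocks of the \<open>i\<close>-th factor, and
  \<open>\<beta> i = 1/h\<^sub>i\<close>, with \<open>h\<^sub>1 = p\<^sub>1\<close>, is the exponent that this factor contributes to Hoelder's inequality.
\<close>

locale product_exponents = resolution \<Psi> for \<Psi> :: "'a::euclidean_space \<Rightarrow> complex" +
  fixes m :: nat and s \<alpha> \<beta> :: "nat \<Rightarrow> real"
  assumes m: "2 \<le> m"
    and s1: "0 < s 1" "s 1 < real DIM('a) * \<alpha> 1"
    and s_gt: "\<And>i. i \<in> {2..m} \<Longrightarrow> s 1 < s i"
    and beta1: "\<beta> 1 = \<alpha> 1"
    and beta: "\<And>i. i \<in> {2..m} \<Longrightarrow> 0 < \<beta> i" "\<And>i. i \<in> {2..m} \<Longrightarrow> \<beta> i \<le> \<alpha> i"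
      "\<And>i. i \<in> {2..m} \<Longrightarrow> real DIM('a) * (\<alpha> i - \<beta> i) < s i"
    and beta_sum: "(\<Sum>i=1..m. \<beta> i) < 1"
begin

text \<open>The reciprocal \<open>1/p\<close> of the exponent of the product.\<close>

definition \<pi> :: real where "\<pi> = (\<Sum>i=1..m. \<beta> i)"

lemma alpha_pos: "i \<in> {1..m} \<Longrightarrow> 0 < \<alpha> i"
proof (cases "i = 1")
  case True
  have "0 < real DIM('a) * \<alpha> 1" using s1 by simp
  then show ?thesis using True by (simp add: zero_less_mult_iff)
next
  case False
  assume "i \<in> {1..m}"
  then have "i \<in> {2..m}" using False by auto
  then show ?thesis using beta[of i] by simp
qed

lemma beta_pos: "i \<in> {1..m} \<Longrightarrow> 0 < \<beta> i"
  using alpha_pos[of 1] beta1 beta(1)[of i] m by (cases "i = 1") auto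

lemma beta_le_alpha: "i \<in> {1..m} \<Longrightarrow> \<beta> i \<le> \<alpha> i"
  using beta1 beta(2)[of i] by (cases "i = 1") auto

lemma beta_le_pi: "i \<in> {1..m} \<Longrightarrow> \<beta> i \<le> \<pi>"
  unfolding \<pi>_def by (rule member_le_sum) (auto intro!: less_imp_le[OF beta_pos])

lemma pi_bounds: "0 < \<pi>" "\<pi> < 1"
  using beta_le_pi[of 1] beta_pos[of 1] m beta_sum by (auto simp: \<pi>_def)

lemma beta_less_1: "i \<in> {1..m} \<Longrightarrow> \<beta> i < 1"
  using beta_le_pi[of i] pi_bounds by simp

text \<open>
  The decay rate left for the blocks of the \<open>i\<close>-th factor after raising their integrability from \<open>\<alpha> i\<close>
  to \<open>\<gamma>\<close>; the positivity for \<open>\<gamma> = \<beta> i\<close> is the lower bound on \<open>1/h\<^sub>i\<close>.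
\<close>

definition gain :: "nat \<Rightarrow> real \<Rightarrow> real" where "gain i \<gamma> = s i - real DIM('a) * (\<alpha> i - \<gamma>)"

lemma gain_beta_pos: "i \<in> {1..m} \<Longrightarrow> 0 < gain i (\<beta> i)"
  using beta1 s1 beta(3)[of i] by (cases "i = 1") (auto simp: gain_def)

text \<open>
  Each \<open>u i\<close> has norm at most \<open>A i\<close> in the Besov space with third index infinity. For the first factor
  this is weaker than the assumed bound, but sufficient for everything except the main term.
\<close>

definition blocks_le :: "(nat \<Rightarrow> 'a functional) \<Rightarrow> (nat \<Rightarrow> real) \<Rightarrow> bool" where
  "blocks_le u A \<longleftrightarrow> (\<forall>i\<in>{1..m}. u i \<in> tempered_distributions \<and> 0 \<le> A i \<and>
     (\<forall>k. Lnorm_le lborel (\<alpha> i) (\<lambda>x. norm (lp_block \<Psi> k (u i) x)) (A i * 2 powr (- real k * s i))))"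

lemma blocks_leD:
  assumes "blocks_le u A" "i \<in> {1..m}"
  shows "u i \<in> tempered_distributions" "0 \<le> A i"
    "Lnorm_le lborel (\<alpha> i) (\<lambda>x. norm (lp_block \<Psi> k (u i) x)) (A i * 2 powr (- real k * s i))"
  using assms by (auto simp: blocks_le_def)

lemma block_bound:
  assumes i: "i \<in> {1..m}" and g: "0 < \<gamma>" "\<gamma> \<le> \<alpha> i"
  shows "\<exists>C>0. \<forall>u A k. blocks_le u A \<longrightarrow>
    Lnorm_le lborel \<gamma> (\<lambda>x. norm (lp_block \<Psi> k (u i) x)) (C * A i * 2 powr (- real k * gain i \<gamma>))"
proof -
  obtain C where C: "C > 0" "\<And>u k A \<beta>. u \<in> tempered_distributions \<Longrightarrow> 0 < \<beta> \<Longrightarrow> \<beta> \<le> \<alpha> i \<Longrightarrow>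
     Lnorm_le lborel (\<alpha> i) (\<lambda>x. norm (lp_block \<Psi> k u x)) A \<Longrightarrow>
     Lnorm_le lborel \<beta> (\<lambda>x. norm (lp_block \<Psi> k u x)) (C * 2 powr (real k * real DIM('a) * (\<alpha> i - \<beta>)) * A)"
    using lp_block_nikolskii[OF alpha_pos[OF i]] by blast
  have "Lnorm_le lborel \<gamma> (\<lambda>x. norm (lp_block \<Psi> k (u i) x)) (C * A i * 2 powr (- real k * gain i \<gamma>))"
    if "blocks_le u A" for u A k
  proof -
    have e: "2 powr (real k * real DIM('a) * (\<alpha> i - \<gamma>)) * 2 powr (- real k * s i) = (2::real) powr (- real k * gain i \<gamma>)"
      unfolding powr_add[symmetric] by (simp add: gain_def algebra_simps)
    have "C * 2 powr (real k * real DIM('a) * (\<alpha> i - \<gamma>)) * (A i * 2 powr (- real k * s i)) = C * A i * 2 powr (- real k * gain i \<gamma>)"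
      unfolding e[symmetric] by simp
    then show ?thesis
      using C(2)[OF blocks_leD(1)[OF that i] g blocks_leD(3)[OF that i], of k] by (simp only:)
  qed
  then show ?thesis using C(1) by blast
qed

lemma block_sum_bound:
  assumes i: "i \<in> {1..m}" and g: "0 < \<gamma>" "\<gamma> \<le> \<alpha> i" "0 < gain i \<gamma>"
  shows "\<exists>C>0. \<forall>u A F L. blocks_le u A \<longrightarrow> finite F \<longrightarrow> (\<forall>k\<in>F. L \<le> k) \<longrightarrow>
    Lnorm_le lborel \<gamma> (\<lambda>x. \<Sum>k\<in>F. norm (lp_block \<Psi> k (u i) x)) (C * A i * 2 powr (- real L * gain i \<gamma>))"
proof -
  obtain C where C: "C > 0" "\<And>u A k. blocks_le u A \<Longrightarrow>
    Lnorm_le lborel \<gamma> (\<lambda>x. norm (lp_block \<Psi> k (u i) x)) (C * A i * 2 powr (- real k * gain i \<gamma>))"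
    using block_bound[OF i g(1,2)] by blast
  have "Lnorm_le lborel \<gamma> (\<lambda>x. \<Sum>k\<in>F. norm (lp_block \<Psi> k (u i) x)) ((geometric_const \<gamma> (gain i \<gamma>) * C) * A i * 2 powr (- real L * gain i \<gamma>))"
    if "blocks_le u A" "finite F" "\<forall>k\<in>F. L \<le> k" for u A F L
    using Lnorm_le_geometric[OF that(2), of L \<gamma> "gain i \<gamma>" "C * A i" lborel "\<lambda>k x. norm (lp_block \<Psi> k (u i) x)"]
      that g C blocks_leD(2)[OF that(1) i] by (simp add: mult.assoc)
  moreover have "geometric_const \<gamma> (gain i \<gamma>) * C > 0" using geometric_const_pos[OF g(3,1)] C(1) by simp
  ultimately show ?thesis by blast
qed

lemma partial_sum_tail_bound:
  assumes i: "i \<in> {1..m}" and g: "0 < \<gamma>" "\<gamma> \<le> \<alpha> i" "0 < gain i \<gamma>"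
  shows "\<exists>C>0. \<forall>u A l T. blocks_le u A \<longrightarrow> l \<le> T \<longrightarrow>
    Lnorm_le lborel \<gamma> (\<lambda>x. norm (partial_sum (u i) T x - partial_sum (u i) l x)) (C * A i * 2 powr (- real l * gain i \<gamma>))"
proof -
  obtain C where C: "C > 0" "\<And>u A F L. blocks_le u A \<Longrightarrow> finite F \<Longrightarrow> (\<forall>k\<in>F. L \<le> k) \<Longrightarrow>
    Lnorm_le lborel \<gamma> (\<lambda>x. \<Sum>k\<in>F. norm (lp_block \<Psi> k (u i) x)) (C * A i * 2 powr (- real L * gain i \<gamma>))"
    using block_sum_bound[OF i g] by blast
  have "Lnorm_le lborel \<gamma> (\<lambda>x. norm (partial_sum (u i) T x - partial_sum (u i) l x)) (C * A i * 2 powr (- real l * gain i \<gamma>))"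
    if u: "blocks_le u A" and "l \<le> T" for u A l T
  proof (rule Lnorm_le_mono[OF C(2)[OF u, of "{l..<T}" l]])
    have [measurable]: "partial_sum (u i) T \<in> borel_measurable borel" for T by (rule partial_sum_measurable[OF blocks_leD(1)[OF u i]])
    show "(\<lambda>x. norm (partial_sum (u i) T x - partial_sum (u i) l x)) \<in> borel_measurable lborel" by measurable
    fix x
    have "partial_sum (u i) T x - partial_sum (u i) l x = (\<Sum>k\<in>{l..<T}. lp_block \<Psi> k (u i) x)"
      unfolding partial_sum_def atLeast0LessThan[symmetric] using sum_diff_nat_ivl[of 0 l T] that(2) by simp
    then show "norm (partial_sum (u i) T x - partial_sum (u i) l x) \<le> (\<Sum>k\<in>{l..<T}. norm (lp_block \<Psi> k (u i) x))"
      by (simp add: norm_sum)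
  qed (use g in auto)
  then show ?thesis using C(1) by blast
qed

lemma partial_sum_norm_bound:
  assumes i: "i \<in> {1..m}" and g: "0 < \<gamma>" "\<gamma> \<le> \<alpha> i" "0 < gain i \<gamma>"
  shows "\<exists>C>0. \<forall>u A T. blocks_le u A \<longrightarrow> Lnorm_le lborel \<gamma> (\<lambda>x. norm (partial_sum (u i) T x)) (C * A i)"
proof -
  obtain C where C: "C > 0" "\<And>u A l T. blocks_le u A \<Longrightarrow> l \<le> T \<Longrightarrow>
    Lnorm_le lborel \<gamma> (\<lambda>x. norm (partial_sum (u i) T x - partial_sum (u i) l x)) (C * A i * 2 powr (- real l * gain i \<gamma>))"
    using partial_sum_tail_bound[OF assms] by blast
  have "Lnorm_le lborel \<gamma> (\<lambda>x. norm (partial_sum (u i) T x)) (C * A i)" if "blocks_le u A" for u A T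
    using C(2)[OF that, of 0 T] by (simp add: partial_sum_0)
  then show ?thesis using C(1) by blast
qed

text \<open>
  The bound depends on \<open>T\<close>; it justifies manipulations of integrals of partial sums.
\<close>

lemma partial_sum_bounded:
  assumes "blocks_le u A" "i \<in> {1..m}"
  shows "\<exists>B. \<forall>x. norm (partial_sum (u i) T x) \<le> B"
proof -
  obtain C where C: "\<And>u k A x. u \<in> tempered_distributions \<Longrightarrow> Lnorm_le lborel (\<alpha> i) (\<lambda>x. norm (lp_block \<Psi> k u x)) A \<Longrightarrow>
     norm (lp_block \<Psi> k u x) \<le> C * 2 powr (real k * real DIM('a) * \<alpha> i) * A"
    using lp_block_sup[OF alpha_pos[OF assms(2)]] by blast
  have "norm (partial_sum (u i) T x) \<le> (\<Sum>k<T. C * 2 powr (real k * real DIM('a) * \<alpha> i) * (A i * 2 powr (- real k * s i)))" for x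
    unfolding partial_sum_def by (rule order_trans[OF norm_sum]) (intro sum_mono C blocks_leD[OF assms])
  then show ?thesis by blast
qed

end

lemma two_powr_decay_mono:
  assumes "a \<le> b" shows "(2::real) powr (- real l * b) \<le> 2 powr (- real l * a)"
  using mult_left_mono[OF assms, of "real l"] by (intro powr_mono) auto

lemma telescoped_bound:
  fixes a b :: "nat \<Rightarrow> 'b \<Rightarrow> complex"
  assumes p: "p \<le> m" and \<beta>: "\<And>i. i \<in> {p..m} \<Longrightarrow> 0 < \<beta> i"
    and a: "\<And>i. i \<in> {p..m} \<Longrightarrow> a i \<in> borel_measurable M" "\<And>i. i \<in> {p..m} \<Longrightarrow> Lnorm_le M (\<beta> i) (\<lambda>x. norm (a i x)) (K i)"
    and b: "\<And>i. i \<in> {p..m} \<Longrightarrow> b i \<in> borel_measurable M" "\<And>i. i \<in> {p..m} \<Longrightarrow> Lnorm_le M (\<beta> i) (\<lambda>x. norm (b i x)) (K i)"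
    and ab: "\<And>i. i \<in> {p..m} \<Longrightarrow> Lnorm_le M (\<beta> i) (\<lambda>x. norm (a i x - b i x)) (K i * t)" and t: "0 \<le> t"
  shows "Lnorm_le M (\<Sum>i=p..m. \<beta> i) (\<lambda>x. norm ((\<Prod>i=p..m. a i x) - (\<Prod>i=p..m. b i x)))
    (real (card {p..m}) powr (1 + (\<Sum>i=p..m. \<beta> i)) * ((\<Prod>i=p..m. K i) * t))"
proof (rule Lnorm_le_prod_terms[where c="\<lambda>r i x. if i < r then a i x else if i = r then a i x - b i x else b i x"
      and \<gamma>="\<lambda>r i. \<beta> i" and B="\<lambda>r i. K i * (if i = r then t else 1)" and I="{p..m}"])
  have K: "0 \<le> K i" if "i \<in> {p..m}" for i by (rule Lnorm_leD(3)[OF a(2)[OF that]])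
  show "Lnorm_le M (\<beta> i) (\<lambda>x. norm (if i < r then a i x else if i = r then a i x - b i x else b i x)) (K i * (if i = r then t else 1))"
    if "i \<in> {p..m}" for r i
    using a(2)[OF that] b(2)[OF that] ab[OF that] by (cases "i < r"; cases "i = r") auto
  show "(\<Prod>i=p..m. K i * (if i = r then t else 1)) \<le> (\<Prod>i=p..m. K i) * t" if "r \<in> {p..m}" for r
    using that by (simp add: prod.distrib)
  show "0 \<le> (\<Prod>i=p..m. K i) * t" using K t by (intro mult_nonneg_nonneg prod_nonneg) auto
  show "(\<lambda>x. (\<Prod>i=p..m. a i x) - (\<Prod>i=p..m. b i x)) \<in> borel_measurable M"
    by (intro borel_measurable_diff borel_measurable_prod a b)
  show "(\<Prod>i=p..m. a i x) - (\<Prod>i=p..m. b i x) = (\<Sum>r=p..m. \<Prod>i=p..m. if i < r then a i x else if i = r then a i x - b i x else b i x)" for x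
    by (rule prod_diff_telescope) (use p in simp)
  show "0 < (\<Sum>i=p..m. \<beta> i)" using p \<beta> by (intro sum_pos) auto
qed (use p \<beta> in auto)

lemma Lnorm_le_add:
  assumes f: "Lnorm_le M \<beta> f A" and g: "Lnorm_le M \<beta> g A" and b: "0 < \<beta>"
  shows "Lnorm_le M \<beta> (\<lambda>x. f x + g x) (2 powr (1 + \<beta>) * A)"
proof -
  have "Lnorm_le M \<beta> (\<lambda>x. \<Sum>i\<in>{0..<2::nat}. (if i = 0 then f else g) x) (real (card {0..<2::nat}) powr (1 + \<beta>) * A)"
    by (rule Lnorm_le_sum) (use f g b Lnorm_leD(3)[OF f] in auto)
  then show ?thesis by (simp add: numeral_2_eq_2)
qed

context resolution
begin

lemma smoothing_diff:
  assumes "continuous_on UNIV f" "continuous_on UNIV g" "\<tau> \<in> schwartz_space" "\<And>x. norm (f x) \<le> B" "\<And>x. norm (g x) \<le> B'"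
  shows "smoothing \<tau> (\<lambda>x. f x - g x) x = smoothing \<tau> f x - smoothing \<tau> g x"
proof -
  have "continuous_on UNIV (\<lambda>x. f x - g x)" by (intro continuous_on_diff assms)
  then show ?thesis
    using integrable_smoothing[OF assms(1,3,4), of x] integrable_smoothing[OF assms(2,3,5), of x] assms
    by (simp add: smoothing_shift left_diff_distrib)
qed

end

context product_exponents
begin

text \<open>
  A Hoelder exponent below one that all factors afford. Half of the minimum makes the inequalities strict, so that the
  sums over the blocks converge geometrically.
\<close>

definition eps :: real where "eps = Min (insert 1 ((\<lambda>i. gain i (\<beta> i)) ` {1..m})) / 2"

lemma eps: "0 < eps" "eps < 1" "i \<in> {1..m} \<Longrightarrow> eps < gain i (\<beta> i)"
proof -
  let ?S = "insert 1 ((\<lambda>i. gain i (\<beta> i)) ` {1..m})"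
  define M where "M = Min ?S"
  have e: "eps = M / 2" by (simp only: eps_def M_def)
  have "M \<in> ?S" unfolding M_def by (intro Min_in) auto
  then have pos: "0 < M" using gain_beta_pos by auto
  then show "0 < eps" by (simp add: e)
  have "M \<le> 1" unfolding M_def by (intro Min_le) auto
  then show "eps < 1" using pos by (simp add: e)
  show "eps < gain i (\<beta> i)" if "i \<in> {1..m}"
  proof -
    have "M \<le> gain i (\<beta> i)" unfolding M_def using that by (intro Min_le) auto
    then show ?thesis using pos by (simp add: e)
  qed
qed

text \<open>
  Raising the regularity to \<open>eps\<close> costs \<open>2 powr (k * eps)\<close> for the block \<open>k\<close>, which is covered by the decay rate; so the bound is
  uniform in the number of blocks.
\<close>

lemma partial_sum_modulus:
  assumes i: "i \<in> {1..m}"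
  shows "\<exists>C>0. \<forall>u A l z. blocks_le u A \<longrightarrow>
    Lnorm_le lborel (\<beta> i) (\<lambda>x. norm (partial_sum (u i) l (x + z) - partial_sum (u i) l x)) (C * A i * norm z powr eps)"
proof -
  note b = beta_pos[OF i] beta_less_1[OF i] beta_le_alpha[OF i]
  let ?g = "gain i (\<beta> i)"
  obtain C1 where C1: "C1 > 0" "\<And>u k A \<beta> z. u \<in> tempered_distributions \<Longrightarrow> 0 < \<beta> \<Longrightarrow> \<beta> \<le> 1 \<Longrightarrow>
     Lnorm_le lborel \<beta> (\<lambda>x. norm (lp_block \<Psi> k u x)) A \<Longrightarrow>
     Lnorm_le lborel \<beta> (\<lambda>x. norm (lp_block \<Psi> k u (x + z) - lp_block \<Psi> k u x)) (C1 * (2 ^ k * norm z) powr eps * A)"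
    using lp_block_modulus[OF eps(1) less_imp_le[OF eps(2)]] by blast
  obtain C2 where C2: "C2 > 0" "\<And>u A k. blocks_le u A \<Longrightarrow>
    Lnorm_le lborel (\<beta> i) (\<lambda>x. norm (lp_block \<Psi> k (u i) x)) (C2 * A i * 2 powr (- real k * ?g))"
    using block_bound[OF i b(1,3)] by blast
  define C where "C = geometric_const (\<beta> i) (?g - eps) * (C1 * C2)"
  have "Lnorm_le lborel (\<beta> i) (\<lambda>x. norm (partial_sum (u i) l (x + z) - partial_sum (u i) l x)) (C * A i * norm z powr eps)"
    if u: "blocks_le u A" for u A l z
  proof -
    note ui = blocks_leD(1,2)[OF u i]
    have [measurable]: "partial_sum (u i) l \<in> borel_measurable borel" by (rule partial_sum_measurable[OF ui(1)])
    have e: "C1 * (2 ^ k * norm z) powr eps * (C2 * A i * 2 powr (- real k * ?g)) = (C1 * C2 * A i * norm z powr eps) * 2 powr (- real k * (?g - eps))" for k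
    proof -
      have 1: "(2 ^ k * norm z) powr eps = 2 powr (real k * eps) * norm z powr eps"
        by (simp add: powr_mult powr_realpow[symmetric] powr_powr)
      have 2: "2 powr (real k * eps) * 2 powr (- real k * ?g) = (2::real) powr (- real k * (?g - eps))"
        unfolding powr_add[symmetric] by (simp add: algebra_simps)
      show ?thesis unfolding 1 2[symmetric] by (simp only: mult_ac)
    qed
    have "Lnorm_le lborel (\<beta> i) (\<lambda>x. \<Sum>k\<in>{..<l}. norm (lp_block \<Psi> k (u i) (x + z) - lp_block \<Psi> k (u i) x))
       (geometric_const (\<beta> i) (?g - eps) * (C1 * C2 * A i * norm z powr eps) * 2 powr (- real 0 * (?g - eps)))"
    proof (rule Lnorm_le_geometric)
      show "Lnorm_le lborel (\<beta> i) (\<lambda>x. norm (lp_block \<Psi> k (u i) (x + z) - lp_block \<Psi> k (u i) x)) (C1 * C2 * A i * norm z powr eps * 2 powr (- real k * (?g - eps)))" for k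
        using C1(2)[OF ui(1) b(1) less_imp_le[OF b(2)] C2(2)[OF u], of k z] unfolding e .
    qed (use b eps(3)[OF i] C1 C2 ui in auto)
    then have L: "Lnorm_le lborel (\<beta> i) (\<lambda>x. \<Sum>k\<in>{..<l}. norm (lp_block \<Psi> k (u i) (x + z) - lp_block \<Psi> k (u i) x)) (C * A i * norm z powr eps)"
      by (simp add: C_def mult.assoc)
    show ?thesis
    proof (rule Lnorm_le_mono[OF L])
      show "(\<lambda>x. norm (partial_sum (u i) l (x + z) - partial_sum (u i) l x)) \<in> borel_measurable lborel" by measurable
      show "norm (partial_sum (u i) l (x + z) - partial_sum (u i) l x) \<le> (\<Sum>k\<in>{..<l}. norm (lp_block \<Psi> k (u i) (x + z) - lp_block \<Psi> k (u i) x))" for x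
        unfolding partial_sum_def sum_subtractf[symmetric] by (rule norm_sum)
    qed (use b in auto)
  qed
  moreover have "C > 0" unfolding C_def using geometric_const_pos[OF _ b(1), of "?g - eps"] eps(3)[OF i] C1 C2 by simp
  ultimately show ?thesis by blast
qed

text \<open>
  A common constant for the size, the tails and the modulus of continuity of the partial sums of one factor.
\<close>

definition partial_sum_const :: "nat \<Rightarrow> real \<Rightarrow> bool" where
  "partial_sum_const i K \<longleftrightarrow> 0 < K \<and> (\<forall>u A. blocks_le u A \<longrightarrow>
     (\<forall>T. Lnorm_le lborel (\<beta> i) (\<lambda>x. norm (partial_sum (u i) T x)) (K * A i)) \<and>
     (\<forall>l T. l \<le> T \<longrightarrow> Lnorm_le lborel (\<beta> i) (\<lambda>x. norm (partial_sum (u i) T x - partial_sum (u i) l x)) (K * A i * 2 powr (- real l * gain i (\<beta> i)))) \<and>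
     (\<forall>l z. Lnorm_le lborel (\<beta> i) (\<lambda>x. norm (partial_sum (u i) l (x + z) - partial_sum (u i) l x)) (K * A i * norm z powr eps)))"

lemma partial_sum_const_exists:
  assumes i: "i \<in> {1..m}"
  shows "\<exists>K. partial_sum_const i K"
proof -
    note b = beta_pos[OF i] beta_le_alpha[OF i] gain_beta_pos[OF i]
    obtain C1 where C1: "C1 > 0" "\<And>u A T. blocks_le u A \<Longrightarrow> Lnorm_le lborel (\<beta> i) (\<lambda>x. norm (partial_sum (u i) T x)) (C1 * A i)"
      using partial_sum_norm_bound[OF i b] by blast
    obtain C2 where C2: "C2 > 0" "\<And>u A l T. blocks_le u A \<Longrightarrow> l \<le> T \<Longrightarrow>
       Lnorm_le lborel (\<beta> i) (\<lambda>x. norm (partial_sum (u i) T x - partial_sum (u i) l x)) (C2 * A i * 2 powr (- real l * gain i (\<beta> i)))"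
      using partial_sum_tail_bound[OF i b] by blast
    obtain C3 where C3: "C3 > 0" "\<And>u A l z. blocks_le u A \<Longrightarrow>
       Lnorm_le lborel (\<beta> i) (\<lambda>x. norm (partial_sum (u i) l (x + z) - partial_sum (u i) l x)) (C3 * A i * norm z powr eps)"
      using partial_sum_modulus[OF i] by blast
    define K where "K = max C1 (max C2 C3)"
    have K: "0 < K" "C1 \<le> K" "C2 \<le> K" "C3 \<le> K" using C1(1) by (auto simp: K_def)
    show ?thesis unfolding partial_sum_const_def
    proof (intro exI[of _ K] conjI allI impI K(1))
      fix u A assume u: "blocks_le u A"
      note A = blocks_leD(2)[OF u i]
      show "Lnorm_le lborel (\<beta> i) (\<lambda>x. norm (partial_sum (u i) T x)) (K * A i)" for T
        by (rule Lnorm_le_weaken[OF C1(2)[OF u] _ b(1)]) (intro mult_right_mono K A)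
      show "Lnorm_le lborel (\<beta> i) (\<lambda>x. norm (partial_sum (u i) T x - partial_sum (u i) l x)) (K * A i * 2 powr (- real l * gain i (\<beta> i)))" if "l \<le> T" for l T
        by (rule Lnorm_le_weaken[OF C2(2)[OF u that] _ b(1)]) (intro mult_right_mono K A powr_ge_zero)
      show "Lnorm_le lborel (\<beta> i) (\<lambda>x. norm (partial_sum (u i) l (x + z) - partial_sum (u i) l x)) (K * A i * norm z powr eps)" for l z
        by (rule Lnorm_le_weaken[OF C3(2)[OF u] _ b(1)]) (intro mult_right_mono K A powr_ge_zero)
    qed
qed

definition sumbound :: "nat \<Rightarrow> real" where
  "sumbound i = (SOME K. partial_sum_const i K)"

lemma sumbound:
  assumes "i \<in> {1..m}"
  shows "0 < sumbound i"
    and "blocks_le u A \<Longrightarrow> Lnorm_le lborel (\<beta> i) (\<lambda>x. norm (partial_sum (u i) T x)) (sumbound i * A i)"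
    and "blocks_le u A \<Longrightarrow> l \<le> T \<Longrightarrow> Lnorm_le lborel (\<beta> i) (\<lambda>x. norm (partial_sum (u i) T x - partial_sum (u i) l x)) (sumbound i * A i * 2 powr (- real l * gain i (\<beta> i)))"
    and "blocks_le u A \<Longrightarrow> Lnorm_le lborel (\<beta> i) (\<lambda>x. norm (partial_sum (u i) l (x + z) - partial_sum (u i) l x)) (sumbound i * A i * norm z powr eps)"
proof -
  have "partial_sum_const i (sumbound i)"
    unfolding sumbound_def by (rule someI_ex[OF partial_sum_const_exists[OF assms]])
  note * = this[unfolded partial_sum_const_def]
  show "0 < sumbound i" using * by blast
  assume u: "blocks_le u A"
  show "Lnorm_le lborel (\<beta> i) (\<lambda>x. norm (partial_sum (u i) T x)) (sumbound i * A i)" using * u by blast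
  show "Lnorm_le lborel (\<beta> i) (\<lambda>x. norm (partial_sum (u i) T x - partial_sum (u i) l x)) (sumbound i * A i * 2 powr (- real l * gain i (\<beta> i)))" if "l \<le> T"
    using * u that by blast
  show "Lnorm_le lborel (\<beta> i) (\<lambda>x. norm (partial_sum (u i) l (x + z) - partial_sum (u i) l x)) (sumbound i * A i * norm z powr eps)" using * u by blast
qed

lemma product_modulus:
  "\<exists>C>0. \<forall>u A l z. blocks_le u A \<longrightarrow>
    Lnorm_le lborel (\<Sum>i=2..m. \<beta> i) (\<lambda>x. norm ((\<Prod>i=2..m. partial_sum (u i) l (x + z)) - (\<Prod>i=2..m. partial_sum (u i) l x)))
      (C * (\<Prod>i=2..m. A i) * norm z powr eps)"
proof -
  let ?c = "real (card {2..m}) powr (1 + (\<Sum>i=2..m. \<beta> i))"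
  have I: "i \<in> {1..m}" if "i \<in> {2..m}" for i using that by auto
  have "Lnorm_le lborel (\<Sum>i=2..m. \<beta> i) (\<lambda>x. norm ((\<Prod>i=2..m. partial_sum (u i) l (x + z)) - (\<Prod>i=2..m. partial_sum (u i) l x)))
      ((?c * (\<Prod>i=2..m. sumbound i)) * (\<Prod>i=2..m. A i) * norm z powr eps)" if u: "blocks_le u A" for u A l z
  proof -
    have [measurable]: "partial_sum (u i) l \<in> borel_measurable borel" if "i \<in> {2..m}" for i
      by (rule partial_sum_measurable[OF blocks_leD(1)[OF u I[OF that]]])
    have "Lnorm_le lborel (\<Sum>i=2..m. \<beta> i) (\<lambda>x. norm ((\<Prod>i=2..m. partial_sum (u i) l (x + z)) - (\<Prod>i=2..m. partial_sum (u i) l x)))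
      (?c * ((\<Prod>i=2..m. sumbound i * A i) * norm z powr eps))"
    proof (rule telescoped_bound)
      fix i assume i: "i \<in> {2..m}"
      show "Lnorm_le lborel (\<beta> i) (\<lambda>x. norm (partial_sum (u i) l (x + z))) (sumbound i * A i)"
        by (rule Lnorm_le_translate[OF sumbound(2)[OF I[OF i] u]])
      show "Lnorm_le lborel (\<beta> i) (\<lambda>x. norm (partial_sum (u i) l x)) (sumbound i * A i)" by (rule sumbound(2)[OF I[OF i] u])
      show "Lnorm_le lborel (\<beta> i) (\<lambda>x. norm (partial_sum (u i) l (x + z) - partial_sum (u i) l x)) (sumbound i * A i * norm z powr eps)"
        by (rule sumbound(4)[OF I[OF i] u])
      show "(\<lambda>x. partial_sum (u i) l (x + z)) \<in> borel_measurable lborel" "partial_sum (u i) l \<in> borel_measurable lborel"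
        using i by measurable
    qed (use m beta in auto)
    then show ?thesis by (simp add: prod.distrib mult.assoc)
  qed
  moreover have "0 < ?c * (\<Prod>i=2..m. sumbound i)"
    using m sumbound(1) I by (intro mult_pos_pos prod_pos) auto
  ultimately show ?thesis by blast
qed

section \<open>The truncated products\<close>

abbreviation full_product :: "(nat \<Rightarrow> 'a functional) \<Rightarrow> nat \<Rightarrow> 'a \<Rightarrow> complex" where
  "full_product u T x \<equiv> (\<Prod>i=1..m. partial_sum (u i) T x)"

lemma full_product_continuous: "blocks_le u A \<Longrightarrow> continuous_on S (full_product u T)"
  by (intro continuous_on_prod partial_sum_continuous blocks_leD(1)) auto

lemma full_product_measurable: "blocks_le u A \<Longrightarrow> full_product u T \<in> borel_measurable borel"
  by (intro borel_measurable_continuous_onI full_product_continuous)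

lemma prod_bounded:
  assumes "blocks_le u A" "I \<subseteq> {1..m}"
  shows "\<exists>B. \<forall>x. norm (\<Prod>i\<in>I. partial_sum (u i) T x) \<le> B"
proof -
  have "\<forall>i\<in>{1..m}. \<exists>B. \<forall>x. norm (partial_sum (u i) T x) \<le> B"
    using partial_sum_bounded[OF assms(1)] by blast
  from bchoice[OF this] obtain B where B: "\<And>i x. i \<in> {1..m} \<Longrightarrow> norm (partial_sum (u i) T x) \<le> B i"
    by blast
  have "norm (\<Prod>i\<in>I. partial_sum (u i) T x) \<le> (\<Prod>i\<in>I. B i)" for x
    unfolding prod_norm[symmetric] using B assms(2) by (intro prod_mono) auto
  then show ?thesis by blast
qed

lemma full_product_cauchy:
  "\<exists>C>0. \<forall>u A l T. blocks_le u A \<longrightarrow> l \<le> T \<longrightarrow>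
    Lnorm_le lborel \<pi> (\<lambda>x. norm (full_product u T x - full_product u l x)) (C * (\<Prod>i=1..m. A i) * 2 powr (- real l * eps))"
proof -
  let ?c = "real (card {1..m}) powr (1 + (\<Sum>i=1..m. \<beta> i))"
  have "Lnorm_le lborel \<pi> (\<lambda>x. norm (full_product u T x - full_product u l x)) ((?c * (\<Prod>i=1..m. sumbound i)) * (\<Prod>i=1..m. A i) * 2 powr (- real l * eps))"
    if u: "blocks_le u A" and "l \<le> T" for u A l T
  proof -
    have "Lnorm_le lborel (\<Sum>i=1..m. \<beta> i) (\<lambda>x. norm (full_product u T x - full_product u l x)) (?c * ((\<Prod>i=1..m. sumbound i * A i) * 2 powr (- real l * eps)))"
    proof (rule telescoped_bound)
      fix i assume i: "i \<in> {1..m}"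
      have A: "0 \<le> sumbound i * A i" using sumbound(1)[OF i] blocks_leD(2)[OF u i] by simp
      show "Lnorm_le lborel (\<beta> i) (\<lambda>x. norm (partial_sum (u i) T x)) (sumbound i * A i)"
        "Lnorm_le lborel (\<beta> i) (\<lambda>x. norm (partial_sum (u i) l x)) (sumbound i * A i)" by (rule sumbound(2)[OF i u])+
      show "Lnorm_le lborel (\<beta> i) (\<lambda>x. norm (partial_sum (u i) T x - partial_sum (u i) l x)) (sumbound i * A i * 2 powr (- real l * eps))"
      proof (rule Lnorm_le_weaken[OF sumbound(3)[OF i u \<open>l \<le> T\<close>] _ beta_pos[OF i]])
        show "sumbound i * A i * 2 powr (- real l * gain i (\<beta> i)) \<le> sumbound i * A i * 2 powr (- real l * eps)"
          using eps(3)[OF i] by (intro mult_left_mono[OF two_powr_decay_mono A]) simp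
      qed
      show "partial_sum (u i) T \<in> borel_measurable lborel" "partial_sum (u i) l \<in> borel_measurable lborel"
        using partial_sum_measurable[OF blocks_leD(1)[OF u i]] by auto
    qed (use m beta_pos in auto)
    then show ?thesis by (simp add: prod.distrib mult.assoc \<pi>_def)
  qed
  moreover have "0 < ?c * (\<Prod>i=1..m. sumbound i)"
    using m sumbound(1) by (intro mult_pos_pos prod_pos) auto
  ultimately show ?thesis by blast
qed

text \<open>
  The tail of the \<open>r\<close>-th factor is measured with the exponent \<open>\<beta> r + x\<close>, and the first factor with
  \<open>\<beta> 1 - x\<close> in exchange. The former is limited by \<open>\<alpha> r\<close>, the latter by the smoothness \<open>s 1\<close>. If the way to \<open>\<alpha> r\<close> costs less
  than \<open>s 1\<close>, take all of it, since \<open>s r > s 1\<close>. Otherwise spend a large enough part of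
  \<open>s 1\<close>: spending all of it would give the rate \<open>gain r (\<beta> r) + s 1\<close>, which is greater than \<open>s 1\<close>.
\<close>

lemma exponent_shift:
  assumes r: "r \<in> {2..m}"
  shows "\<exists>x\<ge>0. \<beta> r + x \<le> \<alpha> r \<and> real DIM('a) * x < s 1 \<and> s 1 < gain r (\<beta> r + x)"
proof -
  let ?n = "real DIM('a)" and ?d = "\<alpha> r - \<beta> r"
  have n: "?n > 0" by simp
  have d: "0 \<le> ?d" using beta(2)[OF r] by simp
  have \<delta>: "?n * ?d < s r" using beta(3)[OF r] .
  show ?thesis
  proof (cases "?n * ?d < s 1")
    case True
    then show ?thesis using d s_gt[OF r] by (intro exI[of _ ?d]) (auto simp: gain_def)
  next
    case False
    \<comment> \<open>the midpoint of the admissible range for \<open>DIM('a) * x\<close>\<close>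
    define y where "y = (max 0 (s 1 - (s r - ?n * ?d)) + s 1) / 2"
    have y: "0 \<le> y" "y < s 1" "s 1 - (s r - ?n * ?d) < y" using s1 \<delta> by (auto simp: y_def max_def)
    have ny: "?n * (y / ?n) = y" using n by simp
    have "y / ?n \<le> ?d" using y False n by (simp add: divide_le_eq mult.commute)
    moreover have "s 1 < gain r (\<beta> r + y / ?n)"
    proof -
      have "gain r (\<beta> r + y / ?n) = s r - ?n * ?d + ?n * (y / ?n)" by (simp add: gain_def algebra_simps)
      then show ?thesis unfolding ny using y by simp
    qed
    ultimately show ?thesis using y n ny by (intro exI[of _ "y / ?n"]) auto
  qed
qed

text \<open>
  What is left of the increment of the product after removing the change of the first factor alone.
  Each term of its expansion contains a tail of some factor other than the first.
\<close>

definition remainder :: "(nat \<Rightarrow> 'a functional) \<Rightarrow> nat \<Rightarrow> nat \<Rightarrow> 'a \<Rightarrow> complex" where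
  "remainder u l T x = full_product u T x - full_product u l x
     - (partial_sum (u 1) T x - partial_sum (u 1) l x) * (\<Prod>i=2..m. partial_sum (u i) l x)"

lemma split_first_sum: "sum f {1..m} = f 1 + sum f {2..m}" for f :: "nat \<Rightarrow> 'b::comm_monoid_add"
  using m sum.atLeast_Suc_atMost[of 1 m f] by (simp add: numeral_2_eq_2)

lemma split_first_prod: "prod f {1..m} = f 1 * prod f {2..m}" for f :: "nat \<Rightarrow> 'b::comm_monoid_mult"
  using m prod.atLeast_Suc_atMost[of 1 m f] by (simp add: numeral_2_eq_2)

lemma remainder_telescope:
  "remainder u l T x = (\<Sum>r=2..m. \<Prod>i=1..m. if i < r then partial_sum (u i) T x
     else if i = r then partial_sum (u i) T x - partial_sum (u i) l x else partial_sum (u i) l x)"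
proof -
  let ?c = "\<lambda>r i. if i < r then partial_sum (u i) T x
     else if i = r then partial_sum (u i) T x - partial_sum (u i) l x else partial_sum (u i) l x"
  have "full_product u T x - full_product u l x = (\<Sum>r=1..m. \<Prod>i=1..m. ?c r i)"
    by (rule prod_diff_telescope) simp
  also have "\<dots> = (\<Prod>i=1..m. ?c 1 i) + (\<Sum>r=2..m. \<Prod>i=1..m. ?c r i)"
    by (rule split_first_sum)
  also have "(\<Prod>i=1..m. ?c 1 i) = ?c 1 1 * (\<Prod>i=2..m. ?c 1 i)"
    by (rule split_first_prod)
  also have "(\<Prod>i=2..m. ?c 1 i) = (\<Prod>i=2..m. partial_sum (u i) l x)" by (intro prod.cong) auto
  finally show ?thesis unfolding remainder_def by simp
qed

text \<open>
  In the term \<open>r\<close> of the telescoping sum the first factor is complete and is measured with the exponent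
  \<open>\<beta> 1 - x r\<close>, the \<open>r\<close>-th one is a tail and is measured with \<open>\<beta> r + x r\<close>; the sum of the exponents
  is unchanged. The rate \<open>g\<close> exceeds \<open>s 1\<close> by the choice of the shifts.
\<close>

lemma remainder_bound:
  "\<exists>C g. 0 < C \<and> s 1 < g \<and> (\<forall>u A l T. blocks_le u A \<longrightarrow> l \<le> T \<longrightarrow>
    Lnorm_le lborel \<pi> (\<lambda>x. norm (remainder u l T x)) (C * (\<Prod>i=1..m. A i) * 2 powr (- real l * g)))"
proof -
  let ?n = "real DIM('a)"
  obtain x where x: "\<And>r. r \<in> {2..m} \<Longrightarrow> 0 \<le> x r \<and> \<beta> r + x r \<le> \<alpha> r \<and> ?n * x r < s 1 \<and> s 1 < gain r (\<beta> r + x r)"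
    using exponent_shift bchoice[of "{2..m}" "\<lambda>r x. 0 \<le> x \<and> \<beta> r + x \<le> \<alpha> r \<and> ?n * x < s 1 \<and> s 1 < gain r (\<beta> r + x)"] by blast
  have I: "i \<in> {1..m}" if "i \<in> {2..m}" for i using that by auto
  have one: "1 \<in> {1..m}" using m by simp
  define g where "g = Min ((\<lambda>r. gain r (\<beta> r + x r)) ` {2..m})"
  have g_le: "g \<le> gain r (\<beta> r + x r)" if "r \<in> {2..m}" for r unfolding g_def using that by (intro Min_le) auto
  have "g \<in> (\<lambda>r. gain r (\<beta> r + x r)) ` {2..m}" unfolding g_def using m by (intro Min_in) auto
  then have g: "s 1 < g" using x by auto
  have pos1: "0 < \<beta> 1 - x r" if "r \<in> {2..m}" for r
  proof -
    have "?n * x r < ?n * \<alpha> 1" using x[OF that] s1 by linarith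
    then show ?thesis using beta1 by simp
  qed
  have gain1: "0 < gain 1 (\<beta> 1 - x r)" if "r \<in> {2..m}" for r
  proof -
    have "gain 1 (\<beta> 1 - x r) = s 1 - ?n * x r" unfolding gain_def beta1 by (simp add: algebra_simps)
    then show ?thesis using x[OF that] by simp
  qed
  have "\<exists>C>0. \<forall>u A T. blocks_le u A \<longrightarrow> Lnorm_le lborel (\<beta> 1 - x r) (\<lambda>x. norm (partial_sum (u 1) T x)) (C * A 1)" if "r \<in> {2..m}" for r
    by (rule partial_sum_norm_bound[OF one pos1[OF that] _ gain1[OF that]]) (use x[OF that] beta1 in simp)
  then have "\<forall>r\<in>{2..m}. \<exists>C>0. \<forall>u A T. blocks_le u A \<longrightarrow> Lnorm_le lborel (\<beta> 1 - x r) (\<lambda>x. norm (partial_sum (u 1) T x)) (C * A 1)"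
    by blast
  from bchoice[OF this] obtain C1 where C1: "\<And>r. r \<in> {2..m} \<Longrightarrow> C1 r > 0"
    "\<And>r u A T. r \<in> {2..m} \<Longrightarrow> blocks_le u A \<Longrightarrow> Lnorm_le lborel (\<beta> 1 - x r) (\<lambda>x. norm (partial_sum (u 1) T x)) (C1 r * A 1)"
    by blast
  have "\<exists>C>0. \<forall>u A l T. blocks_le u A \<longrightarrow> l \<le> T \<longrightarrow>
    Lnorm_le lborel (\<beta> r + x r) (\<lambda>x. norm (partial_sum (u r) T x - partial_sum (u r) l x)) (C * A r * 2 powr (- real l * gain r (\<beta> r + x r)))"
    if r: "r \<in> {2..m}" for r
    by (rule partial_sum_tail_bound[OF I[OF r]]) (use x[OF r] beta(1)[OF r] s1 in auto)
  then have "\<forall>r\<in>{2..m}. \<exists>C>0. \<forall>u A l T. blocks_le u A \<longrightarrow> l \<le> T \<longrightarrow>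
    Lnorm_le lborel (\<beta> r + x r) (\<lambda>x. norm (partial_sum (u r) T x - partial_sum (u r) l x)) (C * A r * 2 powr (- real l * gain r (\<beta> r + x r)))"
    by blast
  from bchoice[OF this] obtain C2 where C2: "\<And>r. r \<in> {2..m} \<Longrightarrow> C2 r > 0"
    "\<And>r u A l T. r \<in> {2..m} \<Longrightarrow> blocks_le u A \<Longrightarrow> l \<le> T \<Longrightarrow>
      Lnorm_le lborel (\<beta> r + x r) (\<lambda>x. norm (partial_sum (u r) T x - partial_sum (u r) l x)) (C2 r * A r * 2 powr (- real l * gain r (\<beta> r + x r)))"
    by blast
  define E where "E r i = (if i = 1 then C1 r else if i = r then C2 r else sumbound i)" for r i
  have E: "0 < E r i" if "r \<in> {2..m}" "i \<in> {1..m}" for r i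
    using that C1(1) C2(1) sumbound(1) by (auto simp: E_def)
  define D where "D = (\<Sum>r=2..m. \<Prod>i=1..m. E r i)"
  have E_le: "(\<Prod>i=1..m. E r i) \<le> D" if "r \<in> {2..m}" for r
    unfolding D_def by (rule member_le_sum[OF that]) (auto intro!: prod_nonneg less_imp_le[OF E])
  have D: "0 < D" unfolding D_def using m by (intro sum_pos prod_pos E) auto
  let ?c = "real (card {2..m}) powr (1 + \<pi>)"
  have "Lnorm_le lborel \<pi> (\<lambda>x. norm (remainder u l T x)) (?c * (D * (\<Prod>i=1..m. A i) * 2 powr (- real l * g)))"
    if u: "blocks_le u A" and lT: "l \<le> T" for u A l T
  proof (rule Lnorm_le_prod_terms[where c="\<lambda>r i y. if i < r then partial_sum (u i) T y
     else if i = r then partial_sum (u i) T y - partial_sum (u i) l y else partial_sum (u i) l y"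
      and \<gamma>="\<lambda>r i. \<beta> i + (if i = r then x r else 0) - (if i = 1 then x r else 0)"
      and B="\<lambda>r i. E r i * A i * (if i = r then 2 powr (- real l * g) else 1)" and I="{1..m}"])
    have A: "0 \<le> A i" if "i \<in> {1..m}" for i by (rule blocks_leD(2)[OF u that])
    have PA: "0 \<le> (\<Prod>i=1..m. A i)" by (intro prod_nonneg A)
    show "0 \<le> D * (\<Prod>i=1..m. A i) * 2 powr (- real l * g)" using D PA by simp
    have [measurable]: "partial_sum (u i) T \<in> borel_measurable borel" if "i \<in> {1..m}" for i T
      by (rule partial_sum_measurable[OF blocks_leD(1)[OF u that]])
    have "partial_sum (u 1) T \<in> borel_measurable borel" for T by (rule partial_sum_measurable[OF blocks_leD(1)[OF u one]])
    note [measurable] = this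
    have "(\<lambda>x. \<Prod>i=2..m. partial_sum (u i) l x) \<in> borel_measurable borel"
      by (intro borel_measurable_prod) (auto intro!: partial_sum_measurable[OF blocks_leD(1)[OF u]])
    note [measurable] = this full_product_measurable[OF u]
    show "remainder u l T \<in> borel_measurable lborel" unfolding remainder_def[abs_def] by measurable
    fix r assume r: "r \<in> {2..m}"
    have r1: "r \<noteq> 1" using r by simp
    show "(\<Sum>i=1..m. \<beta> i + (if i = r then x r else 0) - (if i = 1 then x r else 0)) = \<pi>"
      using r m by (simp add: sum.distrib sum_subtractf \<pi>_def)
    have "(\<Prod>i=1..m. E r i * A i * (if i = r then 2 powr (- real l * g) else 1)) = (\<Prod>i=1..m. E r i) * (\<Prod>i=1..m. A i) * 2 powr (- real l * g)"
      using r by (simp add: prod.distrib)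
    also have "\<dots> \<le> D * (\<Prod>i=1..m. A i) * 2 powr (- real l * g)" by (intro mult_right_mono E_le r PA) auto
    finally show "(\<Prod>i=1..m. E r i * A i * (if i = r then 2 powr (- real l * g) else 1)) \<le> D * (\<Prod>i=1..m. A i) * 2 powr (- real l * g)" .
    fix i assume i: "i \<in> {1..m}"
    show "0 < \<beta> i + (if i = r then x r else 0) - (if i = 1 then x r else 0)"
      using pos1[OF r] x[OF r] beta_pos[OF i] r1 by auto
    show "Lnorm_le lborel (\<beta> i + (if i = r then x r else 0) - (if i = 1 then x r else 0))
       (\<lambda>y. norm (if i < r then partial_sum (u i) T y else if i = r then partial_sum (u i) T y - partial_sum (u i) l y else partial_sum (u i) l y))
       (E r i * A i * (if i = r then 2 powr (- real l * g) else 1))"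
    proof -
      consider "i = 1" | "i \<noteq> 1" "i = r" | "i \<noteq> 1" "i \<noteq> r" by blast
      then show ?thesis
      proof cases
        case 1
        then show ?thesis using C1(2)[OF r u, of T] r by (simp add: E_def)
      next
        case 2
        have "C2 r * A r * 2 powr (- real l * gain r (\<beta> r + x r)) \<le> C2 r * A r * 2 powr (- real l * g)"
          using C2(1)[OF r] A[OF I[OF r]] by (intro mult_left_mono[OF two_powr_decay_mono[OF g_le[OF r]]]) simp
        from Lnorm_le_weaken[OF C2(2)[OF r u lT] this] show ?thesis
          using 2 beta(1)[OF r] x[OF r] by (simp add: E_def)
      next
        case 3
        then show ?thesis using sumbound(2)[OF i u] by (cases "i < r") (simp_all add: E_def)
      qed
    qed
  qed (use m pi_bounds remainder_telescope in auto)
  moreover have "0 < ?c * D" using D m by (intro mult_pos_pos) auto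
  ultimately show ?thesis using g by (intro exI[of _ "?c * D"] exI[of _ g]) (auto simp: mult.assoc)
qed

end

context product_exponents
begin

text \<open>
  This determines the gap \<open>2 * m\<close> between \<open>j\<close> and the truncation of the low-frequency factors: below it, the
  spectrum of the product of \<open>m\<close> partial sums avoids the support of \<open>lp_symbol \<Psi> j\<close>.
\<close>

lemma bandlimit_count: "real m * (3/2 * 2 ^ l) \<le> 2 ^ (l + 2 * m - 1)"
proof -
  have "l + 2 * m - 1 = l + (m + (m - 1))" using m by simp
  then have e: "(2 ^ (l + 2 * m - 1) :: real) = 2 ^ l * (2 ^ m * 2 ^ (m - 1))" by (simp add: power_add)
  have "real m \<le> 2 ^ m" by (rule less_imp_le[OF of_nat_less_two_power])
  moreover have "(3/2 :: real) \<le> 2 ^ (m - 1)"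
  proof -
    have "(2 ^ 1 :: real) \<le> 2 ^ (m - 1)" using m by (intro power_increasing) auto
    then show ?thesis by simp
  qed
  ultimately have "real m * (3/2) \<le> 2 ^ m * 2 ^ (m - 1)" by (intro mult_mono) auto
  then have "2 ^ l * (real m * (3/2)) \<le> 2 ^ l * (2 ^ m * 2 ^ (m - 1))" by (intro mult_left_mono) auto
  then show ?thesis unfolding e by (simp add: mult_ac)
qed

text \<open>For \<open>j \<le> 2 * m\<close> the partial sums are empty.\<close>

lemma smoothing_full_product_low:
  assumes u: "blocks_le u A"
  shows "smoothing (lp_symbol \<Psi> j) (full_product u (j - 2 * m)) x = 0"
proof (cases "j - 2 * m")
  case 0
  have z: "full_product u 0 y = 0" for y
    using m by (intro prod_zero) (auto simp: partial_sum_0)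
  show ?thesis unfolding 0 smoothing_def z by (simp only: mult_zero_left integral_zero)
next
  case (Suc k)
  let ?l = "j - 2 * m"
  have l: "0 < ?l" using Suc by simp
  have "bandlimited (real m * (3/2 * 2 ^ ?l)) (full_product u ?l)"
    by (rule prod_partial_sum_bandlimited[where m=m]) (use m l blocks_leD(1)[OF u] partial_sum_bounded[OF u] in auto)
  then show ?thesis
  proof (rule smoothing_bandlimited[OF _ lp_symbol_schwartz])
    fix \<xi> :: 'a assume "norm \<xi> \<le> real m * (3/2 * 2 ^ ?l)"
    also have "\<dots> \<le> 2 ^ (?l + 2 * m - 1)" by (rule bandlimit_count)
    also have "?l + 2 * m - 1 = j - 1" using l by simp
    finally show "lp_symbol \<Psi> j \<xi> = 0" by (rule lp_symbol_eq_0_low) (use l in simp)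
  qed
qed

text \<open>
  Replacing \<open>j\<close> by the truncated difference \<open>j - 2 * m\<close> only costs a constant. For \<open>j \<le> 2 * m\<close> the left-hand side
  is one and the total exponent on the right-hand side is nonnegative.
\<close>

lemma decay_shift:
  assumes "0 \<le> g" "g' \<le> g"
  shows "(2::real) powr (- real (j - 2 * m) * g) \<le> 2 powr (2 * real m * g) * 2 powr (- real j * g')"
proof -
  have "- real (j - 2 * m) * g \<le> - (real j - 2 * real m) * g"
    using assms by (intro mult_right_mono) auto
  also have "\<dots> = 2 * real m * g + - real j * g" by (simp add: algebra_simps)
  also have "\<dots> \<le> 2 * real m * g + - real j * g'" using mult_left_mono[OF assms(2), of "real j"] by simp
  finally show ?thesis unfolding powr_add[symmetric] by (intro powr_mono) auto
qed

text \<open>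
  With \<open>l = j - 2 * m\<close>, the increment of the product from \<open>l\<close> to \<open>T\<close> equals \<open>H R\<close> plus the remainder, where \<open>H\<close> is the
  increment of the first factor and \<open>R\<close> the product of the other factors at \<open>l\<close>. Applying the \<open>j\<close>-th block
  annihilates the product at \<open>l\<close>, and it turns \<open>H\<close> into the \<open>j\<close>-th block of the first factor. So the error consists of
  a commutator and of the smoothed remainder.
\<close>

lemma product_block_estimate:
  "\<exists>C \<eta>. 0 < C \<and> 0 < \<eta> \<and> (\<forall>u A j T. blocks_le u A \<longrightarrow> Suc j < T \<longrightarrow>
     Lnorm_le lborel \<pi> (\<lambda>x. norm (smoothing (lp_symbol \<Psi> j) (full_product u T) x
         - (\<Prod>i=2..m. partial_sum (u i) (j - 2 * m) x) * lp_block \<Psi> j (u 1) x))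
       (C * (\<Prod>i=1..m. A i) * 2 powr (- real j * (s 1 + \<eta>))))"
proof -
  have one: "1 \<in> {1..m}" using m by simp
  define \<gamma> where "\<gamma> = (\<Sum>i=2..m. \<beta> i)"
  have \<gamma>: "0 < \<gamma>" unfolding \<gamma>_def using m beta by (intro sum_pos) auto
  have \<pi>: "\<pi> = \<beta> 1 + \<gamma>" unfolding \<pi>_def \<gamma>_def by (rule split_first_sum)
  have b1: "0 < \<beta> 1" by (rule beta_pos[OF one])
  have bg: "\<beta> 1 + \<gamma> \<le> 1" using pi_bounds \<pi> by simp
  obtain C1 where C1: "C1 > 0" "\<And>j H R A A' B B'. continuous_on UNIV H \<Longrightarrow> continuous_on UNIV R \<Longrightarrow> (\<forall>x. norm (H x) \<le> B) \<Longrightarrow> (\<forall>x. norm (R x) \<le> B') \<Longrightarrow>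
     0 \<le> A' \<Longrightarrow> Lnorm_le lborel (\<beta> 1) (\<lambda>x. norm (H x)) A \<Longrightarrow>
     (\<forall>z. Lnorm_le lborel \<gamma> (\<lambda>x. norm (R (x + z) - R x)) (A' * norm z powr eps)) \<Longrightarrow>
     Lnorm_le lborel (\<beta> 1 + \<gamma>) (\<lambda>x. norm (smoothing (lp_symbol \<Psi> j) (\<lambda>x. H x * R x) x - R x * smoothing (lp_symbol \<Psi> j) H x))
       (C1 * 2 powr (- real j * eps) * A * A')"
    using commutator_Lnorm[OF eps(1) b1 \<gamma> bg] by blast
  obtain C2 where C2: "C2 > 0" "\<And>u A l z. blocks_le u A \<Longrightarrow>
    Lnorm_le lborel \<gamma> (\<lambda>x. norm ((\<Prod>i=2..m. partial_sum (u i) l (x + z)) - (\<Prod>i=2..m. partial_sum (u i) l x)))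
      (C2 * (\<Prod>i=2..m. A i) * norm z powr eps)"
    using product_modulus unfolding \<gamma>_def by blast
  obtain C3 g where C3: "C3 > 0" "s 1 < g" "\<And>u A l T. blocks_le u A \<Longrightarrow> l \<le> T \<Longrightarrow>
    Lnorm_le lborel \<pi> (\<lambda>x. norm (remainder u l T x)) (C3 * (\<Prod>i=1..m. A i) * 2 powr (- real l * g))"
    using remainder_bound by blast
  obtain C4 where C4: "C4 > 0" "\<And>j g A \<beta>. 0 < \<beta> \<Longrightarrow> \<beta> \<le> 1 \<Longrightarrow> continuous_on UNIV g \<Longrightarrow> Lnorm_le lborel \<beta> (\<lambda>x. norm (g x)) A \<Longrightarrow>
     Lnorm_le lborel \<beta> (\<lambda>x. norm (smoothing (lp_symbol \<Psi> j) g x)) (C4 * A)"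
    using smoothing_Lnorm by blast
  define \<eta> where "\<eta> = min eps (g - s 1)"
  have \<eta>: "0 < \<eta>" "\<eta> \<le> eps" "s 1 + \<eta> \<le> g" using eps C3 by (auto simp: \<eta>_def)
  define K1 where "K1 = C1 * sumbound 1 * 2 powr (2 * real m * s 1) * C2"
  define K2 where "K2 = C4 * C3 * 2 powr (2 * real m * g)"
  define K where "K = max K1 K2"
  have K1: "K1 > 0" unfolding K1_def using C1 C2 sumbound(1)[OF one] by simp
  have K: "0 < K" "K1 \<le> K" "K2 \<le> K" using K1 by (auto simp: K_def)
  have main: "Lnorm_le lborel \<pi> (\<lambda>x. norm (smoothing (lp_symbol \<Psi> j) (full_product u T) x
         - (\<Prod>i=2..m. partial_sum (u i) (j - 2 * m) x) * lp_block \<Psi> j (u 1) x))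
       ((2 powr (1 + \<pi>) * K) * (\<Prod>i=1..m. A i) * 2 powr (- real j * (s 1 + \<eta>)))"
    if u: "blocks_le u A" and T: "Suc j < T" for u A j T
  proof -
    let ?\<phi> = "lp_symbol \<Psi> j" and ?l = "j - 2 * m" and ?t = "2 powr (- real j * (s 1 + \<eta>))" and ?A = "\<Prod>i=1..m. A i"
    have u1: "u 1 \<in> tempered_distributions" by (rule blocks_leD(1)[OF u one])
    have ui: "u i \<in> tempered_distributions" if "i \<in> {1..m}" for i by (rule blocks_leD(1)[OF u that])
    have A: "0 \<le> A i" if "i \<in> {1..m}" for i by (rule blocks_leD(2)[OF u that])
    have PA: "0 \<le> ?A" by (intro prod_nonneg A)
    have lT: "?l \<le> T" using T by simp
    define H where "H x = partial_sum (u 1) T x - partial_sum (u 1) ?l x" for x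
    define R where "R x = (\<Prod>i=2..m. partial_sum (u i) ?l x)" for x
    have Hc: "continuous_on UNIV H" unfolding H_def[abs_def] by (intro continuous_on_diff partial_sum_continuous u1)
    have Rc: "continuous_on UNIV R" unfolding R_def[abs_def] by (intro continuous_on_prod partial_sum_continuous ui) auto
    obtain B1 where B1: "\<And>x. norm (partial_sum (u 1) T x) \<le> B1" using partial_sum_bounded[OF u one] by blast
    obtain B2 where B2: "\<And>x. norm (partial_sum (u 1) ?l x) \<le> B2" using partial_sum_bounded[OF u one] by blast
    have Hb: "norm (H x) \<le> B1 + B2" for x unfolding H_def by (rule order_trans[OF norm_triangle_ineq4 add_mono[OF B1 B2]])
    have "\<exists>B. \<forall>x. norm (R x) \<le> B" unfolding R_def by (rule prod_bounded[OF u]) auto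
    then obtain B3 where B3: "\<And>x. norm (R x) \<le> B3" by blast
    obtain B4 where B4: "\<And>x. norm (full_product u T x) \<le> B4" using prod_bounded[OF u order_refl] by blast
    obtain B5 where B5: "\<And>x. norm (full_product u ?l x) \<le> B5" using prod_bounded[OF u order_refl] by blast
    have HRc: "continuous_on UNIV (\<lambda>x. H x * R x)" by (intro continuous_on_mult Hc Rc)
    have "0 \<le> B1 + B2" using order_trans[OF norm_ge_zero Hb] .
    then have HRb: "norm (H x * R x) \<le> (B1 + B2) * B3" for x unfolding norm_mult by (intro mult_mono Hb B3) auto
    note Fc = full_product_continuous[OF u, of UNIV]
    have Dc: "continuous_on UNIV (\<lambda>x. full_product u T x - full_product u ?l x)" by (intro continuous_on_diff Fc)
    have Db: "norm (full_product u T x - full_product u ?l x) \<le> B4 + B5" for x by (rule order_trans[OF norm_triangle_ineq4 add_mono[OF B4 B5]])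
    have rem: "remainder u ?l T = (\<lambda>x. (full_product u T x - full_product u ?l x) - H x * R x)"
      by (rule ext) (simp add: remainder_def H_def R_def)
    have remc: "continuous_on UNIV (remainder u ?l T)" unfolding rem by (intro continuous_on_diff Dc HRc)
    have sH: "smoothing ?\<phi> H x = lp_block \<Psi> j (u 1) x" for x
    proof -
      have "smoothing ?\<phi> H x = smoothing ?\<phi> (partial_sum (u 1) T) x - smoothing ?\<phi> (partial_sum (u 1) ?l) x"
        unfolding H_def[abs_def] by (rule smoothing_diff[OF partial_sum_continuous[OF u1] partial_sum_continuous[OF u1] lp_symbol_schwartz B1 B2])
      also have "smoothing ?\<phi> (partial_sum (u 1) ?l) x = 0" using m by (intro smoothing_partial_sum_low[OF u1]) auto
      also have "smoothing ?\<phi> (partial_sum (u 1) T) x = lp_block \<Psi> j (u 1) x" by (rule smoothing_partial_sum_high[OF u1 T])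
      finally show ?thesis by simp
    qed
    have eq: "smoothing ?\<phi> (full_product u T) x - R x * lp_block \<Psi> j (u 1) x
       = (smoothing ?\<phi> (\<lambda>x. H x * R x) x - R x * smoothing ?\<phi> H x) + smoothing ?\<phi> (remainder u ?l T) x" for x
    proof -
      have "smoothing ?\<phi> (remainder u ?l T) x = smoothing ?\<phi> (\<lambda>x. full_product u T x - full_product u ?l x) x - smoothing ?\<phi> (\<lambda>x. H x * R x) x"
        unfolding rem by (rule smoothing_diff[OF Dc HRc lp_symbol_schwartz Db HRb])
      also have "smoothing ?\<phi> (\<lambda>x. full_product u T x - full_product u ?l x) x = smoothing ?\<phi> (full_product u T) x - smoothing ?\<phi> (full_product u ?l) x"
        by (rule smoothing_diff[OF Fc Fc lp_symbol_schwartz B4 B5])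
      finally show ?thesis unfolding smoothing_full_product_low[OF u] sH by simp
    qed
    have "Lnorm_le lborel \<pi> (\<lambda>x. norm (smoothing ?\<phi> (\<lambda>x. H x * R x) x - R x * smoothing ?\<phi> H x))
       (C1 * 2 powr (- real j * eps) * (sumbound 1 * A 1 * 2 powr (- real ?l * gain 1 (\<beta> 1))) * (C2 * (\<Prod>i=2..m. A i)))"
      unfolding \<pi>
    proof (rule C1(2)[OF Hc Rc])
      show "\<forall>x. norm (H x) \<le> B1 + B2" using Hb by blast
      show "\<forall>x. norm (R x) \<le> B3" using B3 by blast
      show "0 \<le> C2 * (\<Prod>i=2..m. A i)" using C2(1) A by (intro mult_nonneg_nonneg prod_nonneg) auto
      show "Lnorm_le lborel (\<beta> 1) (\<lambda>x. norm (H x)) (sumbound 1 * A 1 * 2 powr (- real ?l * gain 1 (\<beta> 1)))"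
        unfolding H_def by (rule sumbound(3)[OF one u lT])
      show "\<forall>z. Lnorm_le lborel \<gamma> (\<lambda>x. norm (R (x + z) - R x)) (C2 * (\<Prod>i=2..m. A i) * norm z powr eps)"
        unfolding R_def using C2(2)[OF u] by blast
    qed
    moreover have "C1 * 2 powr (- real j * eps) * (sumbound 1 * A 1 * 2 powr (- real ?l * gain 1 (\<beta> 1))) * (C2 * (\<Prod>i=2..m. A i)) \<le> K * ?A * ?t"
    proof -
      have g1: "gain 1 (\<beta> 1) = s 1" unfolding gain_def beta1 by simp
      have pa: "?A = A 1 * (\<Prod>i=2..m. A i)" by (rule split_first_prod)
      have "2 powr (- real j * eps) * 2 powr (- real ?l * s 1) \<le> 2 powr (- real j * \<eta>) * (2 powr (2 * real m * s 1) * 2 powr (- real j * s 1))"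
        using s1 \<eta> by (intro mult_mono two_powr_decay_mono decay_shift) auto
      also have "\<dots> = 2 powr (2 * real m * s 1) * ?t"
        by (simp add: powr_add[symmetric] algebra_simps)
      finally have e: "2 powr (- real j * eps) * 2 powr (- real ?l * s 1) \<le> 2 powr (2 * real m * s 1) * ?t" .
      have "C1 * 2 powr (- real j * eps) * (sumbound 1 * A 1 * 2 powr (- real ?l * gain 1 (\<beta> 1))) * (C2 * (\<Prod>i=2..m. A i))
        = (C1 * sumbound 1 * C2 * ?A) * (2 powr (- real j * eps) * 2 powr (- real ?l * s 1))"
        unfolding g1 pa by (simp only: mult_ac)
      also have "\<dots> \<le> (C1 * sumbound 1 * C2 * ?A) * (2 powr (2 * real m * s 1) * ?t)"
        using C1(1) C2(1) sumbound(1)[OF one] PA by (intro mult_left_mono e) auto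
      also have "\<dots> = K1 * (?A * ?t)" unfolding K1_def by (simp only: mult_ac)
      also have "\<dots> \<le> K * (?A * ?t)" using PA by (intro mult_right_mono K) auto
      finally show ?thesis by (simp only: mult.assoc)
    qed
    ultimately have L1: "Lnorm_le lborel \<pi> (\<lambda>x. norm (smoothing ?\<phi> (\<lambda>x. H x * R x) x - R x * smoothing ?\<phi> H x)) (K * ?A * ?t)"
      by (rule Lnorm_le_weaken[OF _ _ pi_bounds(1)])
    have "Lnorm_le lborel \<pi> (\<lambda>x. norm (smoothing ?\<phi> (remainder u ?l T) x)) (C4 * (C3 * ?A * 2 powr (- real ?l * g)))"
      by (rule C4(2)[OF _ _ remc C3(3)[OF u lT]]) (use pi_bounds in auto)
    moreover have "C4 * (C3 * ?A * 2 powr (- real ?l * g)) \<le> K * ?A * ?t"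
    proof -
      have "C4 * (C3 * ?A * 2 powr (- real ?l * g)) \<le> C4 * (C3 * ?A * (2 powr (2 * real m * g) * ?t))"
        using C3(1,2) C4(1) PA s1 \<eta> by (intro mult_left_mono decay_shift) auto
      also have "\<dots> = K2 * (?A * ?t)" unfolding K2_def by (simp only: mult_ac)
      also have "\<dots> \<le> K * (?A * ?t)" using PA by (intro mult_right_mono K) auto
      finally show ?thesis by (simp only: mult.assoc)
    qed
    ultimately have L2: "Lnorm_le lborel \<pi> (\<lambda>x. norm (smoothing ?\<phi> (remainder u ?l T) x)) (K * ?A * ?t)"
      by (rule Lnorm_le_weaken[OF _ _ pi_bounds(1)])
    have [measurable]: "R \<in> borel_measurable borel" "smoothing ?\<phi> (full_product u T) \<in> borel_measurable borel" "lp_block \<Psi> j (u 1) \<in> borel_measurable borel"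
      by (intro borel_measurable_continuous_onI Rc smoothing_measurable Fc lp_symbol_schwartz lp_block_continuous u1)+
    have "Lnorm_le lborel \<pi> (\<lambda>x. norm (smoothing ?\<phi> (full_product u T) x - R x * lp_block \<Psi> j (u 1) x)) (2 powr (1 + \<pi>) * (K * ?A * ?t))"
    proof (rule Lnorm_le_mono[OF Lnorm_le_add[OF L1 L2 pi_bounds(1)]])
      show "(\<lambda>x. norm (smoothing ?\<phi> (full_product u T) x - R x * lp_block \<Psi> j (u 1) x)) \<in> borel_measurable lborel" by measurable
      show "norm (smoothing ?\<phi> (full_product u T) x - R x * lp_block \<Psi> j (u 1) x)
        \<le> norm (smoothing ?\<phi> (\<lambda>x. H x * R x) x - R x * smoothing ?\<phi> H x) + norm (smoothing ?\<phi> (remainder u ?l T) x)" for x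
        unfolding eq by (rule norm_triangle_ineq)
    qed (use pi_bounds in auto)
    then show ?thesis unfolding R_def by (simp only: mult.assoc)
  qed
  have "2 powr (1 + \<pi>) * K > 0" using K by simp
  then show ?thesis using \<eta>(1) main by blast
qed

end

section \<open>Existence of the product\<close>

lemma Lnorm_le_weight:
  assumes \<gamma>: "0 < \<gamma>" "\<gamma> \<le> 1"
  shows "\<exists>c>0. Lnorm_le lborel \<gamma> (\<lambda>x::'a::euclidean_space. 1 / (1 + norm x) ^ (2 * DIM('a))) c"
proof -
  let ?w = "\<lambda>x::'a. 1 / (1 + norm x) ^ (2 * DIM('a))"
  obtain W where W: "W > 0" "(\<integral>\<^sup>+x. ennreal (?w x) \<partial>lborel) \<le> ennreal W"
    by (rule integrable_nn_integral_le[OF integrable_weight]) auto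
  have w: "0 \<le> ?w x" "?w x \<le> 1" for x by (auto simp: divide_le_eq_1 intro!: one_le_power zero_less_power add_pos_nonneg)
  have "(\<integral>\<^sup>+x. ennreal (?w x powr (1 / \<gamma>)) \<partial>lborel) \<le> (\<integral>\<^sup>+x. ennreal (?w x) \<partial>lborel)"
  proof (intro nn_integral_mono ennreal_leI)
    fix x
    show "?w x powr (1 / \<gamma>) \<le> ?w x" using powr_mono'[of 1 "1 / \<gamma>" "?w x"] \<gamma> w[of x] by simp
  qed
  also note W(2)
  also have "ennreal W = ennreal ((W powr \<gamma>) powr (1 / \<gamma>))" using \<gamma> W by (simp add: powr_powr)
  finally have "Lnorm_le lborel \<gamma> ?w (W powr \<gamma>)" unfolding Lnorm_le_def by simp
  then show ?thesis using W(1) by (intro exI[of _ "W powr \<gamma>"]) simp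
qed

lemma schwartz_weight_le_seminorm:
  "\<eta> \<in> schwartz_space \<Longrightarrow> (1 + norm x) ^ N * norm (\<eta> x) \<le> schwartz_seminorm N \<eta>"
proof -
  assume \<eta>: "\<eta> \<in> schwartz_space"
  have "norm (iter_deriv [] \<eta> x) \<le> (\<Sum>bs\<in>deriv_lists N. norm (iter_deriv bs \<eta> x))"
    by (rule member_le_sum) (use finite_deriv_lists in \<open>auto simp: deriv_lists_def\<close>)
  then have "(1 + norm x) ^ N * norm (\<eta> x) \<le> schwartz_weight N \<eta> x"
    unfolding schwartz_weight_def by (intro mult_left_mono) auto
  also have "\<dots> \<le> schwartz_seminorm N \<eta>"
    unfolding schwartz_seminorm_def using \<eta> by (intro cSUP_upper) (auto simp: schwartz_space_def)
  finally show ?thesis .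
qed

lemma schwartz_Lnorm:
  assumes \<gamma>: "0 < \<gamma>" "\<gamma> \<le> 1"
  shows "\<exists>c>0. \<forall>\<eta>\<in>(schwartz_space :: ('a::euclidean_space \<Rightarrow> complex) set).
    Lnorm_le lborel \<gamma> (\<lambda>x. norm (\<eta> x)) (c * schwartz_seminorm (2 * DIM('a)) \<eta>)"
proof -
  let ?w = "\<lambda>x::'a. 1 / (1 + norm x) ^ (2 * DIM('a))"
  obtain c where c: "c > 0" "Lnorm_le lborel \<gamma> ?w c" using Lnorm_le_weight[OF \<gamma>] by blast
  have "Lnorm_le lborel \<gamma> (\<lambda>x. norm (\<eta> x)) (c * schwartz_seminorm (2 * DIM('a)) \<eta>)" if \<eta>: "\<eta> \<in> schwartz_space" for \<eta> :: "'a \<Rightarrow> complex"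
  proof -
    let ?S = "schwartz_seminorm (2 * DIM('a)) \<eta>"
    note le = schwartz_weight_le_seminorm[OF \<eta>, where N="2 * DIM('a)"]
    have S: "0 \<le> ?S" using order_trans[OF _ le[of 0]] by simp
    have "Lnorm_le lborel \<gamma> (\<lambda>x. norm (\<eta> x)) (?S * c)"
    proof (rule Lnorm_le_mono[OF Lnorm_le_cmult[OF c(2) S]])
      show "(\<lambda>x. norm (\<eta> x)) \<in> borel_measurable lborel" using schwartz_measurable[OF \<eta>] by simp
      fix x :: 'a
      have p: "(1 + norm x) ^ (2 * DIM('a)) > 0" by (intro zero_less_power add_pos_nonneg) auto
      show "norm (\<eta> x) \<le> ?S * ?w x" using le[of x] p by (simp add: pos_le_divide_eq mult.commute)
    qed (use \<gamma> in auto)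
    then show ?thesis by (simp add: mult.commute)
  qed
  then show ?thesis using c(1) by blast
qed

text \<open>Hoelder's inequality for dual exponents.\<close>

lemma Lnorm_pairing:
  fixes F \<eta> :: "'b \<Rightarrow> complex"
  assumes "Lnorm_le M \<beta> (\<lambda>x. norm (F x)) A" "Lnorm_le M (1 - \<beta>) (\<lambda>x. norm (\<eta> x)) B" "0 < \<beta>" "\<beta> < 1"
  shows "norm (\<integral>x. F x * \<eta> x \<partial>M) \<le> A * B"
proof -
  have "Lnorm_le M (\<beta> + (1 - \<beta>)) (\<lambda>x. norm (F x) * norm (\<eta> x)) (A * B)"
    using assms by (intro Lnorm_le_mult) auto
  then have L: "Lnorm_le M 1 (\<lambda>x. norm (F x) * norm (\<eta> x)) (A * B)" by simp
  have AB: "0 \<le> A * B" by (rule Lnorm_leD(3)[OF L])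
  have "ennreal (norm (\<integral>x. F x * \<eta> x \<partial>M)) \<le> (\<integral>\<^sup>+x. ennreal (norm (F x * \<eta> x)) \<partial>M)" by (rule norm_integral_le_nn_integral)
  also have "\<dots> \<le> ennreal (A * B)" using Lnorm_leD(4)[OF L] AB by (simp add: norm_mult)
  finally show ?thesis using AB by simp
qed

context product_exponents
begin

text \<open>
  The limit of the truncated products as functionals. Outside the Schwartz space the value is arbitrary.
\<close>

definition product_dist :: "(nat \<Rightarrow> 'a functional) \<Rightarrow> 'a functional" where
  "product_dist u \<eta> = lim (\<lambda>J. \<integral>x. full_product u (Suc J) x * \<eta> x \<partial>lborel)"

lemma full_product_integrable:
  assumes u: "blocks_le u A" and \<eta>: "\<eta> \<in> schwartz_space"
  shows "integrable lborel (\<lambda>x. full_product u T x * \<eta> x)"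
proof -
  obtain B where B: "\<And>x. norm (full_product u T x) \<le> B" using prod_bounded[OF u order_refl] by blast
  note [measurable] = full_product_measurable[OF u] schwartz_measurable[OF \<eta>]
  show ?thesis
  proof (rule Bochner_Integration.integrable_bound[OF integrable_mult_right[OF integrable_norm[OF schwartz_integrable[OF \<eta>]], of B]])
    show "AE x in lborel. norm (full_product u T x * \<eta> x) \<le> norm (B * norm (\<eta> x))"
      unfolding norm_mult real_norm_def abs_mult abs_norm_cancel
      by (intro AE_I2 mult_right_mono order_trans[OF B abs_ge_self] norm_ge_zero)
  qed measurable
qed

text \<open>
  The truncated products are Cauchy in \<open>L\<^sub>p\<close> and Schwartz functions lie in the dual space, with norm
  bounded by a seminorm. Starting the Cauchy estimate at the empty product, which is \<open>0\<close>, also gives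
  the bound for the limit.
\<close>

lemma product_dist_bounds:
  "\<exists>C>0. \<forall>u A. blocks_le u A \<longrightarrow> (\<forall>\<eta>\<in>schwartz_space.
     ((\<lambda>J. \<integral>x. full_product u (Suc J) x * \<eta> x \<partial>lborel) \<longlonglongrightarrow> product_dist u \<eta>) \<and>
     norm (product_dist u \<eta>) \<le> C * (\<Prod>i=1..m. A i) * schwartz_seminorm (2 * DIM('a)) \<eta>)"
proof -
  obtain C where C: "C > 0" "\<And>u A l T. blocks_le u A \<Longrightarrow> l \<le> T \<Longrightarrow>
    Lnorm_le lborel \<pi> (\<lambda>x. norm (full_product u T x - full_product u l x)) (C * (\<Prod>i=1..m. A i) * 2 powr (- real l * eps))"
    using full_product_cauchy by blast
  obtain c where c: "c > 0" "\<And>\<eta>::'a \<Rightarrow> complex. \<eta> \<in> schwartz_space \<Longrightarrow> Lnorm_le lborel (1 - \<pi>) (\<lambda>x. norm (\<eta> x)) (c * schwartz_seminorm (2 * DIM('a)) \<eta>)"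
    using schwartz_Lnorm[of "1 - \<pi>"] pi_bounds by auto
  have "((\<lambda>J. \<integral>x. full_product u (Suc J) x * \<eta> x \<partial>lborel) \<longlonglongrightarrow> product_dist u \<eta>) \<and>
     norm (product_dist u \<eta>) \<le> (C * c) * (\<Prod>i=1..m. A i) * schwartz_seminorm (2 * DIM('a)) \<eta>"
    if u: "blocks_le u A" and \<eta>: "\<eta> \<in> schwartz_space" for u A \<eta>
  proof
    let ?X = "\<lambda>T. \<integral>x. full_product u T x * \<eta> x \<partial>lborel"
    let ?B = "C * (\<Prod>i=1..m. A i) * (c * schwartz_seminorm (2 * DIM('a)) \<eta>)"
    have diff: "norm (?X T - ?X l) \<le> 2 powr (- real l * eps) * ?B" if "l \<le> T" for l T
    proof -
      have "?X T - ?X l = (\<integral>x. (full_product u T x - full_product u l x) * \<eta> x \<partial>lborel)"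
        unfolding left_diff_distrib using full_product_integrable[OF u \<eta>] by simp
      also have "norm \<dots> \<le> (C * (\<Prod>i=1..m. A i) * 2 powr (- real l * eps)) * (c * schwartz_seminorm (2 * DIM('a)) \<eta>)"
        by (rule Lnorm_pairing[OF C(2)[OF u that] c(2)[OF \<eta>] pi_bounds])
      finally show ?thesis by (simp only: mult_ac)
    qed
    have B: "0 \<le> ?B" using order_trans[OF norm_ge_zero diff[of 0 0]] by simp
    have t: "2 powr (- real l * eps) = (2 powr (- eps)) ^ l" for l
      by (simp add: powr_realpow[symmetric] powr_powr mult.commute)
    have "(\<lambda>l. (2 powr (- eps)) ^ l) \<longlonglongrightarrow> 0" using eps by (intro LIMSEQ_realpow_zero) (auto simp: powr_less_one)
    then have lim0: "(\<lambda>l. 2 powr (- real l * eps) * ?B) \<longlonglongrightarrow> 0" unfolding t by (rule tendsto_mult_left_zero)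
    have "Cauchy ?X"
    proof (rule CauchyI')
      fix e :: real assume "0 < e"
      with lim0 have "eventually (\<lambda>l. 2 powr (- real l * eps) * ?B < e) sequentially" by (rule order_tendstoD(2))
      then obtain M where M: "\<And>l. l \<ge> M \<Longrightarrow> 2 powr (- real l * eps) * ?B < e" unfolding eventually_sequentially by blast
      show "\<exists>M. \<forall>m\<ge>M. \<forall>n>m. dist (?X m) (?X n) < e"
      proof (intro exI[of _ M] allI impI)
        fix a b assume "M \<le> a" "a < b"
        then show "dist (?X a) (?X b) < e" using diff[of a b] M[of a] by (simp add: dist_norm norm_minus_commute)
      qed
    qed
    then have "convergent (\<lambda>J. ?X (Suc J))" 
      by (rule iffD2[OF convergent_Suc_iff[of ?X] Cauchy_convergent])
    then show lim: "(\<lambda>J. ?X (Suc J)) \<longlonglongrightarrow> product_dist u \<eta>" unfolding product_dist_def by (simp add: convergent_LIMSEQ_iff)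
    \<comment> \<open>the product of empty partial sums vanishes, as there is at least one factor\<close>
    have "?X 0 = 0" using m by (simp add: partial_sum_0)
    then have "norm (?X T) \<le> ?B" for T using diff[of 0 T] by simp
    then have "norm (product_dist u \<eta>) \<le> ?B" by (intro LIMSEQ_le_const2[OF tendsto_norm[OF lim]]) auto
    then show "norm (product_dist u \<eta>) \<le> (C * c) * (\<Prod>i=1..m. A i) * schwartz_seminorm (2 * DIM('a)) \<eta>" by (simp only: mult_ac)
  qed
  then show ?thesis using C(1) c(1) by (intro exI[of _ "C * c"]) auto
qed

lemma product_dist_LIMSEQ:
  "blocks_le u A \<Longrightarrow> \<eta> \<in> schwartz_space \<Longrightarrow> (\<lambda>J. \<integral>x. full_product u (Suc J) x * \<eta> x \<partial>lborel) \<longlonglongrightarrow> product_dist u \<eta>"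
  using product_dist_bounds by blast

lemma product_dist_tempered:
  assumes u: "blocks_le u A" shows "product_dist u \<in> tempered_distributions"
proof -
  note lim = product_dist_LIMSEQ[OF u]
  have "product_dist u (\<lambda>x. f x + g x) = product_dist u f + product_dist u g" if f: "f \<in> schwartz_space" and g: "g \<in> schwartz_space" for f g
  proof (rule LIMSEQ_unique[OF lim[OF schwartz_add[OF f g]]])
    show "(\<lambda>J. \<integral>x. full_product u (Suc J) x * (f x + g x) \<partial>lborel) \<longlonglongrightarrow> product_dist u f + product_dist u g"
      using tendsto_add[OF lim[OF f] lim[OF g]] full_product_integrable[OF u f] full_product_integrable[OF u g]
      by (simp add: distrib_left)
  qed
  moreover have "product_dist u (\<lambda>x. c * f x) = c * product_dist u f" if f: "f \<in> schwartz_space" for f c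
  proof (rule LIMSEQ_unique[OF lim[OF schwartz_cmult[OF f]]])
    show "(\<lambda>J. \<integral>x. full_product u (Suc J) x * (c * f x) \<partial>lborel) \<longlonglongrightarrow> c * product_dist u f"
      using tendsto_mult_left[OF lim[OF f], of c] by (simp add: mult.left_commute)
  qed
  moreover have "\<exists>N C. \<forall>f\<in>schwartz_space. norm (product_dist u f) \<le> C * schwartz_seminorm N f"
    using product_dist_bounds u by blast
  ultimately show ?thesis unfolding tempered_distributions_def by blast
qed

lemma product_dist_is_product:
  assumes u: "blocks_le u A" shows "is_product \<Psi> m u (product_dist u)"
  unfolding is_product_def
proof (intro conjI ballI product_dist_tempered[OF u])
  fix \<eta> :: "'a \<Rightarrow> complex" assume \<eta>: "\<eta> \<in> schwartz_space"
  have "(\<Prod>i=1..m. lp_lowpass \<Psi> j (u i) x) = full_product u (Suc j) x" for j x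
    by (intro prod.cong refl) (simp add: lp_lowpass_partial_sum blocks_leD(1)[OF u])
  then show "(\<lambda>j. \<integral>x. (\<Prod>i=1..m. lp_lowpass \<Psi> j (u i) x) * \<eta> x \<partial>lborel) \<longlonglongrightarrow> product_dist u \<eta>"
    using product_dist_LIMSEQ[OF u \<eta>] by simp
qed

text \<open>
  A block at \<open>x\<close> is the value on a translated kernel, that is on a Schwartz function.
\<close>

lemma lp_block_product_dist:
  assumes u: "blocks_le u A"
  shows "(\<lambda>J. smoothing (lp_symbol \<Psi> j) (full_product u (Suc J)) x) \<longlonglongrightarrow> lp_block \<Psi> j (product_dist u) x"
  unfolding lp_block_eq[OF product_dist_tempered[OF u]] multiplier_fun_def smoothing_def
  by (intro product_dist_LIMSEQ[OF u] schwartz_translate mkernel_schwartz lp_symbol_schwartz)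

lemma product_dist_block_estimate:
  "\<exists>C \<eta>. 0 < C \<and> 0 < \<eta> \<and> (\<forall>u A j. blocks_le u A \<longrightarrow>
     Lnorm_le lborel \<pi> (\<lambda>x. norm (lp_block \<Psi> j (product_dist u) x
         - (\<Prod>i=2..m. partial_sum (u i) (j - 2 * m) x) * lp_block \<Psi> j (u 1) x))
       (C * (\<Prod>i=1..m. A i) * 2 powr (- real j * (s 1 + \<eta>))))"
proof -
  obtain C \<eta> where C: "0 < C" "0 < \<eta>" "\<And>u A j T. blocks_le u A \<Longrightarrow> Suc j < T \<Longrightarrow>
     Lnorm_le lborel \<pi> (\<lambda>x. norm (smoothing (lp_symbol \<Psi> j) (full_product u T) x
         - (\<Prod>i=2..m. partial_sum (u i) (j - 2 * m) x) * lp_block \<Psi> j (u 1) x))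
       (C * (\<Prod>i=1..m. A i) * 2 powr (- real j * (s 1 + \<eta>)))"
    using product_block_estimate by blast
  have "Lnorm_le lborel \<pi> (\<lambda>x. norm (lp_block \<Psi> j (product_dist u) x
         - (\<Prod>i=2..m. partial_sum (u i) (j - 2 * m) x) * lp_block \<Psi> j (u 1) x))
       (C * (\<Prod>i=1..m. A i) * 2 powr (- real j * (s 1 + \<eta>)))" if u: "blocks_le u A" for u A j
  proof (rule Lnorm_le_limit[OF C(3)[OF u, of j "Suc (n + (j + 2))" for n]])
    show "Suc j < Suc (n + (j + 2))" for n by simp
    show "(\<lambda>n. norm (smoothing (lp_symbol \<Psi> j) (full_product u (Suc (n + (j + 2)))) x - (\<Prod>i=2..m. partial_sum (u i) (j - 2 * m) x) * lp_block \<Psi> j (u 1) x))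
      \<longlonglongrightarrow> norm (lp_block \<Psi> j (product_dist u) x - (\<Prod>i=2..m. partial_sum (u i) (j - 2 * m) x) * lp_block \<Psi> j (u 1) x)" for x
      by (intro tendsto_norm tendsto_diff tendsto_const LIMSEQ_ignore_initial_segment[OF lp_block_product_dist[OF u]])
  qed (rule pi_bounds)
  then show ?thesis using C(1,2) by blast
qed

end

section \<open>Mixed norms as suprema of finite ones\<close>

text \<open>
  The \<open>l\<^sub>q\<close>-norm of the first \<open>J + 1\<close> terms, as a real number. Working with it keeps all quantities
  finite until a single monotone limit at the end.
\<close>

definition finite_lq :: "ennreal \<Rightarrow> nat \<Rightarrow> (nat \<Rightarrow> real) \<Rightarrow> real" where
  "finite_lq q J a = (if q = top then Max (a ` {..J})
     else (\<Sum>j\<le>J. a j powr enn2real q) powr (1 / enn2real q))"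

lemma enn2real_exponent_pos: "0 < q \<Longrightarrow> q \<noteq> top \<Longrightarrow> 0 < enn2real q"
  by (simp add: enn2real_positive_iff top.not_eq_extremum)

lemma finite_lq_nonneg: "(\<And>j. 0 \<le> a j) \<Longrightarrow> 0 \<le> finite_lq q J a"
  unfolding finite_lq_def by (auto simp: Max_ge_iff intro!: bexI[of _ 0])

lemma finite_lq_mono:
  assumes "0 < q" "\<And>j. j \<le> J \<Longrightarrow> a j \<le> b j" "\<And>j. 0 \<le> a j"
  shows "finite_lq q J a \<le> finite_lq q J b"
proof (cases "q = top")
  case True
  have "a j \<le> Max (b ` {..J})" if "j \<le> J" for j
    by (rule order_trans[OF assms(2)[OF that] Max_ge]) (use that in auto)
  then show ?thesis unfolding finite_lq_def using True by auto
next
  case False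
  have Q: "0 < enn2real q" by (rule enn2real_exponent_pos[OF assms(1) False])
  have "(\<Sum>j\<le>J. a j powr enn2real q) \<le> (\<Sum>j\<le>J. b j powr enn2real q)"
    using Q assms by (intro sum_mono powr_mono2) auto
  then show ?thesis unfolding finite_lq_def using False Q by (auto intro!: powr_mono2 sum_nonneg)
qed

lemma finite_lq_mono_length:
  assumes "0 < q" "J \<le> K" "\<And>j. 0 \<le> a j"
  shows "finite_lq q J a \<le> finite_lq q K a"
proof (cases "q = top")
  case True
  then show ?thesis unfolding finite_lq_def using assms by (auto intro!: Max_mono)
next
  case False
  have Q: "0 < enn2real q" by (rule enn2real_exponent_pos[OF assms(1) False])
  have "(\<Sum>j\<le>J. a j powr enn2real q) \<le> (\<Sum>j\<le>K. a j powr enn2real q)"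
    using assms by (intro sum_mono2) auto
  then show ?thesis unfolding finite_lq_def using False Q by (auto intro!: powr_mono2 sum_nonneg)
qed

lemma finite_lq_ge:
  assumes "0 < q" "j \<le> J" "\<And>j. 0 \<le> a j"
  shows "a j \<le> finite_lq q J a"
proof (cases "q = top")
  case True
  then show ?thesis unfolding finite_lq_def using assms by auto
next
  case False
  have Q: "0 < enn2real q" by (rule enn2real_exponent_pos[OF assms(1) False])
  have "a j powr enn2real q \<le> (\<Sum>j\<le>J. a j powr enn2real q)"
    using assms by (intro member_le_sum) auto
  then have "(a j powr enn2real q) powr (1 / enn2real q) \<le> finite_lq q J a"
    unfolding finite_lq_def using False Q by (auto intro!: powr_mono2)
  then show ?thesis using Q assms(3)[of j] by (simp add: powr_powr)
qed

lemma finite_lq_cmult: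
  assumes "0 < q" "0 \<le> c"
  shows "finite_lq q J (\<lambda>j. c * a j) = c * finite_lq q J a"
proof (cases "q = top")
  case True
  have "mono (\<lambda>x::real. c * x)" using assms by (auto intro!: monoI mult_left_mono)
  from mono_Max_commute[OF this, of "a ` {..J}"]
  have "c * Max (a ` {..J}) = Max ((\<lambda>j. c * a j) ` {..J})" by (simp add: image_image)
  then show ?thesis unfolding finite_lq_def using True by simp
next
  case False
  have Q: "0 < enn2real q" by (rule enn2real_exponent_pos[OF assms(1) False])
  show ?thesis unfolding finite_lq_def powr_mult sum_distrib_left[symmetric]
    using False Q assms(2) by (simp add: powr_powr)
qed

text \<open>
  A sum is at most twice the maximum, and the maximum is handled by adding the \<open>q\<close>-th powers. This covers all \<open>q\<close>
  uniformly, as \<open>recip q = 0\<close> for \<open>q = \<infinity>\<close>.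
\<close>

lemma finite_lq_add:
  assumes q: "0 < q" and a: "\<And>j. 0 \<le> a j" and b: "\<And>j. 0 \<le> b j"
  shows "finite_lq q J (\<lambda>j. a j + b j) \<le> 2 powr (1 + recip q) * (finite_lq q J a + finite_lq q J b)"
proof -
  have le: "finite_lq q J (\<lambda>j. a j + b j) \<le> finite_lq q J (\<lambda>j. 2 * max (a j) (b j))"
    using a b by (intro finite_lq_mono[OF q]) (auto simp: max_def)
  also have "\<dots> = 2 * finite_lq q J (\<lambda>j. max (a j) (b j))" by (rule finite_lq_cmult[OF q]) simp
  also have "finite_lq q J (\<lambda>j. max (a j) (b j)) \<le> 2 powr recip q * (finite_lq q J a + finite_lq q J b)"
  proof (cases "q = top")
    case True
    have "max (a j) (b j) \<le> finite_lq q J a + finite_lq q J b" if "j \<le> J" for j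
      using finite_lq_ge[of q j J a] finite_lq_ge[of q j J b] finite_lq_nonneg[of a q J] finite_lq_nonneg[of b q J] q a b that by auto
    then have "Max ((\<lambda>j. max (a j) (b j)) ` {..J}) \<le> finite_lq q J a + finite_lq q J b" by auto
    then show ?thesis using True by (simp add: finite_lq_def recip_def)
  next
    case False
    have Q: "0 < enn2real q" by (rule enn2real_exponent_pos[OF q False])
    have rq: "recip q = 1 / enn2real q"
      unfolding recip_def by (cases q) (use False q in \<open>auto simp: ennreal_1[symmetric] divide_ennreal simp del: ennreal_1\<close>)
    let ?S = "finite_lq q J a + finite_lq q J b"
    have S: "0 \<le> ?S" using finite_lq_nonneg[of a q J] a finite_lq_nonneg[of b q J] b by simp
    have pw: "(\<Sum>j\<le>J. c j powr enn2real q) \<le> ?S powr enn2real q"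
      if "finite_lq q J c \<le> ?S" "\<And>j. 0 \<le> c j" for c
    proof -
      have "(\<Sum>j\<le>J. c j powr enn2real q) = finite_lq q J c powr enn2real q"
        unfolding finite_lq_def using False Q by (simp add: powr_powr sum_nonneg)
      also have "\<dots> \<le> ?S powr enn2real q" using that Q by (intro powr_mono2 finite_lq_nonneg) auto
      finally show ?thesis .
    qed
    have "(\<Sum>j\<le>J. max (a j) (b j) powr enn2real q) \<le> (\<Sum>j\<le>J. a j powr enn2real q + b j powr enn2real q)"
      by (intro sum_mono) (auto simp: max_def)
    also have "\<dots> \<le> 2 * ?S powr enn2real q"
      unfolding sum.distrib using pw[of a] pw[of b] a b finite_lq_nonneg[of a q J] a finite_lq_nonneg[of b q J] b by simp
    finally have "finite_lq q J (\<lambda>j. max (a j) (b j)) \<le> (2 * ?S powr enn2real q) powr (1 / enn2real q)"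
      unfolding finite_lq_def[of q J "\<lambda>j. max (a j) (b j)"] using False Q by (auto intro!: powr_mono2 sum_nonneg)
    also have "\<dots> = 2 powr recip q * ?S" unfolding rq powr_mult using Q S by (simp add: powr_powr)
    finally show ?thesis .
  qed
  also have "2 * (2 powr recip q * (finite_lq q J a + finite_lq q J b)) = 2 powr (1 + recip q) * (finite_lq q J a + finite_lq q J b)"
    by (simp add: powr_add)
  finally show ?thesis by simp
qed

text \<open>
  Each term is at most \<open>2 powr (- j * \<eta>)\<close> times the weighted sum, and the sequence of these factors has a finite \<open>l\<^sub>q\<close>-norm. Thus for
  geometrically decaying errors the value of \<open>q\<close> is immaterial.
\<close>

lemma finite_lq_le_weighted_sum:
  assumes q: "0 < q" and \<eta>: "0 < \<eta>"
  shows "\<exists>K>0. \<forall>J a. (\<forall>j. 0 \<le> a j) \<longrightarrow> finite_lq q J a \<le> K * (\<Sum>j\<le>J. 2 powr (real j * \<eta>) * a j)"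
proof -
  have "\<exists>K>0. \<forall>J. finite_lq q J (\<lambda>j. 2 powr (- real j * \<eta>)) \<le> K"
  proof (cases "q = top")
    case True
    have "2 powr (- real j * \<eta>) \<le> 1" for j using \<eta> powr_mono[of "- real j * \<eta>" 0 2] by simp
    then have "finite_lq q J (\<lambda>j. 2 powr (- real j * \<eta>)) \<le> 1" for J unfolding finite_lq_def using True by auto
    then show ?thesis by (intro exI[of _ 1]) auto
  next
    case False
    have Q: "0 < enn2real q" by (rule enn2real_exponent_pos[OF q False])
    define t where "t = 2 powr (- \<eta> * enn2real q)"
    have t: "0 < t" "t < 1" using \<eta> Q by (auto simp: t_def powr_less_one)
    have tj: "(2 powr (- real j * \<eta>)) powr enn2real q = t ^ j" for j
      by (simp add: t_def powr_realpow[symmetric] powr_powr mult_ac)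
    have "finite_lq q J (\<lambda>j. 2 powr (- real j * \<eta>)) \<le> (1 / (1 - t)) powr (1 / enn2real q)" for J
      unfolding finite_lq_def tj using False Q t geometric_tail_sum[of "{..J}" 0 t]
      by (auto intro!: powr_mono2 sum_nonneg)
    then show ?thesis using t by (intro exI[of _ "(1 / (1 - t)) powr (1 / enn2real q)"]) auto
  qed
  then obtain K where K: "K > 0" "\<And>J. finite_lq q J (\<lambda>j. 2 powr (- real j * \<eta>)) \<le> K" by blast
  have "finite_lq q J a \<le> K * (\<Sum>j\<le>J. 2 powr (real j * \<eta>) * a j)" if a: "\<forall>j. 0 \<le> a j" for J a
  proof -
    let ?S = "\<Sum>j\<le>J. 2 powr (real j * \<eta>) * a j"
    have S: "0 \<le> ?S" using a by (intro sum_nonneg) auto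
    have "finite_lq q J a \<le> finite_lq q J (\<lambda>j. ?S * 2 powr (- real j * \<eta>))"
    proof (rule finite_lq_mono[OF q])
      fix j assume "j \<le> J"
      then have "2 powr (real j * \<eta>) * a j \<le> ?S" by (intro member_le_sum[of j _ "\<lambda>j. 2 powr (real j * \<eta>) * a j"]) (use a in auto)
      then have "(2 powr (real j * \<eta>) * a j) * 2 powr (- real j * \<eta>) \<le> ?S * 2 powr (- real j * \<eta>)" by (intro mult_right_mono) auto
      also have "(2 powr (real j * \<eta>) * a j) * 2 powr (- real j * \<eta>) = a j * (2 powr (real j * \<eta>) * 2 powr (- real j * \<eta>))"
        by (simp only: mult_ac)
      also have "\<dots> = a j" unfolding powr_add[symmetric] by simp
      finally show "a j \<le> ?S * 2 powr (- real j * \<eta>)" .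
    qed (use a in auto)
    also have "\<dots> = ?S * finite_lq q J (\<lambda>j. 2 powr (- real j * \<eta>))" by (rule finite_lq_cmult[OF q S])
    also have "\<dots> \<le> ?S * K" by (intro mult_left_mono K S)
    finally show ?thesis by (simp only: mult.commute)
  qed
  then show ?thesis using K(1) by blast
qed

lemma finite_lq_measurable [measurable]:
  assumes [measurable]: "\<And>j. (\<lambda>x. a x j) \<in> borel_measurable M"
  shows "(\<lambda>x. finite_lq q J (a x) :: real) \<in> borel_measurable M"
  unfolding finite_lq_def by (cases "q = top") simp_all

lemma epowr_ennreal: "0 \<le> a \<Longrightarrow> epowr (ennreal a) P = ennreal (a powr P)"
  by (simp add: epowr_def)

text \<open>
  All computations with \<open>epowr\<close> against a finite bound go through this equivalence.
\<close>

lemma epowr_le_iff: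
  assumes "0 < P" "0 \<le> A"
  shows "epowr x P \<le> ennreal A \<longleftrightarrow> x \<le> ennreal (A powr (1 / P))"
proof (cases x)
  case (real r)
  have "r powr P \<le> A \<longleftrightarrow> r \<le> A powr (1 / P)"
  proof
    assume "r powr P \<le> A"
    then have "(r powr P) powr (1 / P) \<le> A powr (1 / P)" using assms by (intro powr_mono2) auto
    then show "r \<le> A powr (1 / P)" using assms real by (simp add: powr_powr)
  next
    assume "r \<le> A powr (1 / P)"
    then have "r powr P \<le> (A powr (1 / P)) powr P" using assms real by (intro powr_mono2) auto
    then show "r powr P \<le> A" using assms by (simp add: powr_powr)
  qed
  then show ?thesis using real assms by (simp add: epowr_ennreal)
qed (use assms in \<open>auto simp: epowr_def top_unique\<close>)

lemma epowr_mono: "0 \<le> P \<Longrightarrow> x \<le> y \<Longrightarrow> epowr x P \<le> epowr y P"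
  by (cases x; cases y) (auto simp: epowr_def top_unique intro!: ennreal_leI powr_mono2)

lemma epowr_SUP:
  assumes P: "0 < P" and b: "\<And>n. 0 \<le> b n"
  shows "epowr (SUP n. ennreal (b n)) P = (SUP n. ennreal (b n powr P))"
proof (rule antisym)
  show "(SUP n. ennreal (b n powr P)) \<le> epowr (SUP n. ennreal (b n)) P"
    unfolding epowr_ennreal[OF b, symmetric] using P by (intro SUP_least epowr_mono SUP_upper) auto
  show "epowr (SUP n. ennreal (b n)) P \<le> (SUP n. ennreal (b n powr P))"
  proof (cases "SUP n. ennreal (b n powr P)")
    case (real t)
    have "ennreal (b n) \<le> ennreal (t powr (1 / P))" for n
    proof -
      have "epowr (ennreal (b n)) P \<le> ennreal t"
        unfolding epowr_ennreal[OF b] using SUP_upper[of n UNIV "\<lambda>n. ennreal (b n powr P)"] real by simp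
      then show ?thesis using epowr_le_iff[OF P] real by simp
    qed
    then have "(SUP n. ennreal (b n)) \<le> ennreal (t powr (1 / P))" by (rule SUP_least)
    then show ?thesis using epowr_le_iff[OF P] real by simp
  next
    case top
    show ?thesis unfolding top by simp
  qed
qed

text \<open>Both norms are limits of their finite truncations.\<close>

lemma lq_norm_SUP:
  assumes q: "0 < q" and a: "\<And>j. 0 \<le> a j"
  shows "lq_norm q (\<lambda>j. ennreal (a j)) = (SUP J. ennreal (finite_lq q J a))"
proof (cases "q = top")
  case True
  have "(SUP j. ennreal (a j)) = (SUP J. ennreal (finite_lq q J a))"
  proof (rule antisym)
    show "(SUP j. ennreal (a j)) \<le> (SUP J. ennreal (finite_lq q J a))"
      by (intro SUP_mono) (auto intro!: ennreal_leI finite_lq_ge q a)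
    have "ennreal (finite_lq q J a) \<le> (SUP j. ennreal (a j))" for J
    proof -
      have "Max (a ` {..J}) \<in> a ` {..J}" by (rule Max_in) auto
      then obtain j where "Max (a ` {..J}) = a j" by blast
      then show ?thesis using True SUP_upper[of j UNIV "\<lambda>j. ennreal (a j)"] by (simp add: finite_lq_def)
    qed
    then show "(SUP J. ennreal (finite_lq q J a)) \<le> (SUP j. ennreal (a j))"
      by (rule SUP_least)
  qed
  then show ?thesis unfolding lq_norm_def using True by simp
next
  case False
  have Q: "0 < enn2real q" by (rule enn2real_exponent_pos[OF q False])
  have "(\<Sum>j. ennreal (a j powr enn2real q)) = (SUP J. ennreal (\<Sum>j\<le>J. a j powr enn2real q))"
  proof (rule LIMSEQ_unique)
    show "(\<lambda>J. ennreal (\<Sum>j\<le>J. a j powr enn2real q)) \<longlonglongrightarrow> (\<Sum>j. ennreal (a j powr enn2real q))"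
      unfolding sum_ennreal[OF powr_ge_zero, symmetric] by (rule summable_LIMSEQ'[OF summableI])
    show "(\<lambda>J. ennreal (\<Sum>j\<le>J. a j powr enn2real q)) \<longlonglongrightarrow> (SUP J. ennreal (\<Sum>j\<le>J. a j powr enn2real q))"
      by (rule LIMSEQ_SUP[OF incseq_SucI]) (auto intro!: ennreal_leI)
  qed
  then show ?thesis unfolding lq_norm_def epowr_ennreal[OF a] finite_lq_def
    using False Q by (simp add: epowr_SUP sum_nonneg)
qed

lemma recip_pos:
  assumes "0 < recip p"
  shows "0 < enn2real p" "p \<noteq> top" "recip p = 1 / enn2real p"
proof -
  have p: "p \<noteq> 0" "p \<noteq> top" using assms by (auto simp: recip_def ennreal_divide_zero)
  then show "0 < enn2real p" "p \<noteq> top" by (auto simp: enn2real_positive_iff top.not_eq_extremum zero_less_iff_neq_zero)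
  show "recip p = 1 / enn2real p"
    unfolding recip_def by (cases p) (use p in \<open>auto simp: ennreal_1[symmetric] divide_ennreal simp del: ennreal_1\<close>)
qed

lemma Lnorm_le_of_Lp_norm:
  fixes f :: "'a::euclidean_space \<Rightarrow> real"
  assumes p: "0 < recip p" and N: "Lp_norm p F \<le> ennreal A" and f: "\<And>x. ennreal (f x) \<le> F x"
    and m: "f \<in> borel_measurable lborel" "\<And>x. 0 \<le> f x" and A: "0 \<le> A"
  shows "Lnorm_le lborel (recip p) f A"
  unfolding Lnorm_le_def
proof (intro conjI allI m A)
  note P = recip_pos[OF p]
  have "(\<integral>\<^sup>+x. ennreal (f x powr (1 / recip p)) \<partial>lborel) \<le> (\<integral>\<^sup>+x. epowr (F x) (enn2real p) \<partial>lborel)"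
  proof (rule nn_integral_mono)
    fix x
    show "ennreal (f x powr (1 / recip p)) \<le> epowr (F x) (enn2real p)"
      using epowr_mono[OF _ f[of x], of "enn2real p"] P m(2)[of x] by (simp add: epowr_ennreal)
  qed
  also have "\<dots> \<le> ennreal (A powr (1 / recip p))"
    using N P A unfolding Lp_norm_def by (simp add: epowr_le_iff)
  finally show "(\<integral>\<^sup>+x. ennreal (f x powr (1 / recip p)) \<partial>lborel) \<le> ennreal (A powr (1 / recip p))" .
qed

text \<open>Monotone convergence in the length of the truncation.\<close>

lemma Lp_norm_lq_le:
  fixes a :: "'a::euclidean_space \<Rightarrow> nat \<Rightarrow> real"
  assumes p: "0 < recip p" and q: "0 < q" and a: "\<And>x j. 0 \<le> a x j"
    and N: "\<And>J. Lnorm_le lborel (recip p) (\<lambda>x. finite_lq q J (a x)) B"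
  shows "Lp_norm p (\<lambda>x. lq_norm q (\<lambda>j. ennreal (a x j))) \<le> ennreal B"
proof -
  note P = recip_pos[OF p]
  note [measurable] = Lnorm_leD(1)[OF N]
  have B: "0 \<le> B" by (rule Lnorm_leD(3)[OF N])
  have "(\<integral>\<^sup>+x. epowr (lq_norm q (\<lambda>j. ennreal (a x j))) (enn2real p) \<partial>lborel)
      = (\<integral>\<^sup>+x. (SUP J. ennreal (finite_lq q J (a x) powr enn2real p)) \<partial>lborel)"
    by (intro nn_integral_cong) (simp add: lq_norm_SUP[OF q a] epowr_SUP[OF P(1) finite_lq_nonneg[OF a]])
  also have "\<dots> = (SUP J. \<integral>\<^sup>+x. ennreal (finite_lq q J (a x) powr enn2real p) \<partial>lborel)"
  proof (rule nn_integral_monotone_convergence_SUP)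
    show "incseq (\<lambda>J x. ennreal (finite_lq q J (a x) powr enn2real p))"
      using P(1) by (intro incseq_SucI le_funI ennreal_leI powr_mono2 finite_lq_mono_length[OF q] finite_lq_nonneg a) auto
  qed measurable
  also have "\<dots> \<le> ennreal (B powr (1 / recip p))"
    using Lnorm_leD(4)[OF N] P(3) by (intro SUP_least) simp
  finally show ?thesis unfolding Lp_norm_def using P B by (simp add: epowr_le_iff)
qed


section \<open>Boundedness of the product\<close>

context product_exponents
begin

text \<open>
  The low-frequency factors in front of \<open>\<Delta>\<^sub>j f\<^sub>1\<close> are dominated by \<open>G\<close>, a product of sums of absolute values of blocks,
  for all \<open>j \<le> J\<close> at once; hence \<open>G\<close> can be taken out of the \<open>l\<^sub>q\<close>-norm before Hoelder's inequality is applied.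
  The errors, multiplied by \<open>2 powr (j * s 1)\<close>, still decay like \<open>2 powr (- j * \<eta>)\<close>; half of \<open>\<eta>\<close>
  pays for the \<open>l\<^sub>q\<close>-norm, the other half for the summation in \<open>L\<^sub>p\<close>.
\<close>

lemma lq_product_estimate:
  assumes q: "0 < q"
  shows "\<exists>C>0. \<forall>u A. blocks_le u A \<longrightarrow>
    (\<forall>J. Lnorm_le lborel (\<alpha> 1) (\<lambda>x. finite_lq q J (\<lambda>j. 2 powr (real j * s 1) * norm (lp_block \<Psi> j (u 1) x))) (A 1)) \<longrightarrow>
    (\<forall>J. Lnorm_le lborel \<pi> (\<lambda>x. finite_lq q J (\<lambda>j. 2 powr (real j * s 1) * norm (lp_block \<Psi> j (product_dist u) x)))
       (C * (\<Prod>i=1..m. A i)))"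
proof -
  obtain C0 \<eta> where C0: "0 < C0" "0 < \<eta>" "\<And>u A j. blocks_le u A \<Longrightarrow>
     Lnorm_le lborel \<pi> (\<lambda>x. norm (lp_block \<Psi> j (product_dist u) x
         - (\<Prod>i=2..m. partial_sum (u i) (j - 2 * m) x) * lp_block \<Psi> j (u 1) x))
       (C0 * (\<Prod>i=1..m. A i) * 2 powr (- real j * (s 1 + \<eta>)))"
    using product_dist_block_estimate by blast
  have "\<forall>i\<in>{2..m}. \<exists>C>0. \<forall>u A F L. blocks_le u A \<longrightarrow> finite F \<longrightarrow> (\<forall>k\<in>F. L \<le> k) \<longrightarrow>
    Lnorm_le lborel (\<beta> i) (\<lambda>x. \<Sum>k\<in>F. norm (lp_block \<Psi> k (u i) x)) (C * A i * 2 powr (- real L * gain i (\<beta> i)))"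
  proof
    fix i assume i: "i \<in> {2..m}"
    then have i1: "i \<in> {1..m}" by auto
    show "\<exists>C>0. \<forall>u A F L. blocks_le u A \<longrightarrow> finite F \<longrightarrow> (\<forall>k\<in>F. L \<le> k) \<longrightarrow>
      Lnorm_le lborel (\<beta> i) (\<lambda>x. \<Sum>k\<in>F. norm (lp_block \<Psi> k (u i) x)) (C * A i * 2 powr (- real L * gain i (\<beta> i)))"
      by (rule block_sum_bound[OF i1 beta_pos[OF i1] beta_le_alpha[OF i1] gain_beta_pos[OF i1]])
  qed
  from bchoice[OF this] obtain Cg where Cg: "\<forall>i\<in>{2..m}. 0 < Cg i \<and> (\<forall>u A F L. blocks_le u A \<longrightarrow> finite F \<longrightarrow> (\<forall>k\<in>F. L \<le> k) \<longrightarrow>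
    Lnorm_le lborel (\<beta> i) (\<lambda>x. \<Sum>k\<in>F. norm (lp_block \<Psi> k (u i) x)) (Cg i * A i * 2 powr (- real L * gain i (\<beta> i))))" ..
  have "0 < \<eta> / 2" using C0(2) by simp
  from finite_lq_le_weighted_sum[OF q this] obtain K where K: "K > 0"
    "\<And>J a. \<forall>j. 0 \<le> a j \<Longrightarrow> finite_lq q J a \<le> K * (\<Sum>j\<le>J. 2 powr (real j * (\<eta> / 2)) * a j)" by blast
  define D where "D = geometric_const \<pi> (\<eta> / 2)"
  have D: "0 < D" unfolding D_def using C0(2) pi_bounds by (intro geometric_const_pos) auto
  define C1 where "C1 = (\<Prod>i=2..m. Cg i) + K * D * C0"
  have PCg: "0 < (\<Prod>i=2..m. Cg i)" using Cg by (intro prod_pos) auto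
  have KD: "0 < K * D * C0" using K(1) D C0(1) by simp
  define C where "C = 2 powr (1 + recip q) * (2 powr (1 + \<pi>) * C1)"
  have C: "0 < C" unfolding C_def C1_def using PCg KD by simp
  have "Lnorm_le lborel \<pi> (\<lambda>x. finite_lq q J (\<lambda>j. 2 powr (real j * s 1) * norm (lp_block \<Psi> j (product_dist u) x)))
       (C * (\<Prod>i=1..m. A i))"
    if u: "blocks_le u A" and tr: "\<And>J. Lnorm_le lborel (\<alpha> 1) (\<lambda>x. finite_lq q J (\<lambda>j. 2 powr (real j * s 1) * norm (lp_block \<Psi> j (u 1) x))) (A 1)"
    for u A J
  proof -
    have one: "1 \<in> {1..m}" using m by simp
    have A: "0 \<le> A i" if "i \<in> {1..m}" for i using blocks_leD(2)[OF u that] .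
    let ?A = "\<Prod>i=1..m. A i"
    have PA: "0 \<le> ?A" using A by (intro prod_nonneg) auto
    define G where "G x = (\<Prod>i=2..m. \<Sum>k\<in>{..J}. norm (lp_block \<Psi> k (u i) x))" for x
    define E where "E j x = norm (lp_block \<Psi> j (product_dist u) x
         - (\<Prod>i=2..m. partial_sum (u i) (j - 2 * m) x) * lp_block \<Psi> j (u 1) x)" for j x
    let ?V = "\<lambda>x. finite_lq q J (\<lambda>j. 2 powr (real j * s 1) * norm (lp_block \<Psi> j (u 1) x))"
    let ?W = "\<lambda>x. \<Sum>j\<le>J. 2 powr (real j * (\<eta> / 2)) * (2 powr (real j * s 1) * E j x)"
    have G0: "0 \<le> G x" for x unfolding G_def by (intro prod_nonneg sum_nonneg) auto
    have LG: "Lnorm_le lborel (\<Sum>i=2..m. \<beta> i) G (\<Prod>i=2..m. Cg i * A i)"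
      unfolding G_def
    proof (rule Lnorm_le_prod)
      fix i assume i: "i \<in> {2..m}"
      have "Lnorm_le lborel (\<beta> i) (\<lambda>x. \<Sum>k\<in>{..J}. norm (lp_block \<Psi> k (u i) x)) (Cg i * A i * 2 powr (- real 0 * gain i (\<beta> i)))"
        using Cg i u by blast
      then show "Lnorm_le lborel (\<beta> i) (\<lambda>x. \<Sum>k\<in>{..J}. norm (lp_block \<Psi> k (u i) x)) (Cg i * A i)" by simp
      show "0 < \<beta> i" by (rule beta(1)[OF i])
    qed (use m in auto)
    have "Lnorm_le lborel ((\<Sum>i=2..m. \<beta> i) + \<beta> 1) (\<lambda>x. G x * ?V x) ((\<Prod>i=2..m. Cg i * A i) * A 1)"
      by (rule Lnorm_le_mult[OF LG tr[folded beta1]])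
         (use m in \<open>auto intro!: sum_pos beta(1) beta_pos\<close>)
    moreover have "(\<Sum>i=2..m. \<beta> i) + \<beta> 1 = \<pi>" unfolding \<pi>_def split_first_sum[of \<beta>] by simp
    moreover have "(\<Prod>i=2..m. Cg i * A i) * A 1 = (\<Prod>i=2..m. Cg i) * ?A"
      unfolding prod.distrib split_first_prod[of A] by (simp only: mult_ac)
    ultimately have L1: "Lnorm_le lborel \<pi> (\<lambda>x. G x * ?V x) ((\<Prod>i=2..m. Cg i) * ?A)" by simp
    have "Lnorm_le lborel \<pi> ?W (D * (C0 * ?A) * 2 powr (- real 0 * (\<eta> / 2)))"
      unfolding D_def
    proof (rule Lnorm_le_geometric)
      fix j
      have "Lnorm_le lborel \<pi> (\<lambda>x. 2 powr (real j * (\<eta> / 2)) * (2 powr (real j * s 1) * E j x))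
        (2 powr (real j * (\<eta> / 2)) * (2 powr (real j * s 1) * (C0 * ?A * 2 powr (- real j * (s 1 + \<eta>)))))"
        unfolding E_def by (intro Lnorm_le_cmult C0(3)[OF u]) auto
      also have "2 powr (real j * (\<eta> / 2)) * (2 powr (real j * s 1) * (C0 * ?A * 2 powr (- real j * (s 1 + \<eta>))))
        = C0 * ?A * (2 powr (real j * (\<eta> / 2)) * 2 powr (real j * s 1) * 2 powr (- real j * (s 1 + \<eta>)))"
        by (simp only: mult_ac)
      also have "2 powr (real j * (\<eta> / 2)) * 2 powr (real j * s 1) * 2 powr (- real j * (s 1 + \<eta>)) = 2 powr (- real j * (\<eta> / 2))"
        unfolding powr_add[symmetric] by (simp add: field_simps)
      finally show "Lnorm_le lborel \<pi> (\<lambda>x. 2 powr (real j * (\<eta> / 2)) * (2 powr (real j * s 1) * E j x)) (C0 * ?A * 2 powr (- real j * (\<eta> / 2)))" .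
    qed (use C0 PA pi_bounds in auto)
    then have L2: "Lnorm_le lborel \<pi> (\<lambda>x. K * ?W x) (K * (D * (C0 * ?A)))"
      using K(1) by (intro Lnorm_le_cmult) auto
    have "Lnorm_le lborel \<pi> (\<lambda>x. G x * ?V x) (C1 * ?A)"
      by (rule Lnorm_le_weaken[OF L1 _ pi_bounds(1)])
         (use KD in \<open>intro mult_right_mono PA; simp add: C1_def\<close>)
    moreover have "Lnorm_le lborel \<pi> (\<lambda>x. K * ?W x) (C1 * ?A)"
    proof (rule Lnorm_le_weaken[OF L2 _ pi_bounds(1)])
      have "K * (D * (C0 * ?A)) = K * D * C0 * ?A" by (simp only: mult_ac)
      also have "\<dots> \<le> C1 * ?A" unfolding C1_def using PCg by (intro mult_right_mono PA) auto
      finally show "K * (D * (C0 * ?A)) \<le> C1 * ?A" .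
    qed
    ultimately have "Lnorm_le lborel \<pi> (\<lambda>x. G x * ?V x + K * ?W x) (2 powr (1 + \<pi>) * (C1 * ?A))"
      by (intro Lnorm_le_add pi_bounds)
    then have L: "Lnorm_le lborel \<pi> (\<lambda>x. 2 powr (1 + recip q) * (G x * ?V x + K * ?W x)) (2 powr (1 + recip q) * (2 powr (1 + \<pi>) * (C1 * ?A)))"
      by (rule Lnorm_le_cmult) simp
    show ?thesis
    proof (rule Lnorm_le_mono[OF L])
      have [measurable]: "lp_block \<Psi> j (product_dist u) \<in> borel_measurable borel" for j
        by (rule lp_block_measurable[OF product_dist_tempered[OF u]])
      show "(\<lambda>x. finite_lq q J (\<lambda>j. 2 powr (real j * s 1) * norm (lp_block \<Psi> j (product_dist u) x))) \<in> borel_measurable lborel"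
        by measurable
      fix x
      show "0 \<le> finite_lq q J (\<lambda>j. 2 powr (real j * s 1) * norm (lp_block \<Psi> j (product_dist u) x))"
        by (intro finite_lq_nonneg) auto
      have pt: "norm (lp_block \<Psi> j (product_dist u) x) \<le> G x * norm (lp_block \<Psi> j (u 1) x) + E j x" if "j \<le> J" for j
      proof -
        let ?R = "\<Prod>i=2..m. partial_sum (u i) (j - 2 * m) x"
        have "norm ?R \<le> G x"
          unfolding G_def prod_norm[symmetric]
        proof (intro prod_mono conjI norm_ge_zero)
          fix i
          have "norm (partial_sum (u i) (j - 2 * m) x) \<le> (\<Sum>k<j - 2 * m. norm (lp_block \<Psi> k (u i) x))"
            unfolding partial_sum_def by (rule norm_sum)
          also have "\<dots> \<le> (\<Sum>k\<le>J. norm (lp_block \<Psi> k (u i) x))" using that by (intro sum_mono2) auto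
          finally show "norm (partial_sum (u i) (j - 2 * m) x) \<le> (\<Sum>k\<le>J. norm (lp_block \<Psi> k (u i) x))" .
        qed
        then have "norm (?R * lp_block \<Psi> j (u 1) x) \<le> G x * norm (lp_block \<Psi> j (u 1) x)"
          unfolding norm_mult by (intro mult_right_mono) auto
        moreover have "norm (lp_block \<Psi> j (product_dist u) x) \<le> norm (?R * lp_block \<Psi> j (u 1) x) + E j x"
          unfolding E_def by (rule norm_triangle_sub)
        ultimately show ?thesis by linarith
      qed
      have E0: "0 \<le> E j x" for j unfolding E_def by simp
      have "finite_lq q J (\<lambda>j. 2 powr (real j * s 1) * norm (lp_block \<Psi> j (product_dist u) x))
        \<le> finite_lq q J (\<lambda>j. G x * (2 powr (real j * s 1) * norm (lp_block \<Psi> j (u 1) x)) + 2 powr (real j * s 1) * E j x)"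
      proof (rule finite_lq_mono[OF q])
        fix j assume "j \<le> J"
        from mult_left_mono[OF pt[OF this], of "2 powr (real j * s 1)"]
        show "2 powr (real j * s 1) * norm (lp_block \<Psi> j (product_dist u) x)
          \<le> G x * (2 powr (real j * s 1) * norm (lp_block \<Psi> j (u 1) x)) + 2 powr (real j * s 1) * E j x"
          by (simp add: distrib_left mult_ac)
      qed simp
      also have "\<dots> \<le> 2 powr (1 + recip q) * (finite_lq q J (\<lambda>j. G x * (2 powr (real j * s 1) * norm (lp_block \<Psi> j (u 1) x)))
          + finite_lq q J (\<lambda>j. 2 powr (real j * s 1) * E j x))"
        by (rule finite_lq_add[OF q]) (use G0 E0 in auto)
      also have "\<dots> \<le> 2 powr (1 + recip q) * (G x * ?V x + K * ?W x)"
        by (intro mult_left_mono add_mono K(2)) (use E0 finite_lq_cmult[OF q G0[of x]] in auto)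
      finally show "finite_lq q J (\<lambda>j. 2 powr (real j * s 1) * norm (lp_block \<Psi> j (product_dist u) x))
        \<le> 2 powr (1 + recip q) * (G x * ?V x + K * ?W x)" .
    qed (auto simp: C_def mult.assoc pi_bounds)
  qed
  then show ?thesis using C by blast
qed

end


theorem theorem3p2:
  fixes m :: nat
    and \<Psi> :: "'a::euclidean_space \<Rightarrow> complex"
    and s :: "nat \<Rightarrow> real"
    and ps h :: "nat \<Rightarrow> ennreal"
    and p q :: ennreal
  assumes "m \<ge> 2"
    and "resolution_generator \<Psi>"
    and "1 \<le> ps 1" and "ps 1 < top"
    and "\<And>i. i \<in> {2..m} \<Longrightarrow> 0 < ps i"
    and "0 < q"
    and "0 < s 1" and "s 1 < s 2"
    and "\<And>i. i \<in> {2..<m} \<Longrightarrow> s i \<le> s (Suc i)"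
    and "s 1 < real DIM('a) * recip (ps 1)"
    and "recip p = recip (ps 1) + (\<Sum>i=2..m. recip (h i))"
    and "recip (ps 1) + (\<Sum>i=2..m. recip (h i)) < 1"
    and "\<And>i. i \<in> {2..m} \<Longrightarrow> max 0 (recip (ps i) - s i / real DIM('a)) < recip (h i)"
    and "\<And>i. i \<in> {2..m} \<Longrightarrow> recip (h i) \<le> recip (ps i)"
  shows "\<exists>c::real. c > 0 \<and>
    (\<forall>f. f 1 \<in> triebel_space \<Psi> (s 1) (ps 1) q \<longrightarrow>
         (\<forall>i\<in>{2..m}. f i \<in> besov_space \<Psi> (s i) (ps i) top) \<longrightarrow>
         (\<exists>g. is_product \<Psi> m f g \<and> g \<in> triebel_space \<Psi> (s 1) p q \<and>
              triebel_norm \<Psi> (s 1) p q g \<le>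
                ennreal c * triebel_norm \<Psi> (s 1) (ps 1) q (f 1) *
                (\<Prod>i=2..m. besov_norm \<Psi> (s i) (ps i) top (f i))))"
proof -
  note m = assms(1) and q = assms(6)
  have s_gt: "s 1 < s i" if "i \<in> {2..m}" for i
  proof -
    have "i \<le> m \<longrightarrow> s 1 < s i" if "2 \<le> i" for i using that
    proof (induction i rule: dec_induct)
      case (step i)
      then show ?case using assms(9)[of i] by auto
    qed (use assms(8) in auto)
    then show ?thesis using that by auto
  qed
  define \<alpha> where "\<alpha> i = recip (ps i)" for i
  define \<beta> where "\<beta> i = (if i = 1 then recip (ps 1) else recip (h i))" for i
  have b2: "\<beta> i = recip (h i)" if "i \<in> {2..m}" for i using that by (auto simp: \<beta>_def)
  have sumb: "(\<Sum>i=1..m. \<beta> i) = recip p"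
    using m sum.atLeast_Suc_atMost[of 1 m \<beta>] b2 by (simp add: numeral_2_eq_2 assms(11) \<beta>_def)
  interpret product_exponents \<Psi> m s \<alpha> \<beta>
  proof
    show "resolution_generator \<Psi>" by (rule assms(2))
    show "2 \<le> m" by (rule m)
    show "0 < s 1" "s 1 < real DIM('a) * \<alpha> 1" using assms(7,10) by (simp_all add: \<alpha>_def)
    show "\<beta> 1 = \<alpha> 1" by (simp add: \<alpha>_def \<beta>_def)
    show "(\<Sum>i=1..m. \<beta> i) < 1" using sumb assms(11,12) by simp
    fix i assume i: "i \<in> {2..m}"
    show "s 1 < s i" by (rule s_gt[OF i])
    show "0 < \<beta> i" "\<beta> i \<le> \<alpha> i" using assms(13,14)[OF i] b2[OF i] by (auto simp: \<alpha>_def)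
    have "\<alpha> i - \<beta> i < s i / real DIM('a)" using assms(13)[OF i] b2[OF i] by (auto simp: \<alpha>_def)
    then show "real DIM('a) * (\<alpha> i - \<beta> i) < s i" by (simp add: pos_less_divide_eq mult.commute)
  qed
  have pi_recip: "\<pi> = recip p" unfolding \<pi>_def by (rule sumb)
  have rp: "0 < recip p" using pi_bounds(1) pi_recip by simp
  have rps: "0 < recip (ps i)" if "i \<in> {1..m}" for i using alpha_pos[OF that] by (simp add: \<alpha>_def)
  obtain C where C: "0 < C" "\<And>u A J. blocks_le u A \<Longrightarrow>
    (\<forall>J. Lnorm_le lborel (\<alpha> 1) (\<lambda>x. finite_lq q J (\<lambda>j. 2 powr (real j * s 1) * norm (lp_block \<Psi> j (u 1) x))) (A 1)) \<Longrightarrow>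
    Lnorm_le lborel \<pi> (\<lambda>x. finite_lq q J (\<lambda>j. 2 powr (real j * s 1) * norm (lp_block \<Psi> j (product_dist u) x))) (C * (\<Prod>i=1..m. A i))"
    using lq_product_estimate[OF q] by blast
  have "\<exists>g. is_product \<Psi> m f g \<and> g \<in> triebel_space \<Psi> (s 1) p q \<and>
      triebel_norm \<Psi> (s 1) p q g \<le> ennreal C * triebel_norm \<Psi> (s 1) (ps 1) q (f 1) * (\<Prod>i=2..m. besov_norm \<Psi> (s i) (ps i) top (f i))"
    if f1: "f 1 \<in> triebel_space \<Psi> (s 1) (ps 1) q" and fi: "\<forall>i\<in>{2..m}. f i \<in> besov_space \<Psi> (s i) (ps i) top" for f
  proof -
    define N where "N i = (if i = 1 then triebel_norm \<Psi> (s 1) (ps 1) q (f 1) else besov_norm \<Psi> (s i) (ps i) top (f i))" for i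
    define A where "A i = enn2real (N i)" for i
    have A0: "0 \<le> A i" for i by (simp add: A_def)
    have N: "N i = ennreal (A i)" if "i \<in> {1..m}" for i
      using that f1 fi by (cases "i = 1") (auto simp: N_def A_def triebel_space_def besov_space_def)
    have ft: "f i \<in> tempered_distributions" if "i \<in> {1..m}" for i
      using that f1 fi by (cases "i = 1") (auto simp: triebel_space_def besov_space_def)
    have meas: "lp_block \<Psi> k (f i) \<in> borel_measurable borel" if "i \<in> {1..m}" for i k by (rule lp_block_measurable[OF ft[OF that]])
    have one: "1 \<in> {1..m}" using m by simp
    let ?V = "\<lambda>J x. finite_lq q J (\<lambda>j. 2 powr (real j * s 1) * norm (lp_block \<Psi> j (f 1) x))"
    have tr: "Lnorm_le lborel (\<alpha> 1) (?V J) (A 1)" for J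
      unfolding \<alpha>_def
    proof (rule Lnorm_le_of_Lp_norm[OF rps[OF one], where F="\<lambda>x. SUP J. ennreal (?V J x)"])
      show "Lp_norm (ps 1) (\<lambda>x. SUP J. ennreal (?V J x)) \<le> ennreal (A 1)"
        using N[OF one] by (simp add: N_def triebel_norm_def ennreal_mult'[symmetric] lq_norm_SUP[OF q])
      show "ennreal (?V J x) \<le> (SUP J. ennreal (?V J x))" for x by (rule SUP_upper) simp
      note [measurable] = meas[OF one]
      show "?V J \<in> borel_measurable lborel" by measurable
      show "0 \<le> ?V J x" for x by (intro finite_lq_nonneg) simp
    qed (rule A0)
    have bl: "blocks_le f A"
      unfolding blocks_le_def
    proof (intro ballI conjI allI ft A0)
      fix i k assume i: "i \<in> {1..m}"
      have "Lnorm_le lborel (\<alpha> i) (\<lambda>x. 2 powr (real k * s i) * norm (lp_block \<Psi> k (f i) x)) (A i)"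
      proof (cases "i = 1")
        case True
        have "Lnorm_le lborel (\<alpha> 1) (\<lambda>x. 2 powr (real k * s 1) * norm (lp_block \<Psi> k (f 1) x)) (A 1)"
        proof (rule Lnorm_le_mono[OF tr[of k]])
          note [measurable] = meas[OF one]
          show "(\<lambda>x. 2 powr (real k * s 1) * norm (lp_block \<Psi> k (f 1) x)) \<in> borel_measurable lborel" by measurable
          show "2 powr (real k * s 1) * norm (lp_block \<Psi> k (f 1) x) \<le> ?V k x" for x
            by (rule finite_lq_ge[OF q order_refl]) simp
        qed (use alpha_pos[OF one] in auto)
        then show ?thesis using True by simp
      next
        case False
        let ?g = "\<lambda>x. norm (lp_block \<Psi> k (f i) x)"
        have "ennreal (2 powr (real k * s i)) * Lp_norm (ps i) (\<lambda>x. ennreal (?g x)) \<le> N i"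
          using False SUP_upper[of k UNIV "\<lambda>j. ennreal (2 powr (real j * s i)) * Lp_norm (ps i) (\<lambda>x. ennreal (norm (lp_block \<Psi> j (f i) x)))"]
          by (simp add: N_def besov_norm_def lq_norm_def)
        then have le: "ennreal (2 powr (real k * s i)) * Lp_norm (ps i) (\<lambda>x. ennreal (?g x)) \<le> ennreal (A i)" using N[OF i] by simp
        have c: "2 powr (- real k * s i) * 2 powr (real k * s i) = 1" unfolding powr_add[symmetric] by simp
        have "Lp_norm (ps i) (\<lambda>x. ennreal (?g x)) = ennreal (2 powr (- real k * s i)) * (ennreal (2 powr (real k * s i)) * Lp_norm (ps i) (\<lambda>x. ennreal (?g x)))"
          unfolding mult.assoc[symmetric] ennreal_mult'[symmetric, OF powr_ge_zero] c by simp
        also have "\<dots> \<le> ennreal (2 powr (- real k * s i)) * ennreal (A i)" by (intro mult_left_mono le) simp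
        also have "\<dots> = ennreal (2 powr (- real k * s i) * A i)" by (rule ennreal_mult'[symmetric]) simp
        finally have "Lp_norm (ps i) (\<lambda>x. ennreal (?g x)) \<le> ennreal (2 powr (- real k * s i) * A i)" .
        from Lnorm_le_of_Lp_norm[OF rps[OF i] this, of ?g]
        have "Lnorm_le lborel (\<alpha> i) ?g (2 powr (- real k * s i) * A i)"
          using meas[OF i, of k] A0[of i] by (simp add: \<alpha>_def)
        from Lnorm_le_cmult[OF this, of "2 powr (real k * s i)"]
        have "Lnorm_le lborel (\<alpha> i) (\<lambda>x. 2 powr (real k * s i) * ?g x) ((2 powr (- real k * s i) * 2 powr (real k * s i)) * A i)"
          by (simp add: mult_ac)
        then show ?thesis unfolding c by simp
      qed
      from Lnorm_le_cmult[OF this, of "2 powr (- real k * s i)"]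
      show "Lnorm_le lborel (\<alpha> i) (\<lambda>x. norm (lp_block \<Psi> k (f i) x)) (A i * 2 powr (- real k * s i))"
        unfolding mult.assoc[symmetric] powr_add[symmetric] by (simp add: mult.commute)
    qed
    let ?g = "product_dist f"
    have "triebel_norm \<Psi> (s 1) p q ?g = Lp_norm p (\<lambda>x. lq_norm q (\<lambda>j. ennreal (2 powr (real j * s 1) * norm (lp_block \<Psi> j ?g x))))"
      unfolding triebel_norm_def by (simp add: ennreal_mult')
    also have "\<dots> \<le> ennreal (C * (\<Prod>i=1..m. A i))"
      by (rule Lp_norm_lq_le[OF rp q]) (use C(2)[OF bl] tr pi_recip in auto)
    finally have le: "triebel_norm \<Psi> (s 1) p q ?g \<le> ennreal (C * (\<Prod>i=1..m. A i))" .
    then have fin: "triebel_norm \<Psi> (s 1) p q ?g < top" by (rule le_less_trans) simp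
    note le
    also have "ennreal (C * (\<Prod>i=1..m. A i)) = ennreal C * (\<Prod>i=1..m. ennreal (A i))" using C(1) A0 by (simp add: ennreal_mult prod_nonneg prod_ennreal)
    also have "(\<Prod>i=1..m. ennreal (A i)) = (\<Prod>i=1..m. N i)" using N by (intro prod.cong) auto
    also have "\<dots> = N 1 * (\<Prod>i=2..m. N i)" by (rule split_first_prod)
    also have "(\<Prod>i=2..m. N i) = (\<Prod>i=2..m. besov_norm \<Psi> (s i) (ps i) top (f i))" by (intro prod.cong) (auto simp: N_def)
    finally have est: "triebel_norm \<Psi> (s 1) p q ?g \<le> ennreal C * (N 1 * (\<Prod>i=2..m. besov_norm \<Psi> (s i) (ps i) top (f i)))" .
    show ?thesis
      using product_dist_is_product[OF bl] product_dist_tempered[OF bl] fin est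
      by (intro exI[of _ ?g]) (simp add: triebel_space_def N_def mult.assoc)
  qed
  then show ?thesis using C(1) by blast
qed

end
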